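(* Let $X$ be a smooth $n$-dimensional manifold, $Y\to X$ an affine bundle, $Q\to X$ a real vector bundle, and $\mathcal S^*_\infty$ the associated bigraded differential algebra of graded forms. With respect to the local basis $(x^\lambda,s^A_\Lambda,dx^\lambda,\theta^A_\Lambda)$ for $\mathcal S^*_\infty$, any generalized supersymmetry $\upsilon$ takes the form $$\upsilon=\upsilon_H+\upsilon_V=\upsilon^\lambda d_\lambda+\Big(\upsilon^A\partial_A+\sum_{|\Lambda|>0}d_\Lambda\upsilon^A\,\partial_A^\Lambda\Big),$$ where $\upsilon^\lambda$, $\upsilon^A$ are local graded functions.
   Context: Manifolds are smooth, real, finite-dimensional, Hausdorff, second-countable and connected. The algebra $\mathcal S^*_\infty$. For the vector bundle $Q\to X$, the simple graded manifold $(X,\mathfrak A_{J^rQ})$ has as structure sheaf the sheaf of germs of sections of the exterior bundle $\bigwedge(J^rQ)^*$ of the jet bundle $J^rQ\to X$; $\mathcal C^*_{J^rQ}$ is the bigraded differential algebra (BGDA) of graded exterior forms on it, and $\mathcal C^*_\infty$ is the direct limit of $\mathcal C^*_Q\to\mathcal C^*_{J^1Q}\to\cdots$ under pull-backs. Locally $\mathcal C^*_\infty$ is generated over $C^\infty(X)$ by odd elements $c^a_\Lambda$ and the forms $dx^\lambda$, $dc^a_\Lambda$, $|\Lambda|\ge0$, where $c^a$ are the fibre bases of $Q^*$ and transition functions are $c'^a=\rho^a_bc^b$, $c'^a_{\lambda+\Lambda}=d_\lambda(\rho^a_jc^j_\Lambda)$. For the affine bundle $Y\to X$, $\mathcal O^*_\infty$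 is the algebra of exterior forms on finite order jet manifolds $J^rY$ modulo pull-back identification, and $\mathcal P^*_\infty\subset\mathcal O^*_\infty$ is the $C^\infty(X)$-subalgebra of forms whose coefficients are polynomial in the fibre coordinates $y^i_\Lambda$. $\mathcal S^*_\infty=\mathcal C^*_\infty\wedge\mathcal P^*_\infty$ is their graded product over the common subalgebra $\mathcal O^*(X)$ of exterior forms on $X$: it is the BGDA, with form degree $|\cdot|$, Grassmann parity $[\cdot]$ (elements of $\mathcal P^*_\infty$ being even) and differential $d$ induced from the factors, such that $\varphi\wedge\varphi'=(-1)^{|\varphi||\varphi'|+[\varphi][\varphi']}\varphi'\wedge\varphi$ and $d(\varphi\wedge\varphi')=d\varphi\wedge\varphi'+(-1)^{|\varphi|}\varphi\wedge d\varphi'$. In degree zero its elements (graded functions) are polynomials in $c^a_\Lambda,y^i_\Lambda$ (finite jet order) with coefficients in $C^\infty(X)$. Notation. $s^A_\Lambda$ stands for $c^a_\Lambda$ or $y^i_\Lambda$; $\Lambda=(\lambda_k\ldots\lambda_1)$ is a symmetric multi-index of length $|\Lambda|=k$, $\lambda+\Lambda=(\lambda\lambda_k\ldots\lambda_1)$; $\theta^A_\Lambda=ds^A_\Lambda-s^A_{\lambda+\Lambda}dx^\lambda$ are the contact graded one-forms, which locally generate the ideal of contact graded forms; $\partial_A^\Lambda$ are the graded derivations dual to $s^A_\Lambda$, $\partial_A=\partial_A^\Lambda$ for $|\Lambda|=0$; $d_\lambda=\partial_\lambda+\sum_{|\Lambda|\ge0}s^A_{\lambda+\Lambda}\partial_A^\Lambda$,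 $d_\Lambda=d_{\lambda_k}\circ\cdots\circ d_{\lambda_1}$. A generalized supersymmetry is a graded derivation $\upsilon$ of the $\mathbb R$-ring $\mathcal S^0_\infty$ such that the Lie derivative $\mathbf L_\upsilon\phi=\upsilon\rfloor d\phi+d(\upsilon\rfloor\phi)$ preserves the ideal of contact graded forms of $\mathcal S^*_\infty$. The interior product obeys $\upsilon\rfloor df=\upsilon(f)$ for $f\in\mathcal S^0_\infty$ and $\upsilon\rfloor(\phi\wedge\sigma)=(\upsilon\rfloor\phi)\wedge\sigma+(-1)^{|\phi|+[\phi][\upsilon]}\phi\wedge(\upsilon\rfloor\sigma)$. *)

theory Defs
  imports "HOL-Analysis.Analysis" "HOL-Library.Poly_Mapping" "HOL-Library.Multiset"
    "HOL-Library.Countable"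
begin

section \<open>Smooth manifolds and bundles\<close>

fun ck_on :: "nat \<Rightarrow> ('a::real_normed_vector) set \<Rightarrow> ('a \<Rightarrow> real) \<Rightarrow> bool" where
  "ck_on 0 S f \<longleftrightarrow> continuous_on S f"
| "ck_on (Suc r) S f \<longleftrightarrow> (\<forall>x\<in>S. f differentiable (at x)) \<and>
     (\<forall>v. ck_on r S (\<lambda>x. frechet_derivative f (at x) v))"

definition smooth_on :: "('a::real_normed_vector) set \<Rightarrow> ('a \<Rightarrow> real) \<Rightarrow> bool" where
  "smooth_on S f \<longleftrightarrow> (\<forall>r. ck_on r S f)"

text \<open>
  A bundle over the manifold is given by its total space (a type), its projection, its fibre
  dimension and its fibre coordinates over the domain of each chart \<open>k\<close>.  Fibre
  dimensions are natural numbers, so that rank 0 (\<open>Q = 0\<close> or \<open>Y = X\<close>) is included.  The manifold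
  is the whole type \<open>'x\<close>, of dimension \<open>CARD('n)\<close>; \<open>'k\<close> labels the charts, over each of which both
  bundles are trivialized.  The smooth structure of a total space is the one for which these
  trivializations are diffeomorphisms, and enters only through the transition functions.
\<close>

record ('x, 'e, 'k) fbundle =
  proj :: "'e \<Rightarrow> 'x"
  frank :: nat
  fco :: "'k \<Rightarrow> 'e \<Rightarrow> nat \<Rightarrow> real"

record ('x, 'n::finite, 'y, 'q, 'k) setting =
  charts :: "'k set"
  cdom :: "'k \<Rightarrow> 'x set"
  crd :: "'k \<Rightarrow> 'x \<Rightarrow> real ^ 'n"
  bunY :: "('x, 'y, 'k) fbundle"
  bunQ :: "('x, 'q, 'k) fbundle"

text \<open>The function \<open>f\<close> on \<open>V \<subseteq> cdom B k\<close> read in the coordinates of chart \<open>k\<close>.\<close>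

definition smooth_in ::
  "('x, 'n::finite, 'y, 'q, 'k) setting \<Rightarrow> 'k \<Rightarrow> 'x set \<Rightarrow> ('x \<Rightarrow> real) \<Rightarrow> bool" where
  "smooth_in B k V f \<longleftrightarrow> smooth_on (crd B k ` V) (f \<circ> inv_into (cdom B k) (crd B k))"

definition pd ::
  "('x, 'n::finite, 'y, 'q, 'k) setting \<Rightarrow> 'k \<Rightarrow> 'n \<Rightarrow> ('x \<Rightarrow> real) \<Rightarrow> 'x \<Rightarrow> real" where
  "pd B k l f p =
     frechet_derivative (f \<circ> inv_into (cdom B k) (crd B k)) (at (crd B k p)) (axis l 1)"

definition smooth_manifold ::
  "('x::{t2_space,second_countable_topology}, 'n::finite, 'y, 'q, 'k) setting \<Rightarrow> bool" where
  "smooth_manifold B \<longleftrightarrow>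
     connected (UNIV :: 'x set) \<and>
     (\<Union>k\<in>charts B. cdom B k) = UNIV \<and>
     (\<forall>k\<in>charts B. open (cdom B k) \<and> open (crd B k ` cdom B k) \<and>
        homeomorphism (cdom B k) (crd B k ` cdom B k) (crd B k) (inv_into (cdom B k) (crd B k))) \<and>
     (\<forall>j\<in>charts B. \<forall>k\<in>charts B. \<forall>l. smooth_in B j (cdom B j \<inter> cdom B k) (\<lambda>p. crd B k p $ l))"

definition fibrewise_bij ::
  "('x, 'n::finite, 'y, 'q, 'k) setting \<Rightarrow> ('x, 'e, 'k) fbundle \<Rightarrow> bool" where
  "fibrewise_bij B E \<longleftrightarrow> (\<forall>k\<in>charts B. \<forall>p\<in>cdom B k.
     bij_betw (fco E k) {e. proj E e = p} {v. \<forall>a\<ge>frank E. v a = 0})"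

definition affine_bundle ::
  "('x, 'n::finite, 'y, 'q, 'k) setting \<Rightarrow> ('x, 'e, 'k) fbundle \<Rightarrow> bool" where
  "affine_bundle B E \<longleftrightarrow> fibrewise_bij B E \<and>
     (\<forall>j\<in>charts B. \<forall>k\<in>charts B. \<exists>\<rho> b.
        (\<forall>a<frank E. \<forall>c<frank E. smooth_in B j (cdom B j \<inter> cdom B k) (\<rho> a c)) \<and>
        (\<forall>a<frank E. smooth_in B j (cdom B j \<inter> cdom B k) (b a)) \<and>
        (\<forall>e. proj E e \<in> cdom B j \<inter> cdom B k \<longrightarrow> (\<forall>a<frank E.
           fco E k e a = b a (proj E e) + (\<Sum>c<frank E. \<rho> a c (proj E e) * fco E j e c))))"

definition vector_bundle ::
  "('x, 'n::finite, 'y, 'q, 'k) setting \<Rightarrow> ('x, 'e, 'k) fbundle \<Rightarrow> bool" where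
  "vector_bundle B E \<longleftrightarrow> fibrewise_bij B E \<and>
     (\<forall>j\<in>charts B. \<forall>k\<in>charts B. \<exists>\<rho>.
        (\<forall>a<frank E. \<forall>c<frank E. smooth_in B j (cdom B j \<inter> cdom B k) (\<rho> a c)) \<and>
        (\<forall>e. proj E e \<in> cdom B j \<inter> cdom B k \<longrightarrow> (\<forall>a<frank E.
           fco E k e a = (\<Sum>c<frank E. \<rho> a c (proj E e) * fco E j e c))))"

text \<open>
  The coefficients of the (affine) coordinate change from chart \<open>j\<close> to chart \<open>k\<close>, recovered
  by evaluating it on the zero vector and on the unit vectors.
\<close>

definition fib_point :: "('x, 'e, 'k) fbundle \<Rightarrow> 'k \<Rightarrow> 'x \<Rightarrow> (nat \<Rightarrow> real) \<Rightarrow> 'e" where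
  "fib_point E j p v = (THE e. proj E e = p \<and> fco E j e = v)"

definition trans0 :: "('x, 'e, 'k) fbundle \<Rightarrow> 'k \<Rightarrow> 'k \<Rightarrow> nat \<Rightarrow> 'x \<Rightarrow> real" where
  "trans0 E j k a p = fco E k (fib_point E j p (\<lambda>_. 0)) a"

definition trans1 :: "('x, 'e, 'k) fbundle \<Rightarrow> 'k \<Rightarrow> 'k \<Rightarrow> nat \<Rightarrow> nat \<Rightarrow> 'x \<Rightarrow> real" where
  "trans1 E j k a c p =
     fco E k (fib_point E j p (\<lambda>i. if i = c then 1 else 0)) a - trans0 E j k a p"

section \<open>The bigraded commutative algebra over a point\<close>

text \<open>
  A multi-index \<open>\<Lambda>\<close> is a multiset over \<open>'n\<close>, so \<open>\<lambda>+\<Lambda>\<close> is \<open>add_mset \<lambda> \<Lambda>\<close>.  \<open>Ev i\<close> and \<open>Od a\<close>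
  are the values of the index \<open>A\<close>: \<open>Sg (Ev i) \<Lambda>\<close> is \<open>y\<^sup>i\<^sub>\<Lambda>\<close>, \<open>Sg (Od a) \<Lambda>\<close> is \<open>c\<^sup>a\<^sub>\<Lambda>\<close>,
  \<open>DS A \<Lambda>\<close> is \<open>ds\<^sup>A\<^sub>\<Lambda>\<close> and \<open>DX \<lambda>\<close> is \<open>dx\<^sup>\<lambda>\<close>.
\<close>

datatype fld = Ev nat | Od nat

datatype 'n gen = Sg fld "'n multiset" | DX 'n | DS fld "'n multiset"

fun fpar :: "fld \<Rightarrow> nat" where
  "fpar (Ev i) = 0"
| "fpar (Od a) = 1"

fun gdeg :: "'n gen \<Rightarrow> nat" where
  "gdeg (Sg A L) = 0"
| "gdeg (DX l) = 1"
| "gdeg (DS A L) = 1"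

fun gpar :: "'n gen \<Rightarrow> nat" where
  "gpar (Sg A L) = fpar A"
| "gpar (DX l) = 0"
| "gpar (DS A L) = fpar A"

definition anticomm :: "'n gen \<Rightarrow> 'n gen \<Rightarrow> bool" where
  "anticomm g h \<longleftrightarrow> odd (gdeg g * gdeg h + gpar g * gpar h)"

instance fld :: countable
  by countable_datatype

instance gen :: (finite) countable
proof
  define c where "c = (\<lambda>g :: 'a gen. case g of
      Sg A L \<Rightarrow> (0 :: nat, A, count L, [])
    | DX l \<Rightarrow> (1, Ev 0, count {#}, [l])
    | DS A L \<Rightarrow> (2, A, count L, []))"
  have "inj c"
    by (rule injI) (auto simp: c_def count_inject split: gen.splits)
  then have "inj (to_nat \<circ> c)"
    by (intro inj_compose inj_to_nat)
  then show "\<exists>f :: 'a gen \<Rightarrow> nat. inj f"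
    by blast
qed

text \<open>
  The algebra with generators \<open>'n gen\<close> over the reals, subject to
  \<open>g h = (-1)\<^bsup>|g||h|+[g][h]\<^esup> h g\<close> only.  The basis vector with key \<open>M\<close> stands for the product of the
  generators in \<open>M\<close>, with multiplicity, in increasing order with respect to \<open>to_nat\<close>; in
  particular a generator with \<open>g g = -(g g)\<close> occurs at most once (\<open>reduced\<close>), and \<open>tw M N\<close> is the
  sign of sorting the word of \<open>M\<close> followed by the word of \<open>N\<close>.  Beware that \<open>gmul\<close>, not the
  multiplication of \<open>poly_mapping\<close>, is the product.
\<close>

type_synonym 'n salg = "'n gen multiset \<Rightarrow>\<^sub>0 real"

definition reduced :: "'n gen multiset \<Rightarrow> bool" where
  "reduced M \<longleftrightarrow> (\<forall>g. anticomm g g \<longrightarrow> count M g \<le> 1)"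

definition tw :: "('n::finite) gen multiset \<Rightarrow> 'n gen multiset \<Rightarrow> real" where
  "tw M N = (\<Prod>g\<in>#M. \<Prod>h\<in>#N. if to_nat h < to_nat g \<and> anticomm g h then - 1 else 1)"

definition gmul :: "('n::finite) salg \<Rightarrow> 'n salg \<Rightarrow> 'n salg" (infixl \<open>\<cdot>\<close> 70) where
  "a \<cdot> b = (\<Sum>M\<in>Poly_Mapping.keys a. \<Sum>N\<in>Poly_Mapping.keys b.
     if reduced (M + N)
     then Poly_Mapping.single (M + N) (tw M N * Poly_Mapping.lookup a M * Poly_Mapping.lookup b N)
     else 0)"

definition gconst :: "real \<Rightarrow> 'n salg" where
  "gconst r = Poly_Mapping.single {#} r"

definition gvar :: "'n gen \<Rightarrow> 'n salg" where
  "gvar g = Poly_Mapping.single {#g#} 1"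

definition svars :: "'n salg \<Rightarrow> (fld \<times> 'n multiset) set" where
  "svars a = {(A, L). \<exists>M\<in>Poly_Mapping.keys a. Sg A L \<in># M}"

text \<open>The left derivative \<open>\<partial>\<^sub>A\<^sup>\<Lambda>\<close>, extended to forms by letting it annihilate \<open>dx\<close> and \<open>ds\<close>.\<close>

definition pds :: "fld \<Rightarrow> ('n::finite) multiset \<Rightarrow> 'n salg \<Rightarrow> 'n salg" where
  "pds A L a = (\<Sum>M\<in>Poly_Mapping.keys a. Poly_Mapping.single (M - {#Sg A L#})
     (real (count M (Sg A L)) * tw {#Sg A L#} (M - {#Sg A L#}) * Poly_Mapping.lookup a M))"

section \<open>Local forms, total derivatives and coordinate changes\<close>

definition flds :: "('x, 'n::finite, 'y, 'q, 'k) setting \<Rightarrow> fld set" where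
  "flds B = Ev ` {..<frank (bunY B)} \<union> Od ` {..<frank (bunQ B)}"

fun gen_ok :: "('x, 'n::finite, 'y, 'q, 'k) setting \<Rightarrow> nat \<Rightarrow> 'n gen \<Rightarrow> bool" where
  "gen_ok B r (Sg A L) \<longleftrightarrow> A \<in> flds B \<and> size L \<le> r"
| "gen_ok B r (DX l) \<longleftrightarrow> True"
| "gen_ok B r (DS A L) \<longleftrightarrow> A \<in> flds B \<and> size L \<le> r"

text \<open>
  Forms on the domain of chart \<open>k\<close>: polynomials in the generators with smooth coefficients; \<open>r\<close>
  bounds both the jet order and the polynomial degree.  A form is extended by 0 outside its domain.
\<close>

definition local_forms_upto ::
  "('x, 'n::finite, 'y, 'q, 'k) setting \<Rightarrow> 'k \<Rightarrow> nat \<Rightarrow> ('x \<Rightarrow> 'n salg) set" where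
  "local_forms_upto B k r = {\<omega>.
     (\<forall>p. \<forall>M\<in>Poly_Mapping.keys (\<omega> p).
        p \<in> cdom B k \<and> reduced M \<and> size M \<le> r \<and> (\<forall>g\<in>#M. gen_ok B r g)) \<and>
     (\<forall>M. smooth_in B k (cdom B k) (\<lambda>p. Poly_Mapping.lookup (\<omega> p) M))}"

definition local_forms ::
  "('x, 'n::finite, 'y, 'q, 'k) setting \<Rightarrow> 'k \<Rightarrow> ('x \<Rightarrow> 'n salg) set" where
  "local_forms B k = (\<Union>r. local_forms_upto B k r)"

definition local_graded_functions ::
  "('x, 'n::finite, 'y, 'q, 'k) setting \<Rightarrow> 'k \<Rightarrow> ('x \<Rightarrow> 'n salg) set" where
  "local_graded_functions B k = {f \<in> local_forms B k.
     \<forall>p. \<forall>M\<in>Poly_Mapping.keys (f p). \<forall>g\<in>#M. gdeg g = 0}"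

text \<open>The derivative \<open>\<partial>\<^sub>\<lambda>\<close> of the coefficients in chart \<open>k\<close>.\<close>

definition pdx :: "('x, 'n::finite, 'y, 'q, 'k) setting \<Rightarrow> 'k \<Rightarrow> 'n \<Rightarrow>
    ('x \<Rightarrow> 'n salg) \<Rightarrow> 'x \<Rightarrow> 'n salg" where
  "pdx B k l f p = Abs_poly_mapping (\<lambda>M. pd B k l (\<lambda>q. Poly_Mapping.lookup (f q) M) p)"

definition totd :: "('x, 'n::finite, 'y, 'q, 'k) setting \<Rightarrow> 'k \<Rightarrow> 'n \<Rightarrow>
    ('x \<Rightarrow> 'n salg) \<Rightarrow> 'x \<Rightarrow> 'n salg" where
  "totd B k l f p = pdx B k l f p +
     (\<Sum>(A, L)\<in>svars (f p). gvar (Sg A (add_mset l L)) \<cdot> pds A L (f p))"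

definition ldiff :: "('x, 'n::finite, 'y, 'q, 'k) setting \<Rightarrow> 'k \<Rightarrow>
    ('x \<Rightarrow> 'n salg) \<Rightarrow> 'x \<Rightarrow> 'n salg" where
  "ldiff B k \<omega> p = (\<Sum>l\<in>UNIV. gvar (DX l) \<cdot> pdx B k l \<omega> p) +
     (\<Sum>(A, L)\<in>svars (\<omega> p). gvar (DS A L) \<cdot> pds A L (\<omega> p))"

text \<open>
  An enumeration of a multi-index; as the operators \<open>d\<^sub>\<lambda>\<close> commute on smooth graded functions, the
  choice does not matter below.
\<close>

definition enum_of :: "'n multiset \<Rightarrow> 'n list" where
  "enum_of L = (SOME ls. mset ls = L)"

definition totd_multi :: "('x, 'n::finite, 'y, 'q, 'k) setting \<Rightarrow> 'k \<Rightarrow> 'n multiset \<Rightarrow>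
    ('x \<Rightarrow> 'n salg) \<Rightarrow> 'x \<Rightarrow> 'n salg" where
  "totd_multi B k L f = foldr (totd B k) (enum_of L) f"

text \<open>
  The coordinates \<open>s\<^sup>A\<^sub>\<Lambda>\<close> of chart \<open>k\<close> expressed in those of chart \<open>j\<close>: the (affine, resp. linear)
  change of fibre coordinates, prolonged by \<open>d'\<^sub>\<lambda> = \<Sum>\<^sub>\<mu> (\<partial>x\<^sup>\<mu>/\<partial>x'\<^sup>\<lambda>) d\<^sub>\<mu>\<close>, where the primed coordinates
  are those of chart \<open>k\<close>.
\<close>

fun fld_trans :: "('x, 'n::finite, 'y, 'q, 'k) setting \<Rightarrow> 'k \<Rightarrow> 'k \<Rightarrow> fld \<Rightarrow> 'x \<Rightarrow> 'n salg" where
  "fld_trans B j k (Ev i) p = gconst (trans0 (bunY B) j k i p) +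
     (\<Sum>c<frank (bunY B). gconst (trans1 (bunY B) j k i c p) \<cdot> gvar (Sg (Ev c) {#}))"
| "fld_trans B j k (Od a) p =
     (\<Sum>c<frank (bunQ B). gconst (trans1 (bunQ B) j k a c p) \<cdot> gvar (Sg (Od c) {#}))"

definition prolong :: "('x, 'n::finite, 'y, 'q, 'k) setting \<Rightarrow> 'k \<Rightarrow> 'k \<Rightarrow> 'n \<Rightarrow>
    ('x \<Rightarrow> 'n salg) \<Rightarrow> 'x \<Rightarrow> 'n salg" where
  "prolong B j k l f p =
     (\<Sum>m\<in>UNIV. gconst (pd B k l (\<lambda>q. crd B j q $ m) p) \<cdot> totd B j m f p)"

definition jet_trans :: "('x, 'n::finite, 'y, 'q, 'k) setting \<Rightarrow> 'k \<Rightarrow> 'k \<Rightarrow> fld \<Rightarrow> 'n multiset \<Rightarrow>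
    'x \<Rightarrow> 'n salg" where
  "jet_trans B j k A L = foldr (prolong B j k) (enum_of L) (fld_trans B j k A)"

fun gen_trans :: "('x, 'n::finite, 'y, 'q, 'k) setting \<Rightarrow> 'k \<Rightarrow> 'k \<Rightarrow> 'n gen \<Rightarrow> 'x \<Rightarrow> 'n salg" where
  "gen_trans B j k (Sg A L) p = jet_trans B j k A L p"
| "gen_trans B j k (DX l) p =
     (\<Sum>m\<in>UNIV. gconst (pd B j m (\<lambda>q. crd B k q $ l) p) \<cdot> gvar (DX m))"
| "gen_trans B j k (DS A L) p = ldiff B j (jet_trans B j k A L) p"

definition word_of :: "('n::finite) gen multiset \<Rightarrow> 'n gen list" where
  "word_of M = map from_nat (sorted_list_of_multiset (image_mset to_nat M))"

text \<open>The algebra homomorphism substituting \<open>gen_trans\<close> for the generators of chart \<open>k\<close>.\<close>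

definition form_trans :: "('x, 'n::finite, 'y, 'q, 'k) setting \<Rightarrow> 'k \<Rightarrow> 'k \<Rightarrow> 'x \<Rightarrow>
    'n salg \<Rightarrow> 'n salg" where
  "form_trans B j k p a = (\<Sum>M\<in>Poly_Mapping.keys a. gconst (Poly_Mapping.lookup a M) \<cdot>
     foldr (\<lambda>g b. gen_trans B j k g p \<cdot> b) (word_of M) (gconst 1))"

section \<open>The bigraded differential algebra of graded forms\<close>

text \<open>
  A global form is the family of its local expressions, indexed by the charts and vanishing
  outside their domains.  The bound \<open>r\<close> is uniform in the chart: all elements of the direct
  limit have finite jet order and are polynomial.
\<close>

type_synonym ('x, 'n, 'k) gform = "'k \<Rightarrow> 'x \<Rightarrow> 'n salg"

definition compatible_forms ::
  "('x, 'n::finite, 'y, 'q, 'k) setting \<Rightarrow> ('x, 'n, 'k) gform set" where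
  "compatible_forms B = {\<omega>.
     (\<forall>k. k \<notin> charts B \<longrightarrow> \<omega> k = (\<lambda>_. 0)) \<and>
     (\<exists>r. \<forall>k\<in>charts B. \<omega> k \<in> local_forms_upto B k r) \<and>
     (\<forall>j\<in>charts B. \<forall>k\<in>charts B. \<forall>p\<in>cdom B j \<inter> cdom B k. \<omega> j p = form_trans B j k p (\<omega> k p))}"

fun of_Y :: "'n gen \<Rightarrow> bool" where
  "of_Y (Sg (Ev i) L) = True"
| "of_Y (DS (Ev i) L) = True"
| "of_Y _ = False"

fun of_Q :: "'n gen \<Rightarrow> bool" where
  "of_Q (Sg (Od a) L) = True"
| "of_Q (DS (Od a) L) = True"
| "of_Q _ = False"

definition C_inf :: "('x, 'n::finite, 'y, 'q, 'k) setting \<Rightarrow> ('x, 'n, 'k) gform set" where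
  "C_inf B = {\<omega> \<in> compatible_forms B.
     \<forall>k p. \<forall>M\<in>Poly_Mapping.keys (\<omega> k p). \<forall>g\<in>#M. \<not> of_Y g}"

definition P_inf :: "('x, 'n::finite, 'y, 'q, 'k) setting \<Rightarrow> ('x, 'n, 'k) gform set" where
  "P_inf B = {\<omega> \<in> compatible_forms B.
     \<forall>k p. \<forall>M\<in>Poly_Mapping.keys (\<omega> k p). \<forall>g\<in>#M. \<not> of_Q g}"

definition wedge :: "('x, 'n::finite, 'k) gform \<Rightarrow> ('x, 'n, 'k) gform \<Rightarrow> ('x, 'n, 'k) gform"
    (infixl \<open>\<and>\<^sub>g\<close> 70) where
  "\<omega> \<and>\<^sub>g \<eta> = (\<lambda>k p. \<omega> k p \<cdot> \<eta> k p)"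

definition fadd :: "('x, 'n, 'k) gform \<Rightarrow> ('x, 'n, 'k) gform \<Rightarrow> ('x, 'n, 'k) gform"
    (infixl \<open>+\<^sub>g\<close> 65) where
  "\<omega> +\<^sub>g \<eta> = (\<lambda>k p. \<omega> k p + \<eta> k p)"

definition fscale :: "real \<Rightarrow> ('x, 'n::finite, 'k) gform \<Rightarrow> ('x, 'n, 'k) gform" where
  "fscale r \<omega> = (\<lambda>k p. gconst r \<cdot> \<omega> k p)"

definition S_inf :: "('x, 'n::finite, 'y, 'q, 'k) setting \<Rightarrow> ('x, 'n, 'k) gform set" where
  "S_inf B = {\<omega>. \<exists>(m::nat) \<phi> \<psi>. (\<forall>i<m. \<phi> i \<in> C_inf B \<and> \<psi> i \<in> P_inf B) \<and>
     \<omega> = (\<lambda>k p. \<Sum>i<m. (\<phi> i \<and>\<^sub>g \<psi> i) k p)}"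

definition gdiff :: "('x, 'n::finite, 'y, 'q, 'k) setting \<Rightarrow> ('x, 'n, 'k) gform \<Rightarrow> ('x, 'n, 'k) gform"
  where
  "gdiff B \<omega> = (\<lambda>k p. if k \<in> charts B \<and> p \<in> cdom B k then ldiff B k (\<omega> k) p else 0)"

text \<open>Homogeneity in form degree \<open>d\<close> and in Grassmann parity \<open>a\<close> (taken modulo 2).\<close>

definition hom_deg :: "nat \<Rightarrow> ('x, 'n, 'k) gform \<Rightarrow> bool" where
  "hom_deg d \<omega> \<longleftrightarrow> (\<forall>k p. \<forall>M\<in>Poly_Mapping.keys (\<omega> k p). (\<Sum>g\<in>#M. gdeg g) = d)"

definition hom_par :: "nat \<Rightarrow> ('x, 'n, 'k) gform \<Rightarrow> bool" where
  "hom_par a \<omega> \<longleftrightarrow> (\<forall>k p. \<forall>M\<in>Poly_Mapping.keys (\<omega> k p). even ((\<Sum>g\<in>#M. gpar g) + a))"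

definition S0_inf :: "('x, 'n::finite, 'y, 'q, 'k) setting \<Rightarrow> ('x, 'n, 'k) gform set" where
  "S0_inf B = {f \<in> S_inf B. hom_deg 0 f}"

definition theta :: "fld \<Rightarrow> ('n::finite) multiset \<Rightarrow> 'n salg" where
  "theta A L = gvar (DS A L) - (\<Sum>l\<in>UNIV. gvar (Sg A (add_mset l L)) \<cdot> gvar (DX l))"

definition contact_forms ::
  "('x, 'n::finite, 'y, 'q, 'k) setting \<Rightarrow> ('x, 'n, 'k) gform set" where
  "contact_forms B = {\<omega> \<in> S_inf B. \<forall>k\<in>charts B. \<exists>F \<eta>. finite F \<and>
     (\<forall>(A, L)\<in>F. A \<in> flds B \<and> \<eta> A L \<in> local_forms B k) \<and>
     (\<forall>p\<in>cdom B k. \<omega> k p = (\<Sum>(A, L)\<in>F. theta A L \<cdot> \<eta> A L p))}"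

section \<open>Generalized supersymmetries\<close>

definition linear_map_on :: "('x, 'n::finite, 'k) gform set \<Rightarrow> ('x, 'n, 'k) gform set \<Rightarrow>
    (('x, 'n, 'k) gform \<Rightarrow> ('x, 'n, 'k) gform) \<Rightarrow> bool" where
  "linear_map_on V W u \<longleftrightarrow> (\<forall>f\<in>V. u f \<in> W) \<and>
     (\<forall>f\<in>V. \<forall>g\<in>V. u (f +\<^sub>g g) = u f +\<^sub>g u g) \<and>
     (\<forall>f\<in>V. \<forall>r. u (fscale r f) = fscale r (u f))"

definition homogeneous_derivation :: "('x, 'n::finite, 'y, 'q, 'k) setting \<Rightarrow> nat \<Rightarrow>
    (('x, 'n, 'k) gform \<Rightarrow> ('x, 'n, 'k) gform) \<Rightarrow> bool" where
  "homogeneous_derivation B e u \<longleftrightarrow> linear_map_on (S0_inf B) (S0_inf B) u \<and>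
     (\<forall>f\<in>S0_inf B. \<forall>a. hom_par a f \<longrightarrow> hom_par (a + e) (u f)) \<and>
     (\<forall>f\<in>S0_inf B. \<forall>g\<in>S0_inf B. \<forall>a. hom_par a f \<longrightarrow>
        u (f \<and>\<^sub>g g) = (u f \<and>\<^sub>g g) +\<^sub>g fscale ((- 1) ^ (a * e)) (f \<and>\<^sub>g u g))"

definition homogeneous_interior :: "('x, 'n::finite, 'y, 'q, 'k) setting \<Rightarrow> nat \<Rightarrow>
    (('x, 'n, 'k) gform \<Rightarrow> ('x, 'n, 'k) gform) \<Rightarrow> (('x, 'n, 'k) gform \<Rightarrow> ('x, 'n, 'k) gform) \<Rightarrow> bool"
  where
  "homogeneous_interior B e u \<iota> \<longleftrightarrow> linear_map_on (S_inf B) (S_inf B) \<iota> \<and>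
     (\<forall>f\<in>S0_inf B. \<iota> f = (\<lambda>_ _. 0)) \<and>
     (\<forall>f\<in>S0_inf B. \<iota> (gdiff B f) = u f) \<and>
     (\<forall>\<phi>\<in>S_inf B. \<forall>\<sigma>\<in>S_inf B. \<forall>d a. hom_deg d \<phi> \<and> hom_par a \<phi> \<longrightarrow>
        \<iota> (\<phi> \<and>\<^sub>g \<sigma>) = (\<iota> \<phi> \<and>\<^sub>g \<sigma>) +\<^sub>g fscale ((- 1) ^ (d + a * e)) (\<phi> \<and>\<^sub>g \<iota> \<sigma>))"

text \<open>
  The Leibniz rules above only make sense for a homogeneous derivation; a general graded derivation
  is the sum of an even and an odd one, and its interior product is the corresponding sum.
\<close>

definition graded_derivation_with_interior :: "('x, 'n::finite, 'y, 'q, 'k) setting \<Rightarrow>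
    (('x, 'n, 'k) gform \<Rightarrow> ('x, 'n, 'k) gform) \<Rightarrow> (('x, 'n, 'k) gform \<Rightarrow> ('x, 'n, 'k) gform) \<Rightarrow> bool"
  where
  "graded_derivation_with_interior B u \<iota> \<longleftrightarrow> (\<exists>u0 u1 \<iota>0 \<iota>1.
     homogeneous_derivation B 0 u0 \<and> homogeneous_derivation B 1 u1 \<and>
     homogeneous_interior B 0 u0 \<iota>0 \<and> homogeneous_interior B 1 u1 \<iota>1 \<and>
     (\<forall>f\<in>S0_inf B. u f = u0 f +\<^sub>g u1 f) \<and>
     (\<forall>\<omega>\<in>S_inf B. \<iota> \<omega> = \<iota>0 \<omega> +\<^sub>g \<iota>1 \<omega>))"

definition lie_derivative :: "('x, 'n::finite, 'y, 'q, 'k) setting \<Rightarrow>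
    (('x, 'n, 'k) gform \<Rightarrow> ('x, 'n, 'k) gform) \<Rightarrow> ('x, 'n, 'k) gform \<Rightarrow> ('x, 'n, 'k) gform" where
  "lie_derivative B \<iota> \<omega> = \<iota> (gdiff B \<omega>) +\<^sub>g gdiff B (\<iota> \<omega>)"

definition generalized_supersymmetry :: "('x, 'n::finite, 'y, 'q, 'k) setting \<Rightarrow>
    (('x, 'n, 'k) gform \<Rightarrow> ('x, 'n, 'k) gform) \<Rightarrow> bool" where
  "generalized_supersymmetry B u \<longleftrightarrow> (\<exists>\<iota>. graded_derivation_with_interior B u \<iota> \<and>
     (\<forall>\<omega>\<in>contact_forms B. lie_derivative B \<iota> \<omega> \<in> contact_forms B))"

text \<open>The operators \<open>\<upsilon>\<^sub>H\<close> and \<open>\<upsilon>\<^sub>V\<close> in chart \<open>k\<close>; the sum over \<open>\<Lambda>\<close> is finite at each point.\<close>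

definition horizontal_part :: "('x, 'n::finite, 'y, 'q, 'k) setting \<Rightarrow> 'k \<Rightarrow>
    ('n \<Rightarrow> 'x \<Rightarrow> 'n salg) \<Rightarrow> ('x \<Rightarrow> 'n salg) \<Rightarrow> 'x \<Rightarrow> 'n salg" where
  "horizontal_part B k v f p = (\<Sum>l\<in>UNIV. v l p \<cdot> totd B k l f p)"

definition vertical_part :: "('x, 'n::finite, 'y, 'q, 'k) setting \<Rightarrow> 'k \<Rightarrow>
    (fld \<Rightarrow> 'x \<Rightarrow> 'n salg) \<Rightarrow> ('x \<Rightarrow> 'n salg) \<Rightarrow> 'x \<Rightarrow> 'n salg" where
  "vertical_part B k w f p = (\<Sum>A\<in>flds B. w A p \<cdot> pds A {#} (f p)) +
     (\<Sum>(A, L)\<in>{s \<in> svars (f p). size (snd s) > 0}. totd_multi B k L (w A) p \<cdot> pds A L (f p))"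

end

theory Submission
  imports Defs
begin

text \<open>
  A graded derivation is local, so it may be computed on germs.  Every germ of a graded function in a
  chart extends to a global element of \<open>S\<^sup>0\<close>: cut off the fibre coordinates by a bump function and
  prolong them; the prolongations are compatible over all charts because the transformed total
  derivatives commute and form a cocycle.  Contracting \<open>df = \<Sum> dx\<^sup>\<lambda> \<partial>\<^sub>\<lambda>f + \<Sum> ds\<^sup>A\<^sub>\<Lambda> \<partial>\<^sub>A\<^sup>\<Lambda>f\<close> with \<open>\<upsilon>\<close> then
  expresses \<open>\<upsilon>(f)\<close> by \<open>\<upsilon>\<^sup>\<lambda> = \<upsilon>(x\<^sup>\<lambda>)\<close> and \<open>\<upsilon>(s\<^sup>A\<^sub>\<Lambda>)\<close>.  The Lie derivative of \<open>\<theta>\<^sup>A\<^sub>\<Lambda>\<close> is a contact form, so its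
  horizontal part vanishes, which says
  \<open>\<upsilon>(s\<^sup>A\<^bsub>\<lambda>+\<Lambda>\<^esub>) = d\<^sub>\<lambda>(\<upsilon>(s\<^sup>A\<^sub>\<Lambda>)) - \<Sum>\<^sub>\<mu> d\<^sub>\<lambda>(\<upsilon>\<^sup>\<mu>) s\<^sup>A\<^bsub>\<mu>+\<Lambda>\<^esub>\<close>; equivalently the contractions
  \<open>w\<^sub>\<Lambda> = \<upsilon>(s\<^sup>A\<^sub>\<Lambda>) - \<Sum>\<^sub>\<mu> \<upsilon>\<^sup>\<mu> s\<^sup>A\<^bsub>\<mu>+\<Lambda>\<^esub>\<close> of \<open>\<upsilon>\<close> with \<open>\<theta>\<^sup>A\<^sub>\<Lambda>\<close> satisfy \<open>w\<^bsub>\<lambda>+\<Lambda>\<^esub> = d\<^sub>\<lambda> w\<^sub>\<Lambda>\<close>.  Finally,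
  the components have bounded order and degree on the whole chart, since \<open>\<upsilon>\<close> maps a suitable
  locally finite sum of forms to an element of \<open>S\<^sup>0\<close>.
\<close>

text \<open>The obstacle is that \<open>\<upsilon>\<close> acts on global functions only, whereas
  its components are local. The coordinates have no global versions, so each component is read off,
  point by point, from global functions with the right germ. Such functions must moreover be
  exhibited as sums of products of an element of \<open>C_inf\<close> and one of
  \<open>P_inf\<close>, since this is how \<open>S_inf\<close> is defined; membership is therefore
  tracked through every construction. Contraction is a sum of an even and an odd operator, each with
  its own Leibniz signs; it is applied only to products whose left factor is an even one-form or
  whose right factor is a function, where both sign rules give the same formula. Finally, pointwise
  components carry no common bound on jet order and degree, but a local form needs one over the
  whole chart. Restricting to functions that are affine in the fibre coordinates of order 0 makes
  local bounds independent of the function, and second countability turns local bounds into a single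
  one by a gliding-hump argument.\<close>

section \<open>Smooth functions on open sets\<close>

lemma ck_on_cong:
  assumes "open S" "\<And>x. x \<in> S \<Longrightarrow> f x = g x" "ck_on r S f"
  shows "ck_on r S g"
  using assms(2,3)
proof (induction r arbitrary: f g)
  case 0
  then show ?case using continuous_on_cong by fastforce
next
  case (Suc r)
  \<comment> \<open>Openness of \<open>S\<close> lets the derivative at a point of \<open>S\<close>
    depend on the values in \<open>S\<close> alone.\<close>
  have h: "(g has_derivative frechet_derivative f (at x)) (at x)" if "x \<in> S" for x
    using has_derivative_transform_within_open[OF _ assms(1) that] Suc.prems that
    by (metis ck_on.simps(2) frechet_derivative_works)
  have "frechet_derivative g (at x) = frechet_derivative f (at x)" if "x \<in> S" for x
    by (rule frechet_derivative_at[OF h[OF that], symmetric])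
  moreover have "\<forall>x\<in>S. g differentiable (at x)"
    using h differentiable_def by blast
  ultimately show ?case
    using Suc.prems(2) Suc.IH[of "\<lambda>x. frechet_derivative f (at x) v" "\<lambda>x. frechet_derivative g (at x) v" for v]
    by simp
qed

lemma ck_on_subset: "ck_on r S f \<Longrightarrow> T \<subseteq> S \<Longrightarrow> ck_on r T f"
  by (induction r arbitrary: f) (auto intro: continuous_on_subset)

lemma ck_on_SucD: "ck_on (Suc r) S f \<Longrightarrow> ck_on r S f"
proof (induction r arbitrary: f)
  case 0
  then show ?case
    by (auto intro!: continuous_at_imp_continuous_on differentiable_imp_continuous_within)
next
  case (Suc r)
  then show ?case by (metis ck_on.simps(2))
qed

lemma ck_on_Suc_has_derivative:
  "ck_on (Suc r) S f \<Longrightarrow> x \<in> S \<Longrightarrow> (f has_derivative frechet_derivative f (at x)) (at x)"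
  by (simp add: frechet_derivative_works[symmetric])

text \<open>Differentiability is required with respect to full neighbourhoods of each point, so only
  continuity has to be glued, and that is local on open sets.\<close>

lemma ck_on_open_Union:
  assumes "\<And>x. x \<in> S \<Longrightarrow> \<exists>T. open T \<and> x \<in> T \<and> ck_on r T f"
  shows "ck_on r S f"
  using assms
proof (induction r arbitrary: f)
  case 0
  have "isCont f x" if x: "x \<in> S" for x
  proof -
    obtain T where "open T" "x \<in> T" "ck_on 0 T f" using 0[OF x] by blast
    then show ?thesis by (simp add: continuous_on_eq_continuous_at)
  qed
  then show ?case by (simp add: continuous_at_imp_continuous_on)
next
  case (Suc r)
  have "f differentiable (at x)" if "x \<in> S" for x
    using Suc.prems[OF that] by auto
  moreover have "ck_on r S (\<lambda>x. frechet_derivative f (at x) v)" for v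
    using Suc.prems by (intro Suc.IH) force
  ultimately show ?case by simp
qed

lemma ck_on_const [simp]: "ck_on r S (\<lambda>x. c)"
  by (induction r arbitrary: c) auto

lemma ck_on_add:
  assumes "open S"
  shows "ck_on r S f \<Longrightarrow> ck_on r S g \<Longrightarrow> ck_on r S (\<lambda>x. f x + g x)"
proof (induction r arbitrary: f g)
  case 0
  then show ?case by (auto intro: continuous_intros)
next
  case (Suc r)
  have h: "((\<lambda>x. f x + g x) has_derivative (\<lambda>v. frechet_derivative f (at x) v + frechet_derivative g (at x) v)) (at x)"
    if "x \<in> S" for x
    by (intro has_derivative_add ck_on_Suc_has_derivative[OF Suc.prems(1) that] ck_on_Suc_has_derivative[OF Suc.prems(2) that])
  have d: "frechet_derivative (\<lambda>x. f x + g x) (at x) =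
      (\<lambda>v. frechet_derivative f (at x) v + frechet_derivative g (at x) v)" if "x \<in> S" for x
    by (rule frechet_derivative_at[OF h[OF that], symmetric])
  have "ck_on r S (\<lambda>x. frechet_derivative f (at x) v + frechet_derivative g (at x) v)" for v
    using Suc.prems by (intro Suc.IH) auto
  from ck_on_cong[OF assms _ this] have "ck_on r S (\<lambda>x. frechet_derivative (\<lambda>x. f x + g x) (at x) v)" for v
    by (simp add: d)
  moreover have "\<forall>x\<in>S. (\<lambda>x. f x + g x) differentiable (at x)"
    using h differentiable_def by blast
  ultimately show ?case by simp
qed

lemma ck_on_mult:
  assumes "open S"
  shows "ck_on r S f \<Longrightarrow> ck_on r S g \<Longrightarrow> ck_on r S (\<lambda>x. f x * g x)"
proof (induction r arbitrary: f g)
  case 0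
  then show ?case by (auto intro: continuous_intros)
next
  case (Suc r)
  have h: "((\<lambda>x. f x * g x) has_derivative (\<lambda>v. f x * frechet_derivative g (at x) v + frechet_derivative f (at x) v * g x)) (at x)"
    if "x \<in> S" for x
    by (intro has_derivative_mult ck_on_Suc_has_derivative[OF Suc.prems(1) that] ck_on_Suc_has_derivative[OF Suc.prems(2) that])
  have d: "frechet_derivative (\<lambda>x. f x * g x) (at x) =
      (\<lambda>v. f x * frechet_derivative g (at x) v + frechet_derivative f (at x) v * g x)" if "x \<in> S" for x
    by (rule frechet_derivative_at[OF h[OF that], symmetric])
  have "ck_on r S f" "ck_on r S g"
    using Suc.prems ck_on_SucD by blast+
  then have "ck_on r S (\<lambda>x. f x * frechet_derivative g (at x) v + frechet_derivative f (at x) v * g x)" for v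
    using Suc.prems by (intro ck_on_add[OF assms] Suc.IH) auto
  from ck_on_cong[OF assms _ this] have "ck_on r S (\<lambda>x. frechet_derivative (\<lambda>x. f x * g x) (at x) v)" for v
    by (simp add: d)
  moreover have "\<forall>x\<in>S. (\<lambda>x. f x * g x) differentiable (at x)"
    using h differentiable_def by blast
  ultimately show ?case by simp
qed

lemma ck_on_sum:
  assumes "open S" "\<And>i. i \<in> I \<Longrightarrow> ck_on r S (f i)"
  shows "ck_on r S (\<lambda>x. \<Sum>i\<in>I. f i x)"
  using assms(2) by (induction I rule: infinite_finite_induct) (auto intro: ck_on_add assms(1))

text \<open>By the chain rule a derivative of the composite is a sum of products of derivatives of
  the components of \<open>F\<close> with partial derivatives of \<open>f\<close> composed with
  \<open>F\<close>; the latter fall under the induction hypothesis. Components along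
  \<open>Basis\<close> are used because \<open>ck_on\<close> is about real-valued functions.\<close>

lemma ck_on_compose:
  fixes F :: "'a::real_normed_vector \<Rightarrow> 'b::euclidean_space"
  assumes "open S" "open T" "F ` S \<subseteq> T" "\<And>b. b \<in> Basis \<Longrightarrow> ck_on r S (\<lambda>x. F x \<bullet> b)"
  shows "ck_on r T f \<Longrightarrow> ck_on r S (\<lambda>x. f (F x))"
  using assms(4)
proof (induction r arbitrary: f)
  case 0
  have "continuous_on S F"
    using 0(2) by (subst continuous_on_componentwise) simp
  then show ?case using 0(1) assms(3) by (auto intro: continuous_on_compose2)
next
  case (Suc r)
  have F: "(F has_derivative (\<lambda>v. \<Sum>b\<in>Basis. frechet_derivative (\<lambda>x. F x \<bullet> b) (at x) v *\<^sub>R b)) (at x)"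
    if "x \<in> S" for x
  proof (subst has_derivative_componentwise_within, rule ballI)
    fix i :: 'b assume i: "i \<in> Basis"
    then have "(\<Sum>b\<in>Basis. frechet_derivative (\<lambda>x. F x \<bullet> b) (at x) v *\<^sub>R b) \<bullet> i =
        frechet_derivative (\<lambda>x. F x \<bullet> i) (at x) v" for v
      by (simp add: inner_sum_left inner_Basis if_distrib cong: if_cong)
    then show "((\<lambda>x. F x \<bullet> i) has_derivative (\<lambda>v. (\<Sum>b\<in>Basis. frechet_derivative (\<lambda>x. F x \<bullet> b) (at x) v *\<^sub>R b) \<bullet> i)) (at x)"
      using ck_on_Suc_has_derivative[OF Suc.prems(2)[OF i] that] by simp
  qed
  have f: "(f has_derivative frechet_derivative f (at (F x))) (at (F x))" if "x \<in> S" for x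
    using assms(3) that by (intro ck_on_Suc_has_derivative[OF Suc.prems(1)]) auto
  have "((\<lambda>x. f (F x)) has_derivative (\<lambda>v. frechet_derivative f (at (F x))
      (\<Sum>b\<in>Basis. frechet_derivative (\<lambda>x. F x \<bullet> b) (at x) v *\<^sub>R b))) (at x)" if "x \<in> S" for x
    using has_derivative_compose[OF F[OF that] f[OF that]] .
  then have h: "((\<lambda>x. f (F x)) has_derivative (\<lambda>v. \<Sum>b\<in>Basis. frechet_derivative (\<lambda>x. F x \<bullet> b) (at x) v *
      frechet_derivative f (at (F x)) b)) (at x)" if "x \<in> S" for x
    using that by (simp add: linear_sum[OF f[THEN has_derivative_linear]] linear_cmul[OF f[THEN has_derivative_linear]])
  have d: "frechet_derivative (\<lambda>x. f (F x)) (at x) =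
      (\<lambda>v. \<Sum>b\<in>Basis. frechet_derivative (\<lambda>x. F x \<bullet> b) (at x) v * frechet_derivative f (at (F x)) b)"
    if "x \<in> S" for x
    by (rule frechet_derivative_at[OF h[OF that], symmetric])
  have "ck_on r S (\<lambda>x. \<Sum>b\<in>Basis. frechet_derivative (\<lambda>x. F x \<bullet> b) (at x) v * frechet_derivative f (at (F x)) b)" for v
  proof (intro ck_on_sum ck_on_mult assms(1))
    fix b :: 'b assume b: "b \<in> Basis"
    show "ck_on r S (\<lambda>x. frechet_derivative (\<lambda>x. F x \<bullet> b) (at x) v)"
      using Suc.prems(2)[OF b] by simp
    show "ck_on r S (\<lambda>x. frechet_derivative f (at (F x)) b)"
    proof (rule Suc.IH)
      show "ck_on r T (\<lambda>y. frechet_derivative f (at y) b)"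
        using Suc.prems(1) by simp
    qed (rule ck_on_SucD[OF Suc.prems(2)])
  qed
  from ck_on_cong[OF assms(1) _ this] have "ck_on r S (\<lambda>x. frechet_derivative (\<lambda>x. f (F x)) (at x) v)" for v
    by (simp add: d)
  moreover have "\<forall>x\<in>S. (\<lambda>x. f (F x)) differentiable (at x)"
    using h differentiable_def by blast
  ultimately show ?case by simp
qed

lemma has_field_derivative_along_line:
  fixes f :: "'a::real_normed_vector \<Rightarrow> real"
  assumes "f differentiable (at (c + s *\<^sub>R u))"
  shows "((\<lambda>s. f (c + s *\<^sub>R u)) has_field_derivative frechet_derivative f (at (c + s *\<^sub>R u)) u) (at s)"
proof -
  have f: "(f has_derivative frechet_derivative f (at (c + s *\<^sub>R u))) (at (c + s *\<^sub>R u))"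
    using assms frechet_derivative_works by blast
  have "((\<lambda>s. c + s *\<^sub>R u) has_derivative (\<lambda>h. h *\<^sub>R u)) (at s)"
    by (auto intro!: derivative_eq_intros)
  from has_derivative_compose[OF this f]
  have "((\<lambda>s. f (c + s *\<^sub>R u)) has_derivative (\<lambda>h. h * frechet_derivative f (at (c + s *\<^sub>R u)) u)) (at s)"
    using f[THEN has_derivative_linear] by (simp add: linear_cmul)
  then show ?thesis
    by (simp add: has_field_derivative_def mult.commute[of _ "frechet_derivative f (at (c + s *\<^sub>R u)) u"])
qed

text \<open>Two mean values: first along \<open>u\<close> for the increment of \<open>f\<close> by
  \<open>h\<close> times \<open>v\<close>, then along \<open>v\<close> for the derivative of
  \<open>f\<close> in direction \<open>u\<close>. The second difference is symmetric in
  \<open>u\<close> and \<open>v\<close>, which is what makes the mixed derivatives agree.\<close>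

lemma second_difference_mvt:
  fixes f :: "'a::real_normed_vector \<Rightarrow> real"
  assumes f: "ck_on (Suc (Suc 0)) S f" and "h > 0"
    and S: "\<And>s t. 0 \<le> s \<Longrightarrow> s \<le> h \<Longrightarrow> 0 \<le> t \<Longrightarrow> t \<le> h \<Longrightarrow> x + s *\<^sub>R u + t *\<^sub>R v \<in> S"
  shows "\<exists>s t. 0 \<le> s \<and> s \<le> h \<and> 0 \<le> t \<and> t \<le> h \<and>
    f (x + h *\<^sub>R u + h *\<^sub>R v) - f (x + h *\<^sub>R u) - f (x + h *\<^sub>R v) + f x =
    h * h * frechet_derivative (\<lambda>y. frechet_derivative f (at y) u) (at (x + s *\<^sub>R u + t *\<^sub>R v)) v"
proof -
  have S0: "x + s *\<^sub>R u \<in> S" if "0 \<le> s" "s \<le> h" for s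
    using S[of s 0] that assms(2) by simp
  have d: "((\<lambda>s. f (x + h *\<^sub>R v + s *\<^sub>R u) - f (x + s *\<^sub>R u)) has_field_derivative
     frechet_derivative f (at (x + h *\<^sub>R v + s *\<^sub>R u)) u - frechet_derivative f (at (x + s *\<^sub>R u)) u) (at s)"
    if "0 \<le> s" "s \<le> h" for s
    using f S[of s h] S0 that assms(2)
    by (intro DERIV_diff has_field_derivative_along_line) (auto simp: algebra_simps)
  from MVT2[OF assms(2) d] obtain s where s: "0 < s" "s < h" and
    1: "f (x + h *\<^sub>R v + h *\<^sub>R u) - f (x + h *\<^sub>R u) - (f (x + h *\<^sub>R v) - f x) =
      h * (frechet_derivative f (at (x + h *\<^sub>R v + s *\<^sub>R u)) u - frechet_derivative f (at (x + s *\<^sub>R u)) u)"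
    by auto
  have d2: "((\<lambda>t. frechet_derivative f (at (x + s *\<^sub>R u + t *\<^sub>R v)) u) has_field_derivative
     frechet_derivative (\<lambda>y. frechet_derivative f (at y) u) (at (x + s *\<^sub>R u + t *\<^sub>R v)) v) (at t)"
    if "0 \<le> t" "t \<le> h" for t
    using f S[of s t] s that by (intro has_field_derivative_along_line) auto
  from MVT2[OF assms(2) d2] obtain t where t: "0 < t" "t < h" and
    2: "frechet_derivative f (at (x + s *\<^sub>R u + h *\<^sub>R v)) u - frechet_derivative f (at (x + s *\<^sub>R u)) u =
      h * frechet_derivative (\<lambda>y. frechet_derivative f (at y) u) (at (x + s *\<^sub>R u + t *\<^sub>R v)) v"
    by auto
  have "f (x + h *\<^sub>R u + h *\<^sub>R v) - f (x + h *\<^sub>R u) - f (x + h *\<^sub>R v) + f x =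
      h * h * frechet_derivative (\<lambda>y. frechet_derivative f (at y) u) (at (x + s *\<^sub>R u + t *\<^sub>R v)) v"
    using 1 2 by (simp add: algebra_simps)
  then show ?thesis using s t by (intro exI[of _ s] exI[of _ t]) auto
qed

lemma mixed_second_derivatives_commute:
  fixes f :: "'a::real_normed_vector \<Rightarrow> real"
  assumes f: "ck_on (Suc (Suc 0)) S f" and "open S" "x \<in> S"
  shows "frechet_derivative (\<lambda>y. frechet_derivative f (at y) u) (at x) v =
         frechet_derivative (\<lambda>y. frechet_derivative f (at y) v) (at x) u"
proof (rule ccontr)
  let ?A = "\<lambda>y. frechet_derivative (\<lambda>y. frechet_derivative f (at y) u) (at y) v"
  let ?B = "\<lambda>y. frechet_derivative (\<lambda>y. frechet_derivative f (at y) v) (at y) u"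
  assume ne: "?A x \<noteq> ?B x"
  define e where "e = \<bar>?A x - ?B x\<bar> / 2"
  have e: "e > 0" using ne by (simp add: e_def)
  have "isCont ?A x" "isCont ?B x"
    using f assms(2,3) by (auto simp: continuous_on_eq_continuous_at)
  then obtain d1 d2 where d: "d1 > 0" "\<And>y. dist y x < d1 \<Longrightarrow> dist (?A y) (?A x) < e"
    "d2 > 0" "\<And>y. dist y x < d2 \<Longrightarrow> dist (?B y) (?B x) < e"
    using e unfolding continuous_at_eps_delta by metis
  obtain d3 where d3: "d3 > 0" "ball x d3 \<subseteq> S"
    using assms(2,3) openE by blast
  define D where "D = min d1 (min d2 d3)"
  \<comment> \<open>A parallelogram with sides \<open>h\<close> times \<open>u\<close> and
    \<open>h\<close> times \<open>v\<close> then stays within \<open>D\<close> of \<open>x\<close>;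
    the summand 1 keeps the denominator positive when both vectors vanish.\<close>
  define h where "h = D / (2 * (norm u + norm v + 1))"
  have D: "D > 0" "D \<le> d1" "D \<le> d2" "D \<le> d3" using d d3 by (auto simp: D_def)
  have h: "h > 0"
    unfolding h_def using D(1) by (intro divide_pos_pos mult_pos_pos add_nonneg_pos) auto
  have near: "dist (x + s *\<^sub>R u + t *\<^sub>R v) x < D" if "0 \<le> s" "s \<le> h" "0 \<le> t" "t \<le> h" for s t
  proof -
    have "dist (x + s *\<^sub>R u + t *\<^sub>R v) x = norm (s *\<^sub>R u + t *\<^sub>R v)"
      by (simp add: dist_norm algebra_simps)
    also have "\<dots> \<le> s * norm u + t * norm v"
      using that norm_triangle_ineq[of "s *\<^sub>R u" "t *\<^sub>R v"] by simp
    also have "\<dots> \<le> h * norm u + h * norm v"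
      using that by (intro add_mono mult_right_mono) auto
    also have "\<dots> < h * (2 * (norm u + norm v + 1))"
    proof -
      have "norm u + norm v < 2 * (norm u + norm v + 1)"
        using norm_ge_zero[of u] norm_ge_zero[of v] by argo
      from mult_strict_left_mono[OF this h] show ?thesis by (simp add: distrib_left)
    qed
    also have "\<dots> = D"
    proof -
      have "norm u + norm v + 1 > 0"
        using norm_ge_zero[of u] norm_ge_zero[of v] by argo
      then show ?thesis unfolding h_def by (simp add: divide_simps)
    qed
    finally show ?thesis .
  qed
  have inS: "x + s *\<^sub>R u + t *\<^sub>R v \<in> S" if "0 \<le> s" "s \<le> h" "0 \<le> t" "t \<le> h" for s t
    using near[OF that] d3 D by (auto simp: dist_commute intro!: subsetD[OF d3(2)])
  obtain s t where st: "0 \<le> s" "s \<le> h" "0 \<le> t" "t \<le> h"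
    "f (x + h *\<^sub>R u + h *\<^sub>R v) - f (x + h *\<^sub>R u) - f (x + h *\<^sub>R v) + f x = h * h * ?A (x + s *\<^sub>R u + t *\<^sub>R v)"
    using second_difference_mvt[OF f h inS] by blast
  have inS': "x + s *\<^sub>R v + t *\<^sub>R u \<in> S" if "0 \<le> s" "s \<le> h" "0 \<le> t" "t \<le> h" for s t
    using inS[OF that(3,4,1,2)] by (simp add: algebra_simps)
  obtain s' t' where st': "0 \<le> s'" "s' \<le> h" "0 \<le> t'" "t' \<le> h"
    "f (x + h *\<^sub>R v + h *\<^sub>R u) - f (x + h *\<^sub>R v) - f (x + h *\<^sub>R u) + f x = h * h * ?B (x + s' *\<^sub>R v + t' *\<^sub>R u)"
    using second_difference_mvt[OF f h inS'] by blast
  \<comment> \<open>Both sides are the same second difference, with the two directions taken in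
    either order.\<close>
  have "h * h * ?A (x + s *\<^sub>R u + t *\<^sub>R v) = h * h * ?B (x + s' *\<^sub>R v + t' *\<^sub>R u)"
  proof -
    have "x + h *\<^sub>R v + h *\<^sub>R u = x + h *\<^sub>R u + h *\<^sub>R v" by simp
    then have "f (x + h *\<^sub>R v + h *\<^sub>R u) = f (x + h *\<^sub>R u + h *\<^sub>R v)" by (rule arg_cong)
    then show ?thesis using st(5) st'(5) by linarith
  qed
  then have "?A (x + s *\<^sub>R u + t *\<^sub>R v) = ?B (x + s' *\<^sub>R v + t' *\<^sub>R u)"
    using h by simp
  moreover have "dist (?A (x + s *\<^sub>R u + t *\<^sub>R v)) (?A x) < e"
    using near[OF st(1-4)] D d(2) by simp
  moreover have "dist (?B (x + s' *\<^sub>R v + t' *\<^sub>R u)) (?B x) < e"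
    using near[OF st'(3,4,1,2)] D d(4) by (simp add: add.assoc add.commute[of "s' *\<^sub>R v"])
  ultimately show False
    unfolding e_def dist_real_def by argo
qed

section \<open>Smooth cut-off functions built from exp(-1/t)\<close>

section \<open>Bump functions\<close>

text \<open>The family exp(-1/t)/t^n over all \<open>n\<close> is closed under differentiation up to
  linear combinations, so smoothness of the case n = 0 follows by an induction over the whole
  family.\<close>

definition flat_exp :: "nat \<Rightarrow> real \<Rightarrow> real" where
  "flat_exp n t = (if t > 0 then exp (- (1 / t)) / t ^ n else 0)"

text \<open>Quadratic decay makes the difference quotient at 0 tend to 0.\<close>

lemma flat_exp_le:
  assumes "t > 0"
  shows "flat_exp n t \<le> fact (n + 2) * t\<^sup>2"
proof -
  \<comment> \<open>A single term of the exponential series at 1/t; its exponent exceeds the pole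
    order \<open>n\<close> by the two powers of \<open>t\<close> that are claimed.\<close>
  have "(1 / t) ^ (n + 2) / fact (n + 2) \<le> exp (1 / t)"
  proof -
    have "(\<lambda>k. inverse (fact k) * (1 / t) ^ k) sums exp (1 / t)"
      using exp_converges[of "1 / t"] by simp
    from sums_unique[OF this] sum_le_suminf[OF sums_summable[OF this], of "{n + 2}"]
    show ?thesis using assms by (simp add: divide_inverse_commute)
  qed
  then have "1 / t ^ (n + 2) \<le> fact (n + 2) * exp (1 / t)"
    unfolding power_one_over by (subst (asm) pos_divide_le_eq) (auto simp: mult.commute simp del: fact_Suc add_2_eq_Suc')
  then have "1 \<le> fact (n + 2) * exp (1 / t) * t ^ (n + 2)"
    using assms by (subst (asm) pos_divide_le_eq) (auto simp del: fact_Suc add_2_eq_Suc')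
  then have "exp (- (1 / t)) * 1 \<le> exp (- (1 / t)) * (fact (n + 2) * exp (1 / t) * t ^ (n + 2))"
    by (intro mult_left_mono) auto
  also have "\<dots> = fact (n + 2) * t\<^sup>2 * t ^ n"
    by (simp add: exp_minus power_add power2_eq_square)
  finally show ?thesis
    using assms by (simp add: flat_exp_def divide_le_eq del: fact_Suc add_2_eq_Suc')
qed

lemma flat_exp_nonneg: "flat_exp n t \<ge> 0"
  by (simp add: flat_exp_def)

lemma flat_exp_has_derivative:
  "(flat_exp n has_field_derivative (flat_exp (n + 2) t - real n * flat_exp (n + 1) t)) (at t)"
proof (cases t "0 :: real" rule: linorder_cases)
  case less
  have "((\<lambda>_. 0 :: real) has_field_derivative 0) (at t)" by simp
  moreover have "eventually (\<lambda>s. flat_exp n s = 0) (nhds t)"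
    by (rule eventually_mono[OF eventually_nhds_in_open[of "{..<0}"]])
      (use less in \<open>auto simp: flat_exp_def\<close>)
  ultimately have "(flat_exp n has_field_derivative 0) (at t)"
    by (subst DERIV_cong_ev[OF refl _ refl]) auto
  then show ?thesis using less by (simp add: flat_exp_def)
next
  case equal
  have "((\<lambda>h. flat_exp n h / h) \<longlongrightarrow> 0) (at 0)"
  proof (rule Lim_null_comparison)
    show "((\<lambda>h. fact (n + 2) * \<bar>h\<bar>) \<longlongrightarrow> 0) (at (0::real))"
      by (auto intro!: tendsto_eq_intros)
    show "eventually (\<lambda>h. norm (flat_exp n h / h) \<le> fact (n + 2) * \<bar>h\<bar>) (at 0)"
    proof (rule always_eventually, rule allI)
      fix h :: real
      show "norm (flat_exp n h / h) \<le> fact (n + 2) * \<bar>h\<bar>"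
      proof (cases "h > 0")
        case True
        then have "norm (flat_exp n h / h) = flat_exp n h / h"
          using flat_exp_nonneg[of n h] by simp
        also have "\<dots> \<le> fact (n + 2) * h\<^sup>2 / h"
          by (rule divide_right_mono[OF flat_exp_le[OF True]]) (use True in simp)
        finally show ?thesis
          using True by (simp add: power2_eq_square del: fact_Suc add_2_eq_Suc')
      next
        case False
        then have "norm (flat_exp n h / h) = 0" by (simp add: flat_exp_def)
        also have "\<dots> \<le> fact (n + 2) * \<bar>h\<bar>" by (intro mult_nonneg_nonneg) auto
        finally show ?thesis .
      qed
    qed
  qed
  then have "(flat_exp n has_field_derivative 0) (at 0)"
    by (simp add: DERIV_def flat_exp_def)
  then show ?thesis using equal by (simp add: flat_exp_def)
next
  case greater
  have "((\<lambda>s. exp (- (1 / s)) / s ^ n) has_field_derivative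
    flat_exp (n + 2) t - real n * flat_exp (n + 1) t) (at t)"
    using greater
    apply (auto intro!: derivative_eq_intros simp: flat_exp_def)
    by (cases n) (auto simp: field_simps power2_eq_square)
  moreover have "eventually (\<lambda>s. exp (- (1 / s)) / s ^ n = flat_exp n s) (nhds t)"
    by (rule eventually_mono[OF eventually_nhds_in_open[of "{0<..}"]])
      (use greater in \<open>auto simp: flat_exp_def\<close>)
  ultimately show ?thesis
    by (subst (asm) DERIV_cong_ev[OF refl _ refl]) auto
qed

lemma frechet_derivative_real:
  assumes "(f has_field_derivative f') (at x)"
  shows "frechet_derivative f (at x) v = f' * v"
  using frechet_derivative_at[OF assms[unfolded has_field_derivative_def]] by metis

lemma has_field_derivative_imp_differentiable:
  "(f has_field_derivative (f'::real)) (at x) \<Longrightarrow> f differentiable (at x)"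
  using has_field_derivative_def differentiable_def by blast

lemma ck_on_flat_exp: "ck_on r UNIV (flat_exp n)"
proof (induction r arbitrary: n)
  case 0
  then show ?case
    by (auto intro!: continuous_at_imp_continuous_on DERIV_isCont flat_exp_has_derivative)
next
  case (Suc r)
  have "(\<lambda>x. frechet_derivative (flat_exp n) (at x) v) =
     (\<lambda>x. (flat_exp (n + 2) x + - real n * flat_exp (n + 1) x) * v)" for v
    using frechet_derivative_real[OF flat_exp_has_derivative] by fastforce
  moreover have "ck_on r UNIV (\<lambda>x. (flat_exp (n + 2) x + - real n * flat_exp (n + 1) x) * v)" for v
    by (intro ck_on_add ck_on_mult Suc ck_on_const open_UNIV)
  moreover have "flat_exp n differentiable (at x)" for x
    using flat_exp_has_derivative has_field_derivative_imp_differentiable by blast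
  ultimately show ?case by (simp del: add_2_eq_Suc')
qed

lemma ck_on_inverse: "ck_on r {0<..} (\<lambda>x::real. inverse x)"
proof (induction r)
  case 0
  then show ?case by (auto intro!: continuous_intros)
next
  case (Suc r)
  have d: "((\<lambda>x::real. inverse x) has_field_derivative - (inverse x * inverse x)) (at x)" if "x > 0" for x
    using that by (auto intro!: derivative_eq_intros simp: field_simps)
  have "ck_on r {0<..} (\<lambda>x::real. frechet_derivative inverse (at x) v)" for v
  proof (rule ck_on_cong)
    show "ck_on r {0<..} (\<lambda>x::real. (inverse x * inverse x) * (- v))"
      by (intro ck_on_mult Suc) auto
  qed (use frechet_derivative_real[OF d] in auto)
  moreover have "\<forall>x\<in>{0<..}. (inverse :: real \<Rightarrow> real) differentiable (at x)"
    using d has_field_derivative_imp_differentiable by (metis greaterThan_iff)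
  ultimately show ?case by simp
qed

lemma smooth_on_compose_real:
  assumes "open S" "smooth_on S f" "open T" "smooth_on T (g :: real \<Rightarrow> real)" "f ` S \<subseteq> T"
  shows "smooth_on S (\<lambda>x. g (f x))"
  unfolding smooth_on_def
proof
  fix r
  show "ck_on r S (\<lambda>x. g (f x))"
    by (rule ck_on_compose[OF assms(1,3,5)]) (use assms in \<open>auto simp: smooth_on_def\<close>)
qed

lemma ck_on_inner_right: "ck_on r S (\<lambda>x. x \<bullet> b)"
proof -
  have d: "((\<lambda>x. x \<bullet> b) has_derivative (\<lambda>v. v \<bullet> b)) (at x)" for x
    by (auto intro!: derivative_eq_intros)
  from frechet_derivative_at[OF this, symmetric] have "frechet_derivative (\<lambda>x. x \<bullet> b) (at x) = (\<lambda>v. v \<bullet> b)" for x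
    .
  moreover have "(\<lambda>x. x \<bullet> b) differentiable (at x)" for x
    using d differentiable_def by blast
  ultimately show ?thesis by (cases r) (auto intro!: continuous_intros)
qed

lemma bump_function_euclidean:
  fixes a :: "'a::euclidean_space"
  assumes "e > 0"
  obtains f :: "'a \<Rightarrow> real" where "smooth_on UNIV f" "\<And>x. norm (x - a) < e \<Longrightarrow> f x = 1"
    "\<And>x. norm (x - a) \<ge> 2 * e \<Longrightarrow> f x = 0"
proof -
  \<comment> \<open>Affine in the squared distance, which is smooth at \<open>a\<close> as well,
    with value 1 at distance \<open>e\<close> and 0 at twice that distance.\<close>
  define q where "q x = 4 / 3 - (1 / (3 * e\<^sup>2)) * (\<Sum>b\<in>Basis. ((x - a) \<bullet> b) * ((x - a) \<bullet> b))" for x :: 'a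
  have q: "q x = 4 / 3 - (norm (x - a))\<^sup>2 / (3 * e\<^sup>2)" for x
    using euclidean_inner[of "x - a" "x - a"] by (simp add: q_def power2_norm_eq_inner)
  \<comment> \<open>The usual smooth step: 0 for t <= 0 and 1 for t >= 1, since there one of the two
    flat functions vanishes.\<close>
  define s where "s t = flat_exp 0 t * inverse (flat_exp 0 t + flat_exp 0 (1 - t))" for t
  have pos: "flat_exp 0 t + flat_exp 0 (1 - t) > 0" for t
    by (cases "t > 0") (auto simp: flat_exp_def add_pos_pos add_pos_nonneg)
  have q': "q = (\<lambda>x. 4 / 3 + - (1 / (3 * e\<^sup>2)) * (\<Sum>b\<in>Basis. (x \<bullet> b + - (a \<bullet> b)) * (x \<bullet> b + - (a \<bullet> b))))"
    by (simp add: q_def fun_eq_iff inner_diff_left)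
  have sq: "smooth_on UNIV q"
    unfolding smooth_on_def q' by (intro allI ck_on_add ck_on_mult ck_on_sum ck_on_const ck_on_inner_right open_UNIV)
  have 1: "smooth_on UNIV (flat_exp 0)"
    by (simp add: smooth_on_def ck_on_flat_exp)
  have lin: "smooth_on UNIV (\<lambda>t::real. 1 + (-1) * (t \<bullet> 1))"
    unfolding smooth_on_def by (intro allI ck_on_add ck_on_mult ck_on_const ck_on_inner_right open_UNIV)
  have 2: "smooth_on UNIV (\<lambda>t. flat_exp 0 (1 - t))"
    using smooth_on_compose_real[OF open_UNIV lin open_UNIV 1] by simp
  have 3: "smooth_on UNIV (\<lambda>t. flat_exp 0 t + flat_exp 0 (1 - t))"
    using 1 2 unfolding smooth_on_def by (intro allI ck_on_add) auto
  have inv: "smooth_on {0<..} (\<lambda>x::real. inverse x)"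
    by (simp add: smooth_on_def ck_on_inverse)
  have "smooth_on UNIV (\<lambda>t. inverse (flat_exp 0 t + flat_exp 0 (1 - t)))"
    by (rule smooth_on_compose_real[OF open_UNIV 3 open_greaterThan inv]) (use pos in auto)
  then have ss: "smooth_on UNIV s"
    using 1 unfolding smooth_on_def s_def by (intro allI ck_on_mult) auto
  show thesis
  proof
    show "smooth_on UNIV (\<lambda>x. s (q x))"
      by (rule smooth_on_compose_real[OF open_UNIV sq open_UNIV ss]) auto
    show "s (q x) = 1" if "norm (x - a) < e" for x
    proof -
      have "(norm (x - a))\<^sup>2 \<le> e\<^sup>2" using that by (intro power_mono) auto
      then have "q x \<ge> 1" using assms by (simp add: q field_simps)
      then show ?thesis by (simp add: s_def flat_exp_def)
    qed
    show "s (q x) = 0" if "norm (x - a) \<ge> 2 * e" for x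
    proof -
      have "(2 * e)\<^sup>2 \<le> (norm (x - a))\<^sup>2" using that assms by (intro power_mono) auto
      then have "q x \<le> 0" using assms by (simp add: q field_simps power2_eq_square)
      then show ?thesis by (simp add: s_def flat_exp_def)
    qed
  qed
qed

section \<open>Smooth germs and their directional derivatives\<close>

section \<open>Smooth germs\<close>

definition sm_at :: "'a::real_normed_vector \<Rightarrow> ('a \<Rightarrow> real) \<Rightarrow> bool" where
  "sm_at x f \<longleftrightarrow> (\<exists>T. open T \<and> x \<in> T \<and> smooth_on T f)"

abbreviation fdv :: "('a::real_normed_vector \<Rightarrow> real) \<Rightarrow> 'a \<Rightarrow> 'a \<Rightarrow> real" where
  "fdv f v x \<equiv> frechet_derivative f (at x) v"

lemma smooth_on_subset: "smooth_on S f \<Longrightarrow> T \<subseteq> S \<Longrightarrow> smooth_on T f"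
  by (auto simp: smooth_on_def intro: ck_on_subset)

lemma smooth_on_cong: "open S \<Longrightarrow> (\<And>x. x \<in> S \<Longrightarrow> f x = g x) \<Longrightarrow> smooth_on S f \<Longrightarrow> smooth_on S g"
  unfolding smooth_on_def using ck_on_cong by blast

lemma smooth_on_iff_sm_at: "open S \<Longrightarrow> smooth_on S f \<longleftrightarrow> (\<forall>x\<in>S. sm_at x f)"
  unfolding sm_at_def smooth_on_def using ck_on_open_Union[of S _ f] by metis

lemma sm_at_cong: "\<forall>\<^sub>F y in nhds x. f y = g y \<Longrightarrow> sm_at x f \<Longrightarrow> sm_at x g"
proof -
  assume "\<forall>\<^sub>F y in nhds x. f y = g y" "sm_at x f"
  then obtain S T where "open S" "x \<in> S" "\<forall>y\<in>S. f y = g y" "open T" "x \<in> T" "smooth_on T f"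
    unfolding eventually_nhds sm_at_def by blast
  then show ?thesis
    unfolding sm_at_def
    by (intro exI[of _ "S \<inter> T"]) (auto intro: smooth_on_cong[of _ f] smooth_on_subset)
qed

lemma sm_at_binop:
  assumes "sm_at x f" "sm_at x g"
    and "\<And>S. open S \<Longrightarrow> smooth_on S f \<Longrightarrow> smooth_on S g \<Longrightarrow> smooth_on S h"
  shows "sm_at x h"
proof -
  obtain S T where "open S" "x \<in> S" "smooth_on S f" "open T" "x \<in> T" "smooth_on T g"
    using assms(1,2) unfolding sm_at_def by blast
  then show ?thesis
    unfolding sm_at_def
    by (intro exI[of _ "S \<inter> T"]) (auto intro!: assms(3) intro: smooth_on_subset)
qed

lemma sm_at_add: "sm_at x f \<Longrightarrow> sm_at x g \<Longrightarrow> sm_at x (\<lambda>y. f y + g y)"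
  by (rule sm_at_binop[of x f g]) (auto simp: smooth_on_def intro: ck_on_add)

lemma sm_at_mult: "sm_at x f \<Longrightarrow> sm_at x g \<Longrightarrow> sm_at x (\<lambda>y. f y * g y)"
  by (rule sm_at_binop[of x f g]) (auto simp: smooth_on_def intro: ck_on_mult)

lemma sm_at_const: "sm_at x (\<lambda>_. c)"
  unfolding sm_at_def smooth_on_def by (intro exI[of _ UNIV]) auto

lemma sm_at_eventually: "sm_at x f \<Longrightarrow> \<forall>\<^sub>F y in nhds x. sm_at y f"
  unfolding sm_at_def eventually_nhds by blast

lemma sm_at_has_derivative: "sm_at x f \<Longrightarrow> (f has_derivative frechet_derivative f (at x)) (at x)"
  unfolding sm_at_def smooth_on_def using ck_on_Suc_has_derivative by blast

lemma sm_at_fdv: "sm_at x f \<Longrightarrow> sm_at x (fdv f v)"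
  unfolding sm_at_def smooth_on_def by (metis ck_on.simps(2))

lemma fdv_commute: "sm_at x f \<Longrightarrow> fdv (fdv f u) v x = fdv (fdv f v) u x"
  unfolding sm_at_def smooth_on_def using mixed_second_derivatives_commute by metis

lemma fdv_cong:
  assumes "\<forall>\<^sub>F y in nhds x. f y = g y"
  shows "fdv f v x = fdv g v x"
proof -
  have "(f has_derivative D) (at x) \<longleftrightarrow> (g has_derivative D) (at x)" for D
    using assms has_derivative_transform_eventually[of f D x UNIV g]
      has_derivative_transform_eventually[of g D x UNIV f]
    by (auto simp: eventually_nhds_conv_at eq_commute[of "g _"])
  then show ?thesis unfolding frechet_derivative_def by simp
qed

lemma sm_at_compose:
  fixes F :: "'a::real_normed_vector \<Rightarrow> 'b::euclidean_space"
  assumes "sm_at (F x) f" "\<And>b. b \<in> Basis \<Longrightarrow> sm_at x (\<lambda>y. F y \<bullet> b)"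
  shows "sm_at x (\<lambda>y. f (F y))"
proof -
  obtain T where T: "open T" "F x \<in> T" "smooth_on T f"
    using assms(1) unfolding sm_at_def by blast
  obtain S where S: "\<And>b. b \<in> Basis \<Longrightarrow> open (S b) \<and> x \<in> S b \<and> smooth_on (S b) (\<lambda>y. F y \<bullet> b)"
    using assms(2) unfolding sm_at_def by metis
  define S' where "S' = (\<Inter>b\<in>Basis. S b)"
  have S': "open S'" "x \<in> S'" "\<And>b. b \<in> Basis \<Longrightarrow> smooth_on S' (\<lambda>y. F y \<bullet> b)"
    using S by (auto simp: S'_def intro!: open_INT intro: smooth_on_subset)
  have "continuous_on S' F"
  proof (subst continuous_on_componentwise, rule ballI)
    fix b :: 'b assume "b \<in> Basis"
    then have "ck_on 0 S' (\<lambda>y. F y \<bullet> b)" using S'(3) smooth_on_def by blast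
    then show "continuous_on S' (\<lambda>y. F y \<bullet> b)" by simp
  qed
  then have o: "open (S' \<inter> F -` T)"
    using S'(1) T(1) by (metis continuous_on_open_vimage inf_commute)
  have "smooth_on (S' \<inter> F -` T) (\<lambda>y. f (F y))"
    unfolding smooth_on_def
  proof
    fix r
    have "ck_on r (S' \<inter> F -` T) (\<lambda>y. F y \<bullet> b)" if "b \<in> Basis" for b
      using smooth_on_subset[OF S'(3)[OF that]] by (auto simp: smooth_on_def)
    moreover have "ck_on r T f" using T by (simp add: smooth_on_def)
    ultimately show "ck_on r (S' \<inter> F -` T) (\<lambda>y. f (F y))"
      using ck_on_compose[OF o T(1), of F r f] by blast
  qed
  then show ?thesis
    unfolding sm_at_def using o S' T by blast
qed

lemma fdv_compose:
  fixes F :: "'a::real_normed_vector \<Rightarrow> 'b::euclidean_space"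
  assumes "sm_at (F x) f" "\<And>b. b \<in> Basis \<Longrightarrow> sm_at x (\<lambda>y. F y \<bullet> b)"
  shows "fdv (\<lambda>y. f (F y)) v x = (\<Sum>b\<in>Basis. fdv (\<lambda>y. F y \<bullet> b) v x * fdv f b (F x))"
proof -
  have F: "(F has_derivative (\<lambda>v. \<Sum>b\<in>Basis. fdv (\<lambda>x. F x \<bullet> b) v x *\<^sub>R b)) (at x)"
  proof (subst has_derivative_componentwise_within, rule ballI)
    fix i :: 'b assume i: "i \<in> Basis"
    then have "(\<Sum>b\<in>Basis. fdv (\<lambda>x. F x \<bullet> b) v x *\<^sub>R b) \<bullet> i = fdv (\<lambda>x. F x \<bullet> i) v x" for v
      by (simp add: inner_sum_left inner_Basis if_distrib cong: if_cong)
    then show "((\<lambda>x. F x \<bullet> i) has_derivative (\<lambda>v. (\<Sum>b\<in>Basis. fdv (\<lambda>x. F x \<bullet> b) v x *\<^sub>R b) \<bullet> i)) (at x)"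
      using sm_at_has_derivative[OF assms(2)[OF i]] by simp
  qed
  note f = sm_at_has_derivative[OF assms(1)]
  have "((\<lambda>x. f (F x)) has_derivative (\<lambda>v. fdv f (\<Sum>b\<in>Basis. fdv (\<lambda>x. F x \<bullet> b) v x *\<^sub>R b) (F x))) (at x)"
    using has_derivative_compose[OF F f] .
  from frechet_derivative_at[OF this, symmetric]
  show ?thesis
    by (simp add: linear_sum[OF f[THEN has_derivative_linear]] linear_cmul[OF f[THEN has_derivative_linear]])
qed

lemma fdv_add: "sm_at x f \<Longrightarrow> sm_at x g \<Longrightarrow> fdv (\<lambda>y. f y + g y) v x = fdv f v x + fdv g v x"
  using frechet_derivative_at[OF has_derivative_add[OF sm_at_has_derivative[of x f] sm_at_has_derivative[of x g]], symmetric] by simp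

lemma fdv_mult: "sm_at x f \<Longrightarrow> sm_at x g \<Longrightarrow> fdv (\<lambda>y. f y * g y) v x = f x * fdv g v x + fdv f v x * g x"
  using frechet_derivative_at[OF has_derivative_mult[OF sm_at_has_derivative[of x f] sm_at_has_derivative[of x g]], symmetric] by simp

lemma fdv_inner_right: "fdv (\<lambda>y. y \<bullet> b) v x = v \<bullet> b"
proof -
  have "((\<lambda>x. x \<bullet> b) has_derivative (\<lambda>v. v \<bullet> b)) (at x)"
    by (auto intro!: derivative_eq_intros)
  from frechet_derivative_at[OF this, symmetric] show ?thesis by metis
qed

section \<open>Transfer of this calculus to the manifold through its charts\<close>

section \<open>Smooth functions and partial derivatives on the manifold\<close>

locale manifold =
  fixes B :: "('x::{t2_space,second_countable_topology}, 'n::finite, 'y, 'q, 'k) setting"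
  assumes mfd: "smooth_manifold B"
begin

abbreviation psi :: "'k \<Rightarrow> real ^ 'n \<Rightarrow> 'x" where
  "psi k \<equiv> inv_into (cdom B k) (crd B k)"

lemma chart_at: "\<exists>k\<in>charts B. p \<in> cdom B k"
  using mfd unfolding smooth_manifold_def by blast

lemma open_cdom [simp]: "k \<in> charts B \<Longrightarrow> open (cdom B k)"
  using mfd unfolding smooth_manifold_def by blast

lemma chart_homeomorphism: "k \<in> charts B \<Longrightarrow> homeomorphism (cdom B k) (crd B k ` cdom B k) (crd B k) (psi k)"
  using mfd unfolding smooth_manifold_def by blast

lemma open_crd_cdom: "k \<in> charts B \<Longrightarrow> open (crd B k ` cdom B k)"
  using mfd unfolding smooth_manifold_def by blast

lemma psi_crd [simp]: "k \<in> charts B \<Longrightarrow> p \<in> cdom B k \<Longrightarrow> psi k (crd B k p) = p"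
  using chart_homeomorphism by (meson homeomorphism_apply1)

lemma crd_psi: "k \<in> charts B \<Longrightarrow> y \<in> crd B k ` cdom B k \<Longrightarrow> crd B k (psi k y) = y"
  using chart_homeomorphism by (meson homeomorphism_apply2)

lemma open_crd_image:
  assumes "k \<in> charts B" "open W" "W \<subseteq> cdom B k"
  shows "open (crd B k ` W)"
proof -
  have "openin (top_of_set (crd B k ` cdom B k)) (crd B k ` W)"
    using homeomorphism_imp_open_map[OF chart_homeomorphism[OF assms(1)]] assms
    by (simp add: openin_open_eq)
  then show ?thesis using open_crd_cdom[OF assms(1)] openin_open_eq by blast
qed

lemma filterlim_psi:
  assumes "k \<in> charts B" "p \<in> cdom B k"
  shows "filterlim (psi k) (nhds p) (nhds (crd B k p))"
proof -
  have "continuous_on (crd B k ` cdom B k) (psi k)"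
    using chart_homeomorphism[OF assms(1)] homeomorphism_def by blast
  then have "isCont (psi k) (crd B k p)"
    using open_crd_cdom[OF assms(1)] assms(2) by (simp add: continuous_on_eq_continuous_at)
  then have "(psi k \<longlongrightarrow> psi k (crd B k p)) (nhds (crd B k p))"
    by (simp add: continuous_at tendsto_at_iff_tendsto_nhds)
  then show ?thesis using assms by simp
qed

lemma filterlim_crd:
  assumes "k \<in> charts B" "p \<in> cdom B k"
  shows "filterlim (crd B k) (nhds (crd B k p)) (nhds p)"
proof -
  have "continuous_on (cdom B k) (crd B k)"
    using chart_homeomorphism[OF assms(1)] homeomorphism_def by blast
  then have "isCont (crd B k) p"
    using assms by (simp add: continuous_on_eq_continuous_at)
  then show ?thesis
    by (simp add: continuous_at tendsto_at_iff_tendsto_nhds)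
qed

lemma eventually_cdom: "k \<in> charts B \<Longrightarrow> p \<in> cdom B k \<Longrightarrow> \<forall>\<^sub>F q in nhds p. q \<in> cdom B k"
  by (simp add: eventually_nhds_in_open)

lemma eventually_psi:
  "k \<in> charts B \<Longrightarrow> p \<in> cdom B k \<Longrightarrow> \<forall>\<^sub>F q in nhds p. P q \<Longrightarrow> \<forall>\<^sub>F y in nhds (crd B k p). P (psi k y)"
  using filterlim_psi by (auto simp: filterlim_iff)

lemma eventually_crd:
  "k \<in> charts B \<Longrightarrow> p \<in> cdom B k \<Longrightarrow> \<forall>\<^sub>F y in nhds (crd B k p). P y \<Longrightarrow> \<forall>\<^sub>F q in nhds p. P (crd B k q)"
  using filterlim_crd by (auto simp: filterlim_iff)

text \<open>Asking for every chart around \<open>p\<close> makes the predicate chart-free; by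
  smoothness of coordinate changes one chart is enough to establish it (\<open>smI\<close>).\<close>

definition sm :: "'x \<Rightarrow> ('x \<Rightarrow> real) \<Rightarrow> bool" where
  "sm p f \<longleftrightarrow> (\<forall>k\<in>charts B. p \<in> cdom B k \<longrightarrow> sm_at (crd B k p) (f \<circ> psi k))"

lemma smooth_in_iff_sm_at:
  assumes "k \<in> charts B" "open V" "V \<subseteq> cdom B k"
  shows "smooth_in B k V f \<longleftrightarrow> (\<forall>p\<in>V. sm_at (crd B k p) (f \<circ> psi k))"
  unfolding smooth_in_def using smooth_on_iff_sm_at[OF open_crd_image[OF assms]] by blast

lemma chart_change_sm_at:
  assumes "j \<in> charts B" "k \<in> charts B" "p \<in> cdom B j \<inter> cdom B k"
  shows "sm_at (crd B j p) ((\<lambda>q. crd B k q $ l) \<circ> psi j)"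
proof -
  have "smooth_in B j (cdom B j \<inter> cdom B k) (\<lambda>p. crd B k p $ l)"
    using mfd assms unfolding smooth_manifold_def by blast
  then show ?thesis
    using assms by (subst (asm) smooth_in_iff_sm_at) auto
qed

lemma chart_change_sm_at_inner:
  assumes "j \<in> charts B" "k \<in> charts B" "p \<in> cdom B j \<inter> cdom B k" "b \<in> Basis"
  shows "sm_at (crd B j p) (\<lambda>y. crd B k (psi j y) \<bullet> b)"
proof -
  obtain l where b: "b = axis l 1"
    using assms(4) by (auto simp: Basis_vec_def)
  show ?thesis
    using chart_change_sm_at[OF assms(1-3), of l] by (simp add: b inner_axis o_def)
qed

lemma eventually_chart_change:
  assumes "j \<in> charts B" "k \<in> charts B" "p \<in> cdom B j \<inter> cdom B k"
  shows "\<forall>\<^sub>F y in nhds (crd B j p). (f \<circ> psi k) (crd B k (psi j y)) = (f \<circ> psi j) y"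
proof -
  have "\<forall>\<^sub>F q in nhds p. psi k (crd B k q) = q"
    by (rule eventually_mono[OF eventually_cdom[of k p]]) (use assms in auto)
  then show ?thesis
    using eventually_psi[of j p "\<lambda>q. psi k (crd B k q) = q"] assms
    by (auto elim!: eventually_mono)
qed

lemma sm_at_chart_change:
  assumes "j \<in> charts B" "k \<in> charts B" "p \<in> cdom B j \<inter> cdom B k" "sm_at (crd B k p) (f \<circ> psi k)"
  shows "sm_at (crd B j p) (f \<circ> psi j)"
proof -
  have "sm_at (crd B j p) (\<lambda>y. (f \<circ> psi k) (crd B k (psi j y)))"
    by (rule sm_at_compose[OF _ chart_change_sm_at_inner[OF assms(1-3)]]) (use assms in \<open>auto simp: o_def\<close>)
  from sm_at_cong[OF eventually_chart_change[OF assms(1-3), of f] this] show ?thesis .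
qed

lemma smI: "k \<in> charts B \<Longrightarrow> p \<in> cdom B k \<Longrightarrow> sm_at (crd B k p) (f \<circ> psi k) \<Longrightarrow> sm p f"
  unfolding sm_def using sm_at_chart_change by blast

lemma smD: "sm p f \<Longrightarrow> k \<in> charts B \<Longrightarrow> p \<in> cdom B k \<Longrightarrow> sm_at (crd B k p) (f \<circ> psi k)"
  unfolding sm_def by blast

lemma smooth_in_iff:
  "k \<in> charts B \<Longrightarrow> open V \<Longrightarrow> V \<subseteq> cdom B k \<Longrightarrow> smooth_in B k V f \<longleftrightarrow> (\<forall>p\<in>V. sm p f)"
  using smooth_in_iff_sm_at[of k V f] smI[of k _ f] smD[of _ f k] by blast

lemma sm_cong: "sm p f \<Longrightarrow> \<forall>\<^sub>F q in nhds p. f q = g q \<Longrightarrow> sm p g"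
proof -
  assume *: "sm p f" "\<forall>\<^sub>F q in nhds p. f q = g q"
  show ?thesis
    unfolding sm_def
  proof (intro ballI impI)
    fix k assume k: "k \<in> charts B" "p \<in> cdom B k"
    show "sm_at (crd B k p) (g \<circ> psi k)"
      by (rule sm_at_cong[OF _ smD[OF *(1) k]]) (use eventually_psi[OF k *(2)] in simp)
  qed
qed

lemma sm_add: "sm p f \<Longrightarrow> sm p g \<Longrightarrow> sm p (\<lambda>q. f q + g q)"
  unfolding sm_def o_def by (auto intro!: sm_at_add)

lemma sm_mult: "sm p f \<Longrightarrow> sm p g \<Longrightarrow> sm p (\<lambda>q. f q * g q)"
  unfolding sm_def o_def by (auto intro!: sm_at_mult)

lemma sm_const [simp]: "sm p (\<lambda>_. c)"
  unfolding sm_def o_def by (auto intro!: sm_at_const)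

lemma sm_sum: "(\<And>i. i \<in> I \<Longrightarrow> sm p (f i)) \<Longrightarrow> sm p (\<lambda>q. \<Sum>i\<in>I. f i q)"
  by (induction I rule: infinite_finite_induct) (auto intro: sm_add)

lemma sm_crd: "k \<in> charts B \<Longrightarrow> p \<in> cdom B k \<Longrightarrow> sm p (\<lambda>q. crd B k q $ l)"
  unfolding sm_def using chart_change_sm_at by blast

lemma sm_eventually:
  assumes "sm p f"
  shows "\<forall>\<^sub>F q in nhds p. sm q f"
proof -
  obtain k where k: "k \<in> charts B" "p \<in> cdom B k" using chart_at by blast
  have "\<forall>\<^sub>F q in nhds p. sm_at (crd B k q) (f \<circ> psi k)"
    using eventually_crd[OF k sm_at_eventually[OF smD[OF assms k]]] .
  with eventually_cdom[OF k] show ?thesis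
    by eventually_elim (use k smI in blast)
qed

lemma pd_eq: "pd B k l f p = fdv (f \<circ> psi k) (axis l 1) (crd B k p)"
  by (simp add: pd_def)

lemma pd_cong:
  "k \<in> charts B \<Longrightarrow> p \<in> cdom B k \<Longrightarrow> \<forall>\<^sub>F q in nhds p. f q = g q \<Longrightarrow> pd B k l f p = pd B k l g p"
  unfolding pd_eq by (rule fdv_cong) (auto dest: eventually_psi)

lemma pd_const [simp]: "pd B k l (\<lambda>_. c) p = 0"
  unfolding pd_eq o_def by simp

lemma pd_add:
  "k \<in> charts B \<Longrightarrow> p \<in> cdom B k \<Longrightarrow> sm p f \<Longrightarrow> sm p g \<Longrightarrow>
   pd B k l (\<lambda>q. f q + g q) p = pd B k l f p + pd B k l g p"
  unfolding pd_eq o_def using fdv_add smD unfolding o_def by blast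

lemma pd_mult:
  "k \<in> charts B \<Longrightarrow> p \<in> cdom B k \<Longrightarrow> sm p f \<Longrightarrow> sm p g \<Longrightarrow>
   pd B k l (\<lambda>q. f q * g q) p = f p * pd B k l g p + pd B k l f p * g p"
  unfolding pd_eq o_def using fdv_mult[OF smD smD, of p f k g] by (simp add: o_def)

lemma pd_cmult:
  "k \<in> charts B \<Longrightarrow> p \<in> cdom B k \<Longrightarrow> sm p f \<Longrightarrow> pd B k l (\<lambda>q. c * f q) p = c * pd B k l f p"
  using pd_mult[of k p "\<lambda>_. c" f l] by simp

lemma eventually_pd_psi:
  assumes "k \<in> charts B" "p \<in> cdom B k"
  shows "\<forall>\<^sub>F y in nhds (crd B k p). (pd B k l f \<circ> psi k) y = fdv (f \<circ> psi k) (axis l 1) y"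
  by (rule eventually_mono[OF eventually_nhds_in_open[OF open_crd_cdom[OF assms(1)]]])
    (use assms crd_psi in \<open>auto simp: pd_eq\<close>)

lemma sm_pd:
  assumes "k \<in> charts B" "p \<in> cdom B k" "sm p f"
  shows "sm p (pd B k l f)"
proof (rule smI[OF assms(1,2)])
  have "sm_at (crd B k p) (fdv (f \<circ> psi k) (axis l 1))"
    by (intro sm_at_fdv smD assms)
  then show "sm_at (crd B k p) (pd B k l f \<circ> psi k)"
    by (rule sm_at_cong[rotated]) (rule eventually_mono[OF eventually_pd_psi[OF assms(1,2), of l f]], simp)
qed

lemma pd_commute:
  assumes "k \<in> charts B" "p \<in> cdom B k" "sm p f"
  shows "pd B k l (pd B k m f) p = pd B k m (pd B k l f) p"
  unfolding pd_eq[of k _ "pd B k _ f"]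
  using fdv_cong[OF eventually_pd_psi[OF assms(1,2)]] fdv_commute[OF smD[OF assms(3,1,2)]]
  by metis

lemma pd_crd:
  assumes "k \<in> charts B" "p \<in> cdom B k"
  shows "pd B k l (\<lambda>q. crd B k q $ m) p = (if l = m then 1 else 0)"
proof -
  have "\<forall>\<^sub>F y in nhds (crd B k p). ((\<lambda>q. crd B k q $ m) \<circ> psi k) y = y \<bullet> axis m 1"
    by (rule eventually_mono[OF eventually_nhds_in_open[OF open_crd_cdom[OF assms(1)]]])
      (use assms crd_psi in \<open>auto simp: inner_axis\<close>)
  from fdv_cong[OF this, of "axis l 1"] show ?thesis
    unfolding pd_eq by (simp only: fdv_inner_right) (simp add: inner_axis_axis)
qed

text \<open>Applied to the coordinates of a third chart this is also the cocycle law of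
  Jacobians.\<close>

lemma pd_chain:
  assumes "j \<in> charts B" "k \<in> charts B" "p \<in> cdom B j" "p \<in> cdom B k" "sm p f"
  shows "pd B j l f p = (\<Sum>m\<in>UNIV. pd B j l (\<lambda>q. crd B k q $ m) p * pd B k m f p)"
proof -
  have "pd B j l f p = fdv (\<lambda>y. (f \<circ> psi k) (crd B k (psi j y))) (axis l 1) (crd B j p)"
    unfolding pd_eq using eventually_chart_change[of j k p f] assms
    by (intro fdv_cong) (auto elim: eventually_mono)
  also have "\<dots> = (\<Sum>b\<in>Basis. fdv (\<lambda>y. crd B k (psi j y) \<bullet> b) (axis l 1) (crd B j p) *
      fdv (f \<circ> psi k) b (crd B k (psi j (crd B j p))))"
    by (rule fdv_compose[OF _ chart_change_sm_at_inner]) (use smD[OF assms(5,2,4)] assms in \<open>auto simp: o_def\<close>)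
  also have "(Basis :: (real ^ 'n) set) = (\<lambda>m. axis m 1) ` UNIV"
    by (auto simp: Basis_vec_def)
  also have "(\<Sum>b\<in>(\<lambda>m::'n. axis m (1::real)) ` UNIV. fdv (\<lambda>y. crd B k (psi j y) \<bullet> b) (axis l 1) (crd B j p) *
      fdv (f \<circ> psi k) b (crd B k (psi j (crd B j p)))) =
      (\<Sum>m\<in>UNIV. pd B j l (\<lambda>q. crd B k q $ m) p * pd B k m f p)"
    using assms by (subst sum.reindex) (auto intro!: inj_onI simp: axis_eq_axis pd_eq inner_axis o_def)
  finally show ?thesis .
qed

text \<open>The closed set \<open>Z\<close> inside \<open>V\<close> ensures that a function smooth
  on \<open>V\<close>, multiplied by \<open>ch\<close> and extended by 0, is smooth everywhere. It
  is the image of a compact ball, hence closed because the manifold is Hausdorff.\<close>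

lemma bump_function:
  assumes "open V" "p \<in> V"
  obtains ch Z where "\<And>q. sm q ch" "closed Z" "Z \<subseteq> V" "\<And>q. q \<notin> Z \<Longrightarrow> ch q = 0"
    "\<forall>\<^sub>F q in nhds p. ch q = 1"
proof -
  obtain k where k: "k \<in> charts B" "p \<in> cdom B k" using chart_at by blast
  have o: "open (crd B k ` (V \<inter> cdom B k))"
    using k assms by (intro open_crd_image) auto
  obtain e where e: "e > 0" "cball (crd B k p) e \<subseteq> crd B k ` (V \<inter> cdom B k)"
    using o assms k open_contains_cball by (metis IntI imageI)
  obtain f where f: "smooth_on UNIV f" "\<And>x. norm (x - crd B k p) < e / 2 \<Longrightarrow> f x = 1"
    "\<And>x. norm (x - crd B k p) \<ge> e \<Longrightarrow> f x = 0"
    using bump_function_euclidean[of "e / 2" "crd B k p"] e by auto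
  define Z where "Z = psi k ` cball (crd B k p) e"
  define ch where "ch q = (if q \<in> cdom B k then f (crd B k q) else 0)" for q
  have "continuous_on (cball (crd B k p) e) (psi k)"
  proof (rule continuous_on_subset)
    show "continuous_on (crd B k ` cdom B k) (psi k)"
      using chart_homeomorphism[OF k(1)] homeomorphism_def by blast
  qed (use e(2) in auto)
  then have Z: "compact Z"
    unfolding Z_def by (intro compact_continuous_image) auto
  have ZV: "Z \<subseteq> V \<inter> cdom B k"
    unfolding Z_def using e(2) k by fastforce
  have out: "ch q = 0" if "q \<notin> Z" for q
  proof (cases "q \<in> cdom B k")
    case True
    then have "crd B k q \<notin> cball (crd B k p) e"
      using that k by (force simp: Z_def)
    then show ?thesis using True f(3) by (simp add: ch_def dist_norm norm_minus_commute)
  qed (simp add: ch_def)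
  have in_k: "sm q ch" if q: "q \<in> cdom B k" for q
  proof (rule smI[OF k(1) q])
    have "sm_at (crd B k q) f"
      using f(1) by (auto simp: sm_at_def intro!: exI[of _ UNIV])
    moreover have "\<forall>\<^sub>F y in nhds (crd B k q). f y = (ch \<circ> psi k) y"
      by (rule eventually_mono[OF eventually_nhds_in_open[OF open_crd_cdom[OF k(1)]]])
        (use k q in \<open>auto simp: ch_def\<close>)
    ultimately show "sm_at (crd B k q) (ch \<circ> psi k)"
      by (rule sm_at_cong[rotated])
  qed
  have "sm q ch" for q
  proof (cases "q \<in> cdom B k")
    case False
    then have "\<forall>\<^sub>F q in nhds q. q \<in> - Z"
      using Z ZV by (intro eventually_nhds_in_open) (auto simp: compact_imp_closed)
    then have "\<forall>\<^sub>F q in nhds q. 0 = ch q"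
      by eventually_elim (use out in auto)
    then show ?thesis using sm_cong[of q "\<lambda>_. 0" ch] by simp
  qed (use in_k in auto)
  moreover have "\<forall>\<^sub>F q in nhds p. ch q = 1"
  proof -
    have "\<forall>\<^sub>F y in nhds (crd B k p). y \<in> ball (crd B k p) (e / 2)"
      using e by (intro eventually_nhds_in_open) auto
    from eventually_crd[OF k this] eventually_cdom[OF k] show ?thesis
      by eventually_elim (auto simp: ch_def dist_norm norm_minus_commute intro!: f(2))
  qed
  ultimately show thesis
    using that[of ch Z] out Z ZV compact_imp_closed by blast
qed

end

section \<open>The graded algebra as a monoid algebra twisted by sorting signs\<close>

section \<open>The graded algebra\<close>

abbreviation kys :: "('a \<Rightarrow>\<^sub>0 'b::zero) \<Rightarrow> 'a set" where "kys \<equiv> Poly_Mapping.keys"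
abbreviation lkp :: "('a \<Rightarrow>\<^sub>0 'b::zero) \<Rightarrow> 'a \<Rightarrow> 'b" where "lkp \<equiv> Poly_Mapping.lookup"
abbreviation mon :: "'a \<Rightarrow> 'b::zero \<Rightarrow> ('a \<Rightarrow>\<^sub>0 'b)" where "mon \<equiv> Poly_Mapping.single"

lemma keys_sum_superset:
  assumes "finite S" "kys a \<subseteq> S" "\<And>M. F M 0 = 0"
  shows "(\<Sum>M\<in>kys a. F M (lkp a M)) = (\<Sum>M\<in>S. F M (lkp a M))"
  using assms by (intro sum.mono_neutral_left) (auto simp: in_keys_iff)

text \<open>Cancellation may make the keys of a sum fewer, so all three sums are first taken over
  the union of the keys of \<open>a\<close> and \<open>b\<close>.\<close>

lemma keys_sum_add:
  assumes "\<And>M. F M 0 = 0" "\<And>M x y. F M (x + y) = F M x + F M y"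
  shows "(\<Sum>M\<in>kys (a + b). F M (lkp (a + b) M)) = (\<Sum>M\<in>kys a. F M (lkp a M)) + (\<Sum>M\<in>kys b. F M (lkp b M))"
proof -
  have "(\<Sum>M\<in>kys c. F M (lkp c M)) = (\<Sum>M\<in>kys a \<union> kys b. F M (lkp c M))"
    if "c \<in> {a, b, a + b}" for c
    using that assms(1) keys_add[of a b] by (intro keys_sum_superset) auto
  from this[of a] this[of b] this[of "a + b"] show ?thesis
    by (simp only: lookup_add assms(2) sum.distrib) simp
qed

lemma salg_expand:
  fixes a :: "'a \<Rightarrow>\<^sub>0 real"
  assumes "finite S" "kys a \<subseteq> S"
  shows "a = (\<Sum>M\<in>S. mon M (lkp a M))"
  by (rule poly_mapping_eqI) (use assms in \<open>auto simp: lookup_sum lookup_single when_def in_keys_iff\<close>)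

text \<open>The monomial case keeps \<open>M \<in> kys a\<close>, so conditions known for the keys
  of \<open>a\<close> remain available there.\<close>

lemma salg_induct [case_names zero mon add]:
  fixes a :: "'a \<Rightarrow>\<^sub>0 real"
  assumes "P 0" "\<And>M c. M \<in> kys a \<Longrightarrow> P (mon M c)" "\<And>a b. P a \<Longrightarrow> P b \<Longrightarrow> P (a + b)"
  shows "P a"
proof -
  have "P (\<Sum>M\<in>S. mon M (lkp a M))" if "S \<subseteq> kys a" for S
    using finite_subset[OF that finite_keys] that by (induction S rule: finite_induct) (auto intro: assms)
  from this[of "kys a"] show ?thesis using salg_expand[of "kys a" a] by simp
qed

lemma gmul_mon: "mon M x \<cdot> mon N y = (if reduced (M + N) then mon (M + N) (tw M N * x * y) else 0)"
  by (cases "x = 0"; cases "y = 0") (auto simp: gmul_def)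

lemma gmul_zero [simp]: "0 \<cdot> a = 0" "a \<cdot> 0 = 0"
  by (auto simp: gmul_def)

lemma gmul_add_left: "(a + b) \<cdot> c = a \<cdot> c + b \<cdot> c"
proof -
  define F where "F M x = (\<Sum>N\<in>kys c. if reduced (M + N) then mon (M + N) (tw M N * x * lkp c N) else 0)" for M x
  have "a \<cdot> c = (\<Sum>M\<in>kys a. F M (lkp a M))" for a by (simp add: gmul_def F_def)
  moreover have "F M 0 = 0" for M
    unfolding F_def by (intro sum.neutral) simp
  moreover have "F M (x + y) = F M x + F M y" for M x y
    unfolding F_def by (auto simp: sum.distrib[symmetric] single_add[symmetric] algebra_simps intro!: sum.cong)
  ultimately show ?thesis using keys_sum_add[of F] by simp
qed

lemma gmul_add_right: "c \<cdot> (a + b) = c \<cdot> a + c \<cdot> b"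
proof -
  define F where "F N x = (\<Sum>M\<in>kys c. if reduced (M + N) then mon (M + N) (tw M N * lkp c M * x) else 0)" for N x
  have "c \<cdot> a = (\<Sum>M\<in>kys a. F M (lkp a M))" for a unfolding gmul_def F_def by (rule sum.swap)
  moreover have "F M 0 = 0" for M
    unfolding F_def by (intro sum.neutral) simp
  moreover have "F M (x + y) = F M x + F M y" for M x y
    unfolding F_def by (auto simp: sum.distrib[symmetric] single_add[symmetric] algebra_simps intro!: sum.cong)
  ultimately show ?thesis using keys_sum_add[of F] by simp
qed

lemma gmul_sum_left: "(\<Sum>i\<in>I. f i) \<cdot> c = (\<Sum>i\<in>I. f i \<cdot> c)"
  by (induction I rule: infinite_finite_induct) (auto simp: gmul_add_left)

lemma gmul_sum_right: "c \<cdot> (\<Sum>i\<in>I. f i) = (\<Sum>i\<in>I. c \<cdot> f i)"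
  by (induction I rule: infinite_finite_induct) (auto simp: gmul_add_right)

lemma gmul_uminus_left: "(- a) \<cdot> b = - (a \<cdot> b)"
  using gmul_add_left[of "- a" a b] by (simp add: eq_neg_iff_add_eq_0)

lemma gmul_uminus_right: "b \<cdot> (- a) = - (b \<cdot> a)"
  using gmul_add_right[of b "- a" a] by (simp add: eq_neg_iff_add_eq_0)

lemma gmul_diff_left: "(a - b) \<cdot> c = a \<cdot> c - b \<cdot> c"
  using gmul_add_left[of a "- b" c] by (simp add: gmul_uminus_left)

lemma gmul_diff_right: "c \<cdot> (a - b) = c \<cdot> a - c \<cdot> b"
  using gmul_add_right[of c a "- b"] by (simp add: gmul_uminus_right)

lemma reduced_addD: "reduced (M + N) \<Longrightarrow> reduced M \<and> reduced N"
  by (auto simp: reduced_def le_add1 dest: add_leD1 add_leD2)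

lemma reduced_add_msetD: "reduced (add_mset g M) \<Longrightarrow> reduced M"
  using reduced_addD[of "{#g#}" M] by simp

lemma reduced_empty [simp]: "reduced {#}" by (simp add: reduced_def)
lemma reduced_single [simp]: "reduced {#g#}" by (simp add: reduced_def)

lemma tw_empty [simp]: "tw {#} N = 1" "tw M {#} = 1"
  by (simp_all add: tw_def)

lemma tw_add_left: "tw (M + N) K = tw M K * tw N K"
  by (simp add: tw_def)

lemma tw_add_right: "tw M (N + K) = tw M N * tw M K"
  by (simp add: tw_def prod_mset.distrib)

lemma tw_add_mset_left: "tw (add_mset g M) K = tw {#g#} K * tw M K"
  using tw_add_left[of "{#g#}" M K] by simp

lemma tw_add_mset_right: "tw M (add_mset g K) = tw M {#g#} * tw M K"
  using tw_add_right[of M "{#g#}" K] by simp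

lemma tw_single: "tw {#g#} {#h#} = (if to_nat h < to_nat g \<and> anticomm g h then - 1 else 1)"
  by (simp add: tw_def)

lemma tw_square: "tw M N * tw M N = 1"
proof (induction M)
  case (add g M)
  have "tw {#g#} N * tw {#g#} N = 1"
  proof (induction N)
    case (add h N)
    have "tw {#g#} (add_mset h N) = tw {#g#} {#h#} * tw {#g#} N"
      by (rule tw_add_mset_right)
    then show ?case using add by (auto simp: tw_single)
  qed simp
  moreover have "tw {#g#} N * tw M N * (tw {#g#} N * tw M N) = (tw {#g#} N * tw {#g#} N) * (tw M N * tw M N)"
    by (simp only: mult_ac)
  ultimately show ?case using add by (simp only: tw_add_mset_left[of g M] mult_1)
qed simp

lemma tw_square': "tw M N * (tw M N * x) = x"
  using tw_square[of M N] by (simp add: mult.assoc[symmetric])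

text \<open>The sign \<open>tw\<close> is multiplicative in each argument, hence a 2-cocycle; and a
  product is killed in one bracketing exactly when it is in the other, because submultisets of
  reduced multisets are reduced.\<close>

lemma gmul_assoc: "a \<cdot> b \<cdot> c = a \<cdot> (b \<cdot> c)"
proof (induction a rule: salg_induct)
  case (mon M x)
  show ?case
  proof (induction b rule: salg_induct)
    case (mon N y)
    show ?case
    proof (induction c rule: salg_induct)
      case (mon K z)
      show ?case
      proof (cases "reduced (M + N + K)")
        case True
        then have "reduced (M + N)" "reduced (N + K)" "reduced (M + (N + K))"
          using reduced_addD[of "M + N" K] reduced_addD[of M "N + K"] by (auto simp: add.assoc)
        with True show ?thesis
          by (simp add: gmul_mon tw_add_left tw_add_right mult_ac add_ac)
      qed (auto simp: gmul_mon add_ac)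
    qed (auto simp: gmul_add_right)
  qed (auto simp: gmul_add_right gmul_add_left)
qed (auto simp: gmul_add_left)

text \<open>The type also contains monomials with a repeated anticommuting generator, which
  multiplication sends to 0. The algebra proper, on which \<open>gconst 1\<close> is a unit,
  consists of the elements without them.\<close>

definition redu :: "'n salg \<Rightarrow> bool" where
  "redu a \<longleftrightarrow> (\<forall>M\<in>kys a. reduced M)"

lemma keys_gmul: "kys (a \<cdot> b) \<subseteq> {M + N | M N. M \<in> kys a \<and> N \<in> kys b \<and> reduced (M + N)}"
proof
  fix K assume K: "K \<in> kys (a \<cdot> b)"
  show "K \<in> {M + N | M N. M \<in> kys a \<and> N \<in> kys b \<and> reduced (M + N)}"
  proof (rule ccontr)
    assume "\<not> ?thesis"
    then have "lkp (a \<cdot> b) K = 0"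
      unfolding gmul_def lookup_sum by (intro sum.neutral ballI) (auto simp: lookup_single when_def)
    then show False using K by (simp add: in_keys_iff)
  qed
qed

lemma keys_gmulE:
  assumes "K \<in> kys (a \<cdot> b)"
  obtains M N where "K = M + N" "M \<in> kys a" "N \<in> kys b" "reduced (M + N)"
  using keys_gmul assms by blast

lemma keys_addE:
  fixes a b :: "'n salg"
  assumes "K \<in> kys (a + b)" obtains "K \<in> kys a" | "K \<in> kys b"
proof -
  have "lkp a K \<noteq> 0 \<or> lkp b K \<noteq> 0" using assms by (auto simp: in_keys_iff lookup_add)
  then show thesis using that by (auto simp: in_keys_iff)
qed

lemma keys_sumE:
  fixes f :: "'i \<Rightarrow> 'n salg"
  assumes "K \<in> kys (\<Sum>i\<in>I. f i)" obtains i where "i \<in> I" "K \<in> kys (f i)"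
proof -
  have "\<exists>i\<in>I. lkp (f i) K \<noteq> 0"
  proof (rule ccontr)
    assume "\<not> ?thesis"
    then have "(\<Sum>i\<in>I. lkp (f i) K) = 0" by (intro sum.neutral) simp
    then show False using assms by (simp add: in_keys_iff lookup_sum)
  qed
  then show thesis using that by (auto simp: in_keys_iff)
qed

lemma keys_diffE:
  fixes a b :: "'n salg"
  assumes "K \<in> kys (a - b)" obtains "K \<in> kys a" | "K \<in> kys b"
proof -
  have "lkp a K \<noteq> 0 \<or> lkp b K \<noteq> 0" using assms by (auto simp: in_keys_iff lookup_minus)
  then show thesis using that by (auto simp: in_keys_iff)
qed

lemma redu_gmul [simp]: "redu (a \<cdot> b)"
  unfolding redu_def using keys_gmul by blast

lemma redu_zero [simp]: "redu 0" by (simp add: redu_def)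

lemma redu_add: "redu a \<Longrightarrow> redu b \<Longrightarrow> redu (a + b)"
  unfolding redu_def by (auto elim: keys_addE)

lemma redu_diff: "redu a \<Longrightarrow> redu b \<Longrightarrow> redu (a - b)"
  unfolding redu_def by (auto elim: keys_diffE)

lemma redu_sum: "(\<And>i. i \<in> I \<Longrightarrow> redu (f i)) \<Longrightarrow> redu (\<Sum>i\<in>I. f i)"
  unfolding redu_def by (auto elim: keys_sumE)

lemma redu_mon: "reduced M \<Longrightarrow> redu (mon M c)"
  by (cases "c = 0") (auto simp: redu_def)

lemma redu_gconst [simp]: "redu (gconst r)"
  by (simp add: gconst_def redu_mon)

lemma redu_gvar [simp]: "redu (gvar g)"
  by (simp add: gvar_def redu_mon)

lemma gconst_mon: "reduced M \<Longrightarrow> gconst r \<cdot> mon M c = mon M (r * c)"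
  by (simp add: gconst_def gmul_mon)

lemma gconst_gconst: "gconst r \<cdot> gconst s = gconst (r * s)"
  by (simp add: gconst_def gmul_mon)

lemma gconst_gconst_gmul: "gconst r \<cdot> (gconst s \<cdot> a) = gconst (r * s) \<cdot> a"
  by (simp add: gmul_assoc[symmetric] gconst_gconst)

lemma gconst_0 [simp]: "gconst 0 = 0"
  by (simp add: gconst_def)

lemma gconst_add: "gconst (r + s) = gconst r + gconst s"
  by (simp add: gconst_def single_add)

lemma gconst_sum: "gconst (\<Sum>i\<in>I. f i) = (\<Sum>i\<in>I. gconst (f i))"
  by (induction I rule: infinite_finite_induct) (auto simp: gconst_add)

lemma lookup_gconst_gmul: "lkp (gconst r \<cdot> a) M = (if reduced M then r * lkp a M else 0)"
  by (induction a rule: salg_induct)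
    (auto simp: gmul_add_right lookup_add algebra_simps gconst_def gmul_mon lookup_single when_def)

lemma lookup_gmul_gconst: "lkp (a \<cdot> gconst r) M = (if reduced M then r * lkp a M else 0)"
  by (induction a rule: salg_induct)
    (auto simp: gmul_add_left lookup_add algebra_simps gconst_def gmul_mon lookup_single when_def)

lemma gmul_gconst: "a \<cdot> gconst r = gconst r \<cdot> a"
  by (rule poly_mapping_eqI) (simp add: lookup_gconst_gmul lookup_gmul_gconst)

lemma gmul_gconst_left_commute: "a \<cdot> (gconst r \<cdot> b) = gconst r \<cdot> (a \<cdot> b)"
  by (metis gmul_assoc gmul_gconst)

lemma redu_lookup: "redu a \<Longrightarrow> \<not> reduced M \<Longrightarrow> lkp a M = 0"
  by (auto simp: redu_def in_keys_iff)

lemma gconst_1_gmul [simp]: "redu a \<Longrightarrow> gconst 1 \<cdot> a = a"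
  by (rule poly_mapping_eqI) (auto simp: lookup_gconst_gmul redu_lookup)

lemma gmul_gconst_1 [simp]: "redu a \<Longrightarrow> a \<cdot> gconst 1 = a"
  by (simp add: gmul_gconst)

lemma gconst_uminus_1 [simp]: "redu a \<Longrightarrow> gconst (- 1) \<cdot> a = - a"
  by (rule poly_mapping_eqI) (auto simp: lookup_gconst_gmul redu_lookup)

lemma gvar_mon: "gvar g \<cdot> mon M c =
    (if reduced (add_mset g M) then mon (add_mset g M) (tw {#g#} M * c) else 0)"
  by (simp add: gvar_def gmul_mon)

lemma mon_add_mset:
  assumes "reduced (add_mset g M)"
  shows "mon (add_mset g M) c = gvar g \<cdot> mon M (tw {#g#} M * c)"
  using assms by (simp add: gvar_mon tw_square')

lemma mon_empty: "mon {#} c = gconst c" by (simp add: gconst_def)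

text \<open>A reduced monomial is built by multiplying generators from the left, and the sorting
  signs go into the real constant at its end. The set \<open>G\<close> carries along which
  generators occur.\<close>

lemma redu_induct [consumes 1, case_names const gvar add]:
  assumes "\<forall>M\<in>kys a. reduced M \<and> set_mset M \<subseteq> G"
    and "\<And>r. P (gconst r)"
    and "\<And>g a. g \<in> G \<Longrightarrow> redu a \<Longrightarrow> P a \<Longrightarrow> P (gvar g \<cdot> a)"
    and "\<And>a b. redu a \<Longrightarrow> redu b \<Longrightarrow> P a \<Longrightarrow> P b \<Longrightarrow> P (a + b)"
  shows "P a"
proof -
  have m: "P (mon M c)" if "reduced M" "set_mset M \<subseteq> G" for M c
    using that
  proof (induction M arbitrary: c)
    case empty
    then show ?case by (simp add: mon_empty assms(2))
  next
    case (add g M)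
    then show ?case
      using reduced_add_msetD[of g M] by (auto simp: mon_add_mset intro!: assms(3) redu_mon)
  qed
  have "redu a \<and> P a"
    using assms(2)[of 0]
    by (induction a rule: salg_induct) (use assms(1,4) in \<open>auto intro: redu_add redu_mon m\<close>)
  then show ?thesis by simp
qed

lemma reduE: "redu a \<Longrightarrow> \<forall>M\<in>kys a. reduced M \<and> set_mset M \<subseteq> UNIV"
  by (simp add: redu_def)

subsection \<open>Bidegrees\<close>

definition mdeg :: "'n gen multiset \<Rightarrow> nat" where "mdeg M = (\<Sum>g\<in>#M. gdeg g)"
definition mpar :: "'n gen multiset \<Rightarrow> nat" where "mpar M = (\<Sum>g\<in>#M. gpar g)"

definition homog :: "nat \<Rightarrow> nat \<Rightarrow> 'n salg \<Rightarrow> bool" where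
  "homog d e a \<longleftrightarrow> (\<forall>M\<in>kys a. mdeg M = d \<and> even (mpar M + e))"

lemma mdeg_simps [simp]: "mdeg {#} = 0" "mdeg (add_mset g M) = gdeg g + mdeg M" "mdeg (M + N) = mdeg M + mdeg N"
  by (auto simp: mdeg_def)

lemma mpar_simps [simp]: "mpar {#} = 0" "mpar (add_mset g M) = gpar g + mpar M" "mpar (M + N) = mpar M + mpar N"
  by (auto simp: mpar_def)

lemma homog_zero [simp]: "homog d e 0" by (simp add: homog_def)

lemma homog_add: "homog d e a \<Longrightarrow> homog d e b \<Longrightarrow> homog d e (a + b)"
  unfolding homog_def by (auto elim: keys_addE)

lemma homog_sum: "(\<And>i. i \<in> I \<Longrightarrow> homog d e (f i)) \<Longrightarrow> homog d e (\<Sum>i\<in>I. f i)"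
  by (induction I rule: infinite_finite_induct) (auto intro: homog_add)

lemma homog_gmul: "homog d e a \<Longrightarrow> homog d' e' b \<Longrightarrow> homog (d + d') (e + e') (a \<cdot> b)"
  unfolding homog_def by (auto elim!: keys_gmulE)

lemma homog_gconst [simp]: "homog 0 0 (gconst r)"
  by (cases "r = 0") (auto simp: homog_def gconst_def)

lemma homog_gvar: "homog (gdeg g) (gpar g) (gvar g)"
  by (auto simp: homog_def gvar_def)

lemma homog_gconst_gmul: "homog d e a \<Longrightarrow> homog d e (gconst r \<cdot> a)"
  using homog_gmul[of 0 0 "gconst r" d e a] by simp

definition csgn :: "'n gen \<Rightarrow> 'n gen \<Rightarrow> real" where
  "csgn g h = (if anticomm g h then - 1 else 1)"

lemma csgn_eq: "csgn g h = (- 1) ^ (gdeg g * gdeg h + gpar g * gpar h)"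
  by (simp add: csgn_def anticomm_def)

lemma prod_csgn: "(\<Prod>g\<in>#M. \<Prod>h\<in>#N. csgn g h) = (- 1) ^ (mdeg M * mdeg N + mpar M * mpar N)"
proof (induction M)
  case (add g M)
  have "(\<Prod>h\<in>#N. csgn g h) = (- 1) ^ (gdeg g * mdeg N + gpar g * mpar N)"
    by (induction N) (auto simp: csgn_eq power_add[symmetric] algebra_simps)
  then show ?case using add by (simp add: power_add algebra_simps)
qed simp

lemma reduced_common: "reduced (M + N) \<Longrightarrow> g \<in># M \<Longrightarrow> g \<in># N \<Longrightarrow> \<not> anticomm g g"
proof
  assume "reduced (M + N)" "g \<in># M" "g \<in># N" "anticomm g g"
  then have "count (M + N) g \<le> 1" "count M g \<ge> 1" "count N g \<ge> 1" by (auto simp: reduced_def)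
  then show False by simp
qed

text \<open>Of the two orders of a pair of distinct generators exactly one is an inversion, so the
  two signs differ by the commutation sign of the pair, and the product of these signs depends on
  the total degrees only. A generator common to both monomials commutes with itself, by
  reducedness.\<close>

lemma tw_commute:
  assumes "reduced (M + N)"
  shows "tw M N = (- 1) ^ (mdeg M * mdeg N + mpar M * mpar N) * tw N M"
proof -
  let ?t = "\<lambda>g h. if to_nat h < to_nat g \<and> anticomm g h then - 1 else 1 :: real"
  have t: "?t g h = csgn g h * ?t h g" if "g \<in># M" "h \<in># N" for g h
  proof (cases "g = h")
    case True
    then show ?thesis using reduced_common[OF assms] that by (auto simp: csgn_def)
  next
    case False
    then have "to_nat g < to_nat h \<or> to_nat h < to_nat g" by (metis nat_neq_iff from_nat_to_nat)
    then show ?thesis by (auto simp: csgn_def anticomm_def mult.commute)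
  qed
  have "tw M N = (\<Prod>g\<in>#M. \<Prod>h\<in>#N. csgn g h * ?t h g)"
    unfolding tw_def by (intro arg_cong[of _ _ prod_mset] image_mset_cong) (use t in auto)
  also have "\<dots> = (\<Prod>g\<in>#M. \<Prod>h\<in>#N. csgn g h) * (\<Prod>g\<in>#M. \<Prod>h\<in>#N. ?t h g)"
    by (simp add: prod_mset.distrib)
  also have "(\<Prod>g\<in>#M. \<Prod>h\<in>#N. ?t h g) = tw N M"
    unfolding tw_def by (rule prod_mset.swap)
  finally show ?thesis by (simp add: prod_csgn)
qed

lemma gmul_commute:
  assumes "homog d e a" "homog d' e' b"
  shows "a \<cdot> b = gconst ((- 1) ^ (d * d' + e * e')) \<cdot> (b \<cdot> a)"
proof (rule salg_induct[of _ a])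
  fix M x assume "M \<in> kys a"
  then have 1: "mdeg M = d" "even (mpar M + e)" using assms(1) by (auto simp: homog_def)
  show "mon M x \<cdot> b = gconst ((- 1) ^ (d * d' + e * e')) \<cdot> (b \<cdot> mon M x)"
  proof (rule salg_induct[of _ b])
    fix N y assume "N \<in> kys b"
    then have 2: "mdeg N = d'" "even (mpar N + e')" using assms(2) by (auto simp: homog_def)
    have "even (mpar M * mpar N) = even (e * e')" using 1 2 by auto
    then have "(- 1 :: real) ^ (d * d' + e * e') = (- 1) ^ (mdeg M * mdeg N + mpar M * mpar N)"
      using 1(1) 2(1) by (auto simp: power_add uminus_power_if)
    then show "mon M x \<cdot> mon N y = gconst ((- 1) ^ (d * d' + e * e')) \<cdot> (mon N y \<cdot> mon M x)"
      using tw_commute[of M N]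
      by (auto simp: gmul_mon gconst_mon add.commute[of N M] mult_ac)
  qed (auto simp: gmul_add_left gmul_add_right)
qed (auto simp: gmul_add_left gmul_add_right)

text \<open>Homogeneity, as in \<open>gmul_commute\<close>, is replaced by the condition that the
  generators of the two factors commute pairwise.\<close>

lemma gmul_commute_noanti:
  assumes "\<And>M N g h. M \<in> kys a \<Longrightarrow> N \<in> kys b \<Longrightarrow> g \<in># M \<Longrightarrow> h \<in># N \<Longrightarrow> \<not> anticomm g h"
  shows "a \<cdot> b = b \<cdot> a"
proof (rule salg_induct[of _ a])
  fix M x assume M: "M \<in> kys a"
  show "mon M x \<cdot> b = b \<cdot> mon M x"
  proof (rule salg_induct[of _ b])
    fix N y assume N: "N \<in> kys b"
    have "tw M N = 1"
      unfolding tw_def by (intro prod_mset.neutral ballI) (use assms[OF M N] in \<open>auto intro!: prod_mset.neutral\<close>)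
    moreover have "\<not> anticomm h g" if "g \<in># M" "h \<in># N" for g h
      using assms[OF M N that] by (simp add: anticomm_def mult.commute)
    then have "tw N M = 1"
      unfolding tw_def by (intro prod_mset.neutral ballI) (auto intro!: prod_mset.neutral)
    ultimately show "mon M x \<cdot> mon N y = mon N y \<cdot> mon M x"
      by (simp add: gmul_mon add.commute mult.commute)
  qed (auto simp: gmul_add_left gmul_add_right)
qed (auto simp: gmul_add_left gmul_add_right)

lemma lookup_gvar_gmul:
  "lkp (gvar g \<cdot> a) M = (if g \<in># M \<and> reduced M then tw {#g#} (M - {#g#}) * lkp a (M - {#g#}) else 0)"
proof (induction a rule: salg_induct)
  case (mon N c)
  show ?case
    by (cases "g \<in># M") (auto simp: gvar_mon lookup_single when_def)
qed (auto simp: gmul_add_right lookup_add algebra_simps)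

section \<open>Left derivatives and the derivations built from them\<close>

subsection \<open>Left derivatives\<close>

lemma pds_mon: "pds A L (mon M c) = mon (M - {#Sg A L#}) (real (count M (Sg A L)) * tw {#Sg A L#} (M - {#Sg A L#}) * c)"
  by (cases "c = 0") (auto simp: pds_def)

lemma pds_zero [simp]: "pds A L 0 = 0" by (simp add: pds_def)

lemma pds_add: "pds A L (a + b) = pds A L a + pds A L b"
  unfolding pds_def by (rule keys_sum_add) (auto simp: single_add[symmetric] algebra_simps)

lemma lookup_pds: "lkp (pds A L a) N =
    real (count N (Sg A L) + 1) * tw {#Sg A L#} N * lkp a (add_mset (Sg A L) N)"
proof (induction a rule: salg_induct)
  case (mon M c)
  show ?case
  proof (cases "Sg A L \<in># M")
    case True
    then obtain K where "M = add_mset (Sg A L) K" by (metis multi_member_split)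
    then show ?thesis by (auto simp: pds_mon lookup_single when_def)
  next
    case False
    then have "count M (Sg A L) = 0" "M \<noteq> add_mset (Sg A L) N" by (auto simp: not_in_iff)
    then show ?thesis by (auto simp: pds_mon lookup_single when_def)
  qed
qed (auto simp: pds_add lookup_add algebra_simps)

lemma redu_pds: "redu a \<Longrightarrow> redu (pds A L a)"
  by (auto simp: redu_def in_keys_iff lookup_pds dest: reduced_add_msetD)

lemma keys_pds: "N \<in> kys (pds A L a) \<Longrightarrow> add_mset (Sg A L) N \<in> kys a"
  by (auto simp: in_keys_iff lookup_pds)

lemma pds_eq_0: "(A, L) \<notin> svars a \<Longrightarrow> pds A L a = 0"
proof (rule poly_mapping_eqI)
  fix N assume "(A, L) \<notin> svars a"
  then have "add_mset (Sg A L) N \<notin> kys a" by (auto simp: svars_def)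
  then show "lkp (pds A L a) N = lkp 0 N" by (simp add: lookup_pds in_keys_iff)
qed

lemma tw_single_commute: "g \<noteq> h \<Longrightarrow> tw {#g#} {#h#} * tw {#h#} {#g#} = csgn g h"
  by (cases "to_nat g" "to_nat h" rule: linorder_cases) (auto simp: tw_single csgn_def anticomm_def mult.commute)

lemma reduced_add_mset: "reduced (add_mset g M) \<longleftrightarrow> reduced M \<and> (anticomm g g \<longrightarrow> g \<notin># M)"
proof
  assume r: "reduced (add_mset g M)"
  then show "reduced M \<and> (anticomm g g \<longrightarrow> g \<notin># M)"
    using reduced_common[of "{#g#}" M g] reduced_add_msetD by auto
qed (auto simp: reduced_def not_in_iff)

text \<open>The generator moves past the derivative at the price of its commutation sign. For
  \<open>g\<close> equal to the variable there are two regimes: if it anticommutes with itself, both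
  sides vanish once it already occurs; otherwise its multiplicity grows by one.\<close>

lemma pds_gvar_gmul:
  assumes "redu b"
  shows "pds A L (gvar g \<cdot> b) = (if g = Sg A L then b else 0) + gconst (csgn g (Sg A L)) \<cdot> (gvar g \<cdot> pds A L b)"
  using reduE[OF assms]
proof (rule_tac salg_induct[of _ b])
  let ?x = "Sg A L"
  assume 0: "\<forall>M\<in>kys b. reduced M \<and> set_mset M \<subseteq> UNIV"
  fix M c assume "M \<in> kys b"
  then have M: "reduced M" using 0 by simp
  show "pds A L (gvar g \<cdot> mon M c) = (if g = ?x then mon M c else 0) +
      gconst (csgn g ?x) \<cdot> (gvar g \<cdot> pds A L (mon M c))"
  proof (cases "?x \<in># M")
    case False
    then have c: "count M ?x = 0" by (simp add: not_in_iff)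
    then have 1: "pds A L (mon M c) = 0" by (simp add: pds_mon)
    show ?thesis
    proof (cases "g = ?x")
      case True
      then show ?thesis using False M c
        by (simp add: 1 gvar_mon reduced_add_mset pds_mon tw_square')
    next
      case gx: False
      then show ?thesis using c by (simp add: 1 gvar_mon pds_mon)
    qed
  next
    case True
    then obtain N where N: "M = add_mset ?x N" by (metis multi_member_split)
    have rN: "reduced N" using M N reduced_add_msetD by blast
    show ?thesis
    proof (cases "g = ?x")
      case gx: True
      show ?thesis
      proof (cases "anticomm ?x ?x")
        case True
        then have "?x \<notin># N" using M N by (simp add: reduced_add_mset)
        then have cN: "count N ?x = 0" by (simp add: not_in_iff)
        have "pds A L (mon M c) = mon N (tw {#?x#} N * c)"
          by (simp add: pds_mon N cN)
        then show ?thesis using M N True gx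
          by (simp add: gvar_mon reduced_add_mset csgn_def tw_square' redu_mon)
      next
        case False
        then have "reduced (add_mset ?x M)" using M by (simp add: reduced_add_mset)
        moreover have "tw {#?x#} {#?x#} = 1" by (simp add: tw_single)
        moreover have "tw {#?x#} M = tw {#?x#} {#?x#} * tw {#?x#} N"
          unfolding N by (rule tw_add_mset_right)
        ultimately show ?thesis using M N False gx tw_square[of "{#?x#}" N]
          by (simp add: pds_mon gvar_mon csgn_def redu_mon single_add[symmetric] algebra_simps)
      qed
    next
      case gx: False
      have red: "reduced (add_mset g M) \<longleftrightarrow> reduced (add_mset g N)"
        using M N gx rN by (auto simp: reduced_add_mset)
      have 1: "pds A L (mon M c) = mon N (real (count M ?x) * tw {#?x#} N * c)"
        by (simp add: pds_mon N)
      have 2: "tw {#g#} M = tw {#g#} {#?x#} * tw {#g#} N"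
        unfolding N by (rule tw_add_mset_right)
      have 3: "tw {#?x#} (add_mset g N) = tw {#?x#} {#g#} * tw {#?x#} N"
        by (rule tw_add_mset_right)
      have 4: "add_mset g M - {#?x#} = add_mset g N" "count (add_mset g M) ?x = count M ?x"
        using gx by (auto simp: N)
      have s: "tw {#g#} {#?x#} * (tw {#?x#} {#g#} * y) = csgn g ?x * y" for y
        using tw_single_commute[OF gx] by (simp add: mult.assoc[symmetric])
      show ?thesis
      proof (cases "reduced (add_mset g N)")
        case True
        have "real (count M ?x) * tw {#?x#} (add_mset g N) * (tw {#g#} M * c) =
          tw {#g#} {#?x#} * (tw {#?x#} {#g#} * (tw {#g#} N * (real (count M ?x) * tw {#?x#} N * c)))"
          unfolding 2 3 by (simp add: mult_ac)
        then have E: "real (count M ?x) * tw {#?x#} (add_mset g N) * (tw {#g#} M * c) =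
            csgn g ?x * (tw {#g#} N * (real (count M ?x) * tw {#?x#} N * c))"
          unfolding s .
        have "pds A L (gvar g \<cdot> mon M c) = mon (add_mset g N) (real (count M ?x) * tw {#?x#} (add_mset g N) * (tw {#g#} M * c))"
          using True by (simp only: gvar_mon red if_True pds_mon 4)
        then show ?thesis
          unfolding 1 E using gx True by (simp only: gvar_mon gconst_mon if_True if_False add_0)
      qed (use gx in \<open>simp add: gvar_mon red 1\<close>)
    qed
  qed
qed (auto simp: gmul_add_right pds_add)

lemma pds_gvar: "pds A L (gvar g) = (if g = Sg A L then gconst 1 else 0)"
  by (simp add: gvar_def pds_mon mon_empty)

lemma pds_gconst [simp]: "pds A L (gconst r) = 0"
  by (simp add: gconst_def pds_mon)

lemma pds_gconst_gmul: "redu a \<Longrightarrow> pds A L (gconst r \<cdot> a) = gconst r \<cdot> pds A L a"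
  by (rule poly_mapping_eqI) (auto simp: lookup_pds lookup_gconst_gmul redu_lookup dest: reduced_add_msetD)

subsection \<open>Derivations prescribed on the generators\<close>

text \<open>The common shape of the fibre parts of the total derivatives, of the exterior
  differential and of \<open>\<upsilon>\<close> itself.\<close>

definition der :: "(fld \<Rightarrow> ('n::finite) multiset \<Rightarrow> 'n salg) \<Rightarrow> 'n salg \<Rightarrow> 'n salg" where
  "der h a = (\<Sum>(A, L)\<in>svars a. h A L \<cdot> pds A L a)"

lemma finite_svars [simp]: "finite (svars a)"
proof -
  have "svars a \<subseteq> (\<lambda>g. case g of Sg A L \<Rightarrow> (A, L)) ` (\<Union>M\<in>kys a. set_mset M)"
    by (force simp: svars_def image_iff)
  then show ?thesis by (rule finite_subset) auto
qed

lemma der_superset: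
  assumes "finite S" "svars a \<subseteq> S"
  shows "der h a = (\<Sum>(A, L)\<in>S. h A L \<cdot> pds A L a)"
  unfolding der_def using assms by (intro sum.mono_neutral_left) (auto simp: pds_eq_0)

lemma der_zero [simp]: "der h 0 = 0"
  by (simp add: der_def)

lemma svars_add: "svars (a + b) \<subseteq> svars a \<union> svars b"
  by (auto simp: svars_def elim!: keys_addE)

lemma svars_gmul: "svars (a \<cdot> b) \<subseteq> svars a \<union> svars b"
  by (fastforce simp: svars_def elim!: keys_gmulE)

lemma svars_gconst [simp]: "svars (gconst r) = {}"
  by (cases "r = 0") (auto simp: svars_def gconst_def)

lemma svars_gvar: "svars (gvar g) = {(A, L). g = Sg A L}"
  by (auto simp: svars_def gvar_def)

lemma der_add: "der h (a + b) = der h a + der h b"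
proof -
  let ?S = "svars a \<union> svars b"
  have "der h c = (\<Sum>(A, L)\<in>?S. h A L \<cdot> pds A L c)" if "c \<in> {a, b, a + b}" for c
    using that svars_add by (intro der_superset) auto
  then show ?thesis
    by (simp add: pds_add gmul_add_right split_def sum.distrib)
qed

lemma der_gconst [simp]: "der h (gconst r) = 0"
  by (simp add: der_def)

lemma der_gvar:
  assumes "\<And>A L. redu (h A L)"
  shows "der h (gvar g) = (case g of Sg A L \<Rightarrow> h A L | _ \<Rightarrow> 0)"
proof -
  have "{(A, L). Sg A' L' = Sg A L} = {(A', L')}" for A' and L' :: "'a multiset" by auto
  then show ?thesis
    by (cases g) (auto simp: der_def svars_gvar pds_gvar assms)
qed

lemma der_gconst_gmul: "redu a \<Longrightarrow> der h (gconst r \<cdot> a) = gconst r \<cdot> der h a"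
proof -
  assume "redu a"
  moreover have "der h (gconst r \<cdot> a) = (\<Sum>(A, L)\<in>svars a. h A L \<cdot> pds A L (gconst r \<cdot> a))"
    using svars_gmul[of "gconst r" a] by (intro der_superset) auto
  ultimately show ?thesis
    by (simp add: der_def pds_gconst_gmul gmul_sum_right gmul_gconst_left_commute split_def)
qed

text \<open>The sign \<epsilon> is what the derivation picks up when passing \<open>g\<close>. By
  the last assumption \<open>h A L\<close> commutes with \<open>g\<close> like the variable it
  replaces, up to \<epsilon>; the two occurrences of the commutation sign then cancel.\<close>

lemma der_gvar_gmul:
  assumes "redu b" "\<And>A L. redu (h A L)"
    and "\<And>A L. h A L \<cdot> gvar g = gconst (\<epsilon> * csgn g (Sg A L)) \<cdot> (gvar g \<cdot> h A L)"
  shows "der h (gvar g \<cdot> b) = der h (gvar g) \<cdot> b + gconst \<epsilon> \<cdot> (gvar g \<cdot> der h b)"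
proof -
  let ?S = "svars (gvar g) \<union> svars b"
  have 1: "der h (gvar g \<cdot> b) = (\<Sum>(A, L)\<in>?S. h A L \<cdot> pds A L (gvar g \<cdot> b))"
    using svars_gmul[of "gvar g" b] by (intro der_superset) auto
  have "h A L \<cdot> (gconst (csgn g (Sg A L)) \<cdot> (gvar g \<cdot> pds A L b)) = gconst \<epsilon> \<cdot> (gvar g \<cdot> (h A L \<cdot> pds A L b))" for A L
  proof -
    have "h A L \<cdot> (gconst (csgn g (Sg A L)) \<cdot> (gvar g \<cdot> pds A L b)) =
        gconst (csgn g (Sg A L)) \<cdot> ((h A L \<cdot> gvar g) \<cdot> pds A L b)"
      by (simp add: gmul_gconst_left_commute gmul_assoc)
    also have "\<dots> = gconst (csgn g (Sg A L) * (\<epsilon> * csgn g (Sg A L))) \<cdot> (gvar g \<cdot> (h A L \<cdot> pds A L b))"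
      unfolding assms(3) by (simp add: gconst_gconst_gmul gmul_assoc)
    also have "csgn g (Sg A L) * (\<epsilon> * csgn g (Sg A L)) = \<epsilon>" by (simp add: csgn_def)
    finally show ?thesis .
  qed
  then have "der h (gvar g \<cdot> b) = (\<Sum>(A, L)\<in>?S. h A L \<cdot> (if g = Sg A L then b else 0)) +
      (\<Sum>(A, L)\<in>?S. gconst \<epsilon> \<cdot> (gvar g \<cdot> (h A L \<cdot> pds A L b)))"
    unfolding 1 pds_gvar_gmul[OF assms(1)] by (simp add: gmul_add_right sum.distrib split_def)
  also have "(\<Sum>(A, L)\<in>?S. gconst \<epsilon> \<cdot> (gvar g \<cdot> (h A L \<cdot> pds A L b))) = gconst \<epsilon> \<cdot> (gvar g \<cdot> der h b)"
    by (subst der_superset[of ?S b]) (auto simp: gmul_sum_right split_def)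
  also have "(\<Sum>(A, L)\<in>?S. h A L \<cdot> (if g = Sg A L then b else 0)) = (\<Sum>(A, L)\<in>?S. h A L \<cdot> pds A L (gvar g) \<cdot> b)"
    by (intro sum.cong) (auto simp: pds_gvar gmul_assoc assms(1))
  also have "\<dots> = der h (gvar g) \<cdot> b"
    by (subst der_superset[of ?S "gvar g"]) (auto simp: gmul_sum_left split_def)
  finally show ?thesis .
qed

section \<open>Algebra homomorphisms given by the images of the generators\<close>

subsection \<open>Substitution homomorphisms\<close>

definition wordprod :: "('n gen \<Rightarrow> 'n salg) \<Rightarrow> ('n::finite) gen list \<Rightarrow> 'n salg" where
  "wordprod \<sigma> ws = foldr (\<lambda>g b. \<sigma> g \<cdot> b) ws (gconst 1)"

definition subst_alg :: "('n gen \<Rightarrow> 'n salg) \<Rightarrow> ('n::finite) salg \<Rightarrow> 'n salg" where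
  "subst_alg \<sigma> a = (\<Sum>M\<in>kys a. gconst (lkp a M) \<cdot> wordprod \<sigma> (word_of M))"

lemma wordprod_simps [simp]: "wordprod \<sigma> [] = gconst 1" "wordprod \<sigma> (g # ws) = \<sigma> g \<cdot> wordprod \<sigma> ws"
  by (auto simp: wordprod_def)

lemma form_trans_eq_subst_alg: "form_trans B j k p = subst_alg (\<lambda>g. gen_trans B j k g p)"
  by (simp add: fun_eq_iff form_trans_def subst_alg_def wordprod_def)

lemma mset_word_of [simp]: "mset (word_of M) = M"
proof -
  have "mset (word_of M) = image_mset from_nat (image_mset to_nat M)"
    by (simp add: word_of_def)
  then show ?thesis by (simp add: multiset.map_comp o_def)
qed

lemma map_to_nat_word_of: "map to_nat (word_of M) = sorted_list_of_multiset (image_mset to_nat M)"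
proof -
  have "to_nat (from_nat x :: 'a gen) = x" if "x \<in># image_mset to_nat M" for x
    using that by auto
  then have "map (to_nat \<circ> (from_nat :: nat \<Rightarrow> 'a gen)) (sorted_list_of_multiset (image_mset to_nat M)) =
     map id (sorted_list_of_multiset (image_mset to_nat M))"
    by (intro map_cong) auto
  then show ?thesis by (simp add: word_of_def)
qed

lemma word_of_eqI:
  assumes "mset ws = M" "sorted (map to_nat ws)"
  shows "word_of M = ws"
proof -
  have "map to_nat (word_of M) = map to_nat ws"
    unfolding map_to_nat_word_of assms(1)[symmetric] mset_map[symmetric] sorted_list_of_multiset_mset
    by (rule sorted_sort_id[OF assms(2)])
  then show ?thesis by (simp add: inj_map_eq_map)
qed

lemma sorted_word_of [simp]: "sorted (map to_nat (word_of M))"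
  by (simp add: map_to_nat_word_of)

lemma word_of_add_mset: "word_of (add_mset g M) = insort_key to_nat g (word_of M)"
  by (rule word_of_eqI) (auto simp: sorted_insort_key)

lemma word_of_empty [simp]: "word_of {#} = []"
  by (rule word_of_eqI) auto

text \<open>Images of the same bidegree satisfy the commutation relations of the generators, which
  is what makes the substitution multiplicative.\<close>

definition graded_subst :: "(('n::finite) gen \<Rightarrow> 'n salg) \<Rightarrow> bool" where
  "graded_subst \<sigma> \<longleftrightarrow> (\<forall>g. redu (\<sigma> g) \<and> homog (gdeg g) (gpar g) (\<sigma> g))"

lemma graded_subst_commute:
  assumes "graded_subst \<sigma>"
  shows "\<sigma> g \<cdot> \<sigma> h = gconst (csgn g h) \<cdot> (\<sigma> h \<cdot> \<sigma> g)"
  using gmul_commute[of "gdeg g" "gpar g" "\<sigma> g" "gdeg h" "gpar h" "\<sigma> h"] assms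
  by (simp add: graded_subst_def csgn_eq)

lemma graded_subst_square:
  assumes "graded_subst \<sigma>" "anticomm g g"
  shows "\<sigma> g \<cdot> \<sigma> g = 0"
proof -
  have "\<sigma> g \<cdot> \<sigma> g = - (\<sigma> g \<cdot> \<sigma> g)"
    using graded_subst_commute[OF assms(1), of g g] assms(2) by (simp add: csgn_def)
  then have "lkp (\<sigma> g \<cdot> \<sigma> g) M = - lkp (\<sigma> g \<cdot> \<sigma> g) M" for M
    by (metis lookup_uminus)
  then show ?thesis by (intro poly_mapping_eqI) (simp add: eq_neg_iff_add_eq_0)
qed

text \<open>Insertion sort: each transposition contributes one commutation sign, and these are the
  factors of \<open>tw\<close>. A repeated anticommuting letter ends up next to its copy, where the
  square vanishes.\<close>

lemma wordprod_insort:
  assumes "graded_subst \<sigma>"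
  shows "sorted (map to_nat ws) \<Longrightarrow> reduced (mset ws) \<Longrightarrow>
    \<sigma> g \<cdot> wordprod \<sigma> ws = (if reduced (add_mset g (mset ws))
      then gconst (tw {#g#} (mset ws)) \<cdot> wordprod \<sigma> (insort_key to_nat g ws) else 0)"
proof (induction ws)
  case (Cons h ws)
  have red: "reduced (mset ws)" using Cons.prems reduced_add_msetD by auto
  have sort: "sorted (map to_nat ws)" using Cons.prems by simp
  show ?case
  proof (cases "to_nat g \<le> to_nat h")
    case True
    show ?thesis
    proof (cases "reduced (add_mset g (mset (h # ws)))")
      case red': True
      have "\<not> to_nat h' < to_nat g" if "h' \<in> set (h # ws)" for h'
        using True Cons.prems(1) that by auto
      then have "tw {#g#} (mset (h # ws)) = 1"
        unfolding tw_def by (auto intro!: prod_mset.neutral)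
      then show ?thesis using True red' by simp
    next
      case red': False
      then have "anticomm g g" "g \<in> set (h # ws)"
        using Cons.prems(2) by (auto simp: reduced_add_mset)
      moreover have "g = h"
      proof (rule ccontr)
        assume "g \<noteq> h"
        then have "to_nat h \<le> to_nat g" using calculation Cons.prems(1) by auto
        then show False using True \<open>g \<noteq> h\<close> by simp
      qed
      ultimately show ?thesis
        using red' graded_subst_square[OF assms, of g] by (simp add: gmul_assoc[symmetric])
    qed
  next
    case False
    then have ne: "g \<noteq> h" by auto
    have red': "reduced (add_mset g (mset (h # ws))) \<longleftrightarrow> reduced (add_mset g (mset ws))"
      using ne Cons.prems(2) red by (auto simp: reduced_add_mset)
    have "tw {#g#} {#h#} = csgn g h" using False by (simp add: tw_single csgn_def)
    then have t: "tw {#g#} (mset (h # ws)) = csgn g h * tw {#g#} (mset ws)"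
      using tw_add_mset_right[of "{#g#}" h "mset ws"] by simp
    have "\<sigma> g \<cdot> wordprod \<sigma> (h # ws) = gconst (csgn g h) \<cdot> (\<sigma> h \<cdot> (\<sigma> g \<cdot> wordprod \<sigma> ws))"
      using graded_subst_commute[OF assms, of g h] by (simp add: gmul_assoc[symmetric])
    also have "\<dots> = (if reduced (add_mset g (mset ws))
      then gconst (csgn g h * tw {#g#} (mset ws)) \<cdot> (\<sigma> h \<cdot> wordprod \<sigma> (insort_key to_nat g ws)) else 0)"
      unfolding Cons.IH[OF sort red] by (simp add: gmul_gconst_left_commute[of "\<sigma> h"] gconst_gconst_gmul)
    finally show ?thesis using False t red' by simp
  qed
qed (use assms in \<open>simp add: graded_subst_def\<close>)

lemma subst_alg_mon: "subst_alg \<sigma> (mon M c) = gconst c \<cdot> wordprod \<sigma> (word_of M)"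
  by (cases "c = 0") (auto simp: subst_alg_def)

lemma subst_alg_zero [simp]: "subst_alg \<sigma> 0 = 0"
  by (simp add: subst_alg_def)

lemma subst_alg_add: "subst_alg \<sigma> (a + b) = subst_alg \<sigma> a + subst_alg \<sigma> b"
  unfolding subst_alg_def by (rule keys_sum_add) (auto simp: gconst_add gmul_add_left)

lemma subst_alg_uminus: "subst_alg \<sigma> (- a) = - subst_alg \<sigma> a"
  using subst_alg_add[of \<sigma> "- a" a] by (simp add: eq_neg_iff_add_eq_0)

lemma subst_alg_diff: "subst_alg \<sigma> (a - b) = subst_alg \<sigma> a - subst_alg \<sigma> b"
  using subst_alg_add[of \<sigma> a "- b"] by (simp add: subst_alg_uminus)

lemma subst_alg_sum: "subst_alg \<sigma> (\<Sum>i\<in>I. f i) = (\<Sum>i\<in>I. subst_alg \<sigma> (f i))"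
  by (induction I rule: infinite_finite_induct) (auto simp: subst_alg_add)

lemma subst_alg_gconst [simp]: "subst_alg \<sigma> (gconst r) = gconst r"
  using subst_alg_mon[of \<sigma> "{#}" r] by (simp add: mon_empty)

lemma redu_subst_alg [simp]: "redu (subst_alg \<sigma> a)"
  unfolding subst_alg_def by (intro redu_sum) simp

lemma subst_alg_gvar: "graded_subst \<sigma> \<Longrightarrow> subst_alg \<sigma> (gvar g) = \<sigma> g"
  using subst_alg_mon[of \<sigma> "{#g#}" 1] word_of_eqI[of "[g]"] by (simp add: gvar_def graded_subst_def)

lemma subst_alg_gvar_gmul:
  assumes "graded_subst \<sigma>" "redu a"
  shows "subst_alg \<sigma> (gvar g \<cdot> a) = \<sigma> g \<cdot> subst_alg \<sigma> a"
proof (rule salg_induct[of _ a])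
  fix M c assume "M \<in> kys a"
  then have M: "reduced M" using assms(2) by (simp add: redu_def)
  have "\<sigma> g \<cdot> subst_alg \<sigma> (mon M c) = gconst c \<cdot> (\<sigma> g \<cdot> wordprod \<sigma> (word_of M))"
    by (simp add: subst_alg_mon gmul_gconst_left_commute)
  then show "subst_alg \<sigma> (gvar g \<cdot> mon M c) = \<sigma> g \<cdot> subst_alg \<sigma> (mon M c)"
    using wordprod_insort[OF assms(1), of "word_of M" g] M
    by (simp add: gvar_mon subst_alg_mon word_of_add_mset gconst_gconst_gmul mult.commute)
qed (auto simp: gmul_add_right subst_alg_add)

lemma subst_alg_gconst_gmul:
  "redu a \<Longrightarrow> subst_alg \<sigma> (gconst r \<cdot> a) = gconst r \<cdot> subst_alg \<sigma> a"
proof (rule salg_induct[of _ a])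
  fix M c assume "redu a" "M \<in> kys a"
  then show "subst_alg \<sigma> (gconst r \<cdot> mon M c) = gconst r \<cdot> subst_alg \<sigma> (mon M c)"
    by (simp add: redu_def gconst_mon subst_alg_mon gconst_gconst_gmul)
qed (auto simp: gmul_add_right subst_alg_add)

lemma subst_alg_gmul:
  assumes "graded_subst \<sigma>" "redu a" "redu b"
  shows "subst_alg \<sigma> (a \<cdot> b) = subst_alg \<sigma> a \<cdot> subst_alg \<sigma> b"
  using reduE[OF assms(2)]
  by (induction a rule: redu_induct)
    (use assms in \<open>auto simp: subst_alg_gconst_gmul subst_alg_gvar_gmul gmul_assoc gmul_add_left subst_alg_add\<close>)

lemma subst_alg_cong_id:
  assumes "graded_subst \<sigma>" "redu a" "\<And>M g. M \<in> kys a \<Longrightarrow> g \<in># M \<Longrightarrow> \<sigma> g = gvar g"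
  shows "subst_alg \<sigma> a = a"
proof -
  have "\<forall>M\<in>kys a. reduced M \<and> set_mset M \<subseteq> {g. \<sigma> g = gvar g}"
    using assms by (auto simp: redu_def)
  then show ?thesis
    by (induction a rule: redu_induct) (auto simp: subst_alg_gvar_gmul assms(1) subst_alg_add)
qed

lemma keys_subst_algE:
  assumes "K \<in> kys (subst_alg \<sigma> a)"
  obtains M where "M \<in> kys a" "K \<in> kys (wordprod \<sigma> (word_of M))"
proof -
  obtain M where M: "M \<in> kys a" "K \<in> kys (gconst (lkp a M) \<cdot> wordprod \<sigma> (word_of M))"
    using assms unfolding subst_alg_def by (elim keys_sumE)
  then have "K \<in> kys (wordprod \<sigma> (word_of M))"
    by (auto simp: in_keys_iff lookup_gconst_gmul split: if_splits)
  then show thesis using that M by blast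
qed

lemma keys_wordprod:
  assumes "\<And>g N. g \<in> set ws \<Longrightarrow> N \<in> kys (\<sigma> g) \<Longrightarrow> size N \<le> s \<and> (\<forall>h\<in>#N. R h)"
    "K \<in> kys (wordprod \<sigma> ws)"
  shows "size K \<le> s * length ws \<and> (\<forall>h\<in>#K. R h)"
  using assms
proof (induction ws arbitrary: K)
  case Nil
  then show ?case by (auto simp: gconst_def)
next
  case (Cons g ws)
  obtain M N where K: "K = M + N" "M \<in> kys (\<sigma> g)" "N \<in> kys (wordprod \<sigma> ws)"
    using Cons.prems(2) by (auto elim: keys_gmulE)
  have "size N \<le> s * length ws \<and> (\<forall>h\<in>#N. R h)"
    using K(3) by (intro Cons.IH Cons.prems(1)) auto
  then show ?case using Cons.prems(1)[of g M] K by auto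
qed

subsection \<open>Monomials of bounded order\<close>

text \<open>Finite, because the base dimension and both ranks are; a form with keys in it amounts to
  a finite vector of coefficients.\<close>

definition mons_upto :: "('x, 'n::finite, 'y, 'q, 'k) setting \<Rightarrow> nat \<Rightarrow> 'n gen multiset set" where
  "mons_upto B r = {M. reduced M \<and> size M \<le> r \<and> (\<forall>g\<in>#M. gen_ok B r g)}"

lemma gen_ok_mono: "gen_ok B r g \<Longrightarrow> r \<le> s \<Longrightarrow> gen_ok B s g"
  by (cases g) auto

lemma mons_upto_mono: "r \<le> s \<Longrightarrow> mons_upto B r \<subseteq> mons_upto B s"
  by (auto simp: mons_upto_def intro: gen_ok_mono)

lemma finite_bounded_msets: "finite S \<Longrightarrow> finite {M. size M \<le> r \<and> set_mset M \<subseteq> S}"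
proof (induction r)
  case 0
  have "{M. size M \<le> 0 \<and> set_mset M \<subseteq> S} = {{#}}" by auto
  then show ?case by simp
next
  case (Suc r)
  have "{M. size M \<le> Suc r \<and> set_mset M \<subseteq> S} \<subseteq>
    insert {#} ((\<lambda>(g, M). add_mset g M) ` (S \<times> {M. size M \<le> r \<and> set_mset M \<subseteq> S}))"
  proof
    fix M assume "M \<in> {M. size M \<le> Suc r \<and> set_mset M \<subseteq> S}"
    then show "M \<in> insert {#} ((\<lambda>(g, M). add_mset g M) ` (S \<times> {M. size M \<le> r \<and> set_mset M \<subseteq> S}))"
      by (cases M) auto
  qed
  then show ?case using Suc by (auto intro: finite_subset)
qed

lemma finite_flds [simp]: "finite (flds B)"
  by (simp add: flds_def)

definition jetvars :: "('x, 'n::finite, 'y, 'q, 'k) setting \<Rightarrow> nat \<Rightarrow> (fld \<times> 'n multiset) set" where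
  "jetvars B r = flds B \<times> {L. size L \<le> r}"

lemma finite_msets_le [simp]: "finite {L :: 'a::finite multiset. size L \<le> r}"
  using finite_bounded_msets[of "UNIV :: 'a set" r] by simp

lemma finite_jetvars [simp]: "finite (jetvars B r)"
  by (simp add: jetvars_def)

lemma finite_mons_upto [simp]: "finite (mons_upto B r)"
proof -
  have "{g. gen_ok B r g} \<subseteq> range DX \<union> (\<lambda>(A, L). Sg A L) ` jetvars B r \<union> (\<lambda>(A, L). DS A L) ` jetvars B r"
  proof
    fix g assume "g \<in> {g. gen_ok B r g}"
    then show "g \<in> range DX \<union> (\<lambda>(A, L). Sg A L) ` jetvars B r \<union> (\<lambda>(A, L). DS A L) ` jetvars B r"
      by (cases g) (auto simp: jetvars_def)
  qed
  then have "finite {g. gen_ok B r g}" by (rule finite_subset) simp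
  from finite_bounded_msets[OF this, of r] show ?thesis
    by (rule rev_finite_subset) (auto simp: mons_upto_def)
qed

lemma mons_upto_add: "M \<in> mons_upto B r \<Longrightarrow> N \<in> mons_upto B s \<Longrightarrow> reduced (M + N) \<Longrightarrow> M + N \<in> mons_upto B (r + s)"
  by (auto simp: mons_upto_def intro: gen_ok_mono)

lemma svars_subset_jetvars: "kys a \<subseteq> mons_upto B r \<Longrightarrow> svars a \<subseteq> jetvars B r"
  by (force simp: svars_def mons_upto_def jetvars_def)

lemma mons_upto_redu: "kys a \<subseteq> mons_upto B r \<Longrightarrow> redu a"
  by (auto simp: mons_upto_def redu_def)

section \<open>Germs of forms: finitely many smooth coefficients\<close>

section \<open>Germs of local forms\<close>

lemma lookup_gmul:
  assumes "finite S" "kys a \<subseteq> S" "finite T" "kys b \<subseteq> T"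
  shows "lkp (a \<cdot> b) K = (\<Sum>M\<in>S. \<Sum>N\<in>T. (if reduced (M + N) \<and> M + N = K then tw M N else 0) * (lkp a M * lkp b N))"
proof -
  have "a \<cdot> b = (\<Sum>M\<in>S. \<Sum>N\<in>T. mon M (lkp a M) \<cdot> mon N (lkp b N))"
    using salg_expand[OF assms(1,2)] salg_expand[OF assms(3,4)]
    by (metis (no_types, lifting) gmul_sum_left gmul_sum_right sum.cong)
  then show ?thesis
    by (auto simp: lookup_sum gmul_mon lookup_single when_def intro!: sum.cong)
qed

lemma lookup_gconst: "lkp (gconst r) M = (if M = {#} then r else 0)"
  by (auto simp: gconst_def lookup_single when_def)

lemma lookup_gvar: "lkp (gvar g) M = (if M = {#g#} then 1 else 0)"
  by (auto simp: gvar_def lookup_single when_def)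

context manifold
begin

text \<open>The bound is imposed on a neighbourhood and not just at \<open>p\<close>: coefficients
  are to be differentiated, and this takes a finite set of monomials that serves all nearby
  points.\<close>

definition germ_form :: "'x \<Rightarrow> ('x \<Rightarrow> 'n salg) \<Rightarrow> bool" where
  "germ_form p f \<longleftrightarrow> (\<exists>r. \<forall>\<^sub>F q in nhds p. kys (f q) \<subseteq> mons_upto B r) \<and> (\<forall>M. sm p (\<lambda>q. lkp (f q) M))"

lemma germ_formE:
  assumes "germ_form p f" obtains r where "\<forall>\<^sub>F q in nhds p. kys (f q) \<subseteq> mons_upto B r" "\<And>M. sm p (\<lambda>q. lkp (f q) M)"
  using assms unfolding germ_form_def by blast

lemma germ_formE2:
  assumes "germ_form p f" "germ_form p g"
  obtains r where "\<forall>\<^sub>F q in nhds p. kys (f q) \<subseteq> mons_upto B r" "\<forall>\<^sub>F q in nhds p. kys (g q) \<subseteq> mons_upto B r"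
proof -
  obtain r s where "\<forall>\<^sub>F q in nhds p. kys (f q) \<subseteq> mons_upto B r" "\<forall>\<^sub>F q in nhds p. kys (g q) \<subseteq> mons_upto B s"
    using assms unfolding germ_form_def by blast
  moreover have "mons_upto B r \<subseteq> mons_upto B (max r s)" "mons_upto B s \<subseteq> mons_upto B (max r s)" by (auto intro: mons_upto_mono[THEN subsetD, rotated])
  ultimately show thesis
    by (intro that[of "max r s"]) (erule eventually_mono, blast)+
qed

lemma germ_form_redu: "germ_form p f \<Longrightarrow> redu (f p)"
  by (elim germ_formE) (auto dest!: eventually_nhds_x_imp_x intro: mons_upto_redu)

lemma germ_form_redu_eventually: "germ_form p f \<Longrightarrow> \<forall>\<^sub>F q in nhds p. redu (f q)"
  by (elim germ_formE) (auto elim!: eventually_mono intro: mons_upto_redu)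

lemma germ_form_cong:
  assumes "germ_form p f" "\<forall>\<^sub>F q in nhds p. f q = g q"
  shows "germ_form p g"
proof -
  obtain r where r: "\<forall>\<^sub>F q in nhds p. kys (f q) \<subseteq> mons_upto B r" "\<And>M. sm p (\<lambda>q. lkp (f q) M)"
    using assms(1) unfolding germ_form_def by blast
  have "\<forall>\<^sub>F q in nhds p. kys (g q) \<subseteq> mons_upto B r"
    using r(1) assms(2) by eventually_elim simp
  moreover have "sm p (\<lambda>q. lkp (g q) M)" for M
    by (rule sm_cong[OF r(2)[of M]]) (use assms(2) in \<open>auto elim: eventually_mono\<close>)
  ultimately show ?thesis unfolding germ_form_def by blast
qed

lemma germ_form_eventually:
  assumes "germ_form p f"
  shows "\<forall>\<^sub>F q in nhds p. germ_form q f"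
proof -
  obtain r where r: "\<forall>\<^sub>F q in nhds p. kys (f q) \<subseteq> mons_upto B r" "\<And>M. sm p (\<lambda>q. lkp (f q) M)"
    using assms unfolding germ_form_def by blast
  \<comment> \<open>Nonzero coefficients belong to the finitely many monomials of the bound, so
    finitely many neighbourhoods are intersected.\<close>
  have "\<forall>\<^sub>F q in nhds p. \<forall>M\<in>mons_upto B r. sm q (\<lambda>q. lkp (f q) M)"
    by (rule eventually_ball_finite) (auto intro: sm_eventually r)
  moreover have "\<forall>\<^sub>F q in nhds p. \<forall>\<^sub>F q' in nhds q. kys (f q') \<subseteq> mons_upto B r"
    using r(1) by (simp add: eventually_eventually)
  ultimately show ?thesis
  proof eventually_elim
    case (elim q)
    have "sm q (\<lambda>q. lkp (f q) M)" if "M \<notin> mons_upto B r" for M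
      by (rule sm_cong[OF sm_const[of q 0]])
        (use elim(2) that in \<open>auto simp: in_keys_iff elim!: eventually_mono\<close>)
    with elim show ?case unfolding germ_form_def by blast
  qed
qed

lemma germ_form_gconst:
  assumes "sm p a"
  shows "germ_form p (\<lambda>q. gconst (a q))"
  unfolding germ_form_def
proof
  show "\<exists>r. \<forall>\<^sub>F q in nhds p. kys (gconst (a q)) \<subseteq> mons_upto B r"
    by (rule exI[of _ 0]) (auto simp: gconst_def mons_upto_def)
  have "sm p (\<lambda>q. lkp (gconst (a q)) M)" for M
    using assms by (cases "M = {#}") (auto simp: lookup_gconst)
  then show "\<forall>M. sm p (\<lambda>q. lkp (gconst (a q)) M)" by blast
qed

definition valid_gen :: "'n gen \<Rightarrow> bool" where "valid_gen g \<longleftrightarrow> (\<exists>r. gen_ok B r g)"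

lemma valid_gen_simps [simp]: "valid_gen (Sg A L) \<longleftrightarrow> A \<in> flds B" "valid_gen (DS A L) \<longleftrightarrow> A \<in> flds B" "valid_gen (DX l)"
  by (auto simp: valid_gen_def)

lemma germ_form_gvar: "valid_gen g \<Longrightarrow> germ_form p (\<lambda>q. gvar g)"
  unfolding germ_form_def
proof
  assume "valid_gen g"
  then obtain r where "gen_ok B r g" by (auto simp: valid_gen_def)
  \<comment> \<open>The bound limits the polynomial degree as well, and a single generator has
    degree 1.\<close>
  then have "gen_ok B (max 1 r) g" by (auto intro: gen_ok_mono)
  then show "\<exists>r. \<forall>\<^sub>F q in nhds p. kys (gvar g) \<subseteq> mons_upto B r"
    by (intro exI[of _ "max 1 r"]) (auto simp: gvar_def mons_upto_def)
qed (simp add: lookup_gvar)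

lemma germ_form_add:
  assumes "germ_form p f" "germ_form p g"
  shows "germ_form p (\<lambda>q. f q + g q)"
proof -
  obtain r where r: "\<forall>\<^sub>F q in nhds p. kys (f q) \<subseteq> mons_upto B r" "\<forall>\<^sub>F q in nhds p. kys (g q) \<subseteq> mons_upto B r"
    using germ_formE2[OF assms] .
  have "\<forall>\<^sub>F q in nhds p. kys (f q + g q) \<subseteq> mons_upto B r"
    using r by eventually_elim (auto elim!: keys_addE)
  moreover have "sm p (\<lambda>q. lkp (f q + g q) M)" for M
    unfolding lookup_add using assms by (intro sm_add) (auto simp: germ_form_def)
  ultimately show ?thesis unfolding germ_form_def by blast
qed

lemma germ_form_zero [simp]: "germ_form p (\<lambda>q. 0)"
  by (simp add: germ_form_def)

lemma germ_form_sum: "(\<And>i. i \<in> I \<Longrightarrow> germ_form p (f i)) \<Longrightarrow> germ_form p (\<lambda>q. \<Sum>i\<in>I. f i q)"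
  by (induction I rule: infinite_finite_induct) (auto intro: germ_form_add)

lemma germ_form_gmul:
  assumes "germ_form p f" "germ_form p g"
  shows "germ_form p (\<lambda>q. f q \<cdot> g q)"
proof -
  obtain r where r: "\<forall>\<^sub>F q in nhds p. kys (f q) \<subseteq> mons_upto B r" "\<forall>\<^sub>F q in nhds p. kys (g q) \<subseteq> mons_upto B r"
    using germ_formE2[OF assms] .
  have "\<forall>\<^sub>F q in nhds p. kys (f q \<cdot> g q) \<subseteq> mons_upto B (r + r)"
    using r by eventually_elim (auto elim!: keys_gmulE intro!: mons_upto_add)
  moreover have "sm p (\<lambda>q. lkp (f q \<cdot> g q) K)" for K
  proof (rule sm_cong)
    show "sm p (\<lambda>q. \<Sum>M\<in>mons_upto B r. \<Sum>N\<in>mons_upto B r. (if reduced (M + N) \<and> M + N = K then tw M N else 0) * (lkp (f q) M * lkp (g q) N))"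
      using assms by (intro sm_sum sm_mult sm_const) (auto simp: germ_form_def)
    show "\<forall>\<^sub>F q in nhds p. (\<Sum>M\<in>mons_upto B r. \<Sum>N\<in>mons_upto B r. (if reduced (M + N) \<and> M + N = K then tw M N else 0) *
       (lkp (f q) M * lkp (g q) N)) = lkp (f q \<cdot> g q) K"
      using r by eventually_elim (intro lookup_gmul[symmetric], auto)
  qed
  ultimately show ?thesis unfolding germ_form_def by blast
qed

lemma germ_form_gconst_gmul: "sm p a \<Longrightarrow> germ_form p f \<Longrightarrow> germ_form p (\<lambda>q. gconst (a q) \<cdot> f q)"
  by (intro germ_form_gmul germ_form_gconst)

lemma germ_form_uminus: "germ_form p f \<Longrightarrow> germ_form p (\<lambda>q. - f q)"
  by (rule germ_form_cong[OF germ_form_gconst_gmul[of p "\<lambda>_. - 1" f]])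
     (auto dest!: germ_form_redu_eventually elim!: eventually_mono)

lemma germ_form_diff: "germ_form p f \<Longrightarrow> germ_form p g \<Longrightarrow> germ_form p (\<lambda>q. f q - g q)"
  using germ_form_add[OF _ germ_form_uminus, of p f g] by simp

lemma germ_form_pds:
  assumes "germ_form p f"
  shows "germ_form p (\<lambda>q. pds A L (f q))"
proof -
  obtain r where r: "\<forall>\<^sub>F q in nhds p. kys (f q) \<subseteq> mons_upto B r" "\<And>M. sm p (\<lambda>q. lkp (f q) M)"
    using assms unfolding germ_form_def by blast
  have "\<forall>\<^sub>F q in nhds p. kys (pds A L (f q)) \<subseteq> mons_upto B r"
    using r(1)
  proof eventually_elim
    case (elim q)
    then show ?case using keys_pds reduced_add_msetD by (fastforce simp: mons_upto_def)
  qed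
  moreover have "sm p (\<lambda>q. lkp (pds A L (f q)) M)" for M
    unfolding lookup_pds using r(2) by (intro sm_mult) auto
  ultimately show ?thesis unfolding germ_form_def by blast
qed

text \<open>The predicate receives the form degree because the Leibniz rule for \<open>d\<close>
  takes its sign from it. A germ is split into monomials of degree \<open>d\<close>, and each of
  them is built from its coefficient by multiplying generators from the left.\<close>

lemma germ_form_induct [consumes 2, case_names const gvar add zero cong]:
  assumes "germ_form p f" "\<forall>\<^sub>F q in nhds p. \<forall>M\<in>kys (f q). mdeg M = d"
    and const: "\<And>a. sm p a \<Longrightarrow> P 0 (\<lambda>q. gconst (a q))"
    and gvar: "\<And>g d f. valid_gen g \<Longrightarrow> germ_form p f \<Longrightarrow> \<forall>\<^sub>F q in nhds p. \<forall>M\<in>kys (f q). mdeg M = d \<Longrightarrow> P d f \<Longrightarrow>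
      P (gdeg g + d) (\<lambda>q. gvar g \<cdot> f q)"
    and add: "\<And>d f f'. germ_form p f \<Longrightarrow> germ_form p f' \<Longrightarrow> P d f \<Longrightarrow> P d f' \<Longrightarrow> P d (\<lambda>q. f q + f' q)"
    and zero: "\<And>d. P d (\<lambda>q. 0)"
    and cong: "\<And>d f f'. germ_form p f \<Longrightarrow> P d f \<Longrightarrow> \<forall>\<^sub>F q in nhds p. f q = f' q \<Longrightarrow> P d f'"
  shows "P d f"
proof -
  have m: "germ_form p (\<lambda>q. mon M (a q)) \<and> P (mdeg M) (\<lambda>q. mon M (a q))"
    if "reduced M" "\<forall>g\<in>#M. valid_gen g" "sm p a" for M a
    using that
  proof (induction M arbitrary: a)
    case empty
    then show ?case by (simp add: mon_empty const germ_form_gconst)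
  next
    case (add g M)
    let ?a = "\<lambda>q. tw {#g#} M * a q"
    have "reduced M" using add.prems reduced_add_msetD by blast
    moreover have "sm p ?a" by (intro sm_mult sm_const add.prems)
    ultimately have IH: "germ_form p (\<lambda>q. mon M (?a q))" "P (mdeg M) (\<lambda>q. mon M (?a q))"
      using add.IH[of ?a] add.prems by auto
    have "\<forall>\<^sub>F q in nhds p. \<forall>N\<in>kys (mon M (?a q)). mdeg N = mdeg M" by simp
    from gvar[OF _ IH(1) this IH(2)] germ_form_gmul[OF germ_form_gvar IH(1)] show ?case
      using add.prems by (simp add: mon_add_mset)
  qed
  obtain r where r: "\<forall>\<^sub>F q in nhds p. kys (f q) \<subseteq> mons_upto B r" "\<And>M. sm p (\<lambda>q. lkp (f q) M)"
    using assms(1) unfolding germ_form_def by blast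
  have s: "germ_form p (\<lambda>q. \<Sum>M\<in>S. mon M (lkp (f q) M)) \<and> P d (\<lambda>q. \<Sum>M\<in>S. mon M (lkp (f q) M))"
    if "S \<subseteq> mons_upto B r \<inter> {M. mdeg M = d}" for S
    using finite_subset[OF that] that
  proof (induction S rule: infinite_finite_induct)
    case (insert M S)
    then have "germ_form p (\<lambda>q. mon M (lkp (f q) M))" "P d (\<lambda>q. mon M (lkp (f q) M))"
      using m[of M "\<lambda>q. lkp (f q) M"] r(2) by (auto simp: mons_upto_def valid_gen_def)
    then show ?case using insert by (auto intro!: add germ_form_add)
  qed (auto intro: zero)
  let ?S = "mons_upto B r \<inter> {M. mdeg M = d}"
  have "\<forall>\<^sub>F q in nhds p. (\<Sum>M\<in>?S. mon M (lkp (f q) M)) = f q"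
    using r(1) assms(2) by eventually_elim (intro salg_expand[symmetric], auto)
  then show ?thesis using s[of ?S] cong by blast
qed

subsection \<open>Derivatives of the coefficients\<close>

text \<open>\<open>Abs_poly_mapping\<close> is meaningful only for finite support, which the common
  monomial bound near \<open>p\<close> supplies.\<close>

lemma lookup_pdx:
  assumes "k \<in> charts B" "p \<in> cdom B k" "germ_form p f"
  shows "lkp (pdx B k l f p) M = pd B k l (\<lambda>q. lkp (f q) M) p"
proof -
  obtain r where r: "\<forall>\<^sub>F q in nhds p. kys (f q) \<subseteq> mons_upto B r" using assms(3) unfolding germ_form_def by blast
  have "pd B k l (\<lambda>q. lkp (f q) M) p = 0" if "M \<notin> mons_upto B r" for M
  proof -
    have "\<forall>\<^sub>F q in nhds p. lkp (f q) M = 0"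
      using r that by (auto elim!: eventually_mono simp: in_keys_iff)
    from pd_cong[OF assms(1,2) this] show ?thesis by simp
  qed
  then have "{M. pd B k l (\<lambda>q. lkp (f q) M) p \<noteq> 0} \<subseteq> mons_upto B r" by blast
  then show ?thesis unfolding pdx_def by (simp add: finite_subset[OF _ finite_mons_upto])
qed

lemma keys_pdx:
  assumes "k \<in> charts B" "p \<in> cdom B k" "germ_form p f" "\<forall>\<^sub>F q in nhds p. \<forall>M\<in>kys (f q). Q M" "M \<in> kys (pdx B k l f p)"
  shows "Q M"
proof (rule ccontr)
  assume "\<not> Q M"
  then have "\<forall>\<^sub>F q in nhds p. lkp (f q) M = 0"
    using assms(4) by (auto elim!: eventually_mono simp: in_keys_iff)
  from pd_cong[OF assms(1,2) this] have "pd B k l (\<lambda>q. lkp (f q) M) p = 0" by simp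
  then show False using assms(5) by (simp add: in_keys_iff lookup_pdx[OF assms(1-3)])
qed

lemma pdx_cong:
  assumes "k \<in> charts B" "p \<in> cdom B k" "\<forall>\<^sub>F q in nhds p. f q = g q"
  shows "pdx B k l f p = pdx B k l g p"
proof -
  have "pd B k l (\<lambda>q. lkp (f q) M) p = pd B k l (\<lambda>q. lkp (g q) M) p" for M
    by (rule pd_cong[OF assms(1,2)]) (use assms(3) in \<open>auto elim: eventually_mono\<close>)
  then show ?thesis by (simp add: pdx_def)
qed

lemma germ_form_pdx:
  assumes "k \<in> charts B" "p \<in> cdom B k" "germ_form p f"
  shows "germ_form p (pdx B k l f)"
proof -
  obtain r where r: "\<forall>\<^sub>F q in nhds p. kys (f q) \<subseteq> mons_upto B r" "\<And>M. sm p (\<lambda>q. lkp (f q) M)"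
    using assms(3) unfolding germ_form_def by blast
  have "\<forall>\<^sub>F q in nhds p. \<forall>\<^sub>F q' in nhds q. kys (f q') \<subseteq> mons_upto B r"
    using r(1) by (simp add: eventually_eventually)
  then have "\<forall>\<^sub>F q in nhds p. kys (pdx B k l f q) \<subseteq> mons_upto B r"
    using germ_form_eventually[OF assms(3)] eventually_cdom[OF assms(1,2)]
  proof eventually_elim
    case (elim q)
    have "\<forall>\<^sub>F q' in nhds q. \<forall>M\<in>kys (f q'). M \<in> mons_upto B r"
      using elim(1) by (rule eventually_mono) blast
    from keys_pdx[OF assms(1) elim(3,2) this] show ?case by blast
  qed
  moreover have "sm p (\<lambda>q. lkp (pdx B k l f q) M)" for M
  proof (rule sm_cong)
    show "sm p (pd B k l (\<lambda>q. lkp (f q) M))" by (intro sm_pd assms r)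
    show "\<forall>\<^sub>F q in nhds p. pd B k l (\<lambda>q. lkp (f q) M) q = lkp (pdx B k l f q) M"
      using germ_form_eventually[OF assms(3)] eventually_cdom[OF assms(1,2)]
      by eventually_elim (simp add: lookup_pdx assms(1))
  qed
  ultimately show ?thesis unfolding germ_form_def by blast
qed

lemma germ_form_lookup: "germ_form p f \<Longrightarrow> sm p (\<lambda>q. lkp (f q) M)"
  by (simp add: germ_form_def)

lemma pdx_add:
  assumes "k \<in> charts B" "p \<in> cdom B k" "germ_form p f" "germ_form p g"
  shows "pdx B k l (\<lambda>q. f q + g q) p = pdx B k l f p + pdx B k l g p"
  by (rule poly_mapping_eqI)
    (simp add: lookup_pdx assms germ_form_add lookup_add pd_add germ_form_lookup)

lemma pdx_gconst:
  assumes "k \<in> charts B" "p \<in> cdom B k" "sm p a"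
  shows "pdx B k l (\<lambda>q. gconst (a q)) p = gconst (pd B k l a p)"
  by (rule poly_mapping_eqI)
    (simp add: lookup_pdx assms germ_form_gconst lookup_gconst)

lemma pdx_const [simp]: "pdx B k l (\<lambda>q. c) p = 0"
  by (simp add: pdx_def)

lemma pdx_gconst_gmul:
  assumes "k \<in> charts B" "p \<in> cdom B k" "sm p a" "germ_form p f"
  shows "pdx B k l (\<lambda>q. gconst (a q) \<cdot> f q) p = gconst (pd B k l a p) \<cdot> f p + gconst (a p) \<cdot> pdx B k l f p"
  by (rule poly_mapping_eqI)
    (simp add: lookup_pdx assms germ_form_gconst_gmul lookup_gconst_gmul lookup_add pd_mult germ_form_lookup)

lemma pdx_gvar_gmul:
  assumes "k \<in> charts B" "p \<in> cdom B k" "valid_gen g" "germ_form p f"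
  shows "pdx B k l (\<lambda>q. gvar g \<cdot> f q) p = gvar g \<cdot> pdx B k l f p"
proof (rule poly_mapping_eqI)
  fix M
  show "lkp (pdx B k l (\<lambda>q. gvar g \<cdot> f q) p) M = lkp (gvar g \<cdot> pdx B k l f p) M"
    by (cases "g \<in># M \<and> reduced M")
      (auto simp: lookup_pdx assms germ_form_gvar germ_form_gmul lookup_gvar_gmul pd_cmult germ_form_lookup)
qed

text \<open>The variables occurring in \<open>f q\<close> change with \<open>q\<close>; all
  variables up to a fixed order form an index set that does not.\<close>

lemma germ_form_der:
  assumes "germ_form p f" "\<And>A L. A \<in> flds B \<Longrightarrow> germ_form p (\<lambda>q. h A L)"
  shows "germ_form p (\<lambda>q. der h (f q))"
proof -
  obtain r where r: "\<forall>\<^sub>F q in nhds p. kys (f q) \<subseteq> mons_upto B r" using assms(1) unfolding germ_form_def by blast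
  have "germ_form p (\<lambda>q. \<Sum>s\<in>jetvars B r. h (fst s) (snd s) \<cdot> pds (fst s) (snd s) (f q))"
    using assms by (intro germ_form_sum germ_form_gmul germ_form_pds) (auto simp: jetvars_def)
  then show ?thesis
  proof (rule germ_form_cong)
    show "\<forall>\<^sub>F q in nhds p. (\<Sum>s\<in>jetvars B r. h (fst s) (snd s) \<cdot> pds (fst s) (snd s) (f q)) = der h (f q)"
      using r
    proof eventually_elim
      case (elim q)
      show ?case
        using der_superset[OF finite_jetvars svars_subset_jetvars[OF elim], of h] by (simp add: split_def)
    qed
  qed
qed

end

section \<open>Leibniz rules, commuting total derivatives and d d = 0\<close>

section \<open>Total derivatives and the exterior differential\<close>

lemma salg_eq_uminus:
  fixes a :: "'n salg"
  assumes "a = - a" shows "a = 0"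
proof (rule poly_mapping_eqI)
  fix M
  have "lkp a M = - lkp a M" using assms by (metis lookup_uminus)
  then show "lkp a M = lkp 0 M" by simp
qed

lemma gvar_commute: "gvar g \<cdot> gvar h = gconst (csgn g h) \<cdot> (gvar h \<cdot> gvar g)"
  using gmul_commute[OF homog_gvar homog_gvar, of g h] by (simp add: csgn_eq)

definition tot_gen :: "'n \<Rightarrow> 'n gen \<Rightarrow> ('n::finite) salg" where
  "tot_gen l g = (case g of Sg A L \<Rightarrow> gvar (Sg A (add_mset l L)) | _ \<Rightarrow> 0)"

definition ext_gen :: "'n gen \<Rightarrow> ('n::finite) salg" where
  "ext_gen g = (case g of Sg A L \<Rightarrow> gvar (DS A L) | _ \<Rightarrow> 0)"

lemma tot_gen_simps [simp]: "tot_gen l (Sg A L) = gvar (Sg A (add_mset l L))" "tot_gen l (DX m) = 0" "tot_gen l (DS A L) = 0"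
  by (auto simp: tot_gen_def)

lemma ext_gen_simps [simp]: "ext_gen (Sg A L) = gvar (DS A L)" "ext_gen (DX m) = 0" "ext_gen (DS A L) = 0"
  by (auto simp: ext_gen_def)

abbreviation der_tot :: "'n::finite \<Rightarrow> 'n salg \<Rightarrow> 'n salg" where
  "der_tot l \<equiv> der (\<lambda>A L. gvar (Sg A (add_mset l L)))"

abbreviation der_ext :: "('n::finite) salg \<Rightarrow> 'n salg" where
  "der_ext \<equiv> der (\<lambda>A L. gvar (DS A L))"

lemma der_tot_gvar_gmul: "redu b \<Longrightarrow> der_tot l (gvar g \<cdot> b) = tot_gen l g \<cdot> b + gvar g \<cdot> der_tot l b"
proof -
  assume b: "redu b"
  have "gvar (Sg A (add_mset l L)) \<cdot> gvar g = gconst (1 * csgn g (Sg A L)) \<cdot> (gvar g \<cdot> gvar (Sg A (add_mset l L)))" for A L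
    using gvar_commute[of "Sg A (add_mset l L)" g] by (simp add: csgn_eq mult.commute)
  from der_gvar_gmul[OF b _ this] show ?thesis by (simp add: der_gvar tot_gen_def)
qed

text \<open>\<open>DS A L\<close> has the parity of \<open>Sg A L\<close> but form degree 1, so it
  passes \<open>g\<close> with an extra sign given by the degree of \<open>g\<close>. For the total
  derivative the bidegree is unchanged and the extra sign is 1.\<close>

lemma der_ext_gvar_gmul:
  "redu b \<Longrightarrow> der_ext (gvar g \<cdot> b) = ext_gen g \<cdot> b + gconst ((- 1) ^ gdeg g) \<cdot> (gvar g \<cdot> der_ext b)"
proof -
  assume b: "redu b"
  have "gvar (DS A L) \<cdot> gvar g = gconst ((- 1) ^ gdeg g * csgn g (Sg A L)) \<cdot> (gvar g \<cdot> gvar (DS A L))" for A L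
    using gvar_commute[of "DS A L" g] by (simp add: csgn_eq mult.commute power_add)
  from der_gvar_gmul[OF b _ this] show ?thesis by (simp add: der_gvar ext_gen_def)
qed

context manifold
begin

lemma totd_eq: "totd B k l f p = pdx B k l f p + der_tot l (f p)"
  by (simp add: totd_def der_def)

lemma ldiff_eq: "ldiff B k f p = (\<Sum>l\<in>UNIV. gvar (DX l) \<cdot> pdx B k l f p) + der_ext (f p)"
  by (simp add: ldiff_def der_def)

lemma totd_cong:
  "k \<in> charts B \<Longrightarrow> p \<in> cdom B k \<Longrightarrow> \<forall>\<^sub>F q in nhds p. f q = g q \<Longrightarrow> totd B k l f p = totd B k l g p"
  using eventually_nhds_x_imp_x[of "\<lambda>q. f q = g q" p] by (simp add: totd_eq pdx_cong[of k p f g])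

lemma ldiff_cong:
  "k \<in> charts B \<Longrightarrow> p \<in> cdom B k \<Longrightarrow> \<forall>\<^sub>F q in nhds p. f q = g q \<Longrightarrow> ldiff B k f p = ldiff B k g p"
  using eventually_nhds_x_imp_x[of "\<lambda>q. f q = g q" p] by (simp add: ldiff_eq pdx_cong[of k p f g])

lemma totd_eventually_cong:
  assumes "k \<in> charts B" "p \<in> cdom B k" "\<forall>\<^sub>F q in nhds p. f q = g q"
  shows "\<forall>\<^sub>F q in nhds p. totd B k l f q = totd B k l g q"
proof -
  have "\<forall>\<^sub>F q in nhds p. \<forall>\<^sub>F q' in nhds q. f q' = g q'" using assms(3) by (simp add: eventually_eventually)
  then show ?thesis using eventually_cdom[OF assms(1,2)] by eventually_elim (rule totd_cong[OF assms(1)])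
qed

lemma ldiff_eventually_cong:
  assumes "k \<in> charts B" "p \<in> cdom B k" "\<forall>\<^sub>F q in nhds p. f q = g q"
  shows "\<forall>\<^sub>F q in nhds p. ldiff B k f q = ldiff B k g q"
proof -
  have "\<forall>\<^sub>F q in nhds p. \<forall>\<^sub>F q' in nhds q. f q' = g q'" using assms(3) by (simp add: eventually_eventually)
  then show ?thesis using eventually_cdom[OF assms(1,2)] by eventually_elim (rule ldiff_cong[OF assms(1)])
qed

lemma germ_form_totd:
  assumes "k \<in> charts B" "p \<in> cdom B k" "germ_form p f"
  shows "germ_form p (totd B k l f)"
  unfolding totd_eq[abs_def] using assms by (intro germ_form_add germ_form_pdx germ_form_der germ_form_gvar) auto

lemma germ_form_ldiff:
  assumes "k \<in> charts B" "p \<in> cdom B k" "germ_form p f"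
  shows "germ_form p (ldiff B k f)"
  unfolding ldiff_eq[abs_def] using assms by (intro germ_form_add germ_form_sum germ_form_gmul germ_form_pdx germ_form_der germ_form_gvar) auto

lemma keys_der:
  assumes "M \<in> kys (der h a)" "redu a"
  obtains A L N K where "add_mset (Sg A L) N \<in> kys a" "K \<in> kys (h A L)" "M = K + N"
proof -
  obtain s where "s \<in> svars a" "M \<in> kys (h (fst s) (snd s) \<cdot> pds (fst s) (snd s) a)"
    using assms(1) unfolding der_def by (elim keys_sumE) (auto simp: split_def)
  then show thesis using that by (elim keys_gmulE) (auto dest: keys_pds)
qed

lemma keys_gvar: "M \<in> kys (gvar g) \<longleftrightarrow> M = {#g#}"
  by (simp add: gvar_def)

text \<open>The free predicate \<open>Q\<close> lets one statement serve for form degree, jet order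
  and the kind of generators.\<close>

lemma keys_totd:
  assumes "k \<in> charts B" "p \<in> cdom B k" "germ_form p f" "\<forall>\<^sub>F q in nhds p. \<forall>M\<in>kys (f q). Q M" "M \<in> kys (totd B k l f p)"
  shows "Q M \<or> (\<exists>A L N. add_mset (Sg A L) N \<in> kys (f p) \<and> Q (add_mset (Sg A L) N) \<and> M = add_mset (Sg A (add_mset l L)) N)"
proof -
  have Q: "\<forall>M\<in>kys (f p). Q M" using assms(4) eventually_nhds_x_imp_x by fastforce
  from assms(5) show ?thesis
    unfolding totd_eq
  proof (cases rule: keys_addE)
    case 1
    then show ?thesis using keys_pdx[OF assms(1-4)] by blast
  next
    case 2
    then show ?thesis
      using Q germ_form_redu[OF assms(3)] by (elim keys_der) (auto simp: keys_gvar)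
  qed
qed

lemma keys_ldiff:
  assumes "k \<in> charts B" "p \<in> cdom B k" "germ_form p f" "\<forall>\<^sub>F q in nhds p. \<forall>M\<in>kys (f q). Q M" "M \<in> kys (ldiff B k f p)"
  shows "(\<exists>l N. Q N \<and> M = add_mset (DX l) N) \<or>
    (\<exists>A L N. add_mset (Sg A L) N \<in> kys (f p) \<and> Q (add_mset (Sg A L) N) \<and> M = add_mset (DS A L) N)"
proof -
  have Q: "\<forall>M\<in>kys (f p). Q M" using assms(4) eventually_nhds_x_imp_x by fastforce
  from assms(5) show ?thesis
    unfolding ldiff_eq
  proof (cases rule: keys_addE)
    case 1
    then obtain l where "M \<in> kys (gvar (DX l) \<cdot> pdx B k l f p)" by (elim keys_sumE)
    then show ?thesis using keys_pdx[OF assms(1-4)] by (elim keys_gmulE) (auto simp: keys_gvar)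
  next
    case 2
    then obtain A L N where "add_mset (Sg A L) N \<in> kys (f p)" "M = add_mset (DS A L) N"
      using germ_form_redu[OF assms(3)] by (elim keys_der) (auto simp: keys_gvar)
    then show ?thesis using Q by blast
  qed
qed

lemma totd_add:
  assumes "k \<in> charts B" "p \<in> cdom B k" "germ_form p f" "germ_form p g"
  shows "totd B k l (\<lambda>q. f q + g q) p = totd B k l f p + totd B k l g p"
  by (simp add: totd_eq pdx_add assms der_add)

lemma ldiff_add:
  assumes "k \<in> charts B" "p \<in> cdom B k" "germ_form p f" "germ_form p g"
  shows "ldiff B k (\<lambda>q. f q + g q) p = ldiff B k f p + ldiff B k g p"
  by (simp add: ldiff_eq pdx_add assms der_add gmul_add_right sum.distrib)

lemma totd_zero [simp]: "totd B k l (\<lambda>q. 0) p = 0"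
  by (simp add: totd_eq)

lemma ldiff_zero [simp]: "ldiff B k (\<lambda>q. 0) p = 0"
  by (simp add: ldiff_eq)

lemma totd_sum:
  assumes "k \<in> charts B" "p \<in> cdom B k" "\<And>i. i \<in> I \<Longrightarrow> germ_form p (f i)"
  shows "totd B k l (\<lambda>q. \<Sum>i\<in>I. f i q) p = (\<Sum>i\<in>I. totd B k l (f i) p)"
  using assms(3) by (induction I rule: infinite_finite_induct) (auto simp: totd_add[OF assms(1,2)] germ_form_sum)

lemma ldiff_sum:
  assumes "k \<in> charts B" "p \<in> cdom B k" "\<And>i. i \<in> I \<Longrightarrow> germ_form p (f i)"
  shows "ldiff B k (\<lambda>q. \<Sum>i\<in>I. f i q) p = (\<Sum>i\<in>I. ldiff B k (f i) p)"
  using assms(3) by (induction I rule: infinite_finite_induct) (auto simp: ldiff_add[OF assms(1,2)] germ_form_sum)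

lemma totd_gconst:
  assumes "k \<in> charts B" "p \<in> cdom B k" "sm p a"
  shows "totd B k l (\<lambda>q. gconst (a q)) p = gconst (pd B k l a p)"
  by (simp add: totd_eq pdx_gconst assms)

lemma ldiff_gconst:
  assumes "k \<in> charts B" "p \<in> cdom B k" "sm p a"
  shows "ldiff B k (\<lambda>q. gconst (a q)) p = (\<Sum>l\<in>UNIV. gvar (DX l) \<cdot> gconst (pd B k l a p))"
  by (simp add: ldiff_eq pdx_gconst assms)

lemma totd_gconst_gmul:
  assumes "k \<in> charts B" "p \<in> cdom B k" "sm p a" "germ_form p f"
  shows "totd B k l (\<lambda>q. gconst (a q) \<cdot> f q) p = gconst (pd B k l a p) \<cdot> f p + gconst (a p) \<cdot> totd B k l f p"
  by (simp add: totd_eq pdx_gconst_gmul assms der_gconst_gmul germ_form_redu gmul_add_right)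

lemma ldiff_gconst_gmul:
  assumes "k \<in> charts B" "p \<in> cdom B k" "sm p a" "germ_form p f"
  shows "ldiff B k (\<lambda>q. gconst (a q) \<cdot> f q) p = ldiff B k (\<lambda>q. gconst (a q)) p \<cdot> f p + gconst (a p) \<cdot> ldiff B k f p"
  by (simp add: ldiff_gconst assms)
     (simp add: ldiff_eq pdx_gconst_gmul assms der_gconst_gmul germ_form_redu gmul_add_right sum.distrib
       gmul_sum_right gmul_sum_left gmul_assoc gmul_gconst_left_commute[of "gvar _"])

lemma totd_gvar_gmul:
  assumes "k \<in> charts B" "p \<in> cdom B k" "valid_gen g" "germ_form p f"
  shows "totd B k l (\<lambda>q. gvar g \<cdot> f q) p = tot_gen l g \<cdot> f p + gvar g \<cdot> totd B k l f p"
  by (simp add: totd_eq pdx_gvar_gmul assms der_tot_gvar_gmul germ_form_redu gmul_add_right)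

lemma ldiff_gvar_gmul:
  assumes "k \<in> charts B" "p \<in> cdom B k" "valid_gen g" "germ_form p f"
  shows "ldiff B k (\<lambda>q. gvar g \<cdot> f q) p = ext_gen g \<cdot> f p + gconst ((- 1) ^ gdeg g) \<cdot> (gvar g \<cdot> ldiff B k f p)"
proof -
  have c: "csgn (DX l) g = (- 1) ^ gdeg g" for l by (simp add: csgn_eq)
  have "gvar (DX l) \<cdot> (gvar g \<cdot> a) = gconst ((- 1) ^ gdeg g) \<cdot> (gvar g \<cdot> (gvar (DX l) \<cdot> a))" for l a
    using gvar_commute[of "DX l" g] unfolding c by (metis gmul_assoc)
  then show ?thesis
    by (simp add: ldiff_eq pdx_gvar_gmul assms der_ext_gvar_gmul germ_form_redu gmul_add_right gmul_sum_right)
qed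

lemma totd_gvar:
  assumes "k \<in> charts B" "p \<in> cdom B k" "valid_gen g"
  shows "totd B k l (\<lambda>q. gvar g) p = tot_gen l g"
  by (simp add: totd_eq der_gvar tot_gen_def)

lemma ldiff_gvar:
  assumes "k \<in> charts B" "p \<in> cdom B k" "valid_gen g"
  shows "ldiff B k (\<lambda>q. gvar g) p = ext_gen g"
  by (simp add: ldiff_eq der_gvar ext_gen_def)

lemma totd_gmul:
  assumes kp: "k \<in> charts B" "p \<in> cdom B k" and f: "germ_form p f" "\<forall>\<^sub>F q in nhds p. \<forall>M\<in>kys (f q). mdeg M = d"
    and g: "germ_form p g"
  shows "totd B k l (\<lambda>q. f q \<cdot> g q) p = totd B k l f p \<cdot> g p + f p \<cdot> totd B k l g p"
  using f
proof (induction rule: germ_form_induct)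
  case (const a)
  then show ?case by (simp add: totd_gconst_gmul totd_gconst kp g)
next
  case (gvar h d f)
  then show ?case
    by (simp add: gmul_assoc totd_gvar_gmul kp germ_form_gmul g gmul_add_left gmul_add_right)
next
  case (add d f f')
  then show ?case by (simp add: gmul_add_left totd_add germ_form_gmul g kp)
next
  case (zero d)
  then show ?case by simp
next
  case (cong d f f')
  then have "\<forall>\<^sub>F q in nhds p. f q \<cdot> g q = f' q \<cdot> g q" "f p = f' p"
    by (auto elim!: eventually_mono dest: eventually_nhds_x_imp_x)
  then show ?case using cong totd_cong[OF kp cong(2)] totd_cong[OF kp, of "\<lambda>q. f q \<cdot> g q" "\<lambda>q. f' q \<cdot> g q"] by simp
qed

lemma ldiff_gmul:
  assumes kp: "k \<in> charts B" "p \<in> cdom B k" and f: "germ_form p f" "\<forall>\<^sub>F q in nhds p. \<forall>M\<in>kys (f q). mdeg M = d"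
    and g: "germ_form p g"
  shows "ldiff B k (\<lambda>q. f q \<cdot> g q) p = ldiff B k f p \<cdot> g p + gconst ((- 1) ^ d) \<cdot> (f p \<cdot> ldiff B k g p)"
  using f
proof (induction rule: germ_form_induct)
  case (const a)
  then show ?case by (simp add: ldiff_gconst_gmul kp g)
next
  case (gvar h d f)
  then show ?case
    by (simp add: gmul_assoc ldiff_gvar_gmul kp germ_form_gmul g gmul_add_left gmul_add_right power_add
      gmul_gconst_left_commute[of "gvar _"] gconst_gconst_gmul)
next
  case (add d f f')
  then show ?case by (simp add: gmul_add_left gmul_add_right ldiff_add germ_form_gmul g kp)
next
  case (zero d)
  then show ?case by simp
next
  case (cong d f f')
  then have "\<forall>\<^sub>F q in nhds p. f q \<cdot> g q = f' q \<cdot> g q" "f p = f' p"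
    by (auto elim!: eventually_mono dest: eventually_nhds_x_imp_x)
  then show ?case using cong ldiff_cong[OF kp cong(2)] ldiff_cong[OF kp, of "\<lambda>q. f q \<cdot> g q" "\<lambda>q. f' q \<cdot> g q"] by simp
qed

lemma eventually_germ_form_cdom:
  "k \<in> charts B \<Longrightarrow> p \<in> cdom B k \<Longrightarrow> germ_form p f \<Longrightarrow> \<forall>\<^sub>F q in nhds p. q \<in> cdom B k \<and> germ_form q f"
  using eventually_cdom germ_form_eventually eventually_conj by blast

text \<open>On coefficients this is the symmetry of second derivatives, on jet coordinates the
  symmetry of multi-indices.\<close>

lemma totd_commute:
  assumes kp: "k \<in> charts B" "p \<in> cdom B k" and f: "germ_form p f" "\<forall>\<^sub>F q in nhds p. \<forall>M\<in>kys (f q). mdeg M = d"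
  shows "totd B k l (totd B k m f) p = totd B k m (totd B k l f) p"
  using f
proof (induction rule: germ_form_induct)
  case (const a)
  have e: "\<forall>\<^sub>F q in nhds p. totd B k l (\<lambda>q. gconst (a q)) q = gconst (pd B k l a q)" for l
    using sm_eventually[OF const] eventually_cdom[OF kp] by eventually_elim (simp add: totd_gconst kp)
  show ?case
    unfolding totd_cong[OF kp e] using const by (simp add: totd_gconst sm_pd kp pd_commute)
next
  case (gvar g d f)
  have e: "\<forall>\<^sub>F q in nhds p. totd B k l (\<lambda>q. gvar g \<cdot> f q) q = tot_gen l g \<cdot> f q + gvar g \<cdot> totd B k l f q" for l
    using eventually_germ_form_cdom[OF kp gvar(2)] by eventually_elim (simp add: totd_gvar_gmul kp gvar)
  show ?case
    unfolding totd_cong[OF kp e] using gvar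
    by (cases g) (auto simp: totd_add totd_gvar_gmul kp germ_form_gmul germ_form_gvar germ_form_totd add_mset_commute)
next
  case (add d f f')
  have e: "\<forall>\<^sub>F q in nhds p. totd B k l (\<lambda>q. f q + f' q) q = totd B k l f q + totd B k l f' q" for l
    using eventually_germ_form_cdom[OF kp add(1)] eventually_germ_form_cdom[OF kp add(2)]
    by eventually_elim (simp add: totd_add kp)
  show ?case
    unfolding totd_cong[OF kp e] using add by (simp add: totd_add kp germ_form_totd)
next
  case (zero d)
  then show ?case by simp
next
  case (cong d f f')
  then show ?case
    using totd_cong[OF kp totd_eventually_cong[OF kp cong(2)]] by metis
qed

text \<open>For coefficients, anticommuting \<open>dx\<close> meet symmetric second derivatives. For
  a jet coordinate times \<open>f\<close>, the two terms \<open>ds\<close> times \<open>df\<close>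
  produced by the Leibniz rule have opposite signs.\<close>

lemma ldiff_ldiff:
  assumes kp: "k \<in> charts B" "p \<in> cdom B k" and f: "germ_form p f" "\<forall>\<^sub>F q in nhds p. \<forall>M\<in>kys (f q). mdeg M = 0"
  shows "ldiff B k (ldiff B k f) p = 0"
proof -
  \<comment> \<open>The induction runs over forms of all degrees; the premise \<open>d = 0\<close>
    discards the generators of positive degree.\<close>
  have "d = 0 \<longrightarrow> ldiff B k (ldiff B k f) p = 0"
    if "germ_form p f" "\<forall>\<^sub>F q in nhds p. \<forall>M\<in>kys (f q). mdeg M = d" for d f
    using that
  proof (induction rule: germ_form_induct)
    case (const a)
    have e: "\<forall>\<^sub>F q in nhds p. ldiff B k (\<lambda>q. gconst (a q)) q = (\<Sum>l\<in>UNIV. gvar (DX l) \<cdot> gconst (pd B k l a q))"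
      using sm_eventually[OF const] eventually_cdom[OF kp] by eventually_elim (simp add: ldiff_gconst kp)
    define T where "T l m = gvar (DX l) \<cdot> (gvar (DX m) \<cdot> gconst (pd B k m (pd B k l a) p))" for l m
    have "gvar (DX l) \<cdot> (gvar (DX m) \<cdot> c) = - (gvar (DX m) \<cdot> (gvar (DX l) \<cdot> c))" for l m c
      using gvar_commute[of "DX l" "DX m"]
      by (simp add: csgn_eq gmul_assoc[symmetric] gmul_uminus_left)
    then have anti: "T l m = - T m l" for l m
      unfolding T_def using pd_commute[OF kp const] by metis
    have "(\<Sum>l\<in>UNIV. \<Sum>m\<in>UNIV. T l m) = (\<Sum>l\<in>UNIV. \<Sum>m\<in>UNIV. - T m l)"
      by (rule sum.cong[OF refl], rule sum.cong[OF refl], rule anti)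
    also have "\<dots> = - (\<Sum>l\<in>UNIV. \<Sum>m\<in>UNIV. T m l)"
      by (simp only: sum_negf)
    also have "(\<Sum>l\<in>UNIV. \<Sum>m\<in>UNIV. T m l) = (\<Sum>l\<in>UNIV. \<Sum>m\<in>UNIV. T l m)"
      by (rule sum.swap)
    finally have "(\<Sum>l\<in>UNIV. \<Sum>m\<in>UNIV. T l m) = 0" by (rule salg_eq_uminus)
    then show ?case
      unfolding ldiff_cong[OF kp e] T_def using const kp
      by (simp add: ldiff_sum germ_form_gmul germ_form_gvar germ_form_gconst sm_pd ldiff_gvar_gmul ldiff_gconst gmul_sum_right sum_negf)
  next
    case (gvar g d f)
    have e: "\<forall>\<^sub>F q in nhds p. ldiff B k (\<lambda>q. gvar g \<cdot> f q) q = ext_gen g \<cdot> f q + gconst ((- 1) ^ gdeg g) \<cdot> (gvar g \<cdot> ldiff B k f q)"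
      using eventually_germ_form_cdom[OF kp gvar(2)] by eventually_elim (simp add: ldiff_gvar_gmul kp gvar)
    show ?case
    proof
      assume "gdeg g + d = 0"
      then obtain A L where g: "g = Sg A L" "d = 0" by (cases g) auto
      then show "ldiff B k (ldiff B k (\<lambda>q. gvar g \<cdot> f q)) p = 0"
        unfolding ldiff_cong[OF kp e] using gvar
        by (simp add: ldiff_add ldiff_gvar_gmul kp germ_form_gmul germ_form_gvar germ_form_ldiff)
    qed
  next
    case (add d f f')
    have e: "\<forall>\<^sub>F q in nhds p. ldiff B k (\<lambda>q. f q + f' q) q = ldiff B k f q + ldiff B k f' q"
      using eventually_germ_form_cdom[OF kp add(1)] eventually_germ_form_cdom[OF kp add(2)]
      by eventually_elim (simp add: ldiff_add kp)
    show ?case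
      unfolding ldiff_cong[OF kp e] using add by (simp add: ldiff_add kp germ_form_ldiff)
  next
    case (zero d)
    then show ?case by (simp add: ldiff_eq pdx_def)
  next
    case (cong d f f')
    then show ?case
      using ldiff_cong[OF kp ldiff_eventually_cong[OF kp cong(2)]] by metis
  qed
  then show ?thesis using f by blast
qed

section \<open>The total derivatives of another chart\<close>

subsection \<open>Prolongation\<close>

lemma germ_form_prolong:
  assumes "j \<in> charts B" "k \<in> charts B" "p \<in> cdom B j" "p \<in> cdom B k" "germ_form p f"
  shows "germ_form p (prolong B j k l f)"
  unfolding prolong_def[abs_def] using assms
  by (intro germ_form_sum germ_form_gconst_gmul germ_form_totd sm_pd sm_crd) auto

lemma prolong_cong:
  "j \<in> charts B \<Longrightarrow> p \<in> cdom B j \<Longrightarrow> \<forall>\<^sub>F q in nhds p. f q = g q \<Longrightarrow> prolong B j k l f p = prolong B j k l g p"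
  by (simp add: prolong_def totd_cong[of j p f g])

lemma prolong_add:
  assumes "j \<in> charts B" "p \<in> cdom B j" "germ_form p f" "germ_form p g"
  shows "prolong B j k l (\<lambda>q. f q + g q) p = prolong B j k l f p + prolong B j k l g p"
  by (simp add: prolong_def totd_add assms gmul_add_right sum.distrib)

lemma prolong_gconst:
  assumes "j \<in> charts B" "k \<in> charts B" "p \<in> cdom B j" "p \<in> cdom B k" "sm p a"
  shows "prolong B j k l (\<lambda>q. gconst (a q)) p = gconst (pd B k l a p)"
  using pd_chain[OF assms(2,1,4,3,5), of l]
  by (simp add: prolong_def totd_gconst assms gconst_gconst gconst_sum)

lemma prolong_gmul:
  assumes "j \<in> charts B" "p \<in> cdom B j" "germ_form p f" "\<forall>\<^sub>F q in nhds p. \<forall>M\<in>kys (f q). mdeg M = d" "germ_form p g"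
  shows "prolong B j k l (\<lambda>q. f q \<cdot> g q) p = prolong B j k l f p \<cdot> g p + f p \<cdot> prolong B j k l g p"
  by (simp add: prolong_def totd_gmul[OF assms] gmul_add_right sum.distrib gmul_sum_left gmul_sum_right
      gmul_assoc gmul_gconst_left_commute[of "f p"])

text \<open>The second-order terms are symmetric because total derivatives commute. By the chain
  rule the first-order coefficients are second derivatives of the coordinates of chart
  \<open>j\<close> with respect to those of chart \<open>k\<close>, hence symmetric too.\<close>

lemma prolong_commute:
  assumes j: "j \<in> charts B" "p \<in> cdom B j" and k: "k \<in> charts B" "p \<in> cdom B k"
    and f: "germ_form p f" "\<forall>\<^sub>F q in nhds p. \<forall>M\<in>kys (f q). mdeg M = d"
  shows "prolong B j k l (prolong B j k m f) p = prolong B j k m (prolong B j k l f) p"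
proof -
  define a where "a l \<mu> = pd B k l (\<lambda>q. crd B j q $ \<mu>)" for l \<mu>
  have sa: "sm p (a l \<mu>)" for l \<mu>
    unfolding a_def by (intro sm_pd sm_crd j k)
  have pr: "prolong B j k l f = (\<lambda>q. \<Sum>\<nu>\<in>UNIV. gconst (a l \<nu> q) \<cdot> totd B j \<nu> f q)" for l f
    by (simp add: fun_eq_iff prolong_def a_def)
  have ch: "(\<Sum>\<mu>\<in>UNIV. a l \<mu> p * pd B j \<mu> (a m \<nu>) p) = pd B k l (a m \<nu>) p" for l m \<nu>
    using pd_chain[OF k(1) j(1) k(2) j(2) sa, of l m \<nu>] by (simp add: a_def)
  have "prolong B j k l (prolong B j k m f) p =
     (\<Sum>\<nu>\<in>UNIV. gconst (pd B k l (a m \<nu>) p) \<cdot> totd B j \<nu> f p) +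
     (\<Sum>\<mu>\<in>UNIV. \<Sum>\<nu>\<in>UNIV. gconst (a l \<mu> p * a m \<nu> p) \<cdot> totd B j \<mu> (totd B j \<nu> f) p)" for l m
  proof -
    have "totd B j \<mu> (\<lambda>q. \<Sum>\<nu>\<in>UNIV. gconst (a m \<nu> q) \<cdot> totd B j \<nu> f q) p =
       (\<Sum>\<nu>\<in>UNIV. gconst (pd B j \<mu> (a m \<nu>) p) \<cdot> totd B j \<nu> f p + gconst (a m \<nu> p) \<cdot> totd B j \<mu> (totd B j \<nu> f) p)" for \<mu>
      using j f sa by (simp add: totd_sum totd_gconst_gmul germ_form_totd germ_form_gconst_gmul)
    then have "prolong B j k l (prolong B j k m f) p =
       (\<Sum>\<mu>\<in>UNIV. \<Sum>\<nu>\<in>UNIV. gconst (a l \<mu> p * pd B j \<mu> (a m \<nu>) p) \<cdot> totd B j \<nu> f p) +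
       (\<Sum>\<mu>\<in>UNIV. \<Sum>\<nu>\<in>UNIV. gconst (a l \<mu> p * a m \<nu> p) \<cdot> totd B j \<mu> (totd B j \<nu> f) p)"
      unfolding pr by (simp add: gmul_sum_right gmul_add_right sum.distrib gconst_gconst_gmul)
    also have "(\<Sum>\<mu>\<in>UNIV. \<Sum>\<nu>\<in>UNIV. gconst (a l \<mu> p * pd B j \<mu> (a m \<nu>) p) \<cdot> totd B j \<nu> f p) =
       (\<Sum>\<nu>\<in>UNIV. gconst (\<Sum>\<mu>\<in>UNIV. a l \<mu> p * pd B j \<mu> (a m \<nu>) p) \<cdot> totd B j \<nu> f p)"
      unfolding gconst_sum gmul_sum_left by (rule sum.swap)
    finally show ?thesis unfolding ch .
  qed
  moreover have "pd B k l (a m \<nu>) p = pd B k m (a l \<nu>) p" for \<nu>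
    unfolding a_def by (intro pd_commute k sm_crd j)
  moreover have "(\<Sum>\<mu>\<in>UNIV. \<Sum>\<nu>\<in>UNIV. gconst (a l \<mu> p * a m \<nu> p) \<cdot> totd B j \<mu> (totd B j \<nu> f) p) =
     (\<Sum>\<mu>\<in>UNIV. \<Sum>\<nu>\<in>UNIV. gconst (a m \<mu> p * a l \<nu> p) \<cdot> totd B j \<mu> (totd B j \<nu> f) p)"
    by (subst sum.swap) (simp add: totd_commute[OF j f] mult.commute)
  ultimately show ?thesis by simp
qed

lemma prolong_self:
  assumes "k \<in> charts B" "p \<in> cdom B k" "germ_form p f"
  shows "prolong B k k l f p = totd B k l f p"
proof -
  have "prolong B k k l f p = (\<Sum>m\<in>UNIV. if l = m then totd B k m f p else 0)"
    unfolding prolong_def pd_crd[OF assms(1,2)]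
    by (intro sum.cong) (auto simp: germ_form_redu germ_form_totd assms)
  then show ?thesis by simp
qed

end

section \<open>Transition functions of the bundles, of jets and of forms\<close>

section \<open>Coordinate changes\<close>

context manifold
begin

lemma germ_form_induct_inhom [consumes 1, case_names const gvar add zero cong]:
  assumes "germ_form p f"
    and const: "\<And>a. sm p a \<Longrightarrow> P (\<lambda>q. gconst (a q))"
    and gvar: "\<And>g f. valid_gen g \<Longrightarrow> germ_form p f \<Longrightarrow> P f \<Longrightarrow> P (\<lambda>q. gvar g \<cdot> f q)"
    and add: "\<And>f f'. germ_form p f \<Longrightarrow> germ_form p f' \<Longrightarrow> P f \<Longrightarrow> P f' \<Longrightarrow> P (\<lambda>q. f q + f' q)"
    and zero: "P (\<lambda>q. 0)"
    and cong: "\<And>f f'. germ_form p f \<Longrightarrow> P f \<Longrightarrow> \<forall>\<^sub>F q in nhds p. f q = f' q \<Longrightarrow> P f'"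
  shows "P f"
proof -
  obtain r where r: "\<forall>\<^sub>F q in nhds p. kys (f q) \<subseteq> mons_upto B r" "\<And>M. sm p (\<lambda>q. lkp (f q) M)"
    using assms(1) unfolding germ_form_def by blast
  have m: "germ_form p (\<lambda>q. mon M (lkp (f q) M)) \<and> P (\<lambda>q. mon M (lkp (f q) M))" if "M \<in> mons_upto B r" for M
  proof -
    have "sm p (\<lambda>q. lkp (mon M (lkp (f q) M)) N)" for N
      by (cases "M = N") (auto simp: lookup_single when_def r(2))
    then have g: "germ_form p (\<lambda>q. mon M (lkp (f q) M))"
      unfolding germ_form_def using that by (intro conjI exI[of _ r] always_eventually) (auto simp: germ_form_def)
    have "\<forall>\<^sub>F q in nhds p. \<forall>N\<in>kys (mon M (lkp (f q) M)). mdeg N = mdeg M" by simp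
    from g this have "P (\<lambda>q. mon M (lkp (f q) M))"
      by (induction rule: germ_form_induct) (use assms(2-) in auto)
    with g show ?thesis by blast
  qed
  have s: "germ_form p (\<lambda>q. \<Sum>M\<in>S. mon M (lkp (f q) M)) \<and> P (\<lambda>q. \<Sum>M\<in>S. mon M (lkp (f q) M))"
    if "S \<subseteq> mons_upto B r" for S
    using finite_subset[OF that] that
    by (induction S rule: infinite_finite_induct) (use m in \<open>auto intro!: zero add germ_form_add\<close>)
  have "\<forall>\<^sub>F q in nhds p. (\<Sum>M\<in>mons_upto B r. mon M (lkp (f q) M)) = f q"
    using r(1) by eventually_elim (intro salg_expand[symmetric], auto)
  then show ?thesis using s[of "mons_upto B r"] cong by blast
qed

lemma vector_bundle_imp_affine_bundle:
  assumes "vector_bundle B E" shows "affine_bundle B E"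
  unfolding affine_bundle_def
proof (intro conjI ballI)
  show "fibrewise_bij B E" using assms by (simp add: vector_bundle_def)
  fix j k assume jk: "j \<in> charts B" "k \<in> charts B"
  from assms[unfolded vector_bundle_def, THEN conjunct2, THEN bspec, OF jk(1), THEN bspec, OF jk(2)]
  obtain \<rho> where "(\<forall>a<frank E. \<forall>c<frank E. smooth_in B j (cdom B j \<inter> cdom B k) (\<rho> a c)) \<and>
        (\<forall>e. proj E e \<in> cdom B j \<inter> cdom B k \<longrightarrow> (\<forall>a<frank E.
           fco E k e a = (\<Sum>c<frank E. \<rho> a c (proj E e) * fco E j e c)))"
    by blast
  moreover have "smooth_in B j (cdom B j \<inter> cdom B k) (\<lambda>_. 0)"
    using jk by (subst smooth_in_iff) auto
  ultimately show "\<exists>\<rho> b. (\<forall>a<frank E. \<forall>c<frank E. smooth_in B j (cdom B j \<inter> cdom B k) (\<rho> a c)) \<and>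
      (\<forall>a<frank E. smooth_in B j (cdom B j \<inter> cdom B k) (b a)) \<and>
      (\<forall>e. proj E e \<in> cdom B j \<inter> cdom B k \<longrightarrow> (\<forall>a<frank E.
           fco E k e a = b a (proj E e) + (\<Sum>c<frank E. \<rho> a c (proj E e) * fco E j e c)))"
    by (intro exI[of _ \<rho>] exI[of _ "\<lambda>_ _. 0"]) auto
qed

lemma fib_point:
  assumes "affine_bundle B E" "j \<in> charts B" "p \<in> cdom B j" "\<forall>a\<ge>frank E. v a = 0"
  shows "proj E (fib_point E j p v) = p" "fco E j (fib_point E j p v) = v"
proof -
  have bij: "bij_betw (fco E j) {e. proj E e = p} {v. \<forall>a\<ge>frank E. v a = 0}"
    using assms unfolding affine_bundle_def fibrewise_bij_def by blast
  have "v \<in> fco E j ` {e. proj E e = p}"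
    using bij assms(4) unfolding bij_betw_def by simp
  then obtain e where e: "proj E e = p" "fco E j e = v" by auto
  have u: "e' = e" if "proj E e' = p \<and> fco E j e' = v" for e'
    using bij that \<open>proj E e = p\<close> \<open>fco E j e = v\<close> unfolding bij_betw_def inj_on_def by auto
  have "fib_point E j p v = e"
    unfolding fib_point_def using e by (intro the_equality u) auto
  with \<open>proj E e = p\<close> \<open>fco E j e = v\<close> show "proj E (fib_point E j p v) = p" "fco E j (fib_point E j p v) = v" by auto
qed

text \<open>The bundle axioms provide transition functions only existentially; evaluation at the
  zero and unit vectors identifies them with \<open>trans0\<close> and \<open>trans1\<close>, which
  thereby inherit smoothness.\<close>

lemma affine_transition:
  assumes E: "affine_bundle B E" and jk: "j \<in> charts B" "k \<in> charts B" and a: "a < frank E"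
  shows "\<And>e. proj E e \<in> cdom B j \<inter> cdom B k \<Longrightarrow>
      fco E k e a = trans0 E j k a (proj E e) + (\<Sum>c<frank E. trans1 E j k a c (proj E e) * fco E j e c)"
    and "\<And>p. p \<in> cdom B j \<inter> cdom B k \<Longrightarrow> sm p (trans0 E j k a)"
    and "\<And>p c. p \<in> cdom B j \<inter> cdom B k \<Longrightarrow> c < frank E \<Longrightarrow> sm p (trans1 E j k a c)"
proof -
  let ?W = "cdom B j \<inter> cdom B k"
  from E[unfolded affine_bundle_def, THEN conjunct2, THEN bspec, OF jk(1), THEN bspec, OF jk(2)]
  obtain \<rho> b where \<rho>: "\<forall>a<frank E. \<forall>c<frank E. smooth_in B j ?W (\<rho> a c)" and b: "\<forall>a<frank E. smooth_in B j ?W (b a)"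
    and t': "\<forall>e. proj E e \<in> ?W \<longrightarrow> (\<forall>a<frank E. fco E k e a = b a (proj E e) + (\<Sum>c<frank E. \<rho> a c (proj E e) * fco E j e c))"
    by (elim exE conjE)
  have sm: "\<And>c. c < frank E \<Longrightarrow> smooth_in B j ?W (\<rho> a c)" "smooth_in B j ?W (b a)"
    using \<rho> b a by auto
  have t: "fco E k e a = b a (proj E e) + (\<Sum>c<frank E. \<rho> a c (proj E e) * fco E j e c)" if "proj E e \<in> ?W" for e
    using t' a that by simp
  have 0: "trans0 E j k a p = b a p" if "p \<in> ?W" for p
    using t[of "fib_point E j p (\<lambda>_. 0)"] fib_point[OF E jk(1), of p "\<lambda>_. 0"] that
    by (simp add: trans0_def)
  have 1: "trans1 E j k a c p = \<rho> a c p" if "p \<in> ?W" "c < frank E" for p c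
    using t[of "fib_point E j p (\<lambda>i. if i = c then 1 else 0)"]
      fib_point[OF E jk(1), of p "\<lambda>i. if i = c then 1 else 0"] that
    by (simp add: trans1_def 0 if_distrib[of "(*) _"] cong: if_cong)
  show "fco E k e a = trans0 E j k a (proj E e) + (\<Sum>c<frank E. trans1 E j k a c (proj E e) * fco E j e c)"
    if "proj E e \<in> ?W" for e
    using t[OF that] 0[OF that] 1[OF that] by simp
  have o: "\<forall>\<^sub>F q in nhds p. q \<in> ?W" if "p \<in> ?W" for p
    using that jk by (intro eventually_nhds_in_open) auto
  show "sm p (trans0 E j k a)" if "p \<in> ?W" for p
  proof (rule sm_cong)
    show "sm p (b a)" using sm(2) that jk by (subst (asm) smooth_in_iff) auto
    show "\<forall>\<^sub>F q in nhds p. b a q = trans0 E j k a q"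
      using o[OF that] by eventually_elim (simp add: 0)
  qed
  show "sm p (trans1 E j k a c)" if "p \<in> ?W" "c < frank E" for p c
  proof (rule sm_cong)
    show "sm p (\<rho> a c)" using sm(1)[OF that(2)] that jk by (subst (asm) smooth_in_iff) auto
    show "\<forall>\<^sub>F q in nhds p. \<rho> a c q = trans1 E j k a c q"
      using o[OF that(1)] by eventually_elim (simp add: 1 that)
  qed
qed

text \<open>The transition from \<open>j\<close> to \<open>k\<close> is applied to the points whose
  coordinates in \<open>i\<close> are zero or a unit vector.\<close>

lemma trans_cocycle:
  assumes E: "affine_bundle B E" and ch: "i \<in> charts B" "j \<in> charts B" "k \<in> charts B"
    and p: "p \<in> cdom B i" "p \<in> cdom B j" "p \<in> cdom B k" and a: "a < frank E"
  shows "trans0 E i k a p = trans0 E j k a p + (\<Sum>c<frank E. trans1 E j k a c p * trans0 E i j c p)"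
    and "d < frank E \<Longrightarrow> trans1 E i k a d p = (\<Sum>c<frank E. trans1 E j k a c p * trans1 E i j c d p)"
proof -
  note t = affine_transition(1)[OF E ch(2,3) a]
  let ?e0 = "fib_point E i p (\<lambda>_. 0)"
  have 0: "proj E ?e0 = p" using fib_point[OF E ch(1) p(1)] by simp
  from t[of ?e0] 0 p
  show e: "trans0 E i k a p = trans0 E j k a p + (\<Sum>c<frank E. trans1 E j k a c p * trans0 E i j c p)"
    by (simp add: trans0_def)
  assume d: "d < frank E"
  let ?e = "fib_point E i p (\<lambda>i. if i = d then 1 else 0)"
  have 1: "proj E ?e = p" using fib_point[OF E ch(1) p(1)] d by simp
  have "trans1 E i k a d p + trans0 E i k a p = fco E k ?e a" by (simp add: trans1_def)
  also have "\<dots> = trans0 E j k a p + (\<Sum>c<frank E. trans1 E j k a c p * (trans1 E i j c d p + trans0 E i j c p))"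
    using t[of ?e] 1 p by (simp add: trans1_def)
  finally show "trans1 E i k a d p = (\<Sum>c<frank E. trans1 E j k a c p * trans1 E i j c d p)"
    using e by (simp add: algebra_simps sum.distrib)
qed

lemma trans_self:
  assumes E: "affine_bundle B E" and k: "k \<in> charts B" "p \<in> cdom B k"
  shows "trans0 E k k a p = 0" "c < frank E \<Longrightarrow> trans1 E k k a c p = (if a = c then 1 else 0)"
proof -
  show 0: "trans0 E k k a p = 0"
    using fib_point(2)[OF E k, of "\<lambda>_. 0"] by (simp add: trans0_def)
  assume "c < frank E"
  then show "trans1 E k k a c p = (if a = c then 1 else 0)"
    using fib_point(2)[OF E k, of "\<lambda>i. if i = c then 1 else 0"] by (simp add: trans1_def 0)
qed

lemma vector_trans0:
  assumes "vector_bundle B E" "j \<in> charts B" "k \<in> charts B" "p \<in> cdom B j" "p \<in> cdom B k" "a < frank E"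
  shows "trans0 E j k a p = 0"
proof -
  note E = vector_bundle_imp_affine_bundle[OF assms(1)]
  from assms(1)[unfolded vector_bundle_def, THEN conjunct2, THEN bspec, OF assms(2), THEN bspec, OF assms(3)]
  obtain \<rho> where "\<forall>e. proj E e \<in> cdom B j \<inter> cdom B k \<longrightarrow> (\<forall>a<frank E.
           fco E k e a = (\<Sum>c<frank E. \<rho> a c (proj E e) * fco E j e c))"
    by (elim exE conjE)
  from this[rule_format, of "fib_point E j p (\<lambda>_. 0)" a] show ?thesis
    using fib_point[OF E assms(2,4), of "\<lambda>_. 0"] assms by (simp add: trans0_def)
qed

text \<open>One formula for both bundles, with \<open>C\<close> either \<open>Ev\<close> or
  \<open>Od\<close>; for the vector bundle the constant term is 0.\<close>

definition aff_trans :: "('x, 'e, 'k) fbundle \<Rightarrow> (nat \<Rightarrow> fld) \<Rightarrow> 'k \<Rightarrow> 'k \<Rightarrow> nat \<Rightarrow> 'x \<Rightarrow> 'n salg" where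
  "aff_trans E C j k a p = gconst (trans0 E j k a p) +
     (\<Sum>c<frank E. gconst (trans1 E j k a c p) \<cdot> gvar (Sg (C c) {#}))"

lemma germ_form_aff_trans:
  assumes "affine_bundle B E" "j \<in> charts B" "k \<in> charts B" "p \<in> cdom B j \<inter> cdom B k" "a < frank E"
    "\<And>c. c < frank E \<Longrightarrow> C c \<in> flds B"
  shows "germ_form p (aff_trans E C j k a)"
  unfolding aff_trans_def[abs_def]
  using affine_transition(2,3)[OF assms(1,2,3,5,4)] assms(6)
  by (intro germ_form_add germ_form_gconst germ_form_sum germ_form_gconst_gmul germ_form_gvar) auto

lemma subst_aff_trans:
  assumes "graded_subst \<sigma>" "\<And>c. c < frank E \<Longrightarrow> \<sigma> (Sg (C c) {#}) = aff_trans E C i j c p"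
    and E: "affine_bundle B E" and ch: "i \<in> charts B" "j \<in> charts B" "k \<in> charts B"
    and p: "p \<in> cdom B i" "p \<in> cdom B j" "p \<in> cdom B k" and a: "a < frank E"
  shows "subst_alg \<sigma> (aff_trans E C j k a p) = aff_trans E C i k a p"
proof -
  have "subst_alg \<sigma> (aff_trans E C j k a p) = gconst (trans0 E j k a p) +
      (\<Sum>c<frank E. gconst (trans1 E j k a c p) \<cdot> aff_trans E C i j c p)"
    by (simp add: aff_trans_def subst_alg_add subst_alg_sum subst_alg_gconst_gmul subst_alg_gvar[OF assms(1)] assms(2))
  also have "(\<Sum>c<frank E. gconst (trans1 E j k a c p) \<cdot> aff_trans E C i j c p) =
      (\<Sum>c<frank E. gconst (trans1 E j k a c p * trans0 E i j c p)) +
      (\<Sum>c<frank E. \<Sum>d<frank E. gconst (trans1 E j k a c p * trans1 E i j c d p) \<cdot> gvar (Sg (C d) {#}))"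
    by (simp add: aff_trans_def gmul_add_right gmul_sum_right sum.distrib gconst_gconst gconst_gconst_gmul)
  also have "(\<Sum>c<frank E. \<Sum>d<frank E. gconst (trans1 E j k a c p * trans1 E i j c d p) \<cdot> gvar (Sg (C d) {#})) =
      (\<Sum>d<frank E. gconst (trans1 E i k a d p) \<cdot> gvar (Sg (C d) {#}))"
    by (subst sum.swap) (simp add: trans_cocycle(2)[OF E ch p a] gconst_sum gmul_sum_left)
  finally show ?thesis
    by (simp add: aff_trans_def[of E C i k] trans_cocycle(1)[OF E ch p a] gconst_add gconst_sum add.assoc)
qed

lemma aff_trans_self:
  assumes "affine_bundle B E" "k \<in> charts B" "p \<in> cdom B k" "a < frank E"
  shows "aff_trans E C k k a p = gvar (Sg (C a) {#})"
proof -
  have "aff_trans E C k k a p = (\<Sum>c<frank E. if c = a then gvar (Sg (C c) {#}) else 0)"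
    unfolding aff_trans_def trans_self(1)[OF assms(1-3)] gconst_0 add_0
    by (intro sum.cong) (auto simp: trans_self(2)[OF assms(1-3)])
  then show ?thesis using assms(4) by simp
qed

end

locale jet_setting = manifold B
  for B :: "('x::{t2_space,second_countable_topology}, 'n::finite, 'y, 'q, 'k) setting" +
  assumes affY: "affine_bundle B (bunY B)" and vecQ: "vector_bundle B (bunQ B)"
begin

lemma affQ: "affine_bundle B (bunQ B)"
  using vecQ by (rule vector_bundle_imp_affine_bundle)

definition overlap :: "'k \<Rightarrow> 'k \<Rightarrow> 'x \<Rightarrow> bool" where
  "overlap j k p \<longleftrightarrow> j \<in> charts B \<and> k \<in> charts B \<and> p \<in> cdom B j \<and> p \<in> cdom B k"

lemma overlap_eventually: "overlap j k p \<Longrightarrow> \<forall>\<^sub>F q in nhds p. overlap j k q"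
  unfolding overlap_def using eventually_conj[OF eventually_cdom[of j p] eventually_cdom[of k p]] by auto

lemma fld_trans_Ev: "fld_trans B j k (Ev i) = aff_trans (bunY B) Ev j k i"
  by (simp add: fun_eq_iff aff_trans_def)

lemma fld_trans_Od: "overlap j k p \<Longrightarrow> a < frank (bunQ B) \<Longrightarrow> fld_trans B j k (Od a) p = aff_trans (bunQ B) Od j k a p"
  by (simp add: aff_trans_def overlap_def vector_trans0[OF vecQ])

lemma flds_simps [simp]: "Ev i \<in> flds B \<longleftrightarrow> i < frank (bunY B)" "Od i \<in> flds B \<longleftrightarrow> i < frank (bunQ B)"
  by (auto simp: flds_def)

lemma germ_form_fld_trans: "A \<in> flds B \<Longrightarrow> overlap j k p \<Longrightarrow> germ_form p (fld_trans B j k A)"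
proof (cases A)
  case (Ev i)
  assume "A \<in> flds B" "overlap j k p"
  then show ?thesis unfolding Ev fld_trans_Ev by (intro germ_form_aff_trans affY) (auto simp: Ev overlap_def)
next
  case (Od a)
  assume *: "A \<in> flds B" "overlap j k p"
  show ?thesis
  proof (rule germ_form_cong)
    show "germ_form p (aff_trans (bunQ B) Od j k a)"
      using * by (intro germ_form_aff_trans affQ) (auto simp: Od overlap_def)
    show "\<forall>\<^sub>F q in nhds p. aff_trans (bunQ B) Od j k a q = fld_trans B j k A q"
      using overlap_eventually[OF *(2)] by eventually_elim (use *(1) Od fld_trans_Od in simp)
  qed
qed

text \<open>Indexed by lists, so that induction on the sequence of prolongations is possible;
  \<open>enum_of\<close> picks an unspecified list.\<close>

definition jet_coord :: "'n list \<Rightarrow> 'k \<Rightarrow> 'k \<Rightarrow> fld \<Rightarrow> 'x \<Rightarrow> 'n salg" where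
  "jet_coord ls j k A = foldr (prolong B j k) ls (fld_trans B j k A)"

lemma jet_coord_simps [simp]: "jet_coord [] j k A = fld_trans B j k A" "jet_coord (l # ls) j k A = prolong B j k l (jet_coord ls j k A)"
  by (auto simp: jet_coord_def)

lemma jet_trans_eq: "jet_trans B j k A L = jet_coord (enum_of L) j k A"
  by (simp add: jet_trans_def jet_coord_def)

lemma mset_enum_of [simp]: "mset (enum_of L) = L"
  unfolding enum_of_def using ex_mset by (rule someI_ex)

lemma germ_form_jet_coord: "A \<in> flds B \<Longrightarrow> overlap j k p \<Longrightarrow> germ_form p (jet_coord ls j k A)"
proof (induction ls)
  case (Cons l ls)
  then show ?case by (auto simp: overlap_def intro!: germ_form_prolong)
qed (simp add: germ_form_fld_trans)

text \<open>Coordinate changes are affine in the jet coordinates and do not raise the order. A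
  constant term can occur for even coordinates only, since \<open>Q\<close> has linear transition
  functions; an odd coordinate could not have one without losing its parity.\<close>

definition jet_mon :: "fld \<Rightarrow> nat \<Rightarrow> 'n gen multiset \<Rightarrow> bool" where
  "jet_mon A n M \<longleftrightarrow> (fpar A = 0 \<and> M = {#}) \<or>
     (\<exists>A' L. M = {#Sg A' L#} \<and> fpar A' = fpar A \<and> A' \<in> flds B \<and> size L \<le> n)"

lemma keys_gconst_gmulE: "M \<in> kys (gconst r \<cdot> a) \<Longrightarrow> M \<in> kys a"
  by (auto simp: in_keys_iff lookup_gconst_gmul split: if_splits)

lemma keys_gconst: "M \<in> kys (gconst r) \<Longrightarrow> M = {#}"
  by (auto simp: in_keys_iff lookup_gconst split: if_splits)

lemma jet_mon_jet_coord: "A \<in> flds B \<Longrightarrow> overlap j k p \<Longrightarrow> M \<in> kys (jet_coord ls j k A p) \<Longrightarrow> jet_mon A (length ls) M"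
proof (induction ls arbitrary: p M)
  case Nil
  then show ?case
    by (cases A) (auto simp: jet_mon_def keys_gvar elim!: keys_addE keys_sumE dest!: keys_gconst_gmulE keys_gconst)
next
  case (Cons l ls)
  have e: "\<forall>\<^sub>F q in nhds p. \<forall>M\<in>kys (jet_coord ls j k A q). jet_mon A (length ls) M"
    using overlap_eventually[OF Cons.prems(2)] by eventually_elim (use Cons in blast)
  from Cons.prems(3) obtain m where "M \<in> kys (totd B j m (jet_coord ls j k A) p)"
    by (auto simp: prolong_def elim!: keys_sumE dest!: keys_gconst_gmulE)
  from keys_totd[OF _ _ germ_form_jet_coord e this] Cons.prems show ?case
    by (auto simp: overlap_def jet_mon_def)
qed

lemma jet_mon_eventually: "A \<in> flds B \<Longrightarrow> overlap j k p \<Longrightarrow> \<forall>\<^sub>F q in nhds p. \<forall>M\<in>kys (jet_coord ls j k A q). jet_mon A (length ls) M"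
  by (rule eventually_mono[OF overlap_eventually]) (auto intro: jet_mon_jet_coord)

lemma jet_mon_mdeg: "jet_mon A n M \<Longrightarrow> mdeg M = 0"
  by (auto simp: jet_mon_def)

lemma jet_mon_mpar: "jet_mon A n M \<Longrightarrow> mpar M = fpar A"
  by (auto simp: jet_mon_def)

lemma jet_coord_mdeg: "A \<in> flds B \<Longrightarrow> overlap j k p \<Longrightarrow> \<forall>\<^sub>F q in nhds p. \<forall>M\<in>kys (jet_coord ls j k A q). mdeg M = 0"
  by (rule eventually_mono[OF jet_mon_eventually]) (auto dest: jet_mon_mdeg)

text \<open>Commuting prolongations let the entry \<open>x\<close> travel to the front; independence
  of the enumeration follows.\<close>

lemma jet_coord_remove1:
  "A \<in> flds B \<Longrightarrow> x \<in> set ls \<Longrightarrow> overlap j k p \<Longrightarrow> jet_coord ls j k A p = prolong B j k x (jet_coord (remove1 x ls) j k A) p"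
proof (induction ls arbitrary: p)
  case (Cons y ls)
  show ?case
  proof (cases "x = y")
    case False
    then have x: "x \<in> set ls" using Cons.prems by simp
    have "\<forall>\<^sub>F q in nhds p. jet_coord ls j k A q = prolong B j k x (jet_coord (remove1 x ls) j k A) q"
      using overlap_eventually[OF Cons.prems(3)] by eventually_elim (use Cons x in blast)
    then have "prolong B j k y (jet_coord ls j k A) p = prolong B j k y (prolong B j k x (jet_coord (remove1 x ls) j k A)) p"
      using Cons.prems(3) by (intro prolong_cong) (auto simp: overlap_def)
    also have "\<dots> = prolong B j k x (prolong B j k y (jet_coord (remove1 x ls) j k A)) p"
      using Cons.prems(3) germ_form_jet_coord[OF Cons.prems(1,3)] jet_coord_mdeg[OF Cons.prems(1,3)]
      by (intro prolong_commute[where d = 0]) (auto simp: overlap_def)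
    finally show ?thesis using False by simp
  qed simp
qed simp

lemma jet_coord_mset_cong:
  "A \<in> flds B \<Longrightarrow> mset ls = mset ls' \<Longrightarrow> overlap j k p \<Longrightarrow> jet_coord ls j k A p = jet_coord ls' j k A p"
proof (induction ls arbitrary: ls' p)
  case (Cons x ls)
  have x: "x \<in> set ls'" "mset ls = mset (remove1 x ls')"
    using Cons.prems(2) by (metis list.set_intros(1) set_mset_mset, metis add_mset_remove_trivial mset.simps(2) mset_remove1)
  have "\<forall>\<^sub>F q in nhds p. jet_coord ls j k A q = jet_coord (remove1 x ls') j k A q"
    using overlap_eventually[OF Cons.prems(3)] by eventually_elim (use Cons x in blast)
  then have "jet_coord (x # ls) j k A p = prolong B j k x (jet_coord (remove1 x ls') j k A) p"
    using Cons.prems(3) by (simp, intro prolong_cong) (auto simp: overlap_def)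
  then show ?case using jet_coord_remove1[OF Cons.prems(1) x(1) Cons.prems(3)] by simp
qed simp

lemma prolong_jet_trans:
  assumes "A \<in> flds B" "overlap j k p"
  shows "prolong B j k l (jet_trans B j k A L) p = jet_trans B j k A (add_mset l L) p"
  using jet_coord_mset_cong[OF assms(1) _ assms(2), of "l # enum_of L" "enum_of (add_mset l L)"]
  by (simp add: jet_trans_eq)

text \<open>Only the generators of valid jet coordinates are transformed sensibly, so the others are sent to 0.\<close>

definition gen_transport :: "'k \<Rightarrow> 'k \<Rightarrow> 'x \<Rightarrow> 'n gen \<Rightarrow> 'n salg" where
  "gen_transport j k p g = (if valid_gen g then gen_trans B j k g p else 0)"

definition transport :: "'k \<Rightarrow> 'k \<Rightarrow> 'x \<Rightarrow> 'n salg \<Rightarrow> 'n salg" where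
  "transport j k p a = subst_alg (gen_transport j k p) a"

lemma form_trans_eq_transport:
  assumes "kys a \<subseteq> mons_upto B r"
  shows "form_trans B j k p a = transport j k p a"
proof -
  have "wordprod (\<lambda>g. gen_trans B j k g p) (word_of M) = wordprod (gen_transport j k p) (word_of M)" if "M \<in> kys a" for M
  proof -
    have "\<forall>g\<in>#M. valid_gen g" using that assms by (auto simp: mons_upto_def valid_gen_def)
    then have "\<forall>g\<in>set (word_of M). valid_gen g" by (metis mset_word_of set_mset_mset)
    then show ?thesis by (induction "word_of M" rule: list.induct) (auto simp: wordprod_def gen_transport_def cong: foldr_cong)
  qed
  then show ?thesis by (simp add: form_trans_eq_subst_alg transport_def subst_alg_def)
qed

lemma gen_transport_simps [simp]:
  "A \<in> flds B \<Longrightarrow> gen_transport j k p (Sg A L) = jet_coord (enum_of L) j k A p"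
  "gen_transport j k p (DX l) = (\<Sum>m\<in>UNIV. gconst (pd B j m (\<lambda>q. crd B k q $ l) p) \<cdot> gvar (DX m))"
  "A \<in> flds B \<Longrightarrow> gen_transport j k p (DS A L) = ldiff B j (jet_coord (enum_of L) j k A) p"
  by (auto simp: gen_transport_def jet_trans_eq)

text \<open>Written as the differential of a function, the transformed \<open>dx\<close> is closed
  by \<open>ldiff_ldiff\<close>.\<close>

lemma gen_transport_DX_eq_ldiff:
  assumes "overlap j k p"
  shows "gen_transport j k p (DX l) = ldiff B j (\<lambda>q. gconst (crd B k q $ l)) p"
  using assms by (simp add: ldiff_gconst sm_crd overlap_def gmul_gconst)

lemma germ_form_gen_transport:
  assumes "valid_gen g" "overlap j k p"
  shows "germ_form p (\<lambda>q. gen_transport j k q g)"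
  using assms
  by (cases g) (auto simp: overlap_def intro!: germ_form_jet_coord[unfolded overlap_def] germ_form_ldiff germ_form_sum germ_form_gconst_gmul germ_form_gvar sm_pd sm_crd)

lemma homog_gen_transport:
  assumes "overlap j k p"
  shows "homog (gdeg g) (gpar g) (gen_transport j k p g)"
proof (cases g)
  case (Sg A L)
  show ?thesis
  proof (cases "A \<in> flds B")
    case True
    have "mdeg M = 0 \<and> mpar M = fpar A" if "M \<in> kys (jet_coord (enum_of L) j k A p)" for M
      using jet_mon_jet_coord[OF True assms that] jet_mon_mdeg jet_mon_mpar by blast
    then show ?thesis using Sg True by (auto simp: homog_def)
  qed (simp add: gen_transport_def Sg)
next
  case (DX l)
  then show ?thesis using homog_gvar[of "DX _"] by (auto intro!: homog_sum homog_gconst_gmul simp del: gmul_gconst)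
next
  case (DS A L)
  show ?thesis
  proof (cases "A \<in> flds B")
    case True
    have "mdeg M = 1 \<and> mpar M = fpar A" if "M \<in> kys (ldiff B j (jet_coord (enum_of L) j k A) p)" for M
      using keys_ldiff[OF _ _ germ_form_jet_coord[OF True assms] jet_mon_eventually[OF True assms] that] assms
      by (auto simp: overlap_def dest: jet_mon_mdeg jet_mon_mpar)
    then show ?thesis using DS True by (auto simp: homog_def)
  qed (simp add: gen_transport_def DS)
qed

lemma graded_gen_transport: "overlap j k p \<Longrightarrow> graded_subst (gen_transport j k p)"
  unfolding graded_subst_def using homog_gen_transport germ_form_redu[OF germ_form_gen_transport] by (metis gen_transport_def redu_zero)

lemma transport_gvar: "overlap j k p \<Longrightarrow> transport j k p (gvar g) = gen_transport j k p g"
  by (simp add: transport_def subst_alg_gvar graded_gen_transport)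

lemma transport_gmul: "overlap j k p \<Longrightarrow> redu a \<Longrightarrow> redu b \<Longrightarrow> transport j k p (a \<cdot> b) = transport j k p a \<cdot> transport j k p b"
  by (simp add: transport_def subst_alg_gmul graded_gen_transport)

lemma transport_simps [simp]: "transport j k p 0 = 0" "transport j k p (gconst r) = gconst r"
  "transport j k p (a + b) = transport j k p a + transport j k p b" "transport j k p (a - b) = transport j k p a - transport j k p b"
  "transport j k p (\<Sum>i\<in>I. f i) = (\<Sum>i\<in>I. transport j k p (f i))" "redu (transport j k p a)"
  by (simp_all add: transport_def subst_alg_add subst_alg_sum subst_alg_diff)

lemma germ_form_transport:
  assumes "germ_form p f" "overlap j k p"
  shows "germ_form p (\<lambda>q. transport j k q (f q))"
  using assms(1)
proof (induction rule: germ_form_induct_inhom)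
  case (const a)
  then show ?case by (simp add: germ_form_gconst)
next
  case (gvar g f)
  show ?case
  proof (rule germ_form_cong[OF germ_form_gmul[OF germ_form_gen_transport[OF gvar(1) assms(2)] gvar(3)]])
    show "\<forall>\<^sub>F q in nhds p. gen_transport j k q g \<cdot> transport j k q (f q) = transport j k q (gvar g \<cdot> f q)"
      using overlap_eventually[OF assms(2)] germ_form_redu_eventually[OF gvar(2)]
      by eventually_elim (simp add: transport_gmul transport_gvar)
  qed
next
  case (add f f')
  then show ?case by (simp add: germ_form_add)
next
  case (cong f f')
  then show ?case by (auto intro!: germ_form_cong[of p "\<lambda>q. transport j k q (f q)"] elim: eventually_mono)
qed simp

lemma transport_gvar_gmul_eventually:
  assumes "overlap j k p" "germ_form p f"
  shows "\<forall>\<^sub>F q in nhds p. transport j k q (gvar g \<cdot> f q) = gen_transport j k q g \<cdot> transport j k q (f q)"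
  using overlap_eventually[OF assms(1)] germ_form_redu_eventually[OF assms(2)]
  by eventually_elim (simp add: transport_gmul transport_gvar)

lemma gen_transport_mdeg: "overlap j k p \<Longrightarrow> \<forall>\<^sub>F q in nhds p. \<forall>M\<in>kys (gen_transport j k q g). mdeg M = gdeg g"
  by (rule eventually_mono[OF overlap_eventually]) (auto simp: homog_gen_transport[unfolded homog_def])

text \<open>The identity is about functions: \<open>totd\<close> annihilates \<open>dx\<close> in
  chart \<open>j\<close>, whereas the transformed \<open>dx\<close> has nonconstant coefficients
  that \<open>prolong\<close> differentiates. On jet coordinates it is
  \<open>prolong_jet_trans\<close>.\<close>

lemma transport_totd:
  assumes o: "overlap i j p" and f: "germ_form p f" "\<forall>\<^sub>F q in nhds p. \<forall>M\<in>kys (f q). mdeg M = 0"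
  shows "transport i j p (totd B j n f p) = prolong B i j n (\<lambda>q. transport i j q (f q)) p"
proof -
  have ij: "i \<in> charts B" "p \<in> cdom B i" "j \<in> charts B" "p \<in> cdom B j" using o by (auto simp: overlap_def)
  have "d = 0 \<longrightarrow> transport i j p (totd B j n f p) = prolong B i j n (\<lambda>q. transport i j q (f q)) p"
    if "germ_form p f" "\<forall>\<^sub>F q in nhds p. \<forall>M\<in>kys (f q). mdeg M = d" for d f
    using that
  proof (induction rule: germ_form_induct)
    case (const a)
    then show ?case using ij by (simp add: totd_gconst prolong_gconst)
  next
    case (gvar g d f)
    show ?case
    proof
      assume "gdeg g + d = 0"
      then obtain A L where g: "g = Sg A L" "d = 0" "A \<in> flds B" using gvar(1) by (cases g) auto
      have "prolong B i j n (\<lambda>q. transport i j q (gvar g \<cdot> f q)) p = prolong B i j n (\<lambda>q. gen_transport i j q g \<cdot> transport i j q (f q)) p"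
        by (rule prolong_cong[OF ij(1,2) transport_gvar_gmul_eventually[OF o gvar(2)]])
      also have "\<dots> = prolong B i j n (\<lambda>q. gen_transport i j q g) p \<cdot> transport i j p (f p) + gen_transport i j p g \<cdot> prolong B i j n (\<lambda>q. transport i j q (f q)) p"
        by (rule prolong_gmul[OF ij(1,2) germ_form_gen_transport[OF gvar(1) o] gen_transport_mdeg[OF o] germ_form_transport[OF gvar(2) o]])
      also have "prolong B i j n (\<lambda>q. gen_transport i j q g) p = gen_transport i j p (Sg A (add_mset n L))"
        using prolong_jet_trans[OF g(3) o, of n L] g by (simp add: jet_trans_eq)
      finally show "transport i j p (totd B j n (\<lambda>q. gvar g \<cdot> f q) p) = prolong B i j n (\<lambda>q. transport i j q (gvar g \<cdot> f q)) p"
        using gvar g ij o by (simp add: totd_gvar_gmul transport_gmul transport_gvar germ_form_redu germ_form_totd del: gen_transport_simps)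
    qed
  next
    case (add d f f')
    then show ?case using ij o by (simp add: totd_add prolong_add germ_form_transport)
  next
    case (zero d)
    then show ?case by (simp add: prolong_def)
  next
    case (cong d f f')
    have "\<forall>\<^sub>F q in nhds p. transport i j q (f q) = transport i j q (f' q)" using cong(2) by (auto elim: eventually_mono)
    then show ?case using cong totd_cong[OF ij(3,4) cong(2)] prolong_cong[OF ij(1,2)] by metis
  qed
  then show ?thesis using f by blast
qed

text \<open>For jet coordinates this is how the image of \<open>ds\<close> is defined; the images of
  \<open>dx\<close> and \<open>ds\<close> are themselves differentials, hence closed.\<close>

lemma ldiff_gen_transport:
  assumes o: "overlap i j p" and g: "valid_gen g"
  shows "ldiff B i (\<lambda>q. gen_transport i j q g) p = transport i j p (ext_gen g)"
proof (cases g)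
  case (Sg A L)
  then show ?thesis using g o by (simp add: transport_gvar)
next
  case (DX l)
  have ij: "i \<in> charts B" "p \<in> cdom B i" "j \<in> charts B" "p \<in> cdom B j" using o by (auto simp: overlap_def)
  have "\<forall>\<^sub>F q in nhds p. gen_transport i j q g = ldiff B i (\<lambda>q. gconst (crd B j q $ l)) q"
    using overlap_eventually[OF o] by eventually_elim (simp add: DX gen_transport_DX_eq_ldiff del: gen_transport_simps)
  note e = ldiff_cong[OF ij(1,2) this]
  have "\<forall>\<^sub>F q in nhds p. \<forall>M\<in>kys (gconst (crd B j q $ l)). mdeg M = 0"
    by (intro always_eventually allI ballI) (drule keys_gconst, simp)
  from ldiff_ldiff[OF ij(1,2) germ_form_gconst[OF sm_crd[OF ij(3,4)]] this] show ?thesis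
    unfolding e by (simp add: DX)
next
  case (DS A L)
  then have A: "A \<in> flds B" using g by simp
  have "ldiff B i (ldiff B i (jet_coord (enum_of L) i j A)) p = 0"
    using o by (intro ldiff_ldiff germ_form_jet_coord A jet_coord_mdeg) (auto simp: overlap_def)
  then show ?thesis using DS A by simp
qed

lemma transport_ldiff:
  assumes o: "overlap i j p" and f: "germ_form p f" "\<forall>\<^sub>F q in nhds p. \<forall>M\<in>kys (f q). mdeg M = d"
  shows "transport i j p (ldiff B j f p) = ldiff B i (\<lambda>q. transport i j q (f q)) p"
proof -
  have ij: "i \<in> charts B" "p \<in> cdom B i" "j \<in> charts B" "p \<in> cdom B j" using o by (auto simp: overlap_def)
  show ?thesis
    using f
  proof (induction rule: germ_form_induct)
    case (const a)
    have "transport i j p (ldiff B j (\<lambda>q. gconst (a q)) p) =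
        (\<Sum>l\<in>UNIV. \<Sum>m\<in>UNIV. gvar (DX m) \<cdot> gconst (pd B i m (\<lambda>q. crd B j q $ l) p * pd B j l a p))"
      using ij o const by (simp add: ldiff_gconst transport_gmul transport_gvar gmul_sum_left gmul_sum_right gmul_gconst gmul_assoc gconst_gconst_gmul mult.commute)
    also have "\<dots> = (\<Sum>m\<in>UNIV. gvar (DX m) \<cdot> gconst (pd B i m a p))"
      using pd_chain[OF ij(1,3,2,4) const] by (subst sum.swap) (simp add: gconst_sum gmul_sum_right)
    finally show ?case using ij const by (simp add: ldiff_gconst)
  next
    case (gvar g d f)
    have "ldiff B i (\<lambda>q. transport i j q (gvar g \<cdot> f q)) p = ldiff B i (\<lambda>q. gen_transport i j q g \<cdot> transport i j q (f q)) p"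
      by (rule ldiff_cong[OF ij(1,2) transport_gvar_gmul_eventually[OF o gvar(2)]])
    also have "\<dots> = ldiff B i (\<lambda>q. gen_transport i j q g) p \<cdot> transport i j p (f p) + gconst ((- 1) ^ gdeg g) \<cdot> (gen_transport i j p g \<cdot> ldiff B i (\<lambda>q. transport i j q (f q)) p)"
      by (rule ldiff_gmul[OF ij(1,2) germ_form_gen_transport[OF gvar(1) o] gen_transport_mdeg[OF o] germ_form_transport[OF gvar(2) o]])
    finally show ?case
      using gvar ij o by (simp add: ldiff_gvar_gmul transport_gmul transport_gvar germ_form_redu germ_form_ldiff ldiff_gen_transport del: gen_transport_simps)
         (cases g, auto simp: transport_gmul germ_form_redu)
  next
    case (add d f f')
    then show ?case using ij o by (simp add: ldiff_add germ_form_transport)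
  next
    case (zero d)
    then show ?case by simp
  next
    case (cong d f f')
    have "\<forall>\<^sub>F q in nhds p. transport i j q (f q) = transport i j q (f' q)" using cong(2) by (auto elim: eventually_mono)
    then show ?case using cong ldiff_cong[OF ij(3,4) cong(2)] ldiff_cong[OF ij(1,2)] by metis
  qed
qed

end

section \<open>Global forms as compatible families, and the sums of products among them\<close>

section \<open>Global forms\<close>

lemma hom_deg_iff: "hom_deg d \<omega> \<longleftrightarrow> (\<forall>k p. \<forall>M\<in>kys (\<omega> k p). mdeg M = d)"
  by (simp add: hom_deg_def mdeg_def)

lemma hom_par_iff: "hom_par a \<omega> \<longleftrightarrow> (\<forall>k p. \<forall>M\<in>kys (\<omega> k p). even (mpar M + a))"
  by (simp add: hom_par_def mpar_def)

context jet_setting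
begin

definition restr :: "('k \<Rightarrow> 'x \<Rightarrow> 'n salg) \<Rightarrow> ('x, 'n, 'k) gform" where
  "restr h = (\<lambda>k p. if k \<in> charts B \<and> p \<in> cdom B k then h k p else 0)"

lemma restr_eventually:
  "k \<in> charts B \<Longrightarrow> p \<in> cdom B k \<Longrightarrow> \<forall>\<^sub>F q in nhds p. h k q = restr h k q"
  by (rule eventually_mono[OF eventually_cdom]) (auto simp: restr_def)

lemma compat_bound:
  assumes "\<omega> \<in> compatible_forms B" obtains r where "\<And>k p. kys (\<omega> k p) \<subseteq> mons_upto B r"
proof -
  obtain r where r: "\<forall>k\<in>charts B. \<omega> k \<in> local_forms_upto B k r" "\<forall>k. k \<notin> charts B \<longrightarrow> \<omega> k = (\<lambda>_. 0)"
    using assms unfolding compatible_forms_def by blast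
  have "kys (\<omega> k p) \<subseteq> mons_upto B r" for k p
    using r by (cases "k \<in> charts B") (auto simp: local_forms_upto_def mons_upto_def)
  then show thesis by (rule that; assumption)
qed

lemma compat_germ_form:
  assumes "\<omega> \<in> compatible_forms B" "k \<in> charts B" "p \<in> cdom B k" shows "germ_form p (\<omega> k)"
proof -
  obtain r where r: "\<And>k p. kys (\<omega> k p) \<subseteq> mons_upto B r" using compat_bound[OF assms(1)] by blast
  obtain r' where "\<omega> k \<in> local_forms_upto B k r'" using assms unfolding compatible_forms_def by blast
  then have "smooth_in B k (cdom B k) (\<lambda>p. lkp (\<omega> k p) M)" for M
    unfolding local_forms_upto_def by blast
  then have "sm p (\<lambda>p. lkp (\<omega> k p) M)" for M
    using assms smooth_in_iff[of k "cdom B k"] by auto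
  then show ?thesis unfolding germ_form_def using r by (auto intro!: exI[of _ r])
qed

lemma compat_transport:
  assumes "\<omega> \<in> compatible_forms B" "overlap j k p" shows "\<omega> j p = transport j k p (\<omega> k p)"
proof -
  obtain r where r: "\<And>k p. kys (\<omega> k p) \<subseteq> mons_upto B r" using compat_bound[OF assms(1)] by blast
  have "\<omega> j p = form_trans B j k p (\<omega> k p)"
    using assms unfolding compatible_forms_def overlap_def by blast
  then show ?thesis using form_trans_eq_transport[OF r] by simp
qed

lemma compat_transport_eventually:
  "\<omega> \<in> compatible_forms B \<Longrightarrow> overlap j k p \<Longrightarrow> \<forall>\<^sub>F q in nhds p. \<omega> j q = transport j k q (\<omega> k q)"
  by (rule eventually_mono[OF overlap_eventually]) (auto intro: compat_transport)

lemma local_forms_uptoI: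
  assumes "k \<in> charts B" "\<And>p. p \<in> cdom B k \<Longrightarrow> germ_form p f" "\<And>p. p \<in> cdom B k \<Longrightarrow> kys (f p) \<subseteq> mons_upto B r"
    "\<And>p. p \<notin> cdom B k \<Longrightarrow> f p = 0"
  shows "f \<in> local_forms_upto B k r"
proof -
  have "p \<in> cdom B k" if "M \<in> kys (f p)" for p M
    by (rule ccontr) (use assms(4)[of p] that in simp)
  moreover have "smooth_in B k (cdom B k) (\<lambda>p. lkp (f p) M)" for M
    using assms(1,2) by (subst smooth_in_iff) (auto intro: germ_form_lookup)
  ultimately show ?thesis
    using assms(3) unfolding local_forms_upto_def mons_upto_def by blast
qed

text \<open>The predicates \<open>of_Y\<close> and \<open>of_Q\<close> give the two factors and the
  constantly false one gives all compatible families, so closure properties are proved once.\<close>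

definition avoiding :: "('n gen \<Rightarrow> bool) \<Rightarrow> ('x, 'n, 'k) gform set" where
  "avoiding Z = {\<omega> \<in> compatible_forms B. \<forall>k p. \<forall>M\<in>kys (\<omega> k p). \<forall>g\<in>#M. \<not> Z g}"

lemma C_inf_eq: "C_inf B = avoiding of_Y" and P_inf_eq: "P_inf B = avoiding of_Q"
  by (simp_all add: C_inf_def P_inf_def avoiding_def)

lemma avoiding_compat: "\<omega> \<in> avoiding Z \<Longrightarrow> \<omega> \<in> compatible_forms B"
  by (simp add: avoiding_def)

lemma compat_eq_avoiding: "compatible_forms B = avoiding (\<lambda>_. False)"
  by (simp add: avoiding_def)

lemma compat_restr: "\<omega> \<in> compatible_forms B \<Longrightarrow> restr \<omega> = \<omega>"
proof (intro ext)
  fix k p assume w: "\<omega> \<in> compatible_forms B"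
  have "\<omega> k p = 0" if "k \<in> charts B" "p \<notin> cdom B k"
  proof -
    have "\<exists>r. \<forall>k\<in>charts B. \<omega> k \<in> local_forms_upto B k r" using w by (simp add: compatible_forms_def)
    then obtain r where "\<forall>k\<in>charts B. \<omega> k \<in> local_forms_upto B k r" by (rule exE)
    then have "\<omega> k \<in> local_forms_upto B k r" using that(1) by (rule bspec)
    then have "\<forall>M\<in>kys (\<omega> k p). p \<in> cdom B k" unfolding local_forms_upto_def by blast
    then have "kys (\<omega> k p) = {}" using that(2) by (simp add: Ball_def ex_in_conv[symmetric])
    then show ?thesis by simp
  qed
  moreover have "\<omega> k = (\<lambda>_. 0)" if "k \<notin> charts B"
    using w that unfolding compatible_forms_def by blast
  ultimately show "restr \<omega> k p = \<omega> k p"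
    unfolding restr_def by (cases "k \<in> charts B") auto
qed

lemma avoidingI:
  assumes "\<And>k p. k \<in> charts B \<Longrightarrow> p \<in> cdom B k \<Longrightarrow> germ_form p (h k)"
    and "\<And>k p. k \<in> charts B \<Longrightarrow> p \<in> cdom B k \<Longrightarrow> kys (h k p) \<subseteq> mons_upto B r"
    and "\<And>j k p. overlap j k p \<Longrightarrow> h j p = transport j k p (h k p)"
    and "\<And>k p M g. k \<in> charts B \<Longrightarrow> p \<in> cdom B k \<Longrightarrow> M \<in> kys (h k p) \<Longrightarrow> g \<in># M \<Longrightarrow> \<not> Z g"
  shows "restr h \<in> avoiding Z"
proof -
  have 1: "restr h k \<in> local_forms_upto B k r" if k: "k \<in> charts B" for k
  proof (rule local_forms_uptoI[OF k])
    fix p assume p: "p \<in> cdom B k"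
    show "germ_form p (restr h k)" by (rule germ_form_cong[OF assms(1)[OF k p] restr_eventually[OF k p, of h]])
  qed (use assms(2)[OF k] k in \<open>auto simp: restr_def\<close>)
  have 2: "restr h j p = form_trans B j k p (restr h k p)" if "j \<in> charts B" "k \<in> charts B" "p \<in> cdom B j \<inter> cdom B k" for j k p
    using assms(3)[of j k p] form_trans_eq_transport[OF assms(2), of k p] that by (simp add: restr_def overlap_def)
  have "\<forall>k. k \<notin> charts B \<longrightarrow> restr h k = (\<lambda>_. 0)"
    by (simp add: restr_def)
  then have "restr h \<in> compatible_forms B"
    unfolding compatible_forms_def using 1 2 by blast
  moreover have "\<not> Z g" if "M \<in> kys (restr h k p)" "g \<in># M" for k p M g
    using assms(4)[of k p M g] that by (auto simp: restr_def split: if_splits)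
  ultimately show ?thesis unfolding avoiding_def by blast
qed

lemma avoiding_gens: "\<omega> \<in> avoiding Z \<Longrightarrow> M \<in> kys (\<omega> k p) \<Longrightarrow> g \<in># M \<Longrightarrow> \<not> Z g"
  by (auto simp: avoiding_def)

lemma avoiding_zero: "(\<lambda>_ _. 0) \<in> avoiding Z"
proof -
  have "restr (\<lambda>_ _. 0) \<in> avoiding Z" by (rule avoidingI) auto
  then show ?thesis by (simp add: restr_def)
qed

lemma avoiding_add:
  assumes "\<omega> \<in> avoiding Z" "\<eta> \<in> avoiding Z" shows "\<omega> +\<^sub>g \<eta> \<in> avoiding Z"
proof -
  note c = avoiding_compat[OF assms(1)] avoiding_compat[OF assms(2)]
  obtain r s where r: "\<And>k p. kys (\<omega> k p) \<subseteq> mons_upto B r" "\<And>k p. kys (\<eta> k p) \<subseteq> mons_upto B s"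
    using compat_bound c by metis
  have "restr (\<omega> +\<^sub>g \<eta>) \<in> avoiding Z"
    unfolding fadd_def
  proof (rule avoidingI[where r = "max r s"])
    fix k p show "kys (\<omega> k p + \<eta> k p) \<subseteq> mons_upto B (max r s)"
      using r(1)[of k p] r(2)[of k p] mons_upto_mono[of r "max r s" B] mons_upto_mono[of s "max r s" B] by (auto elim!: keys_addE)
  next
    fix k p M g assume "M \<in> kys (\<omega> k p + \<eta> k p)" "g \<in># M"
    then show "\<not> Z g" using assms by (elim keys_addE) (auto dest: avoiding_gens)
  qed (use c in \<open>auto simp: compat_transport intro!: germ_form_add compat_germ_form\<close>)
  moreover have "restr (\<omega> +\<^sub>g \<eta>) = \<omega> +\<^sub>g \<eta>"
    using compat_restr[OF c(1)] compat_restr[OF c(2)] by (simp add: restr_def fun_eq_iff fadd_def) (metis add_cancel_right_right)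
  ultimately show ?thesis by simp
qed

lemma avoiding_wedge:
  assumes "\<omega> \<in> avoiding Z" "\<eta> \<in> avoiding Z" shows "\<omega> \<and>\<^sub>g \<eta> \<in> avoiding Z"
proof -
  note c = avoiding_compat[OF assms(1)] avoiding_compat[OF assms(2)]
  obtain r s where r: "\<And>k p. kys (\<omega> k p) \<subseteq> mons_upto B r" "\<And>k p. kys (\<eta> k p) \<subseteq> mons_upto B s"
    using compat_bound c by metis
  have "restr (\<omega> \<and>\<^sub>g \<eta>) \<in> avoiding Z"
    unfolding wedge_def
  proof (rule avoidingI[where r = "r + s"])
    fix k p show "kys (\<omega> k p \<cdot> \<eta> k p) \<subseteq> mons_upto B (r + s)"
      using r(1)[of k p] r(2)[of k p] by (auto elim!: keys_gmulE intro!: mons_upto_add)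
  next
    fix k p M g assume "M \<in> kys (\<omega> k p \<cdot> \<eta> k p)" "g \<in># M"
    then show "\<not> Z g" using assms by (elim keys_gmulE) (auto dest: avoiding_gens)
  next
    fix j k p assume o: "overlap j k p"
    then have "redu (\<omega> k p)" "redu (\<eta> k p)"
      using c by (auto simp: overlap_def intro: germ_form_redu compat_germ_form)
    then show "\<omega> j p \<cdot> \<eta> j p = transport j k p (\<omega> k p \<cdot> \<eta> k p)"
      using compat_transport[OF c(1) o] compat_transport[OF c(2) o] by (simp add: transport_gmul o)
  qed (use c in \<open>auto intro!: germ_form_gmul compat_germ_form\<close>)
  moreover have "restr (\<omega> \<and>\<^sub>g \<eta>) = \<omega> \<and>\<^sub>g \<eta>"
  proof (intro ext)
    fix k p
    show "restr (\<omega> \<and>\<^sub>g \<eta>) k p = (\<omega> \<and>\<^sub>g \<eta>) k p"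
      using fun_cong[OF fun_cong[OF compat_restr[OF c(1)]], of k p] by (auto simp: restr_def wedge_def split: if_splits)
  qed
  ultimately show ?thesis by simp
qed

definition base :: "('x \<Rightarrow> real) \<Rightarrow> ('x, 'n, 'k) gform" where
  "base f = restr (\<lambda>_ p. gconst (f p))"

lemma base_avoiding:
  assumes "\<And>p. sm p f" shows "base f \<in> avoiding Z"
  unfolding base_def
proof (rule avoidingI[where r = 0])
  fix k p and M :: "'n gen multiset" and g assume "M \<in> kys (gconst (f p))" "g \<in># M"
  then show "\<not> Z g" by (auto dest: keys_gconst)
qed (auto intro!: germ_form_gconst assms simp: mons_upto_def dest: keys_gconst)

lemma base_hom: "hom_deg 0 (base f)" "hom_par 0 (base f)"
  by (auto simp: hom_deg_iff hom_par_iff base_def restr_def dest!: keys_gconst split: if_splits)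

lemma base_apply: "k \<in> charts B \<Longrightarrow> p \<in> cdom B k \<Longrightarrow> base f k p = gconst (f p)"
  by (simp add: base_def restr_def)

lemma fscale_eq: "\<omega> \<in> compatible_forms B \<Longrightarrow> fscale r \<omega> = base (\<lambda>_. r) \<and>\<^sub>g \<omega>"
proof (intro ext)
  fix k p assume w: "\<omega> \<in> compatible_forms B"
  show "fscale r \<omega> k p = (base (\<lambda>_. r) \<and>\<^sub>g \<omega>) k p"
    using fun_cong[OF fun_cong[OF compat_restr[OF w]], of k p]
    by (auto simp: fscale_def wedge_def base_def restr_def split: if_splits)
qed

lemma avoiding_False: "\<omega> \<in> avoiding Z \<Longrightarrow> \<omega> \<in> avoiding (\<lambda>_. False)"
  by (simp add: avoiding_def)

lemma avoiding_scale: "\<omega> \<in> avoiding Z \<Longrightarrow> fscale r \<omega> \<in> avoiding Z"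
  by (simp add: fscale_eq avoiding_compat) (intro avoiding_wedge base_avoiding; simp)

lemma S_inf_wedgeI: "\<phi> \<in> C_inf B \<Longrightarrow> \<psi> \<in> P_inf B \<Longrightarrow> \<phi> \<and>\<^sub>g \<psi> \<in> S_inf B"
  unfolding S_inf_def
  by (rule CollectI, rule exI[of _ 1], rule exI[of _ "\<lambda>_. \<phi>"], rule exI[of _ "\<lambda>_. \<psi>"]) simp

lemma S_infE:
  assumes "a \<in> S_inf B"
  obtains m \<phi> \<psi> where "\<forall>i<m. \<phi> i \<in> C_inf B \<and> \<psi> i \<in> P_inf B" "a = (\<lambda>k p. \<Sum>i<(m::nat). (\<phi> i \<and>\<^sub>g \<psi> i) k p)"
  using assms unfolding S_inf_def mem_Collect_eq by (elim exE conjE) (rule that)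

lemma S_inf_zero: "(\<lambda>_ _. 0) \<in> S_inf B"
  unfolding S_inf_def by (auto intro!: exI[of _ "0::nat"])

lemma sum_lessThan_add: "(\<Sum>i<m + (n::nat). F i) = (\<Sum>i<m. F i) + (\<Sum>i<n. F (m + i) :: 'c::comm_monoid_add)"
  by (induction n) (auto simp: add.assoc)

lemma S_inf_add:
  assumes "a \<in> S_inf B" "b \<in> S_inf B" shows "a +\<^sub>g b \<in> S_inf B"
proof -
  obtain m \<phi> \<psi> where 1: "\<forall>i<m. \<phi> i \<in> C_inf B \<and> \<psi> i \<in> P_inf B" "a = (\<lambda>k p. \<Sum>i<(m::nat). (\<phi> i \<and>\<^sub>g \<psi> i) k p)"
    by (rule S_infE[OF assms(1)]) (rule that; assumption)
  obtain m' \<phi>' \<psi>' where 2: "\<forall>i<m'. \<phi>' i \<in> C_inf B \<and> \<psi>' i \<in> P_inf B" "b = (\<lambda>k p. \<Sum>i<(m'::nat). (\<phi>' i \<and>\<^sub>g \<psi>' i) k p)"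
    by (rule S_infE[OF assms(2)]) (rule that; assumption)
  show ?thesis
    unfolding S_inf_def
    by (rule CollectI, rule exI[of _ "m + m'"], rule exI[of _ "\<lambda>i. if i < m then \<phi> i else \<phi>' (i - m)"],
        rule exI[of _ "\<lambda>i. if i < m then \<psi> i else \<psi>' (i - m)"])
      (use 1 2 in \<open>auto simp: fadd_def sum_lessThan_add\<close>)
qed

lemma S_inf_compat: "S_inf B \<subseteq> compatible_forms B"
proof
  fix a assume "a \<in> S_inf B"
  then obtain m \<phi> \<psi> where 1: "\<forall>i<m. \<phi> i \<in> C_inf B \<and> \<psi> i \<in> P_inf B" "a = (\<lambda>k p. \<Sum>i<(m::nat). (\<phi> i \<and>\<^sub>g \<psi> i) k p)"
    by (rule S_infE) (rule that; assumption)
  have "(\<lambda>k p. \<Sum>i<n. (\<phi> i \<and>\<^sub>g \<psi> i) k p) \<in> compatible_forms B" if "n \<le> m" for n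
    using that
  proof (induction n)
    case 0
    then show ?case using avoiding_zero avoiding_compat by simp
  next
    case (Suc n)
    have "\<phi> n \<and>\<^sub>g \<psi> n \<in> compatible_forms B"
      using 1 Suc.prems unfolding C_inf_eq P_inf_eq compat_eq_avoiding
      by (intro avoiding_wedge avoiding_False[of _ of_Y] avoiding_False[of _ of_Q]) auto
    with Suc have "(\<lambda>k p. \<Sum>i<n. (\<phi> i \<and>\<^sub>g \<psi> i) k p) +\<^sub>g (\<phi> n \<and>\<^sub>g \<psi> n) \<in> compatible_forms B"
      unfolding compat_eq_avoiding by (intro avoiding_add) auto
    then show ?case by (simp add: fadd_def)
  qed
  then show "a \<in> compatible_forms B" using 1 by simp
qed

lemma one_right: "\<omega> \<in> compatible_forms B \<Longrightarrow> \<omega> \<and>\<^sub>g base (\<lambda>_. 1) = \<omega>"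
proof (intro ext)
  fix k p assume w: "\<omega> \<in> compatible_forms B"
  have "redu (\<omega> k p)" using compat_bound[OF w] mons_upto_redu by metis
  then show "(\<omega> \<and>\<^sub>g base (\<lambda>_. 1)) k p = \<omega> k p"
    using fun_cong[OF fun_cong[OF compat_restr[OF w]], of k p] by (auto simp: wedge_def base_def restr_def split: if_splits)
qed

lemma one_left: "\<omega> \<in> compatible_forms B \<Longrightarrow> base (\<lambda>_. 1) \<and>\<^sub>g \<omega> = \<omega>"
proof (intro ext)
  fix k p assume w: "\<omega> \<in> compatible_forms B"
  have "redu (\<omega> k p)" using compat_bound[OF w] mons_upto_redu by metis
  then show "(base (\<lambda>_. 1) \<and>\<^sub>g \<omega>) k p = \<omega> k p"
    using fun_cong[OF fun_cong[OF compat_restr[OF w]], of k p] by (auto simp: wedge_def base_def restr_def split: if_splits)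
qed

lemma C_inf_S_inf: "\<omega> \<in> C_inf B \<Longrightarrow> \<omega> \<in> S_inf B"
  using S_inf_wedgeI[of \<omega> "base (\<lambda>_. 1)"] one_right[of \<omega>] base_avoiding[of "\<lambda>_. 1" of_Q]
  by (simp add: C_inf_eq P_inf_eq avoiding_compat)

lemma P_inf_S_inf: "\<omega> \<in> P_inf B \<Longrightarrow> \<omega> \<in> S_inf B"
  using S_inf_wedgeI[of "base (\<lambda>_. 1)" \<omega>] one_left[of \<omega>] base_avoiding[of "\<lambda>_. 1" of_Y]
  by (simp add: C_inf_eq P_inf_eq avoiding_compat)

lemma S_inf_scale:
  assumes "a \<in> S_inf B" shows "fscale r a \<in> S_inf B"
proof -
  obtain m \<phi> \<psi> where 1: "\<forall>i<m. \<phi> i \<in> C_inf B \<and> \<psi> i \<in> P_inf B" "a = (\<lambda>k p. \<Sum>i<(m::nat). (\<phi> i \<and>\<^sub>g \<psi> i) k p)"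
    by (rule S_infE[OF assms]) (rule that; assumption)
  have "fscale r (\<phi> i) \<in> C_inf B" if "i < m" for i
    using 1 that by (simp add: C_inf_eq avoiding_scale)
  then show ?thesis
    unfolding S_inf_def using 1
    by (intro CollectI exI[of _ m] exI[of _ "\<lambda>i. fscale r (\<phi> i)"] exI[of _ \<psi>])
      (auto simp: fscale_def wedge_def gmul_sum_right gmul_assoc)
qed

subsection \<open>Differentials\<close>

definition typ_pred :: "('n gen \<Rightarrow> bool) \<Rightarrow> bool" where "typ_pred Z \<longleftrightarrow> Z = of_Y \<or> Z = of_Q"

lemma of_Y_simp: "of_Y (Sg A L) = even (fpar A)" "of_Y (DS A L) = even (fpar A)"
  by (cases A; simp)+

lemma of_Q_simp: "of_Q (Sg A L) = odd (fpar A)" "of_Q (DS A L) = odd (fpar A)"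
  by (cases A; simp)+

lemma typ_pred_simps:
  assumes "typ_pred Z"
  shows "\<not> Z (DX l)" "Z (DS A L) = Z (Sg A {#})" "Z (Sg A L) = Z (Sg A {#})"
  using assms by (auto simp: typ_pred_def of_Y_simp of_Q_simp)

lemma typ_pred_cases: "typ_pred of_Y" "typ_pred of_Q"
  by (auto simp: typ_pred_def)

lemma gdiff_eq: "gdiff B \<omega> = restr (\<lambda>k. ldiff B k (\<omega> k))"
  by (auto simp: gdiff_def restr_def fun_eq_iff)

lemma gen_ok_Suc: "gen_ok B r g \<Longrightarrow> gen_ok B (Suc r) g"
  by (erule gen_ok_mono) simp

lemma ldiff_keys_mons_upto:
  assumes "k \<in> charts B" "p \<in> cdom B k" "germ_form p f" "\<forall>\<^sub>F q in nhds p. kys (f q) \<subseteq> mons_upto B r"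
  shows "kys (ldiff B k f p) \<subseteq> mons_upto B (Suc r)"
proof
  fix M assume M: "M \<in> kys (ldiff B k f p)"
  then have red: "reduced M" using germ_form_redu[OF germ_form_ldiff[OF assms(1-3)]] by (auto simp: redu_def)
  have "\<forall>\<^sub>F q in nhds p. \<forall>N\<in>kys (f q). N \<in> mons_upto B r" using assms(4) by (auto elim: eventually_mono)
  from keys_ldiff[OF assms(1-3) this M] show "M \<in> mons_upto B (Suc r)"
    using red by (auto simp: mons_upto_def intro: gen_ok_Suc)
qed

lemma totd_keys_mons_upto:
  assumes "k \<in> charts B" "p \<in> cdom B k" "germ_form p f" "\<forall>\<^sub>F q in nhds p. kys (f q) \<subseteq> mons_upto B r"
  shows "kys (totd B k l f p) \<subseteq> mons_upto B (Suc r)"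
proof
  fix M assume M: "M \<in> kys (totd B k l f p)"
  then have red: "reduced M" using germ_form_redu[OF germ_form_totd[OF assms(1-3)]] by (auto simp: redu_def)
  have "\<forall>\<^sub>F q in nhds p. \<forall>N\<in>kys (f q). N \<in> mons_upto B r" using assms(4) by (auto elim: eventually_mono)
  from keys_totd[OF assms(1-3) this M] show "M \<in> mons_upto B (Suc r)"
    using red by (auto simp: mons_upto_def intro: gen_ok_Suc)
qed

lemma ldiff_keys_typ:
  assumes "typ_pred Z" "k \<in> charts B" "p \<in> cdom B k" "\<omega> \<in> avoiding Z" "M \<in> kys (ldiff B k (\<omega> k) p)" "g \<in># M"
  shows "\<not> Z g"
proof -
  have "\<forall>\<^sub>F q in nhds p. \<forall>N\<in>kys (\<omega> k q). \<forall>h\<in>#N. \<not> Z h" using avoiding_gens[OF assms(4)] by auto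
  from keys_ldiff[OF assms(2,3) compat_germ_form[OF avoiding_compat[OF assms(4)] assms(2,3)] this assms(5)] assms(6)
  show ?thesis using assms(1) by (auto simp: typ_pred_def of_Y_simp of_Q_simp)
qed

lemma totd_keys_typ:
  assumes "typ_pred Z" "k \<in> charts B" "p \<in> cdom B k" "\<omega> \<in> avoiding Z" "M \<in> kys (totd B k l (\<omega> k) p)" "g \<in># M"
  shows "\<not> Z g"
proof -
  have "\<forall>\<^sub>F q in nhds p. \<forall>N\<in>kys (\<omega> k q). \<forall>h\<in>#N. \<not> Z h" using avoiding_gens[OF assms(4)] by auto
  from keys_totd[OF assms(2,3) compat_germ_form[OF avoiding_compat[OF assms(4)] assms(2,3)] this assms(5)] assms(6)
  show ?thesis using assms(1) by (auto simp: typ_pred_def of_Y_simp of_Q_simp)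
qed

lemma avoiding_gdiff:
  assumes "typ_pred Z" "\<omega> \<in> avoiding Z" "hom_deg d \<omega>"
  shows "gdiff B \<omega> \<in> avoiding Z"
proof -
  note c = avoiding_compat[OF assms(2)]
  obtain r where r: "\<And>k p. kys (\<omega> k p) \<subseteq> mons_upto B r" using compat_bound[OF c] by blast
  show ?thesis
    unfolding gdiff_eq
  proof (rule avoidingI[where r = "Suc r"])
    fix j k p assume o: "overlap j k p"
    then have "germ_form p (\<omega> k)" "\<forall>\<^sub>F q in nhds p. \<forall>M\<in>kys (\<omega> k q). mdeg M = d"
      using c assms(3) by (auto simp: overlap_def hom_deg_iff intro: compat_germ_form)
    from transport_ldiff[OF o this] show "ldiff B j (\<omega> j) p = transport j k p (ldiff B k (\<omega> k) p)"
      using ldiff_cong[OF _ _ compat_transport_eventually[OF c o]] o by (simp add: overlap_def)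
  next
    fix k p assume kp: "k \<in> charts B" "p \<in> cdom B k"
    show "germ_form p (ldiff B k (\<omega> k))" by (intro germ_form_ldiff compat_germ_form c kp)
    show "kys (ldiff B k (\<omega> k) p) \<subseteq> mons_upto B (Suc r)"
      by (rule ldiff_keys_mons_upto[OF kp compat_germ_form[OF c kp]]) (use r in auto)
  next
    fix k p M g assume "k \<in> charts B" "p \<in> cdom B k" "M \<in> kys (ldiff B k (\<omega> k) p)" "g \<in># M"
    then show "\<not> Z g" using ldiff_keys_typ[OF assms(1) _ _ assms(2)] by blast
  qed
qed

lemma hom_deg_gdiff:
  assumes "\<omega> \<in> compatible_forms B" "hom_deg d \<omega>" shows "hom_deg (Suc d) (gdiff B \<omega>)"
  unfolding hom_deg_iff
proof (intro allI ballI)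
  fix k p M assume M: "M \<in> kys (gdiff B \<omega> k p)"
  then have kp: "k \<in> charts B" "p \<in> cdom B k" "M \<in> kys (ldiff B k (\<omega> k) p)"
    by (auto simp: gdiff_def split: if_splits)
  have "\<forall>\<^sub>F q in nhds p. \<forall>N\<in>kys (\<omega> k q). mdeg N = d" using assms(2) by (auto simp: hom_deg_iff)
  from keys_ldiff[OF kp(1,2) compat_germ_form[OF assms(1) kp(1,2)] this kp(3)] show "mdeg M = Suc d" by auto
qed

lemma hom_par_gdiff:
  assumes "\<omega> \<in> compatible_forms B" "hom_par a \<omega>" shows "hom_par a (gdiff B \<omega>)"
  unfolding hom_par_iff
proof (intro allI ballI)
  fix k p M assume M: "M \<in> kys (gdiff B \<omega> k p)"
  then have kp: "k \<in> charts B" "p \<in> cdom B k" "M \<in> kys (ldiff B k (\<omega> k) p)"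
    by (auto simp: gdiff_def split: if_splits)
  have "\<forall>\<^sub>F q in nhds p. \<forall>N\<in>kys (\<omega> k q). even (mpar N + a)" using assms(2) by (auto simp: hom_par_iff)
  from keys_ldiff[OF kp(1,2) compat_germ_form[OF assms(1) kp(1,2)] this kp(3)] show "even (mpar M + a)" by auto
qed

text \<open>The horizontal part of \<open>d\<close> on functions; what remains, \<open>dV\<close>,
  is a combination of contact forms (\<open>dV_eq\<close>). Both are independent of the chart, so
  \<open>dV\<close> of a global extension of a jet coordinate is a global contact form.\<close>

definition dH :: "'k \<Rightarrow> ('x \<Rightarrow> 'n salg) \<Rightarrow> 'x \<Rightarrow> 'n salg" where
  "dH k f p = (\<Sum>l\<in>UNIV. gvar (DX l) \<cdot> totd B k l f p)"

definition dV :: "'k \<Rightarrow> ('x \<Rightarrow> 'n salg) \<Rightarrow> 'x \<Rightarrow> 'n salg" where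
  "dV k f p = ldiff B k f p - dH k f p"

lemma gvar_DX_Sg: "gvar (DX l) \<cdot> gvar (Sg A L) = gvar (Sg A L) \<cdot> gvar (DX l)"
  using gvar_commute[of "DX l" "Sg A L"] by (simp add: csgn_eq)

lemma dV_eq:
  assumes "kys (f p) \<subseteq> mons_upto B r"
  shows "dV k f p = (\<Sum>(A, L)\<in>jetvars B r. theta A L \<cdot> pds A L (f p))"
proof -
  note s = der_superset[OF finite_jetvars svars_subset_jetvars[OF assms]]
  have "dV k f p = der_ext (f p) - (\<Sum>l\<in>UNIV. gvar (DX l) \<cdot> der_tot l (f p))"
    by (simp add: dV_def dH_def ldiff_eq totd_eq gmul_add_right sum.distrib)
  also have "(\<Sum>l\<in>UNIV. gvar (DX l) \<cdot> der_tot l (f p)) =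
      (\<Sum>(A, L)\<in>jetvars B r. \<Sum>l\<in>UNIV. gvar (Sg A (add_mset l L)) \<cdot> gvar (DX l) \<cdot> pds A L (f p))"
    unfolding s gmul_sum_right split_def
    by (subst sum.swap) (simp add: gmul_assoc[symmetric] gvar_DX_Sg)
  finally show ?thesis
    unfolding s by (simp add: theta_def gmul_diff_left gmul_sum_left sum_subtractf split_def)
qed

text \<open>The Jacobian from \<open>dx\<close> and the inverse Jacobian from the total derivatives
  cancel.\<close>

lemma dH_transport:
  assumes o: "overlap i j p" and f: "germ_form p f" "\<forall>\<^sub>F q in nhds p. \<forall>M\<in>kys (f q). mdeg M = 0"
  shows "transport i j p (dH j f p) = dH i (\<lambda>q. transport i j q (f q)) p"
proof -
  have ij: "i \<in> charts B" "p \<in> cdom B i" "j \<in> charts B" "p \<in> cdom B j" using o by (auto simp: overlap_def)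
  let ?F = "\<lambda>q. transport i j q (f q)"
  let ?a = "\<lambda>m l. pd B i m (\<lambda>q. crd B j q $ l) p"
  let ?b = "\<lambda>l m. pd B j l (\<lambda>q. crd B i q $ m) p"
  have ab: "(\<Sum>l\<in>UNIV. ?a m l * ?b l m') = (if m = m' then 1 else 0)" for m m'
    using pd_chain[OF ij(1,3,2,4) sm_crd[OF ij(1,2)], of m m'] pd_crd[OF ij(1,2), of m m'] by simp
  have "transport i j p (dH j f p) = (\<Sum>l\<in>UNIV. gen_transport i j p (DX l) \<cdot> prolong B i j l ?F p)"
    using ij by (simp add: dH_def transport_gmul[OF o] transport_gvar[OF o] transport_totd[OF o f] germ_form_redu germ_form_totd f del: gen_transport_simps)
  also have "\<dots> = (\<Sum>l\<in>UNIV. \<Sum>m\<in>UNIV. \<Sum>m'\<in>UNIV. gconst (?a m l * ?b l m') \<cdot> (gvar (DX m) \<cdot> totd B i m' ?F p))"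
    by (simp add: prolong_def gmul_sum_left gmul_sum_right gmul_assoc gmul_gconst_left_commute[of "gvar _"] gconst_gconst_gmul)
      (rule sum.cong[OF refl], rule sum.swap)
  also have "\<dots> = (\<Sum>m\<in>UNIV. \<Sum>m'\<in>UNIV. gconst (\<Sum>l\<in>UNIV. ?a m l * ?b l m') \<cdot> (gvar (DX m) \<cdot> totd B i m' ?F p))"
    unfolding gconst_sum gmul_sum_left
    by (subst sum.swap, rule sum.cong[OF refl], rule sum.swap)
  also have "\<dots> = (\<Sum>m\<in>UNIV. \<Sum>m'\<in>UNIV. if m = m' then gvar (DX m) \<cdot> totd B i m' ?F p else 0)"
    unfolding ab by (intro sum.cong) auto
  finally show ?thesis by (simp add: dH_def)
qed

lemma germ_form_dV: "k \<in> charts B \<Longrightarrow> p \<in> cdom B k \<Longrightarrow> germ_form p f \<Longrightarrow> germ_form p (dV k f)"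
  unfolding dV_def[abs_def] dH_def
  by (intro germ_form_diff germ_form_ldiff germ_form_sum germ_form_gmul germ_form_gvar germ_form_totd) auto

lemma dV_cong: "k \<in> charts B \<Longrightarrow> p \<in> cdom B k \<Longrightarrow> \<forall>\<^sub>F q in nhds p. f q = g q \<Longrightarrow> dV k f p = dV k g p"
  by (simp add: dV_def dH_def totd_cong[of k p f g] ldiff_cong[of k p f g])

lemma avoiding_dV:
  assumes Z: "typ_pred Z" and w: "\<omega> \<in> avoiding Z" and d: "hom_deg 0 \<omega>"
  shows "restr (\<lambda>k. dV k (\<omega> k)) \<in> avoiding Z"
proof -
  note c = avoiding_compat[OF w]
  obtain r where r: "\<And>k p. kys (\<omega> k p) \<subseteq> mons_upto B r" using compat_bound[OF c] by blast
  show ?thesis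
  \<comment> \<open>One step up for the differentiation, one for the additional factor
    \<open>dx\<close>.\<close>
  proof (rule avoidingI[where r = "Suc (Suc r)"])
    fix j k p assume o: "overlap j k p"
    then have f: "germ_form p (\<omega> k)" "\<forall>\<^sub>F q in nhds p. \<forall>M\<in>kys (\<omega> k q). mdeg M = 0"
      using c d by (auto simp: overlap_def hom_deg_iff intro: compat_germ_form)
    have "dV j (\<omega> j) p = dV j (\<lambda>q. transport j k q (\<omega> k q)) p"
      using dV_cong[OF _ _ compat_transport_eventually[OF c o]] o by (simp add: overlap_def)
    then show "dV j (\<omega> j) p = transport j k p (dV k (\<omega> k) p)"
      by (simp add: dV_def transport_ldiff[OF o f] dH_transport[OF o f])
  next
    fix k p M assume kp: "k \<in> charts B" "p \<in> cdom B k"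
    note g = compat_germ_form[OF c kp]
    have K: "M \<in> kys (ldiff B k (\<omega> k) p) \<or> (\<exists>l N. N \<in> kys (totd B k l (\<omega> k) p) \<and> M = add_mset (DX l) N \<and> reduced M)"
      if "M \<in> kys (dV k (\<omega> k) p)" for M
      using that unfolding dV_def dH_def
    proof (cases rule: keys_diffE)
      case 2
      then obtain l where "M \<in> kys (gvar (DX l) \<cdot> totd B k l (\<omega> k) p)" by (elim keys_sumE)
      then have "\<exists>N. N \<in> kys (totd B k l (\<omega> k) p) \<and> M = add_mset (DX l) N \<and> reduced M"
        by (elim keys_gmulE) (simp add: keys_gvar)
      then show ?thesis by blast
    qed blast
    show "kys (dV k (\<omega> k) p) \<subseteq> mons_upto B (Suc (Suc r))"
    proof
      fix M assume "M \<in> kys (dV k (\<omega> k) p)"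
      from K[OF this] show "M \<in> mons_upto B (Suc (Suc r))"
        using ldiff_keys_mons_upto[OF kp g always_eventually, of r] totd_keys_mons_upto[OF kp g always_eventually, of r] r
          mons_upto_mono[of "Suc r" "Suc (Suc r)" B]
        by (auto simp: subset_iff) (auto simp: mons_upto_def intro: gen_ok_Suc)
    qed
    show "\<not> Z h" if "M \<in> kys (dV k (\<omega> k) p)" "h \<in># M" for h
      using K[OF that(1)] that(2) ldiff_keys_typ[OF Z kp w] totd_keys_typ[OF Z kp w] typ_pred_simps(1)[OF Z] by auto
  qed (auto intro: germ_form_dV compat_germ_form c)
qed

text \<open>The coefficients in front of the contact one-forms are the left derivatives of the
  function, which are local forms of the same bound.\<close>

lemma dV_contact:
  assumes "\<omega> \<in> compatible_forms B" "restr (\<lambda>k. dV k (\<omega> k)) \<in> S_inf B"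
  shows "restr (\<lambda>k. dV k (\<omega> k)) \<in> contact_forms B"
proof -
  obtain r where r: "\<And>k p. kys (\<omega> k p) \<subseteq> mons_upto B r" using compat_bound[OF assms(1)] by blast
  have "pds A L (\<omega> k p) = 0" if "k \<in> charts B" "p \<notin> cdom B k" for A L k p
    using fun_cong[OF fun_cong[OF compat_restr[OF assms(1)]], of k p] that by (simp add: restr_def)
  moreover have "kys (pds A L a) \<subseteq> mons_upto B r" if "kys a \<subseteq> mons_upto B r" for A L and a :: "'n salg"
    using keys_pds that reduced_add_msetD by (fastforce simp: mons_upto_def)
  ultimately have "(\<lambda>p. pds A L (\<omega> k p)) \<in> local_forms B k" if "k \<in> charts B" for A L k
    unfolding local_forms_def using that r
    by (intro UN_I[of r] local_forms_uptoI germ_form_pds compat_germ_form[OF assms(1)]) auto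
  then show ?thesis
    unfolding contact_forms_def using assms(2)
    by (auto intro!: exI[of _ "jetvars B r"] exI[of _ "\<lambda>A L p. pds A L (\<omega> _ p)"] simp: restr_def dV_eq[OF r])
       (auto simp: jetvars_def)
qed

end

section \<open>Global functions with a prescribed germ\<close>

subsection \<open>Extension of germs to global forms\<close>

lemma mdeg_0_iff: "mdeg M = 0 \<longleftrightarrow> (\<forall>g\<in>#M. gdeg g = 0)"
  by (induction M) auto

context jet_setting
begin

lemma enum_of_empty [simp]: "enum_of {#} = ([] :: 'n list)"
  using mset_enum_of[of "{#}"] by (metis mset_zero_iff)

text \<open>The cocycle law of jet transition functions, by induction on the order: order 0 is the
  cocycle law of the bundle, and each further index combines the invariance of total derivatives
  with the chain rule for Jacobians.\<close>

lemma transport_jet_coord: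
  "A \<in> flds B \<Longrightarrow> overlap i j p \<Longrightarrow> overlap j k p \<Longrightarrow> transport i j p (jet_coord ls j k A p) = jet_coord ls i k A p"
proof (induction ls arbitrary: p)
  case Nil
  note ch = Nil(2,3)[unfolded overlap_def]
  have ik: "overlap i k p" using Nil by (simp add: overlap_def)
  show ?case
  proof (cases A)
    case (Ev a)
    then show ?thesis
      unfolding jet_coord_simps Ev fld_trans_Ev transport_def
      using Nil(1) Ev ch by (intro subst_aff_trans[OF graded_gen_transport[OF Nil(2)] _ affY]) (auto simp: fld_trans_Ev)
  next
    case (Od a)
    then have a: "a < frank (bunQ B)" using Nil(1) by simp
    have "subst_alg (gen_transport i j p) (aff_trans (bunQ B) Od j k a p) = aff_trans (bunQ B) Od i k a p"
      using a ch by (intro subst_aff_trans[OF graded_gen_transport[OF Nil(2)] _ affQ]) (auto simp: fld_trans_Od[OF Nil(2)] simp del: fld_trans.simps)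
    then show ?thesis
      unfolding jet_coord_simps Od transport_def by (simp add: fld_trans_Od[OF Nil(3) a] fld_trans_Od[OF ik a] del: fld_trans.simps)
  qed
next
  case (Cons l ls)
  note o = Cons.prems(2,3)
  have ij: "i \<in> charts B" "p \<in> cdom B i" "j \<in> charts B" "p \<in> cdom B j" "k \<in> charts B" "p \<in> cdom B k"
    using o by (auto simp: overlap_def)
  let ?h = "jet_coord ls j k A" and ?H = "\<lambda>q. transport i j q (jet_coord ls j k A q)"
  let ?a = "\<lambda>m. pd B k l (\<lambda>q. crd B j q $ m) p"
  let ?b = "\<lambda>m n. pd B j m (\<lambda>q. crd B i q $ n) p"
  note h = germ_form_jet_coord[OF Cons.prems(1,3)] jet_coord_mdeg[OF Cons.prems(1,3)]
  have "transport i j p (jet_coord (l # ls) j k A p) = (\<Sum>m\<in>UNIV. gconst (?a m) \<cdot> prolong B i j m ?H p)"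
    using ij by (simp add: prolong_def[of B j k] transport_gmul[OF o(1)] transport_totd[OF o(1) h] germ_form_redu germ_form_totd h)
  also have "\<dots> = (\<Sum>m\<in>UNIV. \<Sum>n\<in>UNIV. gconst (?a m * ?b m n) \<cdot> totd B i n ?H p)"
    by (simp add: prolong_def gmul_sum_right gconst_gconst_gmul)
  also have "\<dots> = (\<Sum>n\<in>UNIV. gconst (\<Sum>m\<in>UNIV. ?a m * ?b m n) \<cdot> totd B i n ?H p)"
    unfolding gconst_sum gmul_sum_left by (rule sum.swap)
  also have "\<dots> = prolong B i k l ?H p"
    using pd_chain[OF ij(5,3,6,4) sm_crd[OF ij(1,2)], of l] by (simp add: prolong_def)
  also have "\<dots> = prolong B i k l (jet_coord ls i k A) p"
  proof (rule prolong_cong[OF ij(1,2)])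
    show "\<forall>\<^sub>F q in nhds p. ?H q = jet_coord ls i k A q"
      using overlap_eventually[OF o(1)] overlap_eventually[OF o(2)] by eventually_elim (use Cons in blast)
  qed
  finally show ?case by simp
qed

lemma jet_coord_self:
  "A \<in> flds B \<Longrightarrow> k \<in> charts B \<Longrightarrow> p \<in> cdom B k \<Longrightarrow> jet_coord ls k k A p = gvar (Sg A (mset ls))"
proof (induction ls arbitrary: p)
  case Nil
  have o: "overlap k k p" using Nil by (simp add: overlap_def)
  show ?case
  proof (cases A)
    case (Ev a)
    then show ?thesis unfolding jet_coord_simps Ev fld_trans_Ev using Nil Ev by (simp add: aff_trans_self affY)
  next
    case (Od a)
    then have "a < frank (bunQ B)" using Nil(1) by simp
    then show ?thesis using Nil Od by (simp add: fld_trans_Od[OF o] aff_trans_self affQ del: fld_trans.simps)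
  qed
next
  case (Cons l ls)
  have o: "overlap k k p" using Cons by (simp add: overlap_def)
  have "\<forall>\<^sub>F q in nhds p. jet_coord ls k k A q = gvar (Sg A (mset ls))"
    using eventually_cdom[OF Cons.prems(2,3)] by eventually_elim (use Cons in blast)
  from totd_cong[OF Cons.prems(2,3) this] show ?case
    using Cons.prems germ_form_jet_coord[OF _ o] by (simp add: prolong_self totd_gvar)
qed

text \<open>The cut-off multiplies the prolonged coordinate, so that no derivative of
  \<open>c\<close> enters. The form has to be given in every chart \<open>j\<close> and not only in
  \<open>k\<close>; compatibility is the cocycle law.\<close>

definition jet_form :: "('x \<Rightarrow> real) \<Rightarrow> 'k \<Rightarrow> fld \<Rightarrow> 'n list \<Rightarrow> ('x, 'n, 'k) gform" where
  "jet_form c k A ls = restr (\<lambda>j p. if p \<in> cdom B k then gconst (c p) \<cdot> jet_coord ls j k A p else 0)"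

lemma jet_form_keys:
  assumes "k \<in> charts B" "A \<in> flds B" "M \<in> kys (jet_form c k A ls j p)"
  shows "jet_mon A (length ls) M"
proof -
  have "j \<in> charts B" "p \<in> cdom B j" "p \<in> cdom B k" "M \<in> kys (gconst (c p) \<cdot> jet_coord ls j k A p)"
    using assms(3) by (auto simp: jet_form_def restr_def split: if_splits)
  then show ?thesis using jet_mon_jet_coord[OF assms(2), of j k p M] assms(1) by (auto simp: overlap_def dest: keys_gconst_gmulE)
qed

lemma jet_form_avoiding:
  assumes k: "k \<in> charts B" and A: "A \<in> flds B" and c: "\<And>q. sm q c" "closed Z0" "Z0 \<subseteq> cdom B k" "\<And>q. q \<notin> Z0 \<Longrightarrow> c q = 0"
    and Z: "typ_pred Z" "\<not> Z (Sg A {#})"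
  shows "jet_form c k A ls \<in> avoiding Z"
  unfolding jet_form_def
proof (rule avoidingI[where r = "Suc (length ls)"])
  let ?h = "\<lambda>j p. if p \<in> cdom B k then gconst (c p) \<cdot> jet_coord ls j k A p else 0"
  fix j p assume j: "j \<in> charts B" "p \<in> cdom B j"
  show "germ_form p (?h j)"
  proof (cases "p \<in> cdom B k")
    case True
    show ?thesis
    proof (rule germ_form_cong)
      show "germ_form p (\<lambda>q. gconst (c q) \<cdot> jet_coord ls j k A q)"
        using j k True by (intro germ_form_gconst_gmul c germ_form_jet_coord A) (auto simp: overlap_def)
      show "\<forall>\<^sub>F q in nhds p. gconst (c q) \<cdot> jet_coord ls j k A q = ?h j q"
        using eventually_cdom[OF k True] by eventually_elim simp
    qed
  next
    case False
    \<comment> \<open>Off the closed support the form is 0 near \<open>p\<close>; this handles the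
      boundary of the domain of chart \<open>k\<close>.\<close>
    then have "\<forall>\<^sub>F q in nhds p. q \<in> - Z0" using c by (intro eventually_nhds_in_open) auto
    then have "\<forall>\<^sub>F q in nhds p. 0 = ?h j q" by eventually_elim (use c(4) in auto)
    then show ?thesis by (rule germ_form_cong[OF germ_form_zero])
  qed
  have J: "jet_mon A (length ls) M \<and> reduced M" if "M \<in> kys (?h j p)" for M
    using jet_form_keys[OF k A, of M c ls j p] that j redu_gmul[of "gconst (c p)" "jet_coord ls j k A p"]
    by (auto simp: jet_form_def restr_def redu_def split: if_splits)
  show "kys (?h j p) \<subseteq> mons_upto B (Suc (length ls))"
  proof
    fix M assume "M \<in> kys (?h j p)"
    from J[OF this] show "M \<in> mons_upto B (Suc (length ls))" by (auto simp: jet_mon_def mons_upto_def)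
  qed
  show "\<not> Z g" if "M \<in> kys (?h j p)" "g \<in># M" for M g
    using J[OF that(1)] that(2) Z by (auto simp: jet_mon_def typ_pred_def of_Y_simp of_Q_simp)
next
  fix i j p assume o: "overlap i j p"
  show "(if p \<in> cdom B k then gconst (c p) \<cdot> jet_coord ls i k A p else 0) =
    transport i j p (if p \<in> cdom B k then gconst (c p) \<cdot> jet_coord ls j k A p else 0)"
  proof (cases "p \<in> cdom B k")
    case True
    then have "overlap j k p" using o k by (simp add: overlap_def)
    then show ?thesis
      using True transport_jet_coord[OF A o, of k ls] germ_form_redu[OF germ_form_jet_coord[OF A]] by (simp add: transport_gmul[OF o])
  qed simp
qed

text \<open>
  The coordinates \<open>x\<^sup>\<lambda>\<close> and \<open>s\<^sup>A\<close> involve only such monomials; forms built from them are a class on which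
  the order of \<open>\<upsilon>(f)\<close> can be bounded uniformly in \<open>f\<close>.
\<close>

definition lin :: "'n gen multiset \<Rightarrow> bool" where
  "lin M \<longleftrightarrow> M = {#} \<or> (\<exists>A. M = {#Sg A {#}#})"

text \<open>A stand-in for a coordinate function, which is not global. Bidegree and membership in
  the factors are recorded because the rules for contraction ask for them.\<close>

definition ext_X :: "'k \<Rightarrow> 'x \<Rightarrow> 'n \<Rightarrow> ('x, 'n, 'k) gform \<Rightarrow> bool" where
  "ext_X k p l X \<longleftrightarrow> X \<in> C_inf B \<and> X \<in> P_inf B \<and> hom_deg 0 X \<and> hom_par 0 X \<and>
     (\<forall>\<^sub>F q in nhds p. X k q = gconst (crd B k q $ l))"

definition ext_S :: "'k \<Rightarrow> 'x \<Rightarrow> fld \<Rightarrow> 'n multiset \<Rightarrow> ('x, 'n, 'k) gform \<Rightarrow> bool" where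
  "ext_S k p A L S \<longleftrightarrow> (S \<in> C_inf B \<or> S \<in> P_inf B) \<and> hom_deg 0 S \<and> hom_par (fpar A) S \<and>
     (\<forall>\<^sub>F q in nhds p. S k q = gvar (Sg A L))"

lemma ext_X_eventually: "ext_X k p l X \<Longrightarrow> \<forall>\<^sub>F q in nhds p. ext_X k q l X"
  unfolding ext_X_def by (simp add: eventually_eventually)

lemma ext_S_eventually: "ext_S k p A L S \<Longrightarrow> \<forall>\<^sub>F q in nhds p. ext_S k q A L S"
  unfolding ext_S_def by (simp add: eventually_eventually)

lemma sm_extend:
  assumes "sm p a"
  obtains f where "\<And>q. sm q f" "\<forall>\<^sub>F q in nhds p. f q = a q"
proof -
  obtain V where V: "open V" "p \<in> V" "\<And>q. q \<in> V \<Longrightarrow> sm q a"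
    using sm_eventually[OF assms] unfolding eventually_nhds by blast
  obtain c Z where c: "\<And>q. sm q c" "closed Z" "Z \<subseteq> V" "\<And>q. q \<notin> Z \<Longrightarrow> c q = 0" "\<forall>\<^sub>F q in nhds p. c q = 1"
    using bump_function[OF V(1,2)] by metis
  show thesis
  proof
    show "sm q (\<lambda>q. c q * a q)" for q
    proof (cases "q \<in> V")
      case True
      then show ?thesis by (intro sm_mult c V)
    next
      case False
      then have "\<forall>\<^sub>F q in nhds q. q \<in> - Z" using c by (intro eventually_nhds_in_open) auto
      then have "\<forall>\<^sub>F q in nhds q. 0 = c q * a q" by eventually_elim (use c(4) in simp)
      then show ?thesis by (rule sm_cong[OF sm_const])
    qed
    show "\<forall>\<^sub>F q in nhds p. c q * a q = a q" using c(5) by (auto elim: eventually_mono)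
  qed
qed

lemma base_extend:
  assumes "k \<in> charts B" "p \<in> cdom B k" "sm p a"
  obtains f where "\<And>q. sm q f" "\<forall>\<^sub>F q in nhds p. base f k q = gconst (a q)"
proof -
  obtain f where f: "\<And>q. sm q f" "\<forall>\<^sub>F q in nhds p. f q = a q" using sm_extend[OF assms(3)] by metis
  have "\<forall>\<^sub>F q in nhds p. base f k q = gconst (a q)"
    using f(2) eventually_cdom[OF assms(1,2)] by eventually_elim (simp add: base_apply assms)
  with f(1) show thesis by (rule that)
qed

lemma ext_X_exists:
  assumes "k \<in> charts B" "p \<in> cdom B k"
  shows "\<exists>X. ext_X k p l X \<and> (\<forall>j q. \<forall>M\<in>kys (X j q). lin M)"
proof -
  obtain f where f: "\<And>q. sm q f" "\<forall>\<^sub>F q in nhds p. base f k q = gconst (crd B k q $ l)"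
    using base_extend[OF assms sm_crd[OF assms]] by metis
  moreover have "lin M" if "M \<in> kys (base f j q)" for M j q
    using that by (auto simp: base_def restr_def lin_def dest!: keys_gconst split: if_splits)
  ultimately show ?thesis
    unfolding ext_X_def C_inf_eq P_inf_eq using base_avoiding[OF f(1)] base_hom by blast
qed

lemma ext_S_exists:
  assumes "k \<in> charts B" "p \<in> cdom B k" "A \<in> flds B"
  shows "\<exists>S. ext_S k p A L S \<and> (L = {#} \<longrightarrow> (\<forall>j q. \<forall>M\<in>kys (S j q). lin M))"
proof -
  obtain c Z where c: "\<And>q. sm q c" "closed Z" "Z \<subseteq> cdom B k" "\<And>q. q \<notin> Z \<Longrightarrow> c q = 0" "\<forall>\<^sub>F q in nhds p. c q = 1"
    using bump_function[OF open_cdom[OF assms(1)] assms(2)] by metis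
  define S where "S = jet_form c k A (enum_of L)"
  note J = jet_form_keys[OF assms(1,3)]
  have "S \<in> avoiding of_Y \<or> S \<in> avoiding of_Q"
  proof (cases "of_Y (Sg A {#} :: 'n gen)")
    case True
    then have "\<not> of_Q (Sg A {#} :: 'n gen)" by (simp add: of_Y_simp of_Q_simp)
    then show ?thesis unfolding S_def using jet_form_avoiding[OF assms(1,3) c(1-4) typ_pred_cases(2)] by blast
  next
    case False
    then show ?thesis unfolding S_def using jet_form_avoiding[OF assms(1,3) c(1-4) typ_pred_cases(1)] by blast
  qed
  moreover have "hom_deg 0 S" "hom_par (fpar A) S"
    unfolding hom_deg_iff hom_par_iff S_def using J jet_mon_mdeg jet_mon_mpar by fastforce+
  moreover have "\<forall>\<^sub>F q in nhds p. S k q = gvar (Sg A L)"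
    using c(5) eventually_cdom[OF assms(1,2)]
    by eventually_elim (simp add: S_def jet_form_def restr_def jet_coord_self assms)
  moreover have "lin M" if "M \<in> kys (S j q)" "L = {#}" for M j q
    using J[OF that(1)[unfolded S_def]] that(2) by (auto simp: jet_mon_def lin_def)
  ultimately show ?thesis unfolding ext_S_def C_inf_eq P_inf_eq by blast
qed

text \<open>A function in \<open>S0_inf\<close> may be a sum of products of inhomogeneous factors
  whose parts of higher degree cancel, and then it is not evident that its differential lies in
  \<open>S_inf\<close>. With factors of degree 0 this follows from the Leibniz rule.\<close>

inductive_set split_forms :: "('x, 'n, 'k) gform set" where
  split_forms_wedge: "\<phi> \<in> C_inf B \<Longrightarrow> hom_deg 0 \<phi> \<Longrightarrow> \<psi> \<in> P_inf B \<Longrightarrow> hom_deg 0 \<psi> \<Longrightarrow> \<phi> \<and>\<^sub>g \<psi> \<in> split_forms"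
| split_forms_add: "a \<in> split_forms \<Longrightarrow> b \<in> split_forms \<Longrightarrow> a +\<^sub>g b \<in> split_forms"
| split_forms_zero: "(\<lambda>_ _. 0) \<in> split_forms"

lemma hom_deg_wedge: "hom_deg d a \<Longrightarrow> hom_deg e b \<Longrightarrow> hom_deg (d + e) (a \<and>\<^sub>g b)"
  by (auto simp: hom_deg_iff wedge_def elim!: keys_gmulE)

lemma hom_deg_add: "hom_deg d a \<Longrightarrow> hom_deg d b \<Longrightarrow> hom_deg d (a +\<^sub>g b)"
  by (auto simp: hom_deg_iff fadd_def elim!: keys_addE)

lemma split_forms_S_inf: "a \<in> split_forms \<Longrightarrow> a \<in> S_inf B"
  by (induction rule: split_forms.induct) (auto intro: S_inf_wedgeI S_inf_add S_inf_zero)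

lemma split_forms_hom_deg: "a \<in> split_forms \<Longrightarrow> hom_deg 0 a"
  by (induction rule: split_forms.induct) (auto intro: hom_deg_add hom_deg_wedge[of 0 _ 0, simplified], auto simp: hom_deg_iff)

lemma split_forms_S0: "a \<in> split_forms \<Longrightarrow> a \<in> S0_inf B"
  by (simp add: S0_inf_def split_forms_S_inf split_forms_hom_deg)

lemma wedge_assoc: "a \<and>\<^sub>g b \<and>\<^sub>g c = a \<and>\<^sub>g (b \<and>\<^sub>g c)"
  by (simp add: wedge_def gmul_assoc)

lemma wedge_add_right: "a \<and>\<^sub>g (b +\<^sub>g c) = (a \<and>\<^sub>g b) +\<^sub>g (a \<and>\<^sub>g c)"
  by (simp add: wedge_def fadd_def gmul_add_right)

lemma wedge_zero_right: "a \<and>\<^sub>g (\<lambda>_ _. 0) = (\<lambda>_ _. 0)"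
  by (simp add: wedge_def)

text \<open>The generators occurring in \<open>P_inf\<close> have even parity, and against degree 0
  the form degrees cause no sign.\<close>

lemma wedge_P_commute:
  assumes "a \<in> P_inf B" "hom_deg 0 \<phi>"
  shows "a \<and>\<^sub>g \<phi> = \<phi> \<and>\<^sub>g a"
  unfolding wedge_def
proof (intro ext gmul_commute_noanti)
  fix k p M N g h assume *: "M \<in> kys (a k p)" "N \<in> kys (\<phi> k p)" "g \<in># M" "h \<in># N"
  have "\<not> of_Q g" using assms(1) * by (auto simp: P_inf_eq dest: avoiding_gens)
  then have "even (gpar g)" by (cases g) (auto simp: of_Q_simp)
  moreover have "gdeg h = 0" using assms(2) * by (metis hom_deg_iff mdeg_0_iff)
  ultimately show "\<not> anticomm g h" by (simp add: anticomm_def)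
qed

text \<open>\<open>S_inf\<close> wants the factor from \<open>C_inf\<close> first, so an
  \<open>a\<close> from \<open>P_inf\<close> has to be moved past \<phi>; this works because \<phi>
  has degree 0.\<close>

lemma split_forms_left_S_inf:
  assumes "a \<in> C_inf B \<or> a \<in> P_inf B" "G \<in> split_forms"
  shows "a \<and>\<^sub>g G \<in> S_inf B"
  using assms(2)
proof (induction rule: split_forms.induct)
  case (split_forms_wedge \<phi> \<psi>)
  from assms(1) show ?case
  proof
    assume "a \<in> C_inf B"
    then have "a \<and>\<^sub>g \<phi> \<in> C_inf B" using split_forms_wedge by (auto simp: C_inf_eq intro: avoiding_wedge)
    then show ?thesis using split_forms_wedge S_inf_wedgeI by (simp add: wedge_assoc[symmetric])
  next
    assume a: "a \<in> P_inf B"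
    then have "a \<and>\<^sub>g \<psi> \<in> P_inf B" using split_forms_wedge by (auto simp: P_inf_eq intro: avoiding_wedge)
    moreover have "a \<and>\<^sub>g (\<phi> \<and>\<^sub>g \<psi>) = \<phi> \<and>\<^sub>g (a \<and>\<^sub>g \<psi>)"
      using wedge_P_commute[OF a split_forms_wedge(2)] by (simp add: wedge_assoc[symmetric])
    ultimately show ?thesis using split_forms_wedge S_inf_wedgeI by simp
  qed
qed (auto simp: wedge_add_right wedge_zero_right intro: S_inf_add S_inf_zero)

lemma split_forms_left:
  assumes "a \<in> C_inf B \<or> a \<in> P_inf B" "hom_deg 0 a" "G \<in> split_forms"
  shows "a \<and>\<^sub>g G \<in> split_forms"
  using assms(3)
proof (induction rule: split_forms.induct)
  case (split_forms_wedge \<phi> \<psi>)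
  from assms(1) show ?case
  proof
    assume "a \<in> C_inf B"
    then have "a \<and>\<^sub>g \<phi> \<in> C_inf B" using split_forms_wedge by (auto simp: C_inf_eq intro: avoiding_wedge)
    then show ?thesis using split_forms_wedge split_forms.split_forms_wedge hom_deg_wedge[OF assms(2) split_forms_wedge(2)] by (simp add: wedge_assoc[symmetric])
  next
    assume a: "a \<in> P_inf B"
    then have "a \<and>\<^sub>g \<psi> \<in> P_inf B" using split_forms_wedge by (auto simp: P_inf_eq intro: avoiding_wedge)
    moreover have "a \<and>\<^sub>g (\<phi> \<and>\<^sub>g \<psi>) = \<phi> \<and>\<^sub>g (a \<and>\<^sub>g \<psi>)"
      using wedge_P_commute[OF a split_forms_wedge(2)] by (simp add: wedge_assoc[symmetric])
    ultimately show ?thesis using split_forms_wedge split_forms.split_forms_wedge hom_deg_wedge[OF assms(2) split_forms_wedge(4)] by simp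
  qed
qed (auto simp: wedge_add_right wedge_zero_right intro: split_forms.intros)

lemma C_P_compat: "a \<in> C_inf B \<or> a \<in> P_inf B \<Longrightarrow> a \<in> compatible_forms B"
  by (auto simp: C_inf_eq P_inf_eq intro: avoiding_compat)

lemma C_P_S_inf: "a \<in> C_inf B \<or> a \<in> P_inf B \<Longrightarrow> a \<in> S_inf B"
  using C_inf_S_inf P_inf_S_inf by blast

lemma gdiff_C_P:
  assumes "hom_deg d a"
  shows "a \<in> C_inf B \<Longrightarrow> gdiff B a \<in> C_inf B" "a \<in> P_inf B \<Longrightarrow> gdiff B a \<in> P_inf B"
  using avoiding_gdiff typ_pred_cases assms by (auto simp: C_inf_eq P_inf_eq)

lemma gdiff_add:
  assumes "a \<in> compatible_forms B" "b \<in> compatible_forms B"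
  shows "gdiff B (a +\<^sub>g b) = gdiff B a +\<^sub>g gdiff B b"
  by (intro ext) (use assms in \<open>auto simp: gdiff_def fadd_def ldiff_add compat_germ_form\<close>)

lemma gdiff_wedge_0:
  assumes "a \<in> compatible_forms B" "b \<in> compatible_forms B" "hom_deg 0 a"
  shows "gdiff B (a \<and>\<^sub>g b) = (gdiff B a \<and>\<^sub>g b) +\<^sub>g (a \<and>\<^sub>g gdiff B b)"
proof (intro ext)
  fix k p
  have "\<forall>\<^sub>F q in nhds p. \<forall>M\<in>kys (a k q). mdeg M = 0" using assms(3) by (simp add: hom_deg_iff)
  then show "gdiff B (a \<and>\<^sub>g b) k p = ((gdiff B a \<and>\<^sub>g b) +\<^sub>g (a \<and>\<^sub>g gdiff B b)) k p"
    using ldiff_gmul[of k p "a k" 0 "b k"] assms(1,2) by (auto simp: gdiff_def fadd_def wedge_def compat_germ_form)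
qed

lemma gdiff_zero: "gdiff B (\<lambda>_ _. 0) = (\<lambda>_ _. 0)"
  by (auto simp: gdiff_def fun_eq_iff)

lemma gdiff_split_forms: "G \<in> split_forms \<Longrightarrow> gdiff B G \<in> S_inf B"
proof (induction rule: split_forms.induct)
  case (split_forms_wedge \<phi> \<psi>)
  then have "gdiff B \<phi> \<in> C_inf B" "gdiff B \<psi> \<in> P_inf B" using gdiff_C_P by blast+
  then show ?case
    using split_forms_wedge by (subst gdiff_wedge_0) (auto intro: C_P_compat S_inf_add S_inf_wedgeI)
next
  case (split_forms_add a b)
  then show ?case using split_forms_S_inf S_inf_compat by (subst gdiff_add) (auto intro: S_inf_add)
qed (simp add: gdiff_zero S_inf_zero)

text \<open>Each coefficient and each generator is extended on its own, so that the result is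
  visibly built from products of the two factors.\<close>

lemma split_forms_extend:
  assumes k: "k \<in> charts B" "p \<in> cdom B k" and f: "germ_form p f" "\<forall>\<^sub>F q in nhds p. \<forall>M\<in>kys (f q). mdeg M = 0"
  shows "\<exists>G\<in>split_forms. \<forall>\<^sub>F q in nhds p. G k q = f q"
proof -
  have "d = 0 \<longrightarrow> (\<exists>G\<in>split_forms. \<forall>\<^sub>F q in nhds p. G k q = f q)"
    if "germ_form p f" "\<forall>\<^sub>F q in nhds p. \<forall>M\<in>kys (f q). mdeg M = d" for d f
    using that
  proof (induction rule: germ_form_induct)
    case (const a)
    obtain f where f: "\<And>q. sm q f" "\<forall>\<^sub>F q in nhds p. base f k q = gconst (a q)"
      using base_extend[OF k const] by metis
    have "base f \<and>\<^sub>g base (\<lambda>_. 1) \<in> split_forms"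
      using base_avoiding f(1) base_hom by (intro split_forms_wedge) (auto simp: C_inf_eq P_inf_eq)
    then show ?case using f one_right[OF avoiding_compat[OF base_avoiding[OF f(1)]]] by auto
  next
    case (gvar g d f)
    show ?case
    proof
      assume "gdeg g + d = 0"
      then obtain A L where g: "g = Sg A L" "d = 0" "A \<in> flds B" using gvar(1) by (cases g) auto
      obtain S where S: "ext_S k p A L S" using ext_S_exists[OF k g(3)] by blast
      obtain G where G: "G \<in> split_forms" "\<forall>\<^sub>F q in nhds p. G k q = f q" using gvar(4) g by blast
      have "S \<and>\<^sub>g G \<in> split_forms" using S G by (auto simp: ext_S_def intro: split_forms_left)
      moreover have "\<forall>\<^sub>F q in nhds p. S k q = gvar (Sg A L)" using S by (simp add: ext_S_def)
      then have "\<forall>\<^sub>F q in nhds p. (S \<and>\<^sub>g G) k q = gvar g \<cdot> f q"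
        using G(2) by eventually_elim (simp add: wedge_def g)
      ultimately show "\<exists>G\<in>split_forms. \<forall>\<^sub>F q in nhds p. G k q = gvar g \<cdot> f q" by blast
    qed
  next
    case (add d f f')
    show ?case
    proof
      assume "d = 0"
      then obtain G G' where G: "G \<in> split_forms" "\<forall>\<^sub>F q in nhds p. G k q = f q" "G' \<in> split_forms" "\<forall>\<^sub>F q in nhds p. G' k q = f' q"
        using add by blast
      have "\<forall>\<^sub>F q in nhds p. (G +\<^sub>g G') k q = f q + f' q"
        using G(2,4) by eventually_elim (simp add: fadd_def)
      then show "\<exists>G\<in>split_forms. \<forall>\<^sub>F q in nhds p. G k q = f q + f' q" using split_forms_add[OF G(1,3)] by blast
    qed
  next
    case (zero d)
    then show ?case using split_forms_zero by force
  next
    case (cong d f f')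
    show ?case
    proof
      assume "d = 0"
      then obtain G where G: "G \<in> split_forms" "\<forall>\<^sub>F q in nhds p. G k q = f q" using cong by blast
      have "\<forall>\<^sub>F q in nhds p. G k q = f' q" using G(2) cong(2) by eventually_elim simp
      with G(1) show "\<exists>G\<in>split_forms. \<forall>\<^sub>F q in nhds p. G k q = f' q" by blast
    qed
  qed
  then show ?thesis using f by blast
qed

lemma gdiff_ext_X:
  assumes k: "k \<in> charts B" "p \<in> cdom B k" and X: "ext_X k p l X"
  shows "\<forall>\<^sub>F q in nhds p. gdiff B X k q = gvar (DX l)"
proof -
  have "\<forall>\<^sub>F q in nhds p. ldiff B k (X k) q = ldiff B k (\<lambda>q. gconst (crd B k q $ l)) q"
    by (rule ldiff_eventually_cong[OF k]) (use X in \<open>simp add: ext_X_def\<close>)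
  then show ?thesis
    using eventually_cdom[OF k]
  proof eventually_elim
    case (elim q)
    have "gvar (DX m) \<cdot> gconst (if m = l then 1 else 0) = (if m = l then gvar (DX l) else 0)" for m :: 'n
      by simp
    then show ?case using elim k by (simp add: gdiff_def ldiff_gconst sm_crd pd_crd)
  qed
qed

lemma gdiff_ext_S:
  assumes k: "k \<in> charts B" "p \<in> cdom B k" and S: "ext_S k p A L S" and A: "A \<in> flds B"
  shows "\<forall>\<^sub>F q in nhds p. gdiff B S k q = gvar (DS A L)"
proof -
  have "\<forall>\<^sub>F q in nhds p. ldiff B k (S k) q = ldiff B k (\<lambda>q. gvar (Sg A L)) q"
    by (rule ldiff_eventually_cong[OF k]) (use S in \<open>simp add: ext_S_def\<close>)
  then show ?thesis
    using eventually_cdom[OF k] by eventually_elim (use k A in \<open>simp add: gdiff_def ldiff_gvar\<close>)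
qed

end

section \<open>The horizontal projection and its kernel\<close>

section \<open>Horizontalization\<close>

text \<open>The horizontal projection, which replaces \<open>ds\<close> by its \<open>dx\<close>
  part. It annihilates contact forms and so extracts from the Lie derivative an identity between
  functions.\<close>

definition hor_gen :: "'n gen \<Rightarrow> ('n::finite) salg" where
  "hor_gen g = (case g of DS A L \<Rightarrow> \<Sum>l\<in>UNIV. gvar (Sg A (add_mset l L)) \<cdot> gvar (DX l) | _ \<Rightarrow> gvar g)"

lemma graded_hor_gen: "graded_subst (hor_gen :: 'n::finite gen \<Rightarrow> _)"
  unfolding graded_subst_def
proof
  fix g :: "'n gen"
  show "redu (hor_gen g) \<and> homog (gdeg g) (gpar g) (hor_gen g)"
  proof (cases g)
    case (DS A L)
    have "homog 1 (fpar A) (gvar (Sg A (add_mset l L)) \<cdot> gvar (DX l))" for l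
      using homog_gmul[OF homog_gvar homog_gvar, of "Sg A (add_mset l L)" "DX l"] by simp
    then show ?thesis using DS by (auto simp: hor_gen_def intro!: redu_sum homog_sum)
  qed (auto simp: hor_gen_def homog_gvar[of "Sg _ _", simplified] homog_gvar[of "DX _", simplified])
qed

abbreviation hor :: "('n::finite) salg \<Rightarrow> 'n salg" where "hor \<equiv> subst_alg hor_gen"

lemma hor_theta: "hor (theta A L) = 0"
  by (simp add: theta_def subst_alg_diff subst_alg_sum subst_alg_gmul graded_hor_gen subst_alg_gvar)
     (simp add: hor_gen_def)

lemma redu_theta [simp]: "redu (theta A L)"
  unfolding theta_def by (intro redu_diff redu_sum) auto

lemma hor_deg_0: "redu a \<Longrightarrow> \<forall>M\<in>kys a. mdeg M = 0 \<Longrightarrow> hor a = a"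
proof (rule subst_alg_cong_id[OF graded_hor_gen])
  fix M g assume "\<forall>M\<in>kys a. mdeg M = 0" "M \<in> kys a" "g \<in># M"
  then have "gdeg g = 0" by (metis mdeg_0_iff)
  then show "hor_gen g = gvar g" by (cases g) (auto simp: hor_gen_def)
qed

text \<open>Linear independence of the \<open>dx\<close> over functions: the coefficient of
  \<open>Z l\<close> at \<open>N\<close> reappears, up to sign, at \<open>N\<close> with
  \<open>DX l\<close> added, and no other summand contributes there.\<close>

lemma sum_DX_gmul_eq_0:
  assumes "(\<Sum>l\<in>UNIV. gvar (DX l) \<cdot> Z l) = 0" "\<And>l. redu (Z l)" "\<And>l M. M \<in> kys (Z l) \<Longrightarrow> mdeg M = 0"
  shows "Z l = 0"
proof (rule poly_mapping_eqI, simp, rule ccontr)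
  fix N assume N: "lkp (Z l) N \<noteq> 0"
  then have r: "reduced N" and d: "mdeg N = 0" using assms(2,3) by (auto simp: redu_def in_keys_iff)
  have nin: "DX m \<notin># N" for m using d by (auto simp: mdeg_0_iff)
  have red: "reduced (add_mset (DX l) N)" using r nin by (simp add: reduced_add_mset)
  have "lkp (gvar (DX m) \<cdot> Z m) (add_mset (DX l) N) = (if m = l then tw {#DX l#} N * lkp (Z l) N else 0)" for m
    using nin red by (auto simp: lookup_gvar_gmul)
  then have "lkp (\<Sum>m\<in>UNIV. gvar (DX m) \<cdot> Z m) (add_mset (DX l) N) = tw {#DX l#} N * lkp (Z l) N"
    by (simp add: lookup_sum)
  then have "tw {#DX l#} N = 0" using assms(1) N by simp
  then show False using tw_square[of "{#DX l#}" N] by simp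
qed

context jet_setting
begin

lemma hor_ldiff:
  assumes k: "k \<in> charts B" "p \<in> cdom B k" and f: "germ_form p f" "\<forall>\<^sub>F q in nhds p. \<forall>M\<in>kys (f q). mdeg M = 0"
  shows "hor (ldiff B k f p) = (\<Sum>l\<in>UNIV. gvar (DX l) \<cdot> totd B k l f p)"
proof -
  have d: "\<forall>M\<in>kys (f p). mdeg M = 0" using f(2) eventually_nhds_x_imp_x by fastforce
  have 1: "hor (gvar (DX l) \<cdot> pdx B k l f p) = gvar (DX l) \<cdot> pdx B k l f p" for l
    using keys_pdx[OF k f] germ_form_redu[OF germ_form_pdx[OF k f(1)]]
    by (simp add: subst_alg_gvar_gmul graded_hor_gen hor_deg_0 hor_gen_def)
  have "\<forall>M\<in>kys (pds A L (f p)). mdeg M = 0" for A L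
    using d by (force dest!: keys_pds)
  then have 2: "hor (gvar (DS A L) \<cdot> pds A L (f p)) = (\<Sum>l\<in>UNIV. gvar (DX l) \<cdot> (gvar (Sg A (add_mset l L)) \<cdot> pds A L (f p)))" for A L
    using redu_pds[OF germ_form_redu[OF f(1)]]
    by (simp add: subst_alg_gvar_gmul graded_hor_gen hor_deg_0 hor_gen_def gmul_sum_left gmul_assoc[symmetric] gvar_DX_Sg)
  have "hor (der_ext (f p)) = (\<Sum>l\<in>UNIV. gvar (DX l) \<cdot> der_tot l (f p))"
    unfolding der_def subst_alg_sum gmul_sum_right split_def 2 by (rule sum.swap)
  then show ?thesis
    by (simp add: ldiff_eq totd_eq subst_alg_add subst_alg_sum 1 gmul_add_right sum.distrib)
qed

lemma contact_hor:
  assumes "\<omega> \<in> contact_forms B" "k \<in> charts B" "p \<in> cdom B k"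
  shows "hor (\<omega> k p) = 0"
proof -
  obtain F \<eta> where F: "\<forall>(A, L)\<in>F. A \<in> flds B \<and> \<eta> A L \<in> local_forms B k"
    "\<forall>p\<in>cdom B k. \<omega> k p = (\<Sum>(A, L)\<in>F. theta A L \<cdot> \<eta> A L p)"
    using assms unfolding contact_forms_def by blast
  have "hor (theta (fst s) (snd s) \<cdot> \<eta> (fst s) (snd s) p) = 0" if "s \<in> F" for s
  proof -
    have "\<eta> (fst s) (snd s) \<in> local_forms B k" using F(1) that by (auto simp: split_def)
    then have "redu (\<eta> (fst s) (snd s) p)"
      by (auto simp: local_forms_def local_forms_upto_def redu_def)
    then show ?thesis by (simp add: subst_alg_gmul graded_hor_gen hor_theta)
  qed
  then show ?thesis using F(2) assms(3) by (simp add: subst_alg_sum split_def)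
qed

section \<open>Derivations and contractions are local operators\<close>

section \<open>Locality\<close>

definition gsum :: "'i set \<Rightarrow> ('i \<Rightarrow> ('x, 'n, 'k) gform) \<Rightarrow> ('x, 'n, 'k) gform" where
  "gsum I F = (\<lambda>k p. \<Sum>i\<in>I. F i k p)"

lemma gsum_S_inf: "finite I \<Longrightarrow> (\<And>i. i \<in> I \<Longrightarrow> F i \<in> S_inf B) \<Longrightarrow> gsum I F \<in> S_inf B"
proof (induction I rule: finite_induct)
  case empty
  then show ?case by (simp add: gsum_def S_inf_zero)
next
  case (insert i I)
  then have "gsum (insert i I) F = F i +\<^sub>g gsum I F" by (simp add: gsum_def fadd_def)
  then show ?case using insert by (auto intro: S_inf_add)
qed

lemma S0_inf_add: "a \<in> S0_inf B \<Longrightarrow> b \<in> S0_inf B \<Longrightarrow> a +\<^sub>g b \<in> S0_inf B"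
  by (auto simp: S0_inf_def S_inf_add hom_deg_add)

lemma S0_inf_scale: "a \<in> S0_inf B \<Longrightarrow> fscale r a \<in> S0_inf B"
proof -
  assume a: "a \<in> S0_inf B"
  then have "hom_deg 0 (fscale r a)" by (auto simp: S0_inf_def hom_deg_iff fscale_def dest: keys_gconst_gmulE)
  with a show ?thesis by (simp add: S0_inf_def S_inf_scale)
qed

lemma base_S0: "(\<And>p. sm p f) \<Longrightarrow> base f \<in> S0_inf B"
  using base_avoiding[of f of_Y] base_hom by (simp add: S0_inf_def C_inf_S_inf C_inf_eq)

lemma S_inf_redu: "a \<in> S_inf B \<Longrightarrow> redu (a k p)"
  using S_inf_compat compat_bound mons_upto_redu by (metis subsetD)

text \<open>The bump is supported where the form vanishes in chart \<open>k\<close>, hence in every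
  chart, by compatibility.\<close>

lemma bump_wedge_zero:
  assumes "\<omega> \<in> compatible_forms B" "k \<in> charts B" "p \<in> cdom B k" "\<forall>\<^sub>F q in nhds p. \<omega> k q = 0"
  obtains c where "\<And>q. sm q c" "c p = 1" "base c \<and>\<^sub>g \<omega> = (\<lambda>_ _. 0)"
proof -
  obtain V where V: "open V" "p \<in> V" "\<And>q. q \<in> V \<Longrightarrow> \<omega> k q = 0 \<and> q \<in> cdom B k"
    using eventually_conj[OF assms(4) eventually_cdom[OF assms(2,3)]] unfolding eventually_nhds by blast
  obtain c Z where c: "\<And>q. sm q c" "closed Z" "Z \<subseteq> V" "\<And>q. q \<notin> Z \<Longrightarrow> c q = 0" "\<forall>\<^sub>F q in nhds p. c q = 1"
    using bump_function[OF V(1,2)] by metis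
  have "(base c \<and>\<^sub>g \<omega>) j q = 0" for j q
  proof (cases "j \<in> charts B \<and> q \<in> cdom B j")
    case True
    show ?thesis
    proof (cases "q \<in> V")
      case qV: True
      then have "overlap j k q" using True V(3) assms(2) by (simp add: overlap_def)
      from compat_transport[OF assms(1) this] show ?thesis using V(3)[OF qV] by (simp add: wedge_def)
    next
      case False
      then have "c q = 0" using c by blast
      then show ?thesis using True by (simp add: wedge_def base_apply)
    qed
  qed (auto simp: wedge_def base_def restr_def)
  then have "base c \<and>\<^sub>g \<omega> = (\<lambda>_ _. 0)" by (intro ext)
  then show thesis using that[of c] c(1) eventually_nhds_x_imp_x[OF c(5)] by blast
qed

lemma fscale_0: "fscale 0 a = (\<lambda>_ _. 0)"
  by (simp add: fscale_def)

lemma linear_map_zero: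
  assumes "linear_map_on V W u" "(\<lambda>_ _. 0) \<in> V"
  shows "u (\<lambda>_ _. 0) = (\<lambda>_ _. 0)"
proof -
  have "u (fscale 0 (\<lambda>_ _. 0)) = fscale 0 (u (\<lambda>_ _. 0))"
    using assms unfolding linear_map_on_def by blast
  then show ?thesis by (simp add: fscale_0)
qed

text \<open>The product rule for bump times \<open>f\<close>, which is 0, leaves \<open>u f\<close>
  at \<open>p\<close>, since there \<open>f\<close> vanishes and the bump is 1.\<close>

lemma derivation_local:
  assumes u: "homogeneous_derivation B e u" and f: "f \<in> S0_inf B" and k: "k \<in> charts B" "p \<in> cdom B k"
    and z: "\<forall>\<^sub>F q in nhds p. f k q = 0"
  shows "u f k p = 0"
proof -
  note lin = u[unfolded homogeneous_derivation_def, THEN conjunct1]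
  have fc: "f \<in> compatible_forms B" using f S_inf_compat by (auto simp: S0_inf_def)
  obtain c where c: "\<And>q. sm q c" "c p = 1" "base c \<and>\<^sub>g f = (\<lambda>_ _. 0)"
    using bump_wedge_zero[OF fc k z] by metis
  have "u (base c \<and>\<^sub>g f) = (u (base c) \<and>\<^sub>g f) +\<^sub>g fscale ((- 1) ^ (0 * e)) (base c \<and>\<^sub>g u f)"
    using u base_S0[OF c(1)] f base_hom(2)[of c] unfolding homogeneous_derivation_def by blast
  moreover have "u (\<lambda>_ _. 0) = (\<lambda>_ _. 0)"
    using linear_map_zero[OF lin] split_forms_S0[OF split_forms_zero] by blast
  ultimately have "(u (base c) \<and>\<^sub>g f) k p + fscale 1 (base c \<and>\<^sub>g u f) k p = 0"
    unfolding c(3) by (simp add: fadd_def fun_eq_iff)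
  moreover have "f k p = 0" using z eventually_nhds_x_imp_x by fastforce
  moreover have "redu (u f k p)" using lin f S_inf_redu by (auto simp: linear_map_on_def S0_inf_def)
  ultimately show ?thesis using k c(2) by (simp add: wedge_def fscale_def base_apply)
qed

text \<open>Contraction kills functions, so the bump passes through it.\<close>

lemma interior_local:
  assumes i: "homogeneous_interior B e u i" and f: "f \<in> S_inf B" and k: "k \<in> charts B" "p \<in> cdom B k"
    and z: "\<forall>\<^sub>F q in nhds p. f k q = 0"
  shows "i f k p = 0"
proof -
  note lin = i[unfolded homogeneous_interior_def, THEN conjunct1]
  have fc: "f \<in> compatible_forms B" using f S_inf_compat by auto
  obtain c where c: "\<And>q. sm q c" "c p = 1" "base c \<and>\<^sub>g f = (\<lambda>_ _. 0)"
    using bump_wedge_zero[OF fc k z] by metis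
  have "base c \<in> S_inf B" using base_S0[OF c(1)] by (simp add: S0_inf_def)
  then have "i (base c \<and>\<^sub>g f) = (i (base c) \<and>\<^sub>g f) +\<^sub>g fscale ((- 1) ^ (0 + 0 * e)) (base c \<and>\<^sub>g i f)"
    using i f base_hom[of c] unfolding homogeneous_interior_def by blast
  moreover have "i (\<lambda>_ _. 0) = (\<lambda>_ _. 0)"
    using linear_map_zero[OF lin] S_inf_zero by blast
  moreover have "i (base c) = (\<lambda>_ _. 0)"
    using i base_S0[OF c(1)] unfolding homogeneous_interior_def by blast
  ultimately have "fscale 1 (base c \<and>\<^sub>g i f) k p = 0"
    unfolding c(3) by (simp add: fadd_def fun_eq_iff wedge_def)
  moreover have "redu (i f k p)" using lin f S_inf_redu by (auto simp: linear_map_on_def)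
  ultimately show ?thesis using k c(2) by (simp add: wedge_def fscale_def base_apply)
qed

end

section \<open>The components of a supersymmetry and the relations between them\<close>

section \<open>Generalized supersymmetries\<close>

text \<open>The even and odd parts are kept as parameters because the Leibniz rules are stated for
  them separately.\<close>

locale supersymmetry = jet_setting B
  for B :: "('x::{t2_space,second_countable_topology}, 'n::finite, 'y, 'q, 'k) setting" +
  fixes \<upsilon> \<iota> u0 u1 i0 i1 :: "('x, 'n, 'k) gform \<Rightarrow> ('x, 'n, 'k) gform"
  assumes der: "homogeneous_derivation B 0 u0" "homogeneous_derivation B 1 u1"
    and int: "homogeneous_interior B 0 u0 i0" "homogeneous_interior B 1 u1 i1"
    and \<upsilon>: "\<And>f. f \<in> S0_inf B \<Longrightarrow> \<upsilon> f = u0 f +\<^sub>g u1 f"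
    and \<iota>: "\<And>\<omega>. \<omega> \<in> S_inf B \<Longrightarrow> \<iota> \<omega> = i0 \<omega> +\<^sub>g i1 \<omega>"
    and contact: "\<And>\<omega>. \<omega> \<in> contact_forms B \<Longrightarrow> lie_derivative B \<iota> \<omega> \<in> contact_forms B"
begin

lemma u_lin: "linear_map_on (S0_inf B) (S0_inf B) u0" "linear_map_on (S0_inf B) (S0_inf B) u1"
  using der unfolding homogeneous_derivation_def by blast+

lemma i_lin: "linear_map_on (S_inf B) (S_inf B) i0" "linear_map_on (S_inf B) (S_inf B) i1"
  using int unfolding homogeneous_interior_def by blast+

lemma \<upsilon>_S0: "f \<in> S0_inf B \<Longrightarrow> \<upsilon> f \<in> S0_inf B"
  using u_lin by (auto simp: \<upsilon> linear_map_on_def intro: S0_inf_add)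

lemma \<upsilon>_compat: "f \<in> S0_inf B \<Longrightarrow> \<upsilon> f \<in> compatible_forms B"
  using \<upsilon>_S0 S_inf_compat by (auto simp: S0_inf_def)

lemma \<upsilon>_mdeg: "f \<in> S0_inf B \<Longrightarrow> M \<in> kys (\<upsilon> f k p) \<Longrightarrow> mdeg M = 0"
  using \<upsilon>_S0 by (auto simp: S0_inf_def hom_deg_iff)

lemma \<iota>_add:
  assumes "a \<in> S_inf B" "b \<in> S_inf B"
  shows "\<iota> (a +\<^sub>g b) = \<iota> a +\<^sub>g \<iota> b"
proof -
  have "i0 (a +\<^sub>g b) = i0 a +\<^sub>g i0 b" "i1 (a +\<^sub>g b) = i1 a +\<^sub>g i1 b"
    using i_lin assms unfolding linear_map_on_def by blast+
  then show ?thesis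
    unfolding \<iota>[OF assms(1)] \<iota>[OF assms(2)] \<iota>[OF S_inf_add[OF assms]] by (simp add: fadd_def add_ac)
qed

lemma \<iota>_zero: "\<iota> (\<lambda>_ _. 0) = (\<lambda>_ _. 0)"
  using i_lin by (simp add: \<iota> S_inf_zero linear_map_zero fadd_def)

lemma \<iota>_gsum: "finite I \<Longrightarrow> (\<And>i. i \<in> I \<Longrightarrow> F i \<in> S_inf B) \<Longrightarrow> \<iota> (gsum I F) = gsum I (\<lambda>i. \<iota> (F i))"
proof (induction I rule: finite_induct)
  case empty
  then show ?case by (simp add: gsum_def \<iota>_zero)
next
  case (insert i I)
  then have "gsum (insert i I) F = F i +\<^sub>g gsum I F" "gsum (insert i I) (\<lambda>i. \<iota> (F i)) = \<iota> (F i) +\<^sub>g gsum I (\<lambda>i. \<iota> (F i))"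
    by (simp_all add: gsum_def fadd_def)
  then show ?case using insert by (simp add: \<iota>_add gsum_S_inf)
qed

lemma \<upsilon>_cong:
  assumes "f \<in> S0_inf B" "g \<in> S0_inf B" "k \<in> charts B" "p \<in> cdom B k" "\<forall>\<^sub>F q in nhds p. f k q = g k q"
  shows "\<upsilon> f k p = \<upsilon> g k p"
proof -
  let ?h = "f +\<^sub>g fscale (- 1) g"
  have g: "fscale (- 1) g \<in> S0_inf B" "?h \<in> S0_inf B" using assms(1,2) by (auto intro: S0_inf_add S0_inf_scale)
  have z: "\<forall>\<^sub>F q in nhds p. ?h k q = 0"
    using assms(5) by eventually_elim (use assms(2) S_inf_redu in \<open>simp add: fadd_def fscale_def S0_inf_def\<close>)
  have "u ?h k p = u f k p - u g k p" if "linear_map_on (S0_inf B) (S0_inf B) u" for u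
  proof -
    have "u ?h = u f +\<^sub>g fscale (- 1) (u g)" "u g \<in> S0_inf B"
      using that assms(1,2) g unfolding linear_map_on_def by auto
    then show ?thesis using S_inf_redu by (simp add: fadd_def fscale_def S0_inf_def)
  qed
  from this[OF u_lin(1)] this[OF u_lin(2)] show ?thesis
    using derivation_local[OF der(1) g(2) assms(3,4) z] derivation_local[OF der(2) g(2) assms(3,4) z] assms(1,2)
    by (simp add: \<upsilon> fadd_def)
qed

lemma \<iota>_cong:
  assumes "f \<in> S_inf B" "g \<in> S_inf B" "k \<in> charts B" "p \<in> cdom B k" "\<forall>\<^sub>F q in nhds p. f k q = g k q"
  shows "\<iota> f k p = \<iota> g k p"
proof -
  let ?h = "f +\<^sub>g fscale (- 1) g"
  have g: "fscale (- 1) g \<in> S_inf B" "?h \<in> S_inf B" using assms(1,2) by (auto intro: S_inf_add S_inf_scale)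
  have z: "\<forall>\<^sub>F q in nhds p. ?h k q = 0"
    using assms(5) by eventually_elim (use assms(2) S_inf_redu in \<open>simp add: fadd_def fscale_def\<close>)
  have "u ?h k p = u f k p - u g k p" if "linear_map_on (S_inf B) (S_inf B) u" for u
  proof -
    have "u ?h = u f +\<^sub>g fscale (- 1) (u g)" "u g \<in> S_inf B"
      using that assms(1,2) g unfolding linear_map_on_def by auto
    then show ?thesis using S_inf_redu by (simp add: fadd_def fscale_def)
  qed
  from this[OF i_lin(1)] this[OF i_lin(2)] show ?thesis
    using interior_local[OF int(1) g(2) assms(3,4) z] interior_local[OF int(2) g(2) assms(3,4) z] assms(1,2)
    by (simp add: \<iota> fadd_def)
qed

lemma \<iota>_gdiff: "f \<in> S0_inf B \<Longrightarrow> gdiff B f \<in> S_inf B \<Longrightarrow> \<iota> (gdiff B f) = \<upsilon> f"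
  using int by (simp add: \<iota> \<upsilon> homogeneous_interior_def)

text \<open>The term containing the contraction of \<sigma> is 0; the parity-dependent sign
  disappears with it, and the even and odd parts add up.\<close>

lemma \<iota>_wedge_S0:
  assumes "\<phi> \<in> S_inf B" "\<sigma> \<in> S0_inf B" "\<phi> \<and>\<^sub>g \<sigma> \<in> S_inf B" "hom_deg d \<phi>" "hom_par a \<phi>"
  shows "\<iota> (\<phi> \<and>\<^sub>g \<sigma>) = \<iota> \<phi> \<and>\<^sub>g \<sigma>"
proof -
  have "i (\<phi> \<and>\<^sub>g \<sigma>) = i \<phi> \<and>\<^sub>g \<sigma>" if "homogeneous_interior B e u i" for e u i
  proof -
    have "i (\<phi> \<and>\<^sub>g \<sigma>) = (i \<phi> \<and>\<^sub>g \<sigma>) +\<^sub>g fscale ((- 1) ^ (d + a * e)) (\<phi> \<and>\<^sub>g i \<sigma>)" "i \<sigma> = (\<lambda>_ _. 0)"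
      using that assms unfolding homogeneous_interior_def S0_inf_def by blast+
    then show ?thesis by (simp add: fadd_def fscale_def wedge_def)
  qed
  from this[OF int(1)] this[OF int(2)] show ?thesis
    using assms by (simp add: \<iota> fadd_def wedge_def gmul_add_left)
qed

text \<open>With parity 0 on the left the sign is -1 for both parts of the contraction.\<close>

lemma \<iota>_dX_wedge:
  assumes "\<phi> \<in> S_inf B" "\<sigma> \<in> S_inf B" "\<phi> \<and>\<^sub>g \<sigma> \<in> S_inf B" "hom_deg 1 \<phi>" "hom_par 0 \<phi>"
  shows "\<iota> (\<phi> \<and>\<^sub>g \<sigma>) = (\<iota> \<phi> \<and>\<^sub>g \<sigma>) +\<^sub>g fscale (- 1) (\<phi> \<and>\<^sub>g \<iota> \<sigma>)"
proof -
  have "i (\<phi> \<and>\<^sub>g \<sigma>) = (i \<phi> \<and>\<^sub>g \<sigma>) +\<^sub>g fscale (- 1) (\<phi> \<and>\<^sub>g i \<sigma>)" if "homogeneous_interior B e u i" for e u i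
  proof -
    have "i (\<phi> \<and>\<^sub>g \<sigma>) = (i \<phi> \<and>\<^sub>g \<sigma>) +\<^sub>g fscale ((- 1) ^ (1 + 0 * e)) (\<phi> \<and>\<^sub>g i \<sigma>)"
      using that assms unfolding homogeneous_interior_def by blast
    then show ?thesis by simp
  qed
  from this[OF int(1)] this[OF int(2)] show ?thesis
    using assms by (simp add: \<iota> fadd_def wedge_def fscale_def gmul_add_left gmul_add_right fun_eq_iff)
qed

end

context supersymmetry
begin

text \<open>The local functions \<open>\<upsilon>(x\<^sup>\<lambda>)\<close> and \<open>\<upsilon>(s\<^sup>A\<^sub>\<Lambda>)\<close>; by locality the choice of the extension is irrelevant.\<close>

definition vX :: "'k \<Rightarrow> 'n \<Rightarrow> 'x \<Rightarrow> 'n salg" where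
  "vX k l p = (if p \<in> cdom B k then \<upsilon> (SOME X. ext_X k p l X) k p else 0)"

definition vS :: "'k \<Rightarrow> fld \<Rightarrow> 'n multiset \<Rightarrow> 'x \<Rightarrow> 'n salg" where
  "vS k A L p = (if p \<in> cdom B k then \<upsilon> (SOME S. ext_S k p A L S) k p else 0)"

lemma ext_X_S0: "ext_X k p l X \<Longrightarrow> X \<in> S0_inf B"
  by (auto simp: ext_X_def S0_inf_def intro: C_P_S_inf)

lemma ext_S_S0: "ext_S k p A L S \<Longrightarrow> S \<in> S0_inf B"
  by (auto simp: ext_S_def S0_inf_def intro: C_P_S_inf)

lemma vX_eq:
  assumes "k \<in> charts B" "p \<in> cdom B k" "ext_X k p l X" shows "vX k l p = \<upsilon> X k p"
proof -
  have 1: "ext_X k p l (SOME X. ext_X k p l X)" using someI[of "ext_X k p l" X] assms(3) by simp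
  have "\<forall>\<^sub>F q in nhds p. (SOME X. ext_X k p l X) k q = gconst (crd B k q $ l)" "\<forall>\<^sub>F q in nhds p. X k q = gconst (crd B k q $ l)"
    using 1 assms(3) by (simp_all add: ext_X_def)
  then have "\<forall>\<^sub>F q in nhds p. (SOME X. ext_X k p l X) k q = X k q" by eventually_elim simp
  from \<upsilon>_cong[OF ext_X_S0[OF 1] ext_X_S0[OF assms(3)] assms(1,2) this] assms(2) show ?thesis
    by (simp add: vX_def)
qed

lemma vS_eq:
  assumes "k \<in> charts B" "p \<in> cdom B k" "ext_S k p A L S" shows "vS k A L p = \<upsilon> S k p"
proof -
  have 1: "ext_S k p A L (SOME S. ext_S k p A L S)" using someI[of "ext_S k p A L" S] assms(3) by simp
  have "\<forall>\<^sub>F q in nhds p. (SOME S. ext_S k p A L S) k q = gvar (Sg A L)" "\<forall>\<^sub>F q in nhds p. S k q = gvar (Sg A L)"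
    using 1 assms(3) by (simp_all add: ext_S_def)
  then have "\<forall>\<^sub>F q in nhds p. (SOME S. ext_S k p A L S) k q = S k q" by eventually_elim simp
  from \<upsilon>_cong[OF ext_S_S0[OF 1] ext_S_S0[OF assms(3)] assms(1,2) this] assms(2) show ?thesis
    by (simp add: vS_def)
qed

lemma vX_eventually:
  assumes "k \<in> charts B" "p \<in> cdom B k" "ext_X k p l X" shows "\<forall>\<^sub>F q in nhds p. vX k l q = \<upsilon> X k q"
  using eventually_cdom[OF assms(1,2)] ext_X_eventually[OF assms(3)] by eventually_elim (rule vX_eq[OF assms(1)])

lemma vS_eventually:
  assumes "k \<in> charts B" "p \<in> cdom B k" "ext_S k p A L S" shows "\<forall>\<^sub>F q in nhds p. vS k A L q = \<upsilon> S k q"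
  using eventually_cdom[OF assms(1,2)] ext_S_eventually[OF assms(3)] by eventually_elim (rule vS_eq[OF assms(1)])

lemma germ_form_\<upsilon>: "f \<in> S0_inf B \<Longrightarrow> k \<in> charts B \<Longrightarrow> p \<in> cdom B k \<Longrightarrow> germ_form p (\<upsilon> f k)"
  by (intro compat_germ_form \<upsilon>_compat)

lemma germ_form_vX:
  assumes "k \<in> charts B" "p \<in> cdom B k" shows "germ_form p (vX k l)"
proof -
  obtain X where X: "ext_X k p l X" using ext_X_exists[OF assms] by blast
  have e: "\<forall>\<^sub>F q in nhds p. \<upsilon> X k q = vX k l q" using vX_eventually[OF assms X] by (auto elim: eventually_mono)
  show ?thesis by (rule germ_form_cong[OF germ_form_\<upsilon>[OF ext_X_S0[OF X] assms] e])
qed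

lemma germ_form_vS:
  assumes "k \<in> charts B" "p \<in> cdom B k" "A \<in> flds B" shows "germ_form p (vS k A L)"
proof -
  obtain S where S: "ext_S k p A L S" using ext_S_exists[OF assms] by blast
  have e: "\<forall>\<^sub>F q in nhds p. \<upsilon> S k q = vS k A L q" using vS_eventually[OF assms(1,2) S] by (auto elim: eventually_mono)
  show ?thesis by (rule germ_form_cong[OF germ_form_\<upsilon>[OF ext_S_S0[OF S] assms(1,2)] e])
qed

lemma vX_mdeg: "k \<in> charts B \<Longrightarrow> M \<in> kys (vX k l p) \<Longrightarrow> mdeg M = 0"
proof -
  assume k: "k \<in> charts B" "M \<in> kys (vX k l p)"
  then have p: "p \<in> cdom B k" by (auto simp: vX_def split: if_splits)
  obtain X where X: "ext_X k p l X" using ext_X_exists[OF k(1) p] by blast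
  then show ?thesis using k(2) vX_eq[OF k(1) p X] \<upsilon>_mdeg[OF ext_X_S0[OF X]] by auto
qed

lemma vS_mdeg: "k \<in> charts B \<Longrightarrow> A \<in> flds B \<Longrightarrow> M \<in> kys (vS k A L p) \<Longrightarrow> mdeg M = 0"
proof -
  assume k: "k \<in> charts B" "A \<in> flds B" "M \<in> kys (vS k A L p)"
  then have p: "p \<in> cdom B k" by (auto simp: vS_def split: if_splits)
  obtain S where S: "ext_S k p A L S" using ext_S_exists[OF k(1) p k(2)] by blast
  then show ?thesis using k(3) vS_eq[OF k(1) p S] \<upsilon>_mdeg[OF ext_S_S0[OF S]] by auto
qed

text \<open>
  Near \<open>p\<close>, \<open>df\<close> is a combination of the \<open>dx\<^sup>\<lambda>\<close> and \<open>ds\<^sup>A\<^sub>\<Lambda>\<close> with global forms as coefficients, so contracting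
  it with \<open>\<upsilon>\<close> expresses \<open>\<upsilon>(f)\<close> by the values of \<open>\<upsilon>\<close> on the coordinates.  This replaces the Hadamard lemma.
\<close>

lemma \<upsilon>_coordinates:
  assumes k: "k \<in> charts B" "p \<in> cdom B k" and f: "f \<in> S0_inf B"
    and T: "finite T" "svars (f k p) \<subseteq> T" "T \<subseteq> flds B \<times> UNIV"
  shows "\<upsilon> f k p = (\<Sum>l\<in>UNIV. vX k l p \<cdot> pdx B k l (f k) p) + (\<Sum>(A, L)\<in>T. vS k A L p \<cdot> pds A L (f k p))"
proof -
  have fc: "f \<in> compatible_forms B" using f S_inf_compat by (auto simp: S0_inf_def)
  obtain r where r: "\<And>k p. kys (f k p) \<subseteq> mons_upto B r" using compat_bound[OF fc] by blast
  note gf = compat_germ_form[OF fc k]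
  have df: "\<forall>\<^sub>F q in nhds p. \<forall>M\<in>kys (f k q). mdeg M = 0" using f by (simp add: S0_inf_def hom_deg_iff)
  \<comment> \<open>Near \<open>p\<close> the function is replaced by one whose differential is
    known to lie in \<open>S_inf\<close>.\<close>
  obtain G where G: "G \<in> split_forms" "\<forall>\<^sub>F q in nhds p. G k q = f k q" using split_forms_extend[OF k gf df] by blast
  have "\<forall>\<^sub>F q in nhds p. \<forall>M\<in>kys (pdx B k l (f k) q). mdeg M = 0" for l
    using eventually_germ_form_cdom[OF k gf]
  proof eventually_elim
    case (elim q)
    have "\<forall>\<^sub>F q in nhds q. \<forall>M\<in>kys (f k q). mdeg M = 0" using f by (simp add: S0_inf_def hom_deg_iff)
    then show ?case using keys_pdx[OF k(1), of q "f k" "\<lambda>M. mdeg M = 0"] elim by blast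
  qed
  then have "\<exists>P\<in>split_forms. \<forall>\<^sub>F q in nhds p. P k q = pdx B k l (f k) q" for l
    by (intro split_forms_extend k germ_form_pdx gf)
  then obtain P where P: "\<And>l. P l \<in> split_forms" "\<And>l. \<forall>\<^sub>F q in nhds p. P l k q = pdx B k l (f k) q" by metis
  have "\<forall>M\<in>kys (pds A L (f k q)). mdeg M = 0" for A L q
    using f by (force simp: S0_inf_def hom_deg_iff dest!: keys_pds)
  then have "\<exists>Q\<in>split_forms. \<forall>\<^sub>F q in nhds p. Q k q = pds A L (f k q)" for A L
    by (intro split_forms_extend k germ_form_pds gf) auto
  then obtain Q where Q: "\<And>A L. Q A L \<in> split_forms" "\<And>A L. \<forall>\<^sub>F q in nhds p. Q A L k q = pds A L (f k q)" by metis
  obtain X where X: "\<And>l. ext_X k p l (X l)" using ext_X_exists[OF k] by metis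
  obtain S where S: "\<And>A L. A \<in> flds B \<Longrightarrow> ext_S k p A L (S A L)" using ext_S_exists[OF k] by metis
  have dX: "gdiff B (X l) \<in> C_inf B" "hom_deg 1 (gdiff B (X l))" "hom_par 0 (gdiff B (X l))" for l
    using X[of l] gdiff_C_P hom_deg_gdiff[of "X l" 0] hom_par_gdiff[of "X l" 0]
    by (auto simp: ext_X_def intro: C_P_compat)
  have dS: "gdiff B (S A L) \<in> C_inf B \<or> gdiff B (S A L) \<in> P_inf B" "hom_deg 1 (gdiff B (S A L))" "hom_par (fpar A) (gdiff B (S A L))"
    if "A \<in> flds B" for A L
    using S[OF that, of L] gdiff_C_P hom_deg_gdiff[of "S A L" 0] hom_par_gdiff[of "S A L" "fpar A"]
    by (auto simp: ext_S_def intro: C_P_compat)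
  let ?J = "jetvars B r"
  let ?F = "\<lambda>l. gdiff B (X l) \<and>\<^sub>g P l" and ?H = "\<lambda>s. gdiff B (S (fst s) (snd s)) \<and>\<^sub>g Q (fst s) (snd s)"
  have F: "?F l \<in> S_inf B" for l using dX P by (intro split_forms_left_S_inf) auto
  have H: "?H s \<in> S_inf B" if "s \<in> ?J" for s
    using dS(1)[of "fst s" "snd s"] Q that by (intro split_forms_left_S_inf) (auto simp: jetvars_def)
  \<comment> \<open>The differential of \<open>f\<close> near \<open>p\<close>, written with global
    factors; the jet variables up to the order of \<open>f\<close> suffice.\<close>
  let ?\<omega> = "gsum UNIV ?F +\<^sub>g gsum ?J ?H"
  have \<omega>: "gsum UNIV ?F \<in> S_inf B" "gsum ?J ?H \<in> S_inf B"
    using F H by (auto intro!: gsum_S_inf)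
  have "\<forall>\<^sub>F q in nhds p. \<forall>l\<in>UNIV. ?F l k q = gvar (DX l) \<cdot> pdx B k l (f k) q"
  proof (rule eventually_ball_finite[OF finite], rule ballI)
    fix l show "\<forall>\<^sub>F q in nhds p. ?F l k q = gvar (DX l) \<cdot> pdx B k l (f k) q"
      using gdiff_ext_X[OF k X[of l]] P(2)[of l] by eventually_elim (simp add: wedge_def)
  qed
  moreover have "\<forall>\<^sub>F q in nhds p. \<forall>s\<in>?J. ?H s k q = gvar (DS (fst s) (snd s)) \<cdot> pds (fst s) (snd s) (f k q)"
  proof (rule eventually_ball_finite[OF finite_jetvars], rule ballI)
    fix s assume "s \<in> ?J"
    then have A: "fst s \<in> flds B" by (auto simp: jetvars_def)
    show "\<forall>\<^sub>F q in nhds p. ?H s k q = gvar (DS (fst s) (snd s)) \<cdot> pds (fst s) (snd s) (f k q)"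
      using gdiff_ext_S[OF k S[OF A] A, of "snd s"] Q(2)[of "fst s" "snd s"] by eventually_elim (simp add: wedge_def)
  qed
  moreover have "\<forall>\<^sub>F q in nhds p. gdiff B G k q = ldiff B k (f k) q"
    using ldiff_eventually_cong[OF k G(2)] eventually_cdom[OF k] by eventually_elim (simp add: gdiff_def k)
  ultimately have e: "\<forall>\<^sub>F q in nhds p. gdiff B G k q = ?\<omega> k q"
  proof eventually_elim
    case (elim q)
    then show ?case
      using der_superset[OF finite_jetvars svars_subset_jetvars[OF r], of "\<lambda>A L. gvar (DS A L)" k q]
      by (simp add: ldiff_eq gsum_def fadd_def split_def)
  qed
  have "\<upsilon> f k p = \<upsilon> G k p"
    by (rule \<upsilon>_cong[OF f split_forms_S0[OF G(1)] k]) (use G(2) in \<open>auto elim: eventually_mono\<close>)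
  also have "\<dots> = \<iota> (gdiff B G) k p" using \<iota>_gdiff[OF split_forms_S0[OF G(1)] gdiff_split_forms[OF G(1)]] by simp
  also have "\<dots> = \<iota> ?\<omega> k p"
    by (rule \<iota>_cong[OF gdiff_split_forms[OF G(1)] S_inf_add[OF \<omega>] k e])
  also have "\<dots> = (\<Sum>l\<in>UNIV. \<iota> (?F l) k p) + (\<Sum>s\<in>?J. \<iota> (?H s) k p)"
    unfolding \<iota>_add[OF \<omega>] using F H by (simp add: \<iota>_gsum) (simp add: fadd_def gsum_def)
  also have "(\<Sum>l\<in>UNIV. \<iota> (?F l) k p) = (\<Sum>l\<in>UNIV. vX k l p \<cdot> pdx B k l (f k) p)"
  proof (rule sum.cong[OF refl])
    fix l
    have dXS: "gdiff B (X l) \<in> S_inf B" using dX by (intro C_P_S_inf) auto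
    have "\<iota> (?F l) = \<iota> (gdiff B (X l)) \<and>\<^sub>g P l"
      by (rule \<iota>_wedge_S0[OF dXS split_forms_S0[OF P(1)] F dX(2,3)])
    also have "\<iota> (gdiff B (X l)) = \<upsilon> (X l)" by (rule \<iota>_gdiff[OF ext_X_S0[OF X] dXS])
    finally show "\<iota> (?F l) k p = vX k l p \<cdot> pdx B k l (f k) p"
      using vX_eq[OF k X] eventually_nhds_x_imp_x[OF P(2)[of l]] by (simp add: wedge_def)
  qed
  also have "(\<Sum>s\<in>?J. \<iota> (?H s) k p) = (\<Sum>(A, L)\<in>?J. vS k A L p \<cdot> pds A L (f k p))"
  proof (rule sum.cong[OF refl], clarify)
    fix A L assume "(A, L) \<in> ?J"
    then have A: "A \<in> flds B" and HJ: "?H (A, L) \<in> S_inf B" using H by (auto simp: jetvars_def)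
    have dSS: "gdiff B (S A L) \<in> S_inf B" using dS[OF A] by (intro C_P_S_inf) auto
    have "\<iota> (?H (A, L)) = \<iota> (gdiff B (S A L)) \<and>\<^sub>g Q A L"
      using \<iota>_wedge_S0[OF dSS split_forms_S0[OF Q(1)] _ dS(2,3)[OF A]] HJ by simp
    also have "\<iota> (gdiff B (S A L)) = \<upsilon> (S A L)" by (rule \<iota>_gdiff[OF ext_S_S0[OF S[OF A]] dSS])
    finally show "\<iota> (?H (A, L)) k p = vS k A L p \<cdot> pds A L (f k p)"
      using vS_eq[OF k S[OF A]] eventually_nhds_x_imp_x[OF Q(2)[of A L]] by (simp add: wedge_def)
  qed
  \<comment> \<open>Both index sets contain all variables of \<open>f k p\<close>, and the remaining
    summands vanish.\<close>
  also have "(\<Sum>(A, L)\<in>?J. vS k A L p \<cdot> pds A L (f k p)) = (\<Sum>(A, L)\<in>T. vS k A L p \<cdot> pds A L (f k p))"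
    using der_superset[OF T(1,2), of "\<lambda>A L. vS k A L p"] der_superset[OF finite_jetvars svars_subset_jetvars[OF r], of "\<lambda>A L. vS k A L p" k p]
    by simp
  finally show ?thesis .
qed

text \<open>Preservation of the contact ideal, tested on a global form that equals \<open>\<theta>\<^sup>A\<^sub>\<Lambda>\<close> near \<open>p\<close>.\<close>

lemma vS_add_mset:
  assumes k: "k \<in> charts B" "p \<in> cdom B k" and A: "A \<in> flds B"
  shows "vS k A (add_mset l L) p = totd B k l (vS k A L) p -
    (\<Sum>m\<in>UNIV. totd B k l (vX k m) p \<cdot> gvar (Sg A (add_mset m L)))"
proof -
  obtain X where X: "\<And>l. ext_X k p l (X l)" using ext_X_exists[OF k] by metis
  obtain S where S: "\<And>L. ext_S k p A L (S L)" using ext_S_exists[OF k A] by metis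
  have Sc: "S L \<in> C_inf B \<or> S L \<in> P_inf B" "hom_deg 0 (S L)" for L using S by (auto simp: ext_S_def)
  have dX: "gdiff B (X l) \<in> C_inf B" "gdiff B (X l) \<in> P_inf B" "hom_deg 1 (gdiff B (X l))" "hom_par 0 (gdiff B (X l))" for l
    using X[of l] gdiff_C_P hom_deg_gdiff[of "X l" 0] hom_par_gdiff[of "X l" 0]
    by (auto simp: ext_X_def intro: C_P_compat)
  have dX_S: "gdiff B (X l) \<in> S_inf B" for l using dX C_P_S_inf by blast
  have dS_S: "gdiff B (S L) \<in> C_inf B \<or> gdiff B (S L) \<in> P_inf B" "gdiff B (S L) \<in> S_inf B" for L
    using Sc gdiff_C_P C_P_S_inf by blast+
  have wS: "gdiff B (X m) \<and>\<^sub>g a \<in> S_inf B" if "a \<in> C_inf B \<or> a \<in> P_inf B" for m a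
    using that dX[of m] by (intro C_P_S_inf) (auto simp: C_inf_eq P_inf_eq intro: avoiding_wedge)
  \<comment> \<open>The global contact form with germ \<theta>: the vertical differential of an
    extension of the jet coordinate.\<close>
  define T where "T = restr (\<lambda>k. dV k (S L k))"
  have T: "T \<in> C_inf B \<or> T \<in> P_inf B"
    using Sc[of L] avoiding_dV typ_pred_cases unfolding T_def C_inf_eq P_inf_eq by blast
  have Tdeg: "hom_deg 1 T"
    unfolding hom_deg_iff
  proof (intro allI ballI)
    fix j q M assume M: "M \<in> kys (T j q)"
    then have j: "j \<in> charts B" "q \<in> cdom B j" "M \<in> kys (dV j (S L j) q)" by (auto simp: T_def restr_def split: if_splits)
    note g = compat_germ_form[OF C_P_compat[OF Sc(1)[of L]] j(1,2)]
    have d: "\<forall>\<^sub>F q in nhds q. \<forall>M\<in>kys (S L j q). mdeg M = 0" using Sc(2)[of L] by (simp add: hom_deg_iff)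
    from j(3) show "mdeg M = 1"
      unfolding dV_def
    proof (cases rule: keys_diffE)
      case 1
      from keys_ldiff[OF j(1,2) g d this] show ?thesis by auto
    next
      case 2
      then obtain l where "M \<in> kys (gvar (DX l) \<cdot> totd B j l (S L j) q)" unfolding dH_def by (elim keys_sumE)
      then obtain N where "M = add_mset (DX l) N" "N \<in> kys (totd B j l (S L j) q)" by (elim keys_gmulE) (auto simp: keys_gvar)
      then show ?thesis using keys_totd[OF j(1,2) g d] by fastforce
    qed
  qed
  have dT: "gdiff B T \<in> S_inf B" using T gdiff_C_P[OF Tdeg] C_P_S_inf by blast
  have TS: "T \<in> S_inf B" using T C_P_S_inf by blast
  have Tk: "\<forall>\<^sub>F q in nhds p. T k q = gvar (DS A L) - (\<Sum>m\<in>UNIV. gvar (DX m) \<cdot> gvar (Sg A (add_mset m L)))"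
  proof -
    have "\<forall>\<^sub>F q in nhds p. \<forall>\<^sub>F q' in nhds q. S L k q' = gvar (Sg A L)"
      using S[of L] by (simp add: ext_S_def eventually_eventually)
    then show ?thesis
      using eventually_cdom[OF k]
    proof eventually_elim
      case (elim q)
      then show ?case
        using dV_cong[OF k(1) elim(2,1)] k(1) A by (simp add: T_def restr_def dV_def dH_def ldiff_gvar totd_gvar)
    qed
  qed
  have T_contact: "T \<in> contact_forms B"
    unfolding T_def by (rule dV_contact[OF C_P_compat[OF Sc(1)]]) (use TS in \<open>simp add: T_def\<close>)
  \<comment> \<open>The value expected for the contraction of \<theta> with
    \<open>\<upsilon>\<close>.\<close>
  define W where "W q = vS k A L q - (\<Sum>m\<in>UNIV. vX k m q \<cdot> gvar (Sg A (add_mset m L)))" for q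
  have gS: "\<forall>\<^sub>F q in nhds p. S L k q = gvar (Sg A L)" for L using S by (simp add: ext_S_def)
  have \<iota>T: "\<forall>\<^sub>F q in nhds p. \<iota> T k q = W q"
  proof -
    let ?G = "\<lambda>m. gdiff B (X m) \<and>\<^sub>g S (add_mset m L)"
    \<comment> \<open>Another form with the germ of \<open>T\<close>, arranged with differentials on
      the left and functions on the right, as \<open>\<iota>_wedge_S0\<close> wants them.\<close>
    let ?T = "gdiff B (S L) +\<^sub>g gsum UNIV (\<lambda>m. fscale (- 1) (?G m))"
    have GS: "?G m \<in> S_inf B" "fscale (- 1) (?G m) \<in> S_inf B" for m using wS[OF Sc(1)] S_inf_scale by auto
    then have gs: "gsum UNIV (\<lambda>m. fscale (- 1) (?G m)) \<in> S_inf B" by (intro gsum_S_inf) auto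
    have "\<forall>\<^sub>F q in nhds p. \<forall>m\<in>UNIV. ?G m k q = gvar (DX m) \<cdot> gvar (Sg A (add_mset m L))"
    proof (rule eventually_ball_finite[OF finite], rule ballI)
      fix m show "\<forall>\<^sub>F q in nhds p. ?G m k q = gvar (DX m) \<cdot> gvar (Sg A (add_mset m L))"
        using gdiff_ext_X[OF k X[of m]] gS[of "add_mset m L"] by eventually_elim (simp add: wedge_def)
    qed
    then have "\<forall>\<^sub>F q in nhds p. T k q = ?T k q"
      using Tk gdiff_ext_S[OF k S A, of L]
      by eventually_elim (simp add: fadd_def gsum_def fscale_def wedge_def sum_negf)
    then have "\<forall>\<^sub>F q in nhds p. \<forall>\<^sub>F q' in nhds q. T k q' = ?T k q'" by (simp add: eventually_eventually)
    moreover have "\<forall>\<^sub>F q in nhds p. \<forall>m\<in>UNIV. vX k m q = \<upsilon> (X m) k q \<and> S (add_mset m L) k q = gvar (Sg A (add_mset m L))"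
    proof (rule eventually_ball_finite[OF finite], rule ballI)
      fix m show "\<forall>\<^sub>F q in nhds p. vX k m q = \<upsilon> (X m) k q \<and> S (add_mset m L) k q = gvar (Sg A (add_mset m L))"
        using vX_eventually[OF k X] gS by (rule eventually_conj)
    qed
    ultimately show ?thesis
      using eventually_cdom[OF k] vS_eventually[OF k S[of L]]
    proof eventually_elim
      case (elim q)
      have sc: "\<iota> (fscale (- 1) (?G m)) = fscale (- 1) (\<iota> (?G m))" for m
      proof -
        have "i0 (fscale (- 1) (?G m)) = fscale (- 1) (i0 (?G m))" "i1 (fscale (- 1) (?G m)) = fscale (- 1) (i1 (?G m))"
          using i_lin GS unfolding linear_map_on_def by blast+
        then show ?thesis
          unfolding \<iota>[OF GS(1)] \<iota>[OF GS(2)] by (simp add: fscale_def fadd_def gmul_add_right)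
      qed
      have G: "\<iota> (?G m) = \<upsilon> (X m) \<and>\<^sub>g S (add_mset m L)" for m
        using \<iota>_wedge_S0[OF dX_S ext_S_S0[OF S] GS(1) dX(3,4)] \<iota>_gdiff[OF ext_X_S0[OF X] dX_S] by simp
      have "\<iota> T k q = \<iota> ?T k q"
        by (rule \<iota>_cong[OF TS S_inf_add[OF dS_S(2) gs] k(1) elim(3,1)])
      also have "\<dots> = \<upsilon> (S L) k q + (\<Sum>m\<in>UNIV. fscale (- 1) (\<upsilon> (X m) \<and>\<^sub>g S (add_mset m L)) k q)"
        unfolding \<iota>_add[OF dS_S(2) gs] \<iota>_gsum[OF finite GS(2)] sc G \<iota>_gdiff[OF ext_S_S0[OF S] dS_S(2)]
        by (simp add: fadd_def gsum_def)
      also have "\<dots> = W q"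
        using elim(2,4) by (simp add: fscale_def wedge_def W_def sum_negf)
      finally show ?case .
    qed
  qed
  \<comment> \<open>Near \<open>p\<close> the differential of \<open>T\<close> is a sum of products
    of \<open>dx\<close> with \<open>ds\<close> at a raised multi-index, so each summand contracts
    to two terms.\<close>
  have dT_k: "\<iota> (gdiff B T) k p = (\<Sum>m\<in>UNIV. vX k m p \<cdot> gvar (DS A (add_mset m L)) - gvar (DX m) \<cdot> vS k A (add_mset m L) p)"
  proof -
    let ?G = "\<lambda>m. gdiff B (X m) \<and>\<^sub>g gdiff B (S (add_mset m L))"
    have GS: "?G m \<in> S_inf B" for m using wS[OF dS_S(1)] .
    have "\<forall>\<^sub>F q in nhds p. \<forall>m\<in>UNIV. ?G m k q = gvar (DX m) \<cdot> gvar (DS A (add_mset m L))"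
    proof (rule eventually_ball_finite[OF finite], rule ballI)
      fix m show "\<forall>\<^sub>F q in nhds p. ?G m k q = gvar (DX m) \<cdot> gvar (DS A (add_mset m L))"
        using gdiff_ext_X[OF k X[of m]] gdiff_ext_S[OF k S[of "add_mset m L"] A] by eventually_elim (simp add: wedge_def)
    qed
    moreover have "\<forall>\<^sub>F q in nhds p. gdiff B T k q = (\<Sum>m\<in>UNIV. gvar (DX m) \<cdot> gvar (DS A (add_mset m L)))"
      using ldiff_eventually_cong[OF k Tk] eventually_cdom[OF k]
    proof eventually_elim
      case (elim q)
      have "ldiff B k (\<lambda>q. gvar (DS A L) - (\<Sum>m\<in>UNIV. gvar (DX m) \<cdot> gvar (Sg A (add_mset m L)))) q =
        ldiff B k (\<lambda>q. gvar (DS A L) + (\<Sum>m\<in>UNIV. gconst (- 1) \<cdot> (gvar (DX m) \<cdot> gvar (Sg A (add_mset m L))))) q"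
        by (simp add: sum_negf)
      also have "\<dots> = (\<Sum>m\<in>UNIV. gvar (DX m) \<cdot> gvar (DS A (add_mset m L)))"
        using k(1) elim(2) A
        by (simp add: ldiff_add ldiff_sum ldiff_gconst_gmul ldiff_gvar_gmul ldiff_gvar ldiff_gconst germ_form_gvar germ_form_gmul germ_form_sum germ_form_gconst
            germ_form_gconst_gmul[of q "\<lambda>_. - 1"] del: gconst_uminus_1) (simp add: gmul_uminus_right)
      finally show ?case using elim k(1) by (simp add: gdiff_def)
    qed
    ultimately have "\<forall>\<^sub>F q in nhds p. gdiff B T k q = gsum UNIV ?G k q"
      by eventually_elim (simp add: gsum_def)
    then have "\<iota> (gdiff B T) k p = \<iota> (gsum UNIV ?G) k p"
      using GS by (intro \<iota>_cong[OF dT _ k] gsum_S_inf) auto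
    also have "\<dots> = (\<Sum>m\<in>UNIV. \<iota> (?G m) k p)"
      using \<iota>_gsum[of UNIV ?G] GS by (simp add: gsum_def)
    also have "\<dots> = (\<Sum>m\<in>UNIV. vX k m p \<cdot> gvar (DS A (add_mset m L)) - gvar (DX m) \<cdot> vS k A (add_mset m L) p)"
    proof (rule sum.cong[OF refl])
      fix m show "\<iota> (?G m) k p = vX k m p \<cdot> gvar (DS A (add_mset m L)) - gvar (DX m) \<cdot> vS k A (add_mset m L) p"
      using \<iota>_dX_wedge[OF dX_S dS_S(2) GS dX(3,4), of m]
        \<iota>_gdiff[OF ext_X_S0[OF X] dX_S, of m] \<iota>_gdiff[OF ext_S_S0[OF S] dS_S(2), of "add_mset m L"]
        vX_eq[OF k X, of m] vS_eq[OF k S, of "add_mset m L"]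
        eventually_nhds_x_imp_x[OF gdiff_ext_X[OF k X, of m]] eventually_nhds_x_imp_x[OF gdiff_ext_S[OF k S A, of "add_mset m L"]]
      by (simp add: fadd_def fscale_def wedge_def)
    qed
    finally show ?thesis .
  qed
  have gW: "germ_form p W"
    unfolding W_def using A by (intro germ_form_diff germ_form_vS germ_form_sum germ_form_gmul germ_form_vX germ_form_gvar k) auto
  have v0: "\<forall>\<^sub>F q in nhds p. \<forall>M\<in>kys (vX k m q). mdeg M = 0" for m using vX_mdeg k(1) by auto
  have vg: "germ_form p (\<lambda>q. vX k m q \<cdot> gvar (Sg A (add_mset m L)))" for m
    using A by (intro germ_form_gmul germ_form_vX germ_form_gvar k) auto
  have W': "W = (\<lambda>q. vS k A L q - (\<Sum>m\<in>UNIV. vX k m q \<cdot> gvar (Sg A (add_mset m L))))" by (simp add: W_def fun_eq_iff)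
  have dW: "ldiff B k W p = ldiff B k (vS k A L) p - (\<Sum>m\<in>UNIV. ldiff B k (vX k m) p \<cdot> gvar (Sg A (add_mset m L)) + vX k m p \<cdot> gvar (DS A (add_mset m L)))"
  proof -
    have "ldiff B k (vS k A L) p = ldiff B k (\<lambda>q. W q + (\<Sum>m\<in>UNIV. vX k m q \<cdot> gvar (Sg A (add_mset m L)))) p"
      by (simp add: W')
    also have "\<dots> = ldiff B k W p + (\<Sum>m\<in>UNIV. ldiff B k (\<lambda>q. vX k m q \<cdot> gvar (Sg A (add_mset m L))) p)"
      using gW vg by (simp add: ldiff_add ldiff_sum germ_form_sum k)
    also have "(\<Sum>m\<in>UNIV. ldiff B k (\<lambda>q. vX k m q \<cdot> gvar (Sg A (add_mset m L))) p) =
      (\<Sum>m\<in>UNIV. ldiff B k (vX k m) p \<cdot> gvar (Sg A (add_mset m L)) + vX k m p \<cdot> gvar (DS A (add_mset m L)))"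
      using ldiff_gmul[OF k germ_form_vX[OF k] v0, of "\<lambda>_. gvar (Sg A (add_mset _ L))"] A k by (simp add: ldiff_gvar germ_form_gvar)
    finally show ?thesis by simp
  qed
  have "gdiff B (\<iota> T) k p = ldiff B k W p"
    using ldiff_cong[OF k \<iota>T] k by (simp add: gdiff_def)
  \<comment> \<open>The terms \<open>vX\<close> times \<open>ds\<close> coming from the two halves
    of the Lie derivative cancel.\<close>
  then have lie: "lie_derivative B \<iota> T k p = ldiff B k (vS k A L) p - (\<Sum>m\<in>UNIV. gvar (DX m) \<cdot> vS k A (add_mset m L) p) -
      (\<Sum>m\<in>UNIV. ldiff B k (vX k m) p \<cdot> gvar (Sg A (add_mset m L)))"
    unfolding lie_derivative_def fadd_def dT_k dW by (simp add: sum.distrib sum_subtractf)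
  \<comment> \<open>The coefficient of \<open>DX l\<close> in the horizontal projection of the Lie
    derivative.\<close>
  define Z where "Z l = totd B k l (vS k A L) p - vS k A (add_mset l L) p - (\<Sum>m\<in>UNIV. totd B k l (vX k m) p \<cdot> gvar (Sg A (add_mset m L)))" for l
  have vS0: "\<forall>\<^sub>F q in nhds p. \<forall>M\<in>kys (vS k A L q). mdeg M = 0" for L using vS_mdeg k(1) A by auto
  have r: "redu (vX k m p)" "redu (vS k A L p)" "redu (ldiff B k (vX k m) p)" for m L
    using germ_form_redu germ_form_vX[OF k] germ_form_vS[OF k A] germ_form_ldiff[OF k] by blast+
  have "hor (lie_derivative B \<iota> T k p) = (\<Sum>l\<in>UNIV. gvar (DX l) \<cdot> totd B k l (vS k A L) p) -
      (\<Sum>m\<in>UNIV. gvar (DX m) \<cdot> vS k A (add_mset m L) p) -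
      (\<Sum>m\<in>UNIV. (\<Sum>l\<in>UNIV. gvar (DX l) \<cdot> totd B k l (vX k m) p) \<cdot> gvar (Sg A (add_mset m L)))"
    unfolding lie subst_alg_diff subst_alg_sum
    using vS_mdeg[OF k(1) A]
    by (simp add: hor_ldiff[OF k germ_form_vS[OF k A] vS0] subst_alg_gmul graded_hor_gen r hor_ldiff[OF k germ_form_vX[OF k] v0]
        hor_deg_0 subst_alg_gvar) (simp add: hor_gen_def)
  also have "\<dots> = (\<Sum>l\<in>UNIV. gvar (DX l) \<cdot> Z l)"
    unfolding Z_def gmul_diff_right sum_subtractf gmul_sum_left gmul_sum_right gmul_assoc
    by (rule arg_cong2[where f = minus, OF refl sum.swap])
  finally have 0: "(\<Sum>l\<in>UNIV. gvar (DX l) \<cdot> Z l) = 0"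
    using contact_hor[OF contact[OF T_contact] k] by simp
  have "Z l = 0"
  proof (rule sum_DX_gmul_eq_0[OF 0])
    have t: "redu (totd B k l (vS k A L) p)" for l
      using germ_form_redu germ_form_totd[OF k germ_form_vS[OF k A]] by blast
    show "redu (Z l)" for l unfolding Z_def by (intro redu_diff redu_sum t r) simp
    show "mdeg M = 0" if "M \<in> kys (Z l)" for l M
    proof -
      have 1: "mdeg N = 0" if "N \<in> kys (totd B k l (vS k A L) p)" for N
        using keys_totd[OF k germ_form_vS[OF k A] vS0 that] by auto
      have 2: "mdeg N = 0" if "N \<in> kys (totd B k l (vX k m) p)" for N m
        using keys_totd[OF k germ_form_vX[OF k] v0 that] by auto
      show ?thesis
        using that unfolding Z_def
        by (elim keys_diffE keys_sumE keys_gmulE) (auto simp: 1 2 keys_gvar vS_mdeg[OF k(1) A])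
    qed
  qed
  then show ?thesis by (simp add: Z_def algebra_simps)
qed

end

section \<open>One bound on order and degree for all components\<close>

section \<open>Uniform bounds\<close>

context jet_setting
begin

text \<open>On functions a change of chart replaces each jet coordinate by monomials of degree at
  most 1 and of no higher order, so a bound found in one chart holds in all charts.\<close>

lemma transport_keys_mons_upto:
  assumes o: "overlap j k p" and a: "kys a \<subseteq> mons_upto B r" "\<And>M. M \<in> kys a \<Longrightarrow> mdeg M = 0"
  shows "kys (transport j k p a) \<subseteq> mons_upto B r"
proof
  fix K assume K: "K \<in> kys (transport j k p a)"
  obtain M where M: "M \<in> kys a" "K \<in> kys (wordprod (gen_transport j k p) (word_of M))"
    using K unfolding transport_def by (rule keys_subst_algE)
  have Mr: "size M \<le> r" "\<forall>g\<in>#M. gen_ok B r g" and M0: "\<forall>g\<in>#M. gdeg g = 0"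
    using M(1) a by (auto simp: mons_upto_def mdeg_0_iff)
  have ws: "set (word_of M) = set_mset M" by (metis mset_word_of set_mset_mset)
  have len: "length (word_of M) = size M" by (metis mset_word_of size_mset)
  have "size K \<le> 1 * length (word_of M) \<and> (\<forall>h\<in>#K. gen_ok B r h)"
  proof (rule keys_wordprod[OF _ M(2)])
    fix g N assume "g \<in> set (word_of M)" and N: "N \<in> kys (gen_transport j k p g)"
    then have g: "g \<in># M" using ws by simp
    then obtain A L where gA: "g = Sg A L" using M0 by (cases g) auto
    have A: "A \<in> flds B" "size L \<le> r" using Mr g gA by auto
    have "length (enum_of L) = size L" by (metis mset_enum_of size_mset)
    then have "jet_mon A (size L) N" using jet_mon_jet_coord[OF A(1) o, of N "enum_of L"] N A gA by simp
    then show "size N \<le> 1 \<and> (\<forall>h\<in>#N. gen_ok B r h)" using A by (auto simp: jet_mon_def)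
  qed
  moreover have "reduced K" using K by (metis transport_simps(6) redu_def)
  ultimately show "K \<in> mons_upto B r" using Mr len by (auto simp: mons_upto_def)
qed

lemma lin_mons_upto: "M \<in> mons_upto B r \<Longrightarrow> lin M \<Longrightarrow> M \<in> mons_upto B 1"
  by (auto simp: mons_upto_def lin_def)

lemma lin_mdeg: "lin M \<Longrightarrow> mdeg M = 0"
  by (auto simp: lin_def)

lemma keys_gmul_mons_upto: "kys a \<subseteq> mons_upto B r \<Longrightarrow> kys b \<subseteq> mons_upto B s \<Longrightarrow> kys (a \<cdot> b) \<subseteq> mons_upto B (r + s)"
  by (auto elim!: keys_gmulE intro!: mons_upto_add)

lemma keys_sum_mons_upto:
  fixes f :: "'i \<Rightarrow> 'n salg"
  assumes "\<And>i. i \<in> I \<Longrightarrow> kys (f i) \<subseteq> mons_upto B r" shows "kys (\<Sum>i\<in>I. f i) \<subseteq> mons_upto B r"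
proof
  fix M assume "M \<in> kys (\<Sum>i\<in>I. f i)"
  then obtain i where "i \<in> I" "M \<in> kys (f i)" by (rule keys_sumE)
  then show "M \<in> mons_upto B r" using assms by blast
qed

lemma germ_form_mons_upto_finite:
  assumes "finite I" "\<And>i. i \<in> I \<Longrightarrow> germ_form p (f i)"
  shows "\<exists>r. \<forall>\<^sub>F q in nhds p. \<forall>i\<in>I. kys (f i q) \<subseteq> mons_upto B r"
  using assms
proof (induction I rule: finite_induct)
  case (insert i I)
  then obtain r s where r: "\<forall>\<^sub>F q in nhds p. \<forall>i\<in>I. kys (f i q) \<subseteq> mons_upto B r" "\<forall>\<^sub>F q in nhds p. kys (f i q) \<subseteq> mons_upto B s"
    unfolding germ_form_def by blast
  have m: "mons_upto B r \<subseteq> mons_upto B (max r s)" "mons_upto B s \<subseteq> mons_upto B (max r s)" by (rule mons_upto_mono, simp)+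
  show ?case
    using r by (intro exI[of _ "max r s"], eventually_elim) (use m in blast)
qed simp

definition lin_forms :: "('n gen \<Rightarrow> bool) \<Rightarrow> ('x, 'n, 'k) gform set" where
  "lin_forms Z = {F \<in> avoiding Z. \<forall>k p. \<forall>M\<in>kys (F k p). lin M}"

lemma lin_forms_mons_upto: "F \<in> lin_forms Z \<Longrightarrow> kys (F k p) \<subseteq> mons_upto B 1"
  using compat_bound[OF avoiding_compat, of F Z] lin_mons_upto by (auto simp: lin_forms_def) (meson subsetD)

lemma lin_forms_S0: "typ_pred Z \<Longrightarrow> F \<in> lin_forms Z \<Longrightarrow> F \<in> S0_inf B"
  unfolding typ_pred_def lin_forms_def S0_inf_def
  using C_P_S_inf[of F] lin_mdeg by (auto simp: C_inf_eq P_inf_eq hom_deg_iff)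

lemma ext_X_lin_forms: "k \<in> charts B \<Longrightarrow> p \<in> cdom B k \<Longrightarrow> \<exists>X. ext_X k p l X \<and> X \<in> lin_forms of_Y"
  using ext_X_exists[of k p l] by (auto simp: lin_forms_def ext_X_def C_inf_eq)

lemma ext_S_lin_forms: "k \<in> charts B \<Longrightarrow> p \<in> cdom B k \<Longrightarrow> A \<in> flds B \<Longrightarrow> \<exists>Z S. typ_pred Z \<and> ext_S k p A {#} S \<and> S \<in> lin_forms Z"
  using ext_S_exists[of k p A "{#}"] typ_pred_cases by (auto simp: lin_forms_def ext_S_def C_inf_eq P_inf_eq)

end

context supersymmetry
begin

definition good :: "('n gen \<Rightarrow> bool) \<Rightarrow> nat \<Rightarrow> 'x \<Rightarrow> bool" where
  "good Z r p \<longleftrightarrow> (\<forall>F\<in>lin_forms Z. \<forall>k\<in>charts B. p \<in> cdom B k \<longrightarrow> kys (\<upsilon> F k p) \<subseteq> mons_upto B r)"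

lemma good_mono: "good Z r p \<Longrightarrow> r \<le> s \<Longrightarrow> good Z s p"
  unfolding good_def using mons_upto_mono by blast

text \<open>By \<open>\<upsilon>_coordinates\<close> a form with monomials of type
  \<open>lin\<close> involves only the components along the base coordinates and along the fibre
  coordinates of order 0, in a single chart. These are finitely many germs, so near
  \<open>p0\<close> they have a bound that does not refer to \<open>F\<close>.\<close>

lemma good_local:
  assumes "typ_pred Z"
  shows "\<exists>r. \<forall>\<^sub>F p in nhds p0. good Z r p"
proof -
  obtain k where k: "k \<in> charts B" "p0 \<in> cdom B k" using chart_at by blast
  obtain r where r: "\<forall>\<^sub>F p in nhds p0. \<forall>l\<in>UNIV. kys (vX k l p) \<subseteq> mons_upto B r"
    using germ_form_mons_upto_finite[of "UNIV :: 'n set" p0 "vX k"] germ_form_vX[OF k] by (metis finite)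
  obtain s where s: "\<forall>\<^sub>F p in nhds p0. \<forall>A\<in>flds B. kys (vS k A {#} p) \<subseteq> mons_upto B s"
    using germ_form_mons_upto_finite[of "flds B" p0 "\<lambda>A. vS k A {#}"] germ_form_vS[OF k] by (metis finite_flds)
  \<comment> \<open>The derivatives of \<open>F\<close> add at most 1 to the bound of the
    components.\<close>
  have "\<forall>\<^sub>F p in nhds p0. good Z (max r s + 1) p"
    using r s eventually_cdom[OF k]
  proof eventually_elim
    case (elim p)
    show ?case
      unfolding good_def
    proof (intro ballI impI)
      fix F j assume F: "F \<in> lin_forms Z" and j: "j \<in> charts B" "p \<in> cdom B j"
      note F0 = lin_forms_S0[OF assms F]
      have Fc: "F \<in> compatible_forms B" using F by (auto simp: lin_forms_def intro: avoiding_compat)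
      have m: "mons_upto B r \<subseteq> mons_upto B (max r s)" "mons_upto B s \<subseteq> mons_upto B (max r s)" by (rule mons_upto_mono, simp)+
      have sv: "svars (F k p) \<subseteq> flds B \<times> {{#}}"
        using lin_forms_mons_upto[OF F, of k p] F by (fastforce simp: svars_def lin_forms_def lin_def mons_upto_def)
      have "\<forall>\<^sub>F q in nhds p. \<forall>M\<in>kys (F k q). M \<in> mons_upto B 1" using lin_forms_mons_upto[OF F] by (simp add: subset_iff)
      then have 1: "kys (pdx B k l (F k) p) \<subseteq> mons_upto B 1" for l
        using keys_pdx[OF k(1) elim(3) compat_germ_form[OF Fc k(1) elim(3)]] by blast
      have 2: "kys (pds A L (F k p)) \<subseteq> mons_upto B 1" for A L
      proof
        fix N assume "N \<in> kys (pds A L (F k p))"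
        then have "add_mset (Sg A L) N \<in> mons_upto B 1" using keys_pds lin_forms_mons_upto[OF F] by blast
        then show "N \<in> mons_upto B 1" using reduced_add_msetD by (auto simp: mons_upto_def)
      qed
      have "kys (\<upsilon> F k p) \<subseteq> mons_upto B (max r s + 1)"
      proof
        fix K assume "K \<in> kys (\<upsilon> F k p)"
        then have "K \<in> kys ((\<Sum>l\<in>UNIV. vX k l p \<cdot> pdx B k l (F k) p) + (\<Sum>(A, L)\<in>flds B \<times> {{#}}. vS k A L p \<cdot> pds A L (F k p)))"
          using \<upsilon>_coordinates[OF k(1) elim(3) F0 _ sv Sigma_mono[OF subset_refl subset_UNIV]] by simp
        then show "K \<in> mons_upto B (max r s + 1)"
        proof (cases rule: keys_addE)
          case 1
          have "kys (\<Sum>l\<in>UNIV. vX k l p \<cdot> pdx B k l (F k) p) \<subseteq> mons_upto B (max r s + 1)"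
            using elim(1) m \<open>\<And>l. kys (pdx B k l (F k) p) \<subseteq> mons_upto B 1\<close> by (intro keys_sum_mons_upto keys_gmul_mons_upto) auto
          with 1 show ?thesis by blast
        next
          case 2
          have vs: "kys (vS k A {#} p) \<subseteq> mons_upto B (max r s)" if "A \<in> flds B" for A
            using elim(2) m that by blast
          have "kys (\<Sum>(A, L)\<in>flds B \<times> {{#}}. vS k A L p \<cdot> pds A L (F k p)) \<subseteq> mons_upto B (max r s + 1)"
          proof (rule keys_sum_mons_upto, clarify)
            fix A assume "A \<in> flds B"
            from keys_gmul_mons_upto[OF vs[OF this] \<open>\<And>A L. kys (pds A L (F k p)) \<subseteq> mons_upto B 1\<close>]
            show "K \<in> mons_upto B (max r s + 1)" if "K \<in> kys (vS k A {#} p \<cdot> pds A {#} (F k p))" for K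
              using that by blast
          qed
          with 2 show ?thesis by blast
        qed
      qed
      from transport_keys_mons_upto[OF _ this \<upsilon>_mdeg[OF F0]] show "kys (\<upsilon> F j p) \<subseteq> mons_upto B (max r s + 1)"
        using compat_transport[OF \<upsilon>_compat[OF F0], of j k p] j k(1) elim(3) by (simp add: overlap_def)
    qed
  qed
  then show ?thesis by blast
qed

text \<open>
  If no bound were uniform, violations would occur at the points of a locally finite sequence, and
  a locally finite sum of the violating forms would be mapped by \<open>\<upsilon>\<close> to something of unbounded order.
\<close>

lemma good_uniform:
  assumes Z: "typ_pred Z"
  shows "\<exists>r. \<forall>p. good Z r p"
proof (rule ccontr)
  assume "\<not> ?thesis"
  then have bad: "\<exists>p. \<not> good Z r p" for r by blast
  \<comment> \<open>A closed neighbourhood inside the region of a local bound, obtained from a bump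
    function. The sets \<open>Y\<close> must be closed because finitely many of them are later
    removed from an open set.\<close>
  have "\<exists>W Y. open W \<and> p \<in> W \<and> closed Y \<and> W \<subseteq> Y \<and> (\<exists>r. \<forall>q\<in>Y. good Z r q)" for p
  proof -
    obtain r V where V: "open V" "p \<in> V" "\<forall>q\<in>V. good Z r q"
      using good_local[OF Z, of p] unfolding eventually_nhds by blast
    obtain c Y where c: "closed Y" "Y \<subseteq> V" "\<And>q. q \<notin> Y \<Longrightarrow> c q = 0" "\<forall>\<^sub>F q in nhds p. c q = (1::real)"
      using bump_function[OF V(1,2)] by metis
    obtain W where "open W" "p \<in> W" "\<forall>q\<in>W. c q = 1" using c(4) unfolding eventually_nhds by blast
    moreover from this have "W \<subseteq> Y" using c(3) by force
    moreover have "\<forall>q\<in>Y. good Z r q" using c(2) V(3) by blast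
    ultimately show ?thesis using c(1) by (intro exI[of _ W] exI[of _ Y] conjI exI[of _ r]) simp_all
  qed
  then obtain W Y R where WY: "\<And>p. open (W p)" "\<And>p. p \<in> W p" "\<And>p. closed (Y p)" "\<And>p. W p \<subseteq> Y p" "\<And>p q. q \<in> Y p \<Longrightarrow> good Z (R p) q"
    by metis
  obtain D where D: "D \<subseteq> range W" "countable D" "\<Union>D = \<Union>(range W)"
    using Lindelof[of "range W"] WY(1) by blast
  have "D \<noteq> {}" using D(3) WY(2) by auto
  have "\<exists>c. W c = from_nat_into D m" for m :: nat
    using D(1) from_nat_into[OF \<open>D \<noteq> {}\<close>, of m] by blast
  then obtain c where c: "\<And>m. W (c m) = from_nat_into D m" by metis
  have cov: "\<exists>m. q \<in> W (c m)" for q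
  proof -
    have "q \<in> \<Union>(range W)" using WY(2)[of q] by blast
    then have "q \<in> \<Union>D" by (simp only: D(3))
    then obtain U where "U \<in> D" "q \<in> U" by (rule UnionE)
    then show ?thesis using from_nat_into_surj[OF D(2)] c by metis
  qed
  \<comment> \<open>At least \<open>i\<close>, so that the violated bounds tend to infinity, and at
    least the bounds on \<open>Y (c 0)\<close> up to \<open>Y (c i)\<close>, so that the violating
    point \<open>x i\<close> avoids all these sets.\<close>
  define r' where "r' i = Max (insert i ((\<lambda>m. R (c m)) ` {..i}))" for i
  have "\<forall>i. \<exists>p. \<not> good Z (r' i) p" using bad by blast
  then obtain x where x: "\<And>i. \<not> good Z (r' i) (x i)" by metis
  have xY: "x i \<notin> Y (c m)" if "m \<le> i" for i m
  proof -
    have "R (c m) \<le> r' i" unfolding r'_def using that by (intro Max_ge) auto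
    then show ?thesis using WY(5)[of "x i" "c m"] x[of i] good_mono[of Z "R (c m)" "x i" "r' i"] by blast
  qed
  have "\<exists>F k. F \<in> lin_forms Z \<and> k \<in> charts B \<and> x i \<in> cdom B k \<and> \<not> kys (\<upsilon> F k (x i)) \<subseteq> mons_upto B (r' i)" for i
    using x[of i] unfolding good_def by blast
  then obtain F k where F: "\<And>i. F i \<in> lin_forms Z" and k: "\<And>i. k i \<in> charts B" "\<And>i. x i \<in> cdom B (k i)"
    and Fbad: "\<And>i. \<not> kys (\<upsilon> (F i) (k i) (x i)) \<subseteq> mons_upto B (r' i)" by metis
  have "\<forall>i. \<exists>m. x i \<in> W (c m)" using cov by blast
  then obtain m where m: "\<And>i. x i \<in> W (c (m i))" by metis
  have mi: "i < m i" for i using xY[of "m i" i] WY(4) m[of i] by (meson linorder_not_less subsetD)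
  \<comment> \<open>An open set around \<open>x i\<close> that misses the first sets of the cover
    and every other value of the sequence: points with index at least \<open>m i\<close> avoid
    \<open>W (c (m i))\<close> anyway, which leaves finitely many to remove.\<close>
  define V where "V i = W (c (m i)) - (\<Union>j\<le>i. Y (c j)) - {x j |j. j < m i \<and> x j \<noteq> x i}" for i
  have "finite {x j |j. j < m i \<and> x j \<noteq> x i}" for i by simp
  then have "open (V i)" for i
    unfolding V_def using WY(1,3) by (intro open_Diff closed_UN finite_imp_closed) auto
  moreover have "x i \<in> V i" for i using m xY by (auto simp: V_def)
  ultimately have "\<exists>h Q. (\<forall>q. sm q h) \<and> closed Q \<and> Q \<subseteq> V i \<and> (\<forall>q. q \<notin> Q \<longrightarrow> h q = 0) \<and> (\<forall>\<^sub>F q in nhds (x i). h q = 1)" for i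
    using bump_function[of "V i" "x i"] by metis
  then obtain h Q where h: "\<And>i q. sm q (h i)" "\<And>i. closed (Q i)" "\<And>i. Q i \<subseteq> V i" "\<And>i q. q \<notin> Q i \<Longrightarrow> h i q = 0"
    "\<And>i. \<forall>\<^sub>F q in nhds (x i). h i q = 1" by metis
  have xV: "x j \<notin> V i" if "x j \<noteq> x i" for i j
  proof (cases "j < m i")
    case False
    then have "x j \<notin> W (c (m i))" using xY[of "m i" j] WY(4) by auto
    then show ?thesis by (simp add: V_def)
  qed (use that in \<open>auto simp: V_def\<close>)
  have VW: "V i \<inter> W (c n) = {}" if "n \<le> i" for i n
    using that WY(4) by (auto simp: V_def)
  \<comment> \<open>A point may occur several times in the sequence, with different forms; its last
    occurrence is the one kept.\<close>
  define I where "I = {i. \<forall>j>i. x j \<noteq> x i}"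
  define G where "G k p = (\<Sum>i\<in>{i\<in>I. p \<in> V i}. gconst (h i p) \<cdot> F i k p)" for k p
  \<comment> \<open>On \<open>W (c n)\<close> the terms of index at least \<open>n\<close> vanish,
    so the sum is locally finite.\<close>
  have GW: "G k p = (\<Sum>i\<in>I \<inter> {..<n}. gconst (h i p) \<cdot> F i k p)" if "p \<in> W (c n)" for k p n
  proof -
    have "i < n" if "p \<in> V i" for i using VW[of n i] that \<open>p \<in> W (c n)\<close> by (meson disjoint_iff linorder_not_less)
    then show ?thesis
      unfolding G_def using h(3,4) by (intro sum.mono_neutral_left) fastforce+
  qed
  have transport: "F i \<in> avoiding Z" "F i \<in> compatible_forms B" for i using F[of i] by (auto simp: lin_forms_def intro: avoiding_compat)
  have Gkeys: "M \<in> mons_upto B 1 \<and> lin M" if "M \<in> kys (G k p)" for M k p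
  proof -
    from that[unfolded G_def] obtain i where "i \<in> {i \<in> I. p \<in> V i}" "M \<in> kys (gconst (h i p) \<cdot> F i k p)"
      by (rule keys_sumE)
    then show ?thesis using lin_forms_mons_upto[OF F[of i]] F[of i] by (auto simp: lin_forms_def dest!: keys_gconst_gmulE)
  qed
  have "restr G \<in> avoiding Z"
  proof (rule avoidingI[where r = 1])
    fix j p assume j: "j \<in> charts B" "p \<in> cdom B j"
    obtain n where n: "p \<in> W (c n)" using cov by blast
    show "germ_form p (G j)"
    proof (rule germ_form_cong)
      show "germ_form p (\<lambda>q. \<Sum>i\<in>I \<inter> {..<n}. gconst (h i q) \<cdot> F i j q)"
        by (intro germ_form_sum germ_form_gconst_gmul h compat_germ_form transport j)
      show "\<forall>\<^sub>F q in nhds p. (\<Sum>i\<in>I \<inter> {..<n}. gconst (h i q) \<cdot> F i j q) = G j q"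
        by (rule eventually_mono[OF eventually_nhds_in_open[OF WY(1) n]]) (simp add: GW)
    qed
    show "kys (G j p) \<subseteq> mons_upto B 1" using Gkeys by blast
    show "\<not> Z g" if "M \<in> kys (G j p)" "g \<in># M" for M g
    proof -
      from that(1)[unfolded G_def] obtain i where "i \<in> {i \<in> I. p \<in> V i}" "M \<in> kys (gconst (h i p) \<cdot> F i j p)"
        by (rule keys_sumE)
      then show ?thesis using avoiding_gens[OF transport(1)] that(2) by (auto dest!: keys_gconst_gmulE)
    qed
  next
    fix i j p assume o: "overlap i j p"
    then have "redu (F n j p)" for n using transport(2) by (auto simp: overlap_def intro: germ_form_redu compat_germ_form)
    then show "G i p = transport i j p (G j p)"
      unfolding G_def by (simp add: transport_gmul[OF o] compat_transport[OF transport(2) o])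
  qed
  moreover have "lin M" if "M \<in> kys (restr G k p)" for M k p
    using Gkeys that by (auto simp: restr_def split: if_splits)
  ultimately have GL: "restr G \<in> lin_forms Z" by (auto simp: lin_forms_def)
  obtain r where r: "\<And>k p. kys (\<upsilon> (restr G) k p) \<subseteq> mons_upto B r"
    using compat_bound[OF \<upsilon>_compat[OF lin_forms_S0[OF Z GL]]] by blast
  have fin: "finite {i. x i = x r}"
  proof -
    obtain n where n: "x r \<in> W (c n)" using cov by blast
    have "i < n" if "x i = x r" for i
    proof (rule ccontr)
      assume "\<not> i < n"
      then show False using xY[of n i] WY(4) n that by auto
    qed
    then show ?thesis by (auto intro: finite_subset[of _ "{..<n}"])
  qed
  \<comment> \<open>The last index with the point \<open>x r\<close>. It is at least
    \<open>r\<close>, hence so is \<open>r' i\<close>; near that point the sum coincides with the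
    violating form, which contradicts the bound \<open>r\<close>.\<close>
  define i where "i = Max {i. x i = x r}"
  have i: "x i = x r" "r \<le> i" using Max_in[OF fin] Max_ge[OF fin] by (auto simp: i_def)
  have iI: "i \<in> I"
    unfolding I_def using Max_ge[OF fin] i(1) by (auto simp: i_def not_le[symmetric])
  have "\<forall>\<^sub>F q in nhds (x i). restr G (k i) q = F i (k i) q"
  proof -
    have "\<forall>\<^sub>F q in nhds (x i). \<forall>j\<in>I \<inter> {..<m i}. j \<noteq> i \<longrightarrow> h j q = 0"
    proof (rule eventually_ball_finite, simp, rule ballI)
      fix j assume j: "j \<in> I \<inter> {..<m i}"
      show "\<forall>\<^sub>F q in nhds (x i). j \<noteq> i \<longrightarrow> h j q = 0"
      proof (cases "j = i")
        case False
        then have "x i \<noteq> x j" using j iI by (auto simp: I_def) (metis nat_neq_iff)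
        then have "x i \<in> - Q j" using xV[of i j] h(3)[of j] by auto
        then have "\<forall>\<^sub>F q in nhds (x i). q \<in> - Q j" using h(2) by (intro eventually_nhds_in_open) auto
        then show ?thesis by eventually_elim (use h(4) in auto)
      qed simp
    qed
    then show ?thesis
      using h(5)[of i] eventually_nhds_in_open[OF WY(1) m[of i]] eventually_cdom[OF k(1,2)[of i]]
    proof eventually_elim
      case (elim q)
      have "G (k i) q = (\<Sum>j\<in>I \<inter> {..<m i}. if j = i then gconst (h j q) \<cdot> F j (k i) q else 0)"
        unfolding GW[OF elim(3)] using elim(1) by (intro sum.cong) auto
      also have "\<dots> = F i (k i) q"
        using iI mi[of i] elim(2) germ_form_redu[OF compat_germ_form[OF transport(2) k(1) elim(4)]] by simp
      finally show ?case using elim k by (simp add: restr_def)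
    qed
  qed
  from \<upsilon>_cong[OF lin_forms_S0[OF Z GL] lin_forms_S0[OF Z F] k this] have "kys (\<upsilon> (F i) (k i) (x i)) \<subseteq> mons_upto B r"
    using r by metis
  moreover have "i \<le> r' i" by (simp add: r'_def)
  ultimately show False
    using Fbad[of i] mons_upto_mono[of r "r' i" B] i(2) by (meson order_trans)
qed

lemma components_bound:
  "\<exists>r. \<forall>k\<in>charts B. \<forall>p. (\<forall>l. kys (vX k l p) \<subseteq> mons_upto B r) \<and> (\<forall>A\<in>flds B. kys (vS k A {#} p) \<subseteq> mons_upto B r)"
proof -
  obtain r s where rs: "\<And>p. good of_Y r p" "\<And>p. good of_Q s p"
    using good_uniform typ_pred_cases by metis
  then have g: "good Z (max r s) p" if "typ_pred Z" for Z p
    using that good_mono[OF rs(1), of "max r s" p] good_mono[OF rs(2), of "max r s" p] by (auto simp: typ_pred_def)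
  have "kys (vX k l p) \<subseteq> mons_upto B (max r s)" if k: "k \<in> charts B" for k l p
  proof (cases "p \<in> cdom B k")
    case True
    obtain X where X: "ext_X k p l X" "X \<in> lin_forms of_Y" using ext_X_lin_forms[OF k True] by blast
    then show ?thesis using g[OF typ_pred_cases(1), of p] vX_eq[OF k True X(1)] k True unfolding good_def by auto
  qed (simp add: vX_def)
  moreover have "kys (vS k A {#} p) \<subseteq> mons_upto B (max r s)" if k: "k \<in> charts B" "A \<in> flds B" for k A p
  proof (cases "p \<in> cdom B k")
    case True
    obtain Z S where S: "typ_pred Z" "ext_S k p A {#} S" "S \<in> lin_forms Z" using ext_S_lin_forms[OF k(1) True k(2)] by blast
    then show ?thesis using g[OF S(1), of p] vS_eq[OF k(1) True S(2)] k True unfolding good_def by auto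
  qed (simp add: vS_def)
  ultimately show ?thesis by blast
qed

section \<open>Regrouping the components into total derivatives and a vertical remainder\<close>

section \<open>The horizontal and vertical parts\<close>

text \<open>The contraction of \<open>\<upsilon>\<close> with \<open>\<theta>\<^sup>A\<^sub>\<Lambda>\<close>, i.e. the coefficient of \<open>\<upsilon>\<^sub>V\<close> at \<open>\<partial>\<^sub>A\<^sup>\<Lambda>\<close>.\<close>

definition wV :: "'k \<Rightarrow> fld \<Rightarrow> 'n multiset \<Rightarrow> 'x \<Rightarrow> 'n salg" where
  "wV k A L p = vS k A L p - (\<Sum>m\<in>UNIV. vX k m p \<cdot> gvar (Sg A (add_mset m L)))"

lemma germ_form_wV: "k \<in> charts B \<Longrightarrow> p \<in> cdom B k \<Longrightarrow> A \<in> flds B \<Longrightarrow> germ_form p (wV k A L)"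
  unfolding wV_def by (intro germ_form_diff germ_form_vS germ_form_sum germ_form_gmul germ_form_vX germ_form_gvar) auto

text \<open>The Leibniz rule yields two kinds of terms: those with a derivative of \<open>vX\<close>
  cancel the correction in \<open>vS_add_mset\<close>, and the others complete \<open>wV\<close> at
  the raised multi-index.\<close>

lemma totd_wV:
  assumes k: "k \<in> charts B" "p \<in> cdom B k" and A: "A \<in> flds B"
  shows "totd B k l (wV k A L) p = wV k A (add_mset l L) p"
proof -
  have vg: "germ_form p (\<lambda>q. vX k m q \<cdot> gvar (Sg A (add_mset m L)))" for m
    using A by (intro germ_form_gmul germ_form_vX germ_form_gvar k) auto
  have v0: "\<forall>\<^sub>F q in nhds p. \<forall>M\<in>kys (vX k m q). mdeg M = 0" for m using vX_mdeg k(1) by auto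
  have "totd B k l (vS k A L) p = totd B k l (\<lambda>q. wV k A L q + (\<Sum>m\<in>UNIV. vX k m q \<cdot> gvar (Sg A (add_mset m L)))) p"
    by (simp add: wV_def)
  also have "\<dots> = totd B k l (wV k A L) p + (\<Sum>m\<in>UNIV. totd B k l (\<lambda>q. vX k m q \<cdot> gvar (Sg A (add_mset m L))) p)"
    using germ_form_wV[OF k A] vg by (simp add: totd_add totd_sum germ_form_sum k)
  also have "(\<Sum>m\<in>UNIV. totd B k l (\<lambda>q. vX k m q \<cdot> gvar (Sg A (add_mset m L))) p) =
      (\<Sum>m\<in>UNIV. totd B k l (vX k m) p \<cdot> gvar (Sg A (add_mset m L)) + vX k m p \<cdot> gvar (Sg A (add_mset m (add_mset l L))))"
    using totd_gmul[OF k germ_form_vX[OF k] v0, of "\<lambda>_. gvar (Sg A (add_mset _ L))"] A k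
    by (simp add: totd_gvar germ_form_gvar add_mset_commute)
  finally show ?thesis
    unfolding wV_def[of k A "add_mset l L"] vS_add_mset[OF k A] by (simp add: sum.distrib)
qed

lemma totd_multi_wV:
  assumes k: "k \<in> charts B" "p \<in> cdom B k" and A: "A \<in> flds B"
    and w: "\<And>p. p \<in> cdom B k \<Longrightarrow> w p = wV k A {#} p"
  shows "totd_multi B k L w p = wV k A L p"
proof -
  have "foldr (totd B k) ls w p = wV k A (mset ls) p" if "p \<in> cdom B k" for ls p
    using that
  proof (induction ls arbitrary: p)
    case (Cons l ls)
    have "\<forall>\<^sub>F q in nhds p. foldr (totd B k) ls w q = wV k A (mset ls) q"
      using eventually_cdom[OF k(1) Cons.prems] by eventually_elim (rule Cons.IH)
    from totd_cong[OF k(1) Cons.prems this] show ?case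
      using totd_wV[OF k(1) Cons.prems A] by simp
  qed (simp add: w)
  from this[OF k(2), of "enum_of L"] show ?thesis by (simp add: totd_multi_def)
qed

lemma decomposition:
  assumes k: "k \<in> charts B"
  shows "\<exists>v w. (\<forall>l. v l \<in> local_graded_functions B k) \<and>
    (\<forall>A\<in>flds B. w A \<in> local_graded_functions B k) \<and>
    (\<forall>f\<in>S0_inf B. \<forall>p\<in>cdom B k.
       \<upsilon> f k p = horizontal_part B k v (f k) p + vertical_part B k w (f k) p)"
proof -
  obtain r where r: "\<And>l p. kys (vX k l p) \<subseteq> mons_upto B r" "\<And>A p. A \<in> flds B \<Longrightarrow> kys (vS k A {#} p) \<subseteq> mons_upto B r"
    using components_bound k by metis
  define w where "w A p = (if p \<in> cdom B k then wV k A {#} p else 0)" for A p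
  have "vX k l \<in> local_forms_upto B k r" for l
  proof (rule local_forms_uptoI[OF k])
    show "vX k l p = 0" if "p \<notin> cdom B k" for p using that by (simp add: vX_def)
  qed (use r(1) k in \<open>auto intro: germ_form_vX\<close>)
  then have v: "vX k l \<in> local_graded_functions B k" for l
    using vX_mdeg[OF k] unfolding local_graded_functions_def local_forms_def mdeg_0_iff by blast
  have gw: "w A \<in> local_graded_functions B k" if A: "A \<in> flds B" for A
  proof -
    \<comment> \<open>One more than the bound of the components, for the jet coordinate multiplying
      \<open>vX\<close>.\<close>
    have kw: "kys (wV k A {#} p) \<subseteq> mons_upto B (r + 1)" for p
    proof
      fix M assume "M \<in> kys (wV k A {#} p)"
      then show "M \<in> mons_upto B (r + 1)"
        unfolding wV_def
      proof (cases rule: keys_diffE)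
        case 1
        then show ?thesis using r(2)[OF A] mons_upto_mono[of r "r + 1" B] by (auto simp: subset_iff)
      next
        case 2
        have "kys (gvar (Sg A {#m#})) \<subseteq> mons_upto B 1" for m using A by (auto simp: keys_gvar mons_upto_def)
        then have "kys (\<Sum>m\<in>UNIV. vX k m p \<cdot> gvar (Sg A {#m#})) \<subseteq> mons_upto B (r + 1)"
          using r(1) by (intro keys_sum_mons_upto keys_gmul_mons_upto) auto
        with 2 show ?thesis by blast
      qed
    qed
    have "germ_form p (w A)" if p: "p \<in> cdom B k" for p
    proof (rule germ_form_cong[OF germ_form_wV[OF k p A, of "{#}"]])
      show "\<forall>\<^sub>F q in nhds p. wV k A {#} q = w A q"
        using eventually_cdom[OF k p] by eventually_elim (simp add: w_def)
    qed
    then have "w A \<in> local_forms_upto B k (r + 1)"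
      using kw by (intro local_forms_uptoI k) (auto simp: w_def)
    moreover have "mdeg M = 0" if "M \<in> kys (w A p)" for M p
    proof -
      have "M \<in> kys (wV k A {#} p)" using that by (auto simp: w_def split: if_splits)
      then show ?thesis
        unfolding wV_def
        by (elim keys_diffE keys_sumE keys_gmulE) (auto simp: vS_mdeg[OF k A] vX_mdeg[OF k] keys_gvar)
    qed
    ultimately show ?thesis
      unfolding local_graded_functions_def local_forms_def mdeg_0_iff by blast
  qed
  have "\<upsilon> f k p = horizontal_part B k (vX k) (f k) p + vertical_part B k w (f k) p"
    if f: "f \<in> S0_inf B" and p: "p \<in> cdom B k" for f p
  proof -
    have fc: "f \<in> compatible_forms B" using f S_inf_compat by (auto simp: S0_inf_def)
    obtain s where s: "\<And>k p. kys (f k p) \<subseteq> mons_upto B s" using compat_bound[OF fc] by blast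
    have sv: "svars (f k p) \<subseteq> flds B \<times> UNIV"
      using svars_subset_jetvars[OF s, of k p] by (auto simp: jetvars_def)
    \<comment> \<open>The split mirrors \<open>vertical_part\<close>: all fields with empty
      multi-index, then the variables of \<open>f\<close> with a nonempty one.\<close>
    define T1 where "T1 = flds B \<times> {{#} :: 'n multiset}"
    define T2 where "T2 = {t \<in> svars (f k p). size (snd t) > 0}"
    have T: "finite (T1 \<union> T2)" "svars (f k p) \<subseteq> T1 \<union> T2" "T1 \<union> T2 \<subseteq> flds B \<times> UNIV" "T1 \<inter> T2 = {}" "finite T1" "finite T2"
      using sv by (auto simp: T1_def T2_def nonempty_has_size[symmetric])
    have "totd B k l (f k) p = pdx B k l (f k) p + (\<Sum>(A, L)\<in>T1 \<union> T2. gvar (Sg A (add_mset l L)) \<cdot> pds A L (f k p))" for l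
      unfolding totd_eq using der_superset[OF T(1,2)] by simp
    then have H: "horizontal_part B k (vX k) (f k) p = (\<Sum>l\<in>UNIV. vX k l p \<cdot> pdx B k l (f k) p) +
        (\<Sum>(A, L)\<in>T1 \<union> T2. (\<Sum>l\<in>UNIV. vX k l p \<cdot> gvar (Sg A (add_mset l L))) \<cdot> pds A L (f k p))"
      unfolding horizontal_part_def
      by (simp add: gmul_add_right sum.distrib gmul_sum_right gmul_sum_left gmul_assoc split_def) (rule sum.swap)
    have tm: "totd_multi B k L (w A) p = wV k A L p" if "A \<in> flds B" for A L
      by (rule totd_multi_wV[OF k p that]) (simp add: w_def)
    have "(\<Sum>A\<in>flds B. w A p \<cdot> pds A {#} (f k p)) = (\<Sum>(A, L)\<in>T1. wV k A L p \<cdot> pds A L (f k p))"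
      using p by (simp add: T1_def sum.cartesian_product[symmetric] w_def)
    moreover have "(\<Sum>(A, L)\<in>T2. totd_multi B k L (w A) p \<cdot> pds A L (f k p)) = (\<Sum>(A, L)\<in>T2. wV k A L p \<cdot> pds A L (f k p))"
      using T(3) tm by (intro sum.cong) auto
    ultimately have "vertical_part B k w (f k) p = (\<Sum>(A, L)\<in>T1 \<union> T2. wV k A L p \<cdot> pds A L (f k p))"
      unfolding vertical_part_def T2_def[symmetric] using T(4-6) by (simp add: sum.union_disjoint)
    \<comment> \<open>The horizontal part supplies the \<open>pdx\<close> terms and, at each jet
      variable, exactly the difference between \<open>vS\<close> and \<open>wV\<close>.\<close>
    then show ?thesis
      unfolding H \<upsilon>_coordinates[OF k p f T(1-3)] wV_def
      by (simp add: split_def sum.distrib gmul_diff_left sum_subtractf)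
  qed
  then show ?thesis using v gw by blast
qed

end

theorem proposition6p1:
  fixes B :: "('x::{t2_space,second_countable_topology}, 'n::finite, 'y, 'q, 'k) setting"
    and \<upsilon> :: "('x, 'n, 'k) gform \<Rightarrow> ('x, 'n, 'k) gform"
    and k :: 'k
  assumes "smooth_manifold B"
    and "affine_bundle B (bunY B)"
    and "vector_bundle B (bunQ B)"
    and "generalized_supersymmetry B \<upsilon>"
    and "k \<in> charts B"
  shows "\<exists>v w.
    (\<forall>l. v l \<in> local_graded_functions B k) \<and>
    (\<forall>A\<in>flds B. w A \<in> local_graded_functions B k) \<and>
    (\<forall>f\<in>S0_inf B. \<forall>p\<in>cdom B k.
       \<upsilon> f k p = horizontal_part B k v (f k) p + vertical_part B k w (f k) p)"
proof -
  obtain \<iota> u0 u1 i0 i1 where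
    *: "homogeneous_derivation B 0 u0" "homogeneous_derivation B 1 u1"
      "homogeneous_interior B 0 u0 i0" "homogeneous_interior B 1 u1 i1"
      "\<forall>f\<in>S0_inf B. \<upsilon> f = u0 f +\<^sub>g u1 f" "\<forall>\<omega>\<in>S_inf B. \<iota> \<omega> = i0 \<omega> +\<^sub>g i1 \<omega>"
      "\<forall>\<omega>\<in>contact_forms B. lie_derivative B \<iota> \<omega> \<in> contact_forms B"
    using assms(4) unfolding generalized_supersymmetry_def graded_derivation_with_interior_def by blast
  interpret supersymmetry B \<upsilon> \<iota> u0 u1 i0 i1
    by unfold_locales (use assms * in auto)
  show ?thesis using decomposition[OF assms(5)] .
qed

end
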